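(* Let $Q$ be a ring of finite Krull dimension, and let $\mathbf{f} = f_1,\ldots,f_c$ be a $Q$-regular sequence. Set $A := Q/(\mathbf{f})$. Let $M$ and $N$ be finitely generated $A$-modules such that the projective dimension of $M$ as a $Q$-module is finite, and let $I$ be an ideal of $A$. Then the set $$\bigcup_{n \ge 1} \bigcup_{i \ge 0} \mathrm{Ass}_A\left( \mathrm{Ext}_A^i(M,N/I^n N) \right)$$ is finite.
   Context: All rings are commutative Noetherian with identity. For an $A$-module $E$, $\mathrm{Ass}_A(E)$ denotes the set of associated prime ideals of $E$, i.e. the prime ideals of $A$ of the form $\mathrm{Ann}_A(x)$ for some $x\in E$. *)

theory Defs
  imports "HOL-Algebra.Module" "HOL-Algebra.Ideal_Product" "HOL-Algebra.QuotRing" "HOL-Algebra.Ring_Divisibility" "HOL-Library.Extended_Nat"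
begin

section \<open>Commutative algebra\<close>

text \<open>For the zero ring the supremum is taken over the empty set and gives \<open>0\<close>.\<close>

definition krull_dim :: "('a, 'b) ring_scheme \<Rightarrow> enat" where
  "krull_dim R = Sup {enat n | n. \<exists>p :: nat \<Rightarrow> 'a set.
     (\<forall>i\<le>n. primeideal (p i) R) \<and> (\<forall>i<n. p i \<subset> p (Suc i))}"

text \<open>The second clause says that \<open>fs ! i\<close> is a nonzerodivisor on \<open>R / (fs ! 0, \<dots>, fs ! (i - 1))\<close>.
  As usual for regular sequences (as opposed to weakly regular ones), \<open>R / (fs)\<close> has to be nonzero.\<close>

definition regular_sequence :: "('a, 'b) ring_scheme \<Rightarrow> 'a list \<Rightarrow> bool" where
  "regular_sequence R fs \<longleftrightarrow>
     set fs \<subseteq> carrier R \<and>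
     (\<forall>i<length fs. \<forall>a\<in>carrier R.
        fs ! i \<otimes>\<^bsub>R\<^esub> a \<in> genideal R (set (take i fs)) \<longrightarrow> a \<in> genideal R (set (take i fs))) \<and>
     genideal R (set fs) \<noteq> carrier R"


section \<open>Modules\<close>

text \<open>The type of modules extends the type of rings; the fields \<open>mult\<close> and \<open>one\<close> of a module are
  irrelevant, and they are left unspecified in the constructions below.\<close>

definition module_span :: "('a, 'b) ring_scheme \<Rightarrow> ('a, 'm, 'c) module_scheme \<Rightarrow> 'm set \<Rightarrow> 'm set" where
  "module_span R M S = \<Inter>{U. submodule U R M \<and> S \<subseteq> U}"

definition fin_gen_module :: "('a, 'b) ring_scheme \<Rightarrow> ('a, 'm, 'c) module_scheme \<Rightarrow> bool" where
  "fin_gen_module R M \<longleftrightarrow>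
     module R M \<and> (\<exists>S. finite S \<and> S \<subseteq> carrier M \<and> module_span R M S = carrier M)"

definition ideal_smult :: "('a, 'b) ring_scheme \<Rightarrow> 'a set \<Rightarrow> ('a, 'm, 'c) module_scheme \<Rightarrow> 'm set" where
  "ideal_smult R I M = module_span R M {a \<odot>\<^bsub>M\<^esub> x | a x. a \<in> I \<and> x \<in> carrier M}"

definition quotient_module :: "('a, 'm, 'c) module_scheme \<Rightarrow> 'm set \<Rightarrow> ('a, 'm set) module" where
  "quotient_module M U =
     \<lparr>carrier = a_rcosets\<^bsub>M\<^esub> U, monoid.mult = undefined, one = undefined, zero = U, add = set_add M,
      smult = (\<lambda>a C. \<Union>x\<in>C. U +>\<^bsub>M\<^esub> (a \<odot>\<^bsub>M\<^esub> x))\<rparr>"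

definition restrict_scalars :: "('a \<Rightarrow> 'b) \<Rightarrow> ('b, 'm, 'c) module_scheme \<Rightarrow> ('a, 'm) module" where
  "restrict_scalars \<phi> M =
     \<lparr>carrier = carrier M, monoid.mult = monoid.mult M, one = one M, zero = zero M, add = add M,
      smult = (\<lambda>a. smult M (\<phi> a))\<rparr>"

definition module_ann :: "('a, 'b) ring_scheme \<Rightarrow> ('a, 'm, 'c) module_scheme \<Rightarrow> 'm \<Rightarrow> 'a set" where
  "module_ann R M x = {a \<in> carrier R. a \<odot>\<^bsub>M\<^esub> x = \<zero>\<^bsub>M\<^esub>}"

definition Ass :: "('a, 'b) ring_scheme \<Rightarrow> ('a, 'm, 'c) module_scheme \<Rightarrow> 'a set set" where
  "Ass R M = {p. primeideal p R \<and> (\<exists>x\<in>carrier M. p = module_ann R M x)}"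

definition mod_hom ::
  "('a, 'b) ring_scheme \<Rightarrow> ('a, 'm, 'c) module_scheme \<Rightarrow> ('a, 'n, 'd) module_scheme \<Rightarrow> ('m \<Rightarrow> 'n) set" where
  "mod_hom R M N = {f \<in> carrier M \<rightarrow> carrier N.
     (\<forall>x\<in>carrier M. \<forall>y\<in>carrier M. f (x \<oplus>\<^bsub>M\<^esub> y) = f x \<oplus>\<^bsub>N\<^esub> f y) \<and>
     (\<forall>a\<in>carrier R. \<forall>x\<in>carrier M. f (a \<odot>\<^bsub>M\<^esub> x) = a \<odot>\<^bsub>N\<^esub> f x)}"

text \<open>Restricting to extensional functions makes elements of \<open>Hom\<close> equal as soon as they agree on
  the carrier of the source.\<close>

definition Hom_module ::
  "('a, 'b) ring_scheme \<Rightarrow> ('a, 'm, 'c) module_scheme \<Rightarrow> ('a, 'n, 'd) module_scheme \<Rightarrow> ('a, 'm \<Rightarrow> 'n) module" where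
  "Hom_module R M N =
     \<lparr>carrier = mod_hom R M N \<inter> extensional (carrier M), monoid.mult = undefined, one = undefined,
      zero = (\<lambda>x\<in>carrier M. \<zero>\<^bsub>N\<^esub>),
      add = (\<lambda>f g. \<lambda>x\<in>carrier M. f x \<oplus>\<^bsub>N\<^esub> g x),
      smult = (\<lambda>a f. \<lambda>x\<in>carrier M. a \<odot>\<^bsub>N\<^esub> f x)\<rparr>"

definition free_module :: "('a, 'b) ring_scheme \<Rightarrow> 'x set \<Rightarrow> ('a, 'x \<Rightarrow> 'a) module" where
  "free_module R X =
     \<lparr>carrier = {v. range v \<subseteq> carrier R \<and> finite {x. v x \<noteq> \<zero>\<^bsub>R\<^esub>} \<and> {x. v x \<noteq> \<zero>\<^bsub>R\<^esub>} \<subseteq> X},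
      monoid.mult = undefined, one = undefined,
      zero = (\<lambda>_. \<zero>\<^bsub>R\<^esub>),
      add = (\<lambda>v w x. v x \<oplus>\<^bsub>R\<^esub> w x),
      smult = (\<lambda>a v x. a \<otimes>\<^bsub>R\<^esub> v x)\<rparr>"

text \<open>Projective modules are the direct summands of free modules.  Taking the basis in the element
  type of \<open>P\<close> is no restriction: if \<open>P\<close> is projective, then the canonical map from the free module on
  \<open>carrier P\<close> onto \<open>P\<close> splits.\<close>

definition projective_module :: "('a, 'b) ring_scheme \<Rightarrow> ('a, 'p, 'c) module_scheme \<Rightarrow> bool" where
  "projective_module R P \<longleftrightarrow> module R P \<and>
     (\<exists>X :: 'p set. \<exists>s\<in>mod_hom R P (free_module R X). \<exists>r\<in>mod_hom R (free_module R X) P.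
        \<forall>x\<in>carrier P. r (s x) = x)"


section \<open>Projective resolutions\<close>

text \<open>\<open>\<dots> \<rightarrow> P 2 \<rightarrow> P 1 \<rightarrow> P 0 \<rightarrow> M \<rightarrow> 0\<close> with \<open>d i : P (i + 1) \<rightarrow> P i\<close> and augmentation \<open>e : P 0 \<rightarrow> M\<close>.\<close>

definition projective_resolution ::
  "('a, 'b) ring_scheme \<Rightarrow> ('a, 'm, 'c) module_scheme \<Rightarrow>
   (nat \<Rightarrow> ('a, 'p) module) \<Rightarrow> (nat \<Rightarrow> 'p \<Rightarrow> 'p) \<Rightarrow> ('p \<Rightarrow> 'm) \<Rightarrow> bool" where
  "projective_resolution R M P d e \<longleftrightarrow>
     (\<forall>i. projective_module R (P i)) \<and>
     (\<forall>i. d i \<in> mod_hom R (P (Suc i)) (P i)) \<and>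
     e \<in> mod_hom R (P 0) M \<and>
     e ` carrier (P 0) = carrier M \<and>
     d 0 ` carrier (P 1) = a_kernel (P 0) M e \<and>
     (\<forall>i. d (Suc i) ` carrier (P (Suc (Suc i))) = a_kernel (P (Suc i)) (P i) (d i))"

text \<open>Resolutions of \<open>M\<close> are formed inside a fixed type that is large enough for all purposes: a
  basis can be chosen among the formal expressions generated from elements of \<open>M\<close> by iterated
  formal linear combinations.  Hence every syzygy of \<open>M\<close> in a free resolution can again be indexed
  by such expressions (see \<open>projective_resolution_exists\<close> below).  Likewise, if \<open>M\<close> has some
  projective resolution of length \<open>n\<close>, then truncating any free resolution at the \<open>n\<close>-th syzygy,
  which is then projective, gives one in this type.\<close>

datatype ('a, 'm) formal_comb = Gen 'm | Comb "('a \<times> ('a, 'm) formal_comb) list"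

type_synonym ('a, 'm) res_elem = "('a, 'm) formal_comb \<Rightarrow> 'a"

definition proj_dim :: "('a, 'b) ring_scheme \<Rightarrow> ('a, 'm, 'c) module_scheme \<Rightarrow> enat" where
  "proj_dim R M = Inf {enat n | n.
     \<exists>(P :: nat \<Rightarrow> ('a, ('a, 'm) res_elem) module) d e.
       projective_resolution R M P d e \<and> (\<forall>i>n. carrier (P i) = {\<zero>\<^bsub>P i\<^esub>})}"


section \<open>Consistency of the constructions\<close>

lemma quotient_module_module:
  assumes M: "module R M" and U: "submodule U R M"
  shows "module R (quotient_module M U)"
    and "\<And>a x. a \<in> carrier R \<Longrightarrow> x \<in> carrier M \<Longrightarrow>
      a \<odot>\<^bsub>quotient_module M U\<^esub> (U +>\<^bsub>M\<^esub> x) = U +>\<^bsub>M\<^esub> (a \<odot>\<^bsub>M\<^esub> x)"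
    and "\<And>x y. x \<in> carrier M \<Longrightarrow> y \<in> carrier M \<Longrightarrow>
      (U +>\<^bsub>M\<^esub> x) \<oplus>\<^bsub>quotient_module M U\<^esub> (U +>\<^bsub>M\<^esub> y) = U +>\<^bsub>M\<^esub> (x \<oplus>\<^bsub>M\<^esub> y)"
proof -
  interpret M: module R M by (fact M)
  interpret U: submodule U R M by (fact U)
  interpret S: abelian_subgroup U M
    by (rule abelian_subgroupI3) (auto simp: additive_subgroup_def U.subgroup_axioms M.abelian_group_axioms)
  let ?Q = "quotient_module M U"
  have sm: "a \<odot>\<^bsub>?Q\<^esub> (U +>\<^bsub>M\<^esub> x) = U +>\<^bsub>M\<^esub> (a \<odot>\<^bsub>M\<^esub> x)"
    if a: "a \<in> carrier R" and x: "x \<in> carrier M" for a x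
  proof -
    have "U +>\<^bsub>M\<^esub> (a \<odot>\<^bsub>M\<^esub> y) = U +>\<^bsub>M\<^esub> (a \<odot>\<^bsub>M\<^esub> x)" if y: "y \<in> U +>\<^bsub>M\<^esub> x" for y
    proof -
      obtain u where u: "u \<in> U" "y = u \<oplus>\<^bsub>M\<^esub> x"
        using y by (auto simp: a_r_coset_def')
      have "a \<odot>\<^bsub>M\<^esub> y = a \<odot>\<^bsub>M\<^esub> u \<oplus>\<^bsub>M\<^esub> a \<odot>\<^bsub>M\<^esub> x"
        using u a x S.a_Hcarr by (simp add: M.smult_r_distr)
      moreover have "a \<odot>\<^bsub>M\<^esub> u \<in> U" using u a by simp
      ultimately have "a \<odot>\<^bsub>M\<^esub> y \<in> U +>\<^bsub>M\<^esub> (a \<odot>\<^bsub>M\<^esub> x)"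
        by (auto simp: a_r_coset_def')
      then show ?thesis
        using S.a_repr_independence' a x by auto
    qed
    moreover have "x \<in> U +>\<^bsub>M\<^esub> x" by (rule S.a_rcos_self[OF x])
    ultimately have "(\<Union>y\<in>U +>\<^bsub>M\<^esub> x. U +>\<^bsub>M\<^esub> (a \<odot>\<^bsub>M\<^esub> y)) = U +>\<^bsub>M\<^esub> (a \<odot>\<^bsub>M\<^esub> x)"
      by (intro UN_constant_eq ballI)
    then show ?thesis
      by (simp add: quotient_module_def)
  qed
  have ad: "(U +>\<^bsub>M\<^esub> x) \<oplus>\<^bsub>?Q\<^esub> (U +>\<^bsub>M\<^esub> y) = U +>\<^bsub>M\<^esub> (x \<oplus>\<^bsub>M\<^esub> y)"
    if "x \<in> carrier M" "y \<in> carrier M" for x y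
    using S.a_rcos_sum[OF that] by (simp add: quotient_module_def)
  have car: "carrier ?Q = (\<lambda>x. U +>\<^bsub>M\<^esub> x) ` carrier M"
    by (auto simp: quotient_module_def A_RCOSETS_def')
  have zero: "\<zero>\<^bsub>?Q\<^esub> = U +>\<^bsub>M\<^esub> \<zero>\<^bsub>M\<^esub>"
    using U.subset by (auto simp: quotient_module_def a_r_coset_def')
  have ab: "abelian_group ?Q"
  proof (rule abelian_groupI)
    fix C assume "C \<in> carrier ?Q"
    then obtain x where x: "x \<in> carrier M" "C = U +>\<^bsub>M\<^esub> x"
      by (auto simp: car)
    then have "(U +>\<^bsub>M\<^esub> (\<ominus>\<^bsub>M\<^esub> x)) \<oplus>\<^bsub>?Q\<^esub> C = \<zero>\<^bsub>?Q\<^esub>"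
      by (simp add: ad zero M.l_neg)
    then show "\<exists>D\<in>carrier ?Q. D \<oplus>\<^bsub>?Q\<^esub> C = \<zero>\<^bsub>?Q\<^esub>"
      using x(1) by (auto simp: car)
  qed (auto simp: car ad zero M.a_ac)
  show "module R ?Q"
    by (rule moduleI) (auto simp: M.is_cring ab car sm ad M.smult_l_distr M.smult_r_distr M.smult_assoc1)
  show "\<And>a x. a \<in> carrier R \<Longrightarrow> x \<in> carrier M \<Longrightarrow>
      a \<odot>\<^bsub>?Q\<^esub> (U +>\<^bsub>M\<^esub> x) = U +>\<^bsub>M\<^esub> (a \<odot>\<^bsub>M\<^esub> x)" by (rule sm)
  show "\<And>x y. x \<in> carrier M \<Longrightarrow> y \<in> carrier M \<Longrightarrow>
      (U +>\<^bsub>M\<^esub> x) \<oplus>\<^bsub>?Q\<^esub> (U +>\<^bsub>M\<^esub> y) = U +>\<^bsub>M\<^esub> (x \<oplus>\<^bsub>M\<^esub> y)" by (rule ad)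
qed

lemma Hom_module_module:
  assumes M: "module R M" and N: "module R N"
  shows "module R (Hom_module R M N)"
proof -
  interpret M: module R M by (fact M)
  interpret N: module R N by (fact N)
  have ab: "abelian_group (Hom_module R M N)"
  proof (rule abelian_groupI)
    fix f assume f: "f \<in> carrier (Hom_module R M N)"
    show "\<exists>g\<in>carrier (Hom_module R M N). g \<oplus>\<^bsub>Hom_module R M N\<^esub> f = \<zero>\<^bsub>Hom_module R M N\<^esub>"
      using f by (intro bexI[of _ "\<lambda>x\<in>carrier M. \<ominus>\<^bsub>N\<^esub> f x"])
       (auto simp: Hom_module_def mod_hom_def Pi_iff N.l_neg N.minus_add N.smult_r_minus restrict_def extensional_def)
  qed (auto simp: Hom_module_def mod_hom_def Pi_iff N.a_ac N.smult_r_distr restrict_def extensional_def fun_eq_iff)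
  show ?thesis
    by (rule moduleI[OF M.is_cring ab])
      (auto simp: Hom_module_def mod_hom_def Pi_iff N.smult_l_distr N.smult_r_distr N.smult_assoc1[symmetric] restrict_def extensional_def fun_eq_iff M.m_comm)
qed
lemma mod_homD:
  assumes "f \<in> mod_hom R M N"
  shows "x \<in> carrier M \<Longrightarrow> f x \<in> carrier N"
    and "x \<in> carrier M \<Longrightarrow> y \<in> carrier M \<Longrightarrow> f (x \<oplus>\<^bsub>M\<^esub> y) = f x \<oplus>\<^bsub>N\<^esub> f y"
    and "a \<in> carrier R \<Longrightarrow> x \<in> carrier M \<Longrightarrow> f (a \<odot>\<^bsub>M\<^esub> x) = a \<odot>\<^bsub>N\<^esub> f x"
  using assms by (auto simp: mod_hom_def)

lemma submodule_kernel:
  assumes M: "module R M" and N: "module R N" and f: "f \<in> mod_hom R M N"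
  shows "submodule (a_kernel M N f) R M"
proof -
  interpret M: module R M by (fact M)
  interpret N: module R N by (fact N)
  have z: "f \<zero>\<^bsub>M\<^esub> = \<zero>\<^bsub>N\<^esub>"
    using mod_homD(3)[OF f, of "\<zero>\<^bsub>R\<^esub>" "\<zero>\<^bsub>M\<^esub>"] mod_homD(1)[OF f, of "\<zero>\<^bsub>M\<^esub>"] by simp
  have neg: "\<ominus>\<^bsub>M\<^esub> a = (\<ominus>\<^bsub>R\<^esub> \<one>\<^bsub>R\<^esub>) \<odot>\<^bsub>M\<^esub> a" if "a \<in> carrier M" for a
    using that M.smult_l_minus[of "\<one>\<^bsub>R\<^esub>" a] by simp
  show ?thesis
    using mod_homD[OF f] z
    by (intro M.submoduleI) (auto simp: a_kernel_def' neg)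
qed

lemma free_module_carrier_iff:
  "v \<in> carrier (free_module R X) \<longleftrightarrow>
     (\<forall>x. v x \<in> carrier R) \<and> finite {x. v x \<noteq> \<zero>\<^bsub>R\<^esub>} \<and> (\<forall>x. x \<notin> X \<longrightarrow> v x = \<zero>\<^bsub>R\<^esub>)"
  by (auto simp: free_module_def)

lemma free_module_ops:
  "\<zero>\<^bsub>free_module R X\<^esub> = (\<lambda>_. \<zero>\<^bsub>R\<^esub>)"
  "v \<oplus>\<^bsub>free_module R X\<^esub> w = (\<lambda>x. v x \<oplus>\<^bsub>R\<^esub> w x)"
  "a \<odot>\<^bsub>free_module R X\<^esub> v = (\<lambda>x. a \<otimes>\<^bsub>R\<^esub> v x)"
  by (simp_all add: free_module_def)

lemmas free_module_simps = free_module_carrier_iff free_module_ops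

lemma free_module_module:
  assumes "cring R"
  shows "module R (free_module R X)"
proof -
  interpret cring R by (fact assms)
  have sub: "{x. v x \<oplus>\<^bsub>R\<^esub> w x \<noteq> \<zero>\<^bsub>R\<^esub>} \<subseteq> {x. v x \<noteq> \<zero>\<^bsub>R\<^esub>} \<union> {x. w x \<noteq> \<zero>\<^bsub>R\<^esub>}" for v w :: "'c \<Rightarrow> 'a"
    by auto
  have sub': "{x. a \<otimes>\<^bsub>R\<^esub> v x \<noteq> \<zero>\<^bsub>R\<^esub>} \<subseteq> {x. v x \<noteq> \<zero>\<^bsub>R\<^esub>}" if "a \<in> carrier R" for a and v :: "'c \<Rightarrow> 'a"
    using that by auto
  have sub'': "{x. \<ominus>\<^bsub>R\<^esub> v x \<noteq> \<zero>\<^bsub>R\<^esub>} \<subseteq> {x. v x \<noteq> \<zero>\<^bsub>R\<^esub>}" for v :: "'c \<Rightarrow> 'a"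
    by auto
  have grp: "abelian_group (free_module R X)"
  proof (rule abelian_groupI)
    fix v assume v: "v \<in> carrier (free_module R X)"
    show "\<exists>w\<in>carrier (free_module R X). w \<oplus>\<^bsub>free_module R X\<^esub> v = \<zero>\<^bsub>free_module R X\<^esub>"
      using v sub''[of v]
      by (intro bexI[of _ "\<lambda>x. \<ominus>\<^bsub>R\<^esub> v x"])
        (auto simp: free_module_simps l_neg image_subset_iff fun_eq_iff intro: finite_subset)
  qed (auto simp: free_module_simps a_ac intro: finite_subset[OF sub])
  show ?thesis
    by (rule moduleI[OF assms grp])
      (auto simp: free_module_simps l_distr r_distr m_assoc intro: finite_subset[OF sub'])
qed

lemma free_module_projective:
  assumes "cring R"
  shows "projective_module R (free_module R (X :: 'x set))"
proof -
  interpret cring R by (fact assms)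
  let ?F = "free_module R X"
  define b where "b = (\<lambda>x y :: 'x. if y = x then \<one>\<^bsub>R\<^esub> else \<zero>\<^bsub>R\<^esub>)"
  show ?thesis
  proof (cases "\<one>\<^bsub>R\<^esub> = \<zero>\<^bsub>R\<^esub>")
    case True
    then have "carrier R = {\<zero>\<^bsub>R\<^esub>}"
      using carrier_one_zero by simp
    then have "carrier ?F = {\<lambda>_. \<zero>\<^bsub>R\<^esub>}" and "carrier (free_module R {}) = {\<lambda>_. \<zero>\<^bsub>R\<^esub>}"
      by (auto simp: free_module_simps)
    then show ?thesis
      unfolding projective_module_def
      apply (intro conjI free_module_module assms exI[of _ "{}"]
          bexI[of _ "\<lambda>_ _. \<zero>\<^bsub>R\<^esub>"] bexI[of _ "\<lambda>_ _. \<zero>\<^bsub>R\<^esub>"])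
      by (auto simp: mod_hom_def free_module_simps)
  next
    case False
    then have inj: "b x = b y \<longleftrightarrow> x = y" for x y
      by (auto simp: b_def fun_eq_iff split: if_splits)
    have inj': "b x \<in> b ` X \<longleftrightarrow> x \<in> X" for x
      by (auto simp: inj image_iff)
    define s where "s = (\<lambda>(v :: 'x \<Rightarrow> 'a) g. if g \<in> b ` X then v (inv_into UNIV b g) else \<zero>\<^bsub>R\<^esub>)"
    define r where "r = (\<lambda>(h :: ('x \<Rightarrow> 'a) \<Rightarrow> 'a) x. h (b x))"
    have "inv_into UNIV b (b x) = x" for x
      by (rule inv_into_f_f) (auto simp: inj inj_def)
    then have s: "s v (b x) = (if x \<in> X then v x else \<zero>\<^bsub>R\<^esub>)" for v x
      by (auto simp: s_def inj image_iff)
    have s0: "s v g = \<zero>\<^bsub>R\<^esub>" if "g \<notin> b ` X" for v g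
      using that by (simp add: s_def)
    have fin: "finite {g. s v g \<noteq> \<zero>\<^bsub>R\<^esub>}" if "finite {x. v x \<noteq> \<zero>\<^bsub>R\<^esub>}" for v
    proof (rule finite_subset[OF subsetI finite_imageI[OF that, of b]])
      fix g assume g: "g \<in> {g. s v g \<noteq> \<zero>\<^bsub>R\<^esub>}"
      then obtain x where x: "x \<in> X" "g = b x"
        using s0 by blast
      with g show "g \<in> b ` {x. v x \<noteq> \<zero>\<^bsub>R\<^esub>}"
        by (simp add: s)
    qed
    have fin': "finite {x. h (b x) \<noteq> \<zero>\<^bsub>R\<^esub>}" if "finite {g. h g \<noteq> \<zero>\<^bsub>R\<^esub>}" for h
      using finite_vimageI[OF that, of b] inj by (auto simp: inj_def vimage_def)
    have "s \<in> mod_hom R ?F (free_module R (b ` X))"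
      unfolding mod_hom_def
      using fin by (auto simp: s_def free_module_simps fun_eq_iff)
    moreover have "r \<in> mod_hom R (free_module R (b ` X)) ?F"
      unfolding mod_hom_def
      using fin' inj' by (auto simp: r_def free_module_simps)
    moreover have "\<forall>v\<in>carrier ?F. r (s v) = v"
      by (auto simp: r_def s fun_eq_iff free_module_simps)
    ultimately show ?thesis
      unfolding projective_module_def
      by (intro conjI free_module_module[OF assms] exI[of _ "b ` X"] bexI[of _ s] bexI[of _ r])
  qed
qed

lemma free_module_cover:
  assumes "module R K" and c: "inj_on c (carrier K)"
  shows "\<exists>h\<in>mod_hom R (free_module R (c ` carrier K)) K.
    h ` carrier (free_module R (c ` carrier K)) = carrier K"
proof -
  interpret module R K by (fact assms)
  let ?F = "free_module R (c ` carrier K)"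
  define S where "S = (\<lambda>v. {k \<in> carrier K. v (c k) \<noteq> \<zero>\<^bsub>R\<^esub>})"
  define h where "h = (\<lambda>v. \<Oplus>\<^bsub>K\<^esub>k\<in>S v. v (c k) \<odot>\<^bsub>K\<^esub> k)"
  have SK: "S v \<subseteq> carrier K" for v
    by (auto simp: S_def)
  have fin: "finite (S v)" if "v \<in> carrier ?F" for v
  proof (rule finite_imageD)
    show "finite (c ` S v)"
      using that by (auto simp: free_module_simps S_def intro: finite_subset[rotated])
    show "inj_on c (S v)"
      using c by (auto simp: S_def inj_on_def)
  qed
  have vR: "v x \<in> carrier R" if "v \<in> carrier ?F" for v x
    using that by (auto simp: free_module_simps)
  have h_eq: "h v = (\<Oplus>\<^bsub>K\<^esub>k\<in>T. v (c k) \<odot>\<^bsub>K\<^esub> k)"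
    if "v \<in> carrier ?F" "finite T" "S v \<subseteq> T" "T \<subseteq> carrier K" for v T
    unfolding h_def using that vR SK
    by (intro M.add.finprod_mono_neutral_cong_left) (auto simp: S_def)
  have hK: "h v \<in> carrier K" if "v \<in> carrier ?F" for v
    unfolding h_def using that vR by (intro M.finsum_closed) (auto simp: S_def)
  interpret F: module R ?F
    by (rule free_module_module) (rule is_cring)
  have hom: "h \<in> mod_hom R ?F K"
    unfolding mod_hom_def
  proof (intro CollectI conjI ballI)
    show "h \<in> carrier ?F \<rightarrow> carrier K"
      using hK by auto
    fix v w assume vw: "v \<in> carrier ?F" "w \<in> carrier ?F"
    let ?T = "S v \<union> S w"
    have T: "finite ?T" "?T \<subseteq> carrier K" "S (v \<oplus>\<^bsub>?F\<^esub> w) \<subseteq> ?T"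
      using fin vw SK by (auto simp: S_def free_module_simps)
    have "h (v \<oplus>\<^bsub>?F\<^esub> w) = (\<Oplus>\<^bsub>K\<^esub>k\<in>?T. (v \<oplus>\<^bsub>?F\<^esub> w) (c k) \<odot>\<^bsub>K\<^esub> k)"
      using vw T by (intro h_eq) auto
    also have "\<dots> = (\<Oplus>\<^bsub>K\<^esub>k\<in>?T. v (c k) \<odot>\<^bsub>K\<^esub> k \<oplus>\<^bsub>K\<^esub> w (c k) \<odot>\<^bsub>K\<^esub> k)"
    proof (rule M.finsum_cong'[OF refl])
      show "(\<lambda>k. v (c k) \<odot>\<^bsub>K\<^esub> k \<oplus>\<^bsub>K\<^esub> w (c k) \<odot>\<^bsub>K\<^esub> k) \<in> ?T \<rightarrow> carrier K"
        using T(2) vR[OF vw(1)] vR[OF vw(2)] by blast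
      show "(v \<oplus>\<^bsub>?F\<^esub> w) (c k) \<odot>\<^bsub>K\<^esub> k = v (c k) \<odot>\<^bsub>K\<^esub> k \<oplus>\<^bsub>K\<^esub> w (c k) \<odot>\<^bsub>K\<^esub> k" if "k \<in> ?T" for k
        unfolding free_module_ops
        by (rule smult_l_distr) (use that T(2) vR[OF vw(1)] vR[OF vw(2)] in blast)+
    qed
    also have "\<dots> = (\<Oplus>\<^bsub>K\<^esub>k\<in>?T. v (c k) \<odot>\<^bsub>K\<^esub> k) \<oplus>\<^bsub>K\<^esub> (\<Oplus>\<^bsub>K\<^esub>k\<in>?T. w (c k) \<odot>\<^bsub>K\<^esub> k)"
      by (rule M.finsum_addf) (use T(2) vR[OF vw(1)] vR[OF vw(2)] in blast)+
    also have "\<dots> = h v \<oplus>\<^bsub>K\<^esub> h w"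
      using vw T by (simp add: h_eq[of _ ?T])
    finally show "h (v \<oplus>\<^bsub>?F\<^esub> w) = h v \<oplus>\<^bsub>K\<^esub> h w" .
  next
    fix a v assume av: "a \<in> carrier R" "v \<in> carrier ?F"
    have "h (a \<odot>\<^bsub>?F\<^esub> v) = (\<Oplus>\<^bsub>K\<^esub>k\<in>S v. (a \<odot>\<^bsub>?F\<^esub> v) (c k) \<odot>\<^bsub>K\<^esub> k)"
      using av fin SK by (intro h_eq F.smult_closed) (auto simp: S_def free_module_ops)
    also have "\<dots> = (\<Oplus>\<^bsub>K\<^esub>k\<in>S v. a \<odot>\<^bsub>K\<^esub> (v (c k) \<odot>\<^bsub>K\<^esub> k))"
    proof (rule M.finsum_cong'[OF refl])
      show "(\<lambda>k. a \<odot>\<^bsub>K\<^esub> (v (c k) \<odot>\<^bsub>K\<^esub> k)) \<in> S v \<rightarrow> carrier K"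
        using SK av(1) vR[OF av(2)] by blast
      show "(a \<odot>\<^bsub>?F\<^esub> v) (c k) \<odot>\<^bsub>K\<^esub> k = a \<odot>\<^bsub>K\<^esub> (v (c k) \<odot>\<^bsub>K\<^esub> k)" if "k \<in> S v" for k
        unfolding free_module_ops
        by (rule smult_assoc1) (use that SK av(1) vR[OF av(2)] in blast)+
    qed
    also have "\<dots> = a \<odot>\<^bsub>K\<^esub> h v"
      unfolding h_def
      by (rule finsum_smult_ldistr[symmetric, OF fin[OF av(2)] av(1)])
        (use SK vR[OF av(2)] in blast)
    finally show "h (a \<odot>\<^bsub>?F\<^esub> v) = a \<odot>\<^bsub>K\<^esub> h v" .
  qed
  have "k \<in> h ` carrier ?F" if k: "k \<in> carrier K" for k
  proof -
    define v where "v = (\<lambda>x. if x = c k then \<one>\<^bsub>R\<^esub> else \<zero>\<^bsub>R\<^esub>)"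
    have v: "v \<in> carrier ?F"
      using k by (auto simp: v_def free_module_simps)
    have "S v \<subseteq> {k}"
      using c k by (auto simp: S_def v_def inj_on_def)
    then have "h v = (\<Oplus>\<^bsub>K\<^esub>k\<in>{k}. v (c k) \<odot>\<^bsub>K\<^esub> k)"
      using v k by (intro h_eq) auto
    also have "\<dots> = k"
      using k by (simp add: v_def)
    finally show ?thesis using v by force
  qed
  then have "h ` carrier ?F = carrier K"
    using hK by auto
  then show ?thesis using hom by (rule bexI)
qed

lemma projective_resolution_exists:
  fixes R :: "('a, 'b) ring_scheme" and M :: "('a, 'm, 'c) module_scheme"
  assumes M: "module R M"
  shows "\<exists>(P :: nat \<Rightarrow> ('a, ('a, 'm) res_elem) module) d e. projective_resolution R M P d e"
proof -
  have R: "cring R" using M by (simp add: module_def)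
  let ?F = "\<lambda>X :: ('a, 'm) formal_comb set. free_module R X"
  let ?supp = "\<lambda>v :: ('a, 'm) res_elem. {x. v x \<noteq> \<zero>\<^bsub>R\<^esub>}"
  define L where "L v = (SOME xs. set xs = (\<lambda>x. (v x, x)) ` ?supp v)" for v
  define c where "c v = Comb (L v)" for v
  have c: "inj_on c (carrier (?F X))" for X
  proof (rule inj_onI)
    fix v w assume vw: "v \<in> carrier (?F X)" "w \<in> carrier (?F X)" "c v = c w"
    have *: "set (L v) = (\<lambda>x. (v x, x)) ` ?supp v" if "v \<in> carrier (?F X)" for v
      unfolding L_def
    proof (rule someI_ex, rule finite_list, rule finite_imageI)
      show "finite (?supp v)"
        using that unfolding free_module_carrier_iff by blast
    qed
    have eq: "(\<lambda>x. (v x, x)) ` ?supp v = (\<lambda>x. (w x, x)) ` ?supp w"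
      unfolding *[OF vw(1), symmetric] *[OF vw(2), symmetric] using vw(3) by (simp add: c_def)
    show "v = w"
    proof
      fix x
      show "v x = w x"
      proof (cases "v x = \<zero>\<^bsub>R\<^esub> \<and> w x = \<zero>\<^bsub>R\<^esub>")
        case False
        then have "(v x, x) \<in> (\<lambda>x. (w x, x)) ` ?supp w \<or> (w x, x) \<in> (\<lambda>x. (v x, x)) ` ?supp v"
          using eq by blast
        then show ?thesis by auto
      qed simp
    qed
  qed
  have "inj_on (Gen :: 'm \<Rightarrow> ('a, 'm) formal_comb) (carrier M)"
    by (simp add: inj_on_def)
  from free_module_cover[OF M this] obtain e
    where e: "e \<in> mod_hom R (?F (Gen ` carrier M)) M"
      "e ` carrier (?F (Gen ` carrier M)) = carrier M"
    by blast
  define X0 where "X0 = (Gen ` carrier M :: ('a, 'm) formal_comb set)"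
  define K0 where "K0 = a_kernel (?F X0) M e"
  define sub where "sub t \<longleftrightarrow> submodule (snd t) R (?F (fst t))" for t
  define nxt where "nxt s t \<longleftrightarrow> (\<exists>d. d \<in> mod_hom R (?F (fst t)) (?F (fst s)) \<and>
    d ` carrier (?F (fst t)) = snd s \<and> snd t = a_kernel (?F (fst t)) (?F (fst s)) d)" for s t
  have step: "\<exists>t. sub t \<and> nxt s t" if "sub s" for s
  proof -
    obtain X K where s: "s = (X, K)" by (cases s)
    then have K: "submodule K R (?F X)"
      using that by (simp add: sub_def)
    then have Kc: "K \<subseteq> carrier (?F X)"
      by (rule module.submoduleE(1)[OF free_module_module[OF R]])
    have "module R ((?F X)\<lparr>carrier := K\<rparr>)"
      by (rule submodule.submodule_is_module[OF K free_module_module[OF R]])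
    moreover have "inj_on c (carrier ((?F X)\<lparr>carrier := K\<rparr>))"
      using inj_on_subset[OF c Kc] by simp
    ultimately have "\<exists>d\<in>mod_hom R (?F (c ` K)) ((?F X)\<lparr>carrier := K\<rparr>). d ` carrier (?F (c ` K)) = K"
      using free_module_cover[of R "(?F X)\<lparr>carrier := K\<rparr>" c] by simp
    then obtain d where d: "d \<in> mod_hom R (?F (c ` K)) ((?F X)\<lparr>carrier := K\<rparr>)"
      "d ` carrier (?F (c ` K)) = K"
      by (rule bexE)
    have d': "d \<in> mod_hom R (?F (c ` K)) (?F X)"
      using d(1) Kc unfolding mod_hom_def by (simp add: Pi_iff subset_iff)
    let ?t = "(c ` K, a_kernel (?F (c ` K)) (?F X) d)"
    have "sub ?t"
      unfolding sub_def
      using submodule_kernel[OF free_module_module[OF R] free_module_module[OF R] d'] by simp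
    moreover have "nxt s ?t"
      unfolding nxt_def s fst_conv snd_conv using d' d(2) by (intro exI[of _ d] conjI refl)
    ultimately show ?thesis by blast
  qed
  have sub0: "sub (X0, K0)"
    unfolding sub_def fst_conv snd_conv K0_def X0_def
    by (rule submodule_kernel[OF free_module_module[OF R] M e(1)])
  have "\<exists>t. \<forall>n. (sub (t n) \<and> (n = 0 \<longrightarrow> t n = (X0, K0))) \<and> nxt (t n) (t (Suc n))"
    by (rule dependent_nat_choice) (use sub0 step in auto)
  then obtain t where t0: "t 0 = (X0, K0)" and nxt: "\<And>i. nxt (t i) (t (Suc i))"
    by blast
  define P where "P = (\<lambda>i. ?F (fst (t i)))"
  from nxt obtain d where d: "\<And>i. d i \<in> mod_hom R (P (Suc i)) (P i)"
    "\<And>i. d i ` carrier (P (Suc i)) = snd (t i)"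
    "\<And>i. snd (t (Suc i)) = a_kernel (P (Suc i)) (P i) (d i)"
    unfolding nxt_def P_def by metis
  have P0: "P 0 = ?F (Gen ` carrier M)"
    by (simp add: P_def t0 X0_def)
  have "projective_resolution R M P d e"
    unfolding projective_resolution_def
  proof (intro conjI allI)
    show "projective_module R (P i)" for i
      unfolding P_def by (rule free_module_projective[OF R])
    show "d i \<in> mod_hom R (P (Suc i)) (P i)" for i
      by (rule d(1))
    show "e \<in> mod_hom R (P 0) M" "e ` carrier (P 0) = carrier M"
      using e by (simp_all add: P0)
    show "d 0 ` carrier (P 1) = a_kernel (P 0) M e"
      using d(2)[of 0] by (simp add: t0 P0 K0_def X0_def)
    show "d (Suc i) ` carrier (P (Suc (Suc i))) = a_kernel (P (Suc i)) (P i) (d i)" for i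
      using d(2)[of "Suc i"] d(3)[of i] by simp
  qed
  then show ?thesis by blast
qed


section \<open>Ext\<close>

definition Hom_cocycles ::
  "('a, 'b) ring_scheme \<Rightarrow> (nat \<Rightarrow> ('a, 'p) module) \<Rightarrow> (nat \<Rightarrow> 'p \<Rightarrow> 'p) \<Rightarrow>
   ('a, 'n, 'd) module_scheme \<Rightarrow> nat \<Rightarrow> ('p \<Rightarrow> 'n) set" where
  "Hom_cocycles R P d N i =
     {f \<in> carrier (Hom_module R (P i) N). \<forall>x\<in>carrier (P (Suc i)). f (d i x) = \<zero>\<^bsub>N\<^esub>}"

definition Hom_coboundaries ::
  "('a, 'b) ring_scheme \<Rightarrow> (nat \<Rightarrow> ('a, 'p) module) \<Rightarrow> (nat \<Rightarrow> 'p \<Rightarrow> 'p) \<Rightarrow>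
   ('a, 'n, 'd) module_scheme \<Rightarrow> nat \<Rightarrow> ('p \<Rightarrow> 'n) set" where
  "Hom_coboundaries R P d N i =
     (case i of
        0 \<Rightarrow> {\<zero>\<^bsub>Hom_module R (P 0) N\<^esub>}
      | Suc j \<Rightarrow> (\<lambda>g. \<lambda>x\<in>carrier (P (Suc j)). g (d j x)) ` carrier (Hom_module R (P j) N))"

definition Hom_cohomology ::
  "('a, 'b) ring_scheme \<Rightarrow> (nat \<Rightarrow> ('a, 'p) module) \<Rightarrow> (nat \<Rightarrow> 'p \<Rightarrow> 'p) \<Rightarrow>
   ('a, 'n, 'd) module_scheme \<Rightarrow> nat \<Rightarrow> ('a, ('p \<Rightarrow> 'n) set) module" where
  "Hom_cohomology R P d N i =
     quotient_module ((Hom_module R (P i) N)\<lparr>carrier := Hom_cocycles R P d N i\<rparr>)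
       (Hom_coboundaries R P d N i)"

text \<open>By \<open>projective_resolution_exists\<close> the choice is made among actual resolutions.  As usual,
  \<open>Ext\<close> depends on it only up to isomorphism, and hence its associated primes do not depend on it.\<close>

definition chosen_resolution ::
  "('a, 'b) ring_scheme \<Rightarrow> ('a, 'm, 'c) module_scheme \<Rightarrow>
   (nat \<Rightarrow> ('a, ('a, 'm) res_elem) module) \<times> (nat \<Rightarrow> ('a, 'm) res_elem \<Rightarrow> ('a, 'm) res_elem)" where
  "chosen_resolution R M = (SOME (P, d). \<exists>e. projective_resolution R M P d e)"

definition Ext ::
  "('a, 'b) ring_scheme \<Rightarrow> nat \<Rightarrow> ('a, 'm, 'c) module_scheme \<Rightarrow> ('a, 'n, 'd) module_scheme \<Rightarrow>
   ('a, (('a, 'm) res_elem \<Rightarrow> 'n) set) module" where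
  "Ext R i M N = (case chosen_resolution R M of (P, d) \<Rightarrow> Hom_cohomology R P d N i)"

end

(* The Ext modules over A are computed from a resolution over Q. Let F be a finite resolution of M
   over Q by finitely generated projective modules. On T = (divided powers in c variables of
   degree 2) (x) F there is a Q-linear D of degree -1 that extends the differential of F, commutes
   with the contractions by the variables, and satisfies D D = sum_j f_j shift_j; modulo (f_1, ..., f_c)
   this is an A-projective resolution of M. Hence the classes in Ext^i(M, N / I^m N) are
   represented by homs k : T_i -> N, and k is trivial iff k is congruent to some g D modulo I^m N.

   The family of all homs T_i -> I^m N, over all i and m, is a Noetherian module over the c
   contractions and the generators of I, because F is finite: it is generated over these commuting
   operators by finitely many elements with i <= n and m = 0. The families that are trivial modulo I^(m+1) N
   form a submodule B, and a Noetherian module with operators has only finitely many associated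
   primes relative to B. If p is the annihilator of the class of k modulo I^m N, choose m0 < m
   maximal such that a k is trivial modulo I^m0 N for some a outside p; then a k is equivalent to a
   hom with values in I^m0 N, and p is one of the associated primes relative to B. *)

theory Submission
  imports Defs "HOL-Library.Multiset"
begin

section \<open>Homomorphisms and submodules\<close>

text \<open>The direct sum of the modules N / I^m N is in general not finitely generated over the
  Rees algebra of I, since the generators of N / I^m N in level m do not come from lower levels; so
  no finiteness theorem applies directly to the family of all Ext modules. The sum of the I^m N is
  finitely generated, which is why a class modulo I^m N is traded for a cochain with values in I^m0
  N, tested modulo I^(m0 + 1) N. Only primes have to survive this trade, so localisation at p can be
  imitated by multiplying with elements outside p.

  There are two reasons for working with cochains on a fixed T instead of cohomology. The
  contractions commute with D and with each other strictly, not just up to homotopy, so they act as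
  commuting operators. And the annihilator of a class consists of the a for which a k is trivial, a
  condition that makes sense for every hom k. Hence the Noetherian module can consist of all homs,
  where generators are visible, with the trivial families as the only submodule to be
  controlled.\<close>

lemma mod_homI:
  assumes "\<And>x. x \<in> carrier M \<Longrightarrow> f x \<in> carrier N"
    and "\<And>x y. x \<in> carrier M \<Longrightarrow> y \<in> carrier M \<Longrightarrow> f (x \<oplus>\<^bsub>M\<^esub> y) = f x \<oplus>\<^bsub>N\<^esub> f y"
    and "\<And>a x. a \<in> carrier R \<Longrightarrow> x \<in> carrier M \<Longrightarrow> f (a \<odot>\<^bsub>M\<^esub> x) = a \<odot>\<^bsub>N\<^esub> f x"
  shows "f \<in> mod_hom R M N"
  using assms by (auto simp: mod_hom_def)

lemma mod_hom_comp:
  assumes "f \<in> mod_hom R L M" "g \<in> mod_hom R M N"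
  shows "(\<lambda>x. g (f x)) \<in> mod_hom R L N"
  using assms by (auto simp: mod_hom_def Pi_iff)

lemma mod_hom_zero:
  assumes "module R M" "module R N" "f \<in> mod_hom R M N"
  shows "f \<zero>\<^bsub>M\<^esub> = \<zero>\<^bsub>N\<^esub>"
proof -
  interpret M: module R M by fact
  interpret N: module R N by fact
  show ?thesis
    using mod_homD(3)[OF assms(3), of "\<zero>\<^bsub>R\<^esub>" "\<zero>\<^bsub>M\<^esub>"] mod_homD(1)[OF assms(3), of "\<zero>\<^bsub>M\<^esub>"] by simp
qed

lemma mod_hom_neg:
  assumes "module R M" "module R N" "f \<in> mod_hom R M N" "x \<in> carrier M"
  shows "f (\<ominus>\<^bsub>M\<^esub> x) = \<ominus>\<^bsub>N\<^esub> f x"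
proof -
  interpret M: module R M by fact
  interpret N: module R N by fact
  show ?thesis
    using mod_homD(3)[OF assms(3), of "\<ominus>\<^bsub>R\<^esub> \<one>\<^bsub>R\<^esub>" x] mod_homD(1)[OF assms(3,4)] assms(4)
    by (simp add: M.smult_l_minus N.smult_l_minus)
qed

lemma mod_hom_minus:
  assumes "module R M" "module R N" "f \<in> mod_hom R M N" "x \<in> carrier M" "y \<in> carrier M"
  shows "f (x \<ominus>\<^bsub>M\<^esub> y) = f x \<ominus>\<^bsub>N\<^esub> f y"
proof -
  interpret M: module R M by fact
  interpret N: module R N by fact
  show ?thesis
    using assms(4,5) by (simp add: a_minus_def mod_homD(2)[OF assms(3)] mod_hom_neg[OF assms(1,2,3)])
qed

lemma mod_hom_finsum:
  assumes "module R M" "module R N" "f \<in> mod_hom R M N" "h \<in> S \<rightarrow> carrier M"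
  shows "f (\<Oplus>\<^bsub>M\<^esub>i\<in>S. h i) = (\<Oplus>\<^bsub>N\<^esub>i\<in>S. f (h i))"
proof -
  interpret M: module R M by fact
  interpret N: module R N by fact
  show ?thesis
    using assms(4)
  proof (induction S rule: infinite_finite_induct)
    case (infinite S)
    then show ?case by (simp add: mod_hom_zero[OF assms(1,2,3)])
  next
    case empty
    then show ?case by (simp add: mod_hom_zero[OF assms(1,2,3)])
  next
    case (insert i S)
    have "h \<in> S \<rightarrow> carrier M" "h i \<in> carrier M" using insert.prems by auto
    moreover have "(\<lambda>i. f (h i)) \<in> S \<rightarrow> carrier N" "f (h i) \<in> carrier N"
      using insert.prems mod_homD(1)[OF assms(3)] by (auto simp: Pi_iff)
    ultimately show ?case
      using insert by (simp add: mod_homD(2)[OF assms(3)] M.finsum_closed)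
  qed
qed

lemma mod_hom_const_zero:
  assumes "module R N"
  shows "(\<lambda>_. \<zero>\<^bsub>N\<^esub>) \<in> mod_hom R M N"
proof -
  interpret N: module R N by fact
  show ?thesis by (rule mod_homI) simp_all
qed

lemma mod_hom_add:
  assumes "module R N" "f \<in> mod_hom R M N" "g \<in> mod_hom R M N"
  shows "(\<lambda>x. f x \<oplus>\<^bsub>N\<^esub> g x) \<in> mod_hom R M N"
proof -
  interpret N: module R N by fact
  note f = mod_homD[OF assms(2)] and g = mod_homD[OF assms(3)]
  show ?thesis
    by (rule mod_homI) (simp_all add: f g N.smult_r_distr N.a_ac)
qed

lemma mod_hom_smult:
  assumes "module R N" "f \<in> mod_hom R M N" "a \<in> carrier R"
  shows "(\<lambda>x. a \<odot>\<^bsub>N\<^esub> f x) \<in> mod_hom R M N"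
proof -
  interpret N: module R N by fact
  note f = mod_homD[OF assms(2)]
  show ?thesis
    by (rule mod_homI)
      (simp_all add: f assms(3) N.smult_r_distr N.smult_assoc1[symmetric] N.m_comm)
qed

lemma mod_hom_uminus:
  assumes "module R N" "f \<in> mod_hom R M N"
  shows "(\<lambda>x. \<ominus>\<^bsub>N\<^esub> f x) \<in> mod_hom R M N"
proof -
  interpret N: module R N by fact
  note f = mod_homD[OF assms(2)]
  show ?thesis
    by (rule mod_homI) (simp_all add: f N.minus_add N.smult_r_minus)
qed

lemma mod_hom_diff:
  assumes "module R N" "f \<in> mod_hom R M N" "g \<in> mod_hom R M N"
  shows "(\<lambda>x. f x \<ominus>\<^bsub>N\<^esub> g x) \<in> mod_hom R M N"
  unfolding a_minus_def by (rule mod_hom_add[OF assms(1,2) mod_hom_uminus[OF assms(1,3)]])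

lemma mod_hom_cong:
  assumes "module R M" "\<And>x. x \<in> carrier M \<Longrightarrow> f x = g x"
  shows "f \<in> mod_hom R M N \<longleftrightarrow> g \<in> mod_hom R M N"
proof -
  interpret M: module R M by fact
  show ?thesis
    using assms(2) by (auto simp: mod_hom_def Pi_iff)
qed

lemma submodule_minus:
  assumes "module R M" "submodule U R M" "x \<in> U" "y \<in> U"
  shows "x \<ominus>\<^bsub>M\<^esub> y \<in> U"
proof -
  interpret M: module R M by fact
  show ?thesis
    unfolding a_minus_def
    by (rule M.submoduleE(5)[OF assms(2,3) M.submoduleE(3)[OF assms(2,4)]])
qed

lemma submodule_zero:
  assumes "module R M" "submodule U R M"
  shows "\<zero>\<^bsub>M\<^esub> \<in> U"
proof -
  interpret M: module R M by fact
  obtain u where "u \<in> U" using M.submoduleE(2)[OF assms(2)] by blast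
  moreover from this have "u \<in> carrier M" using M.submoduleE(1)[OF assms(2)] by blast
  ultimately show ?thesis
    using submodule_minus[OF assms, of u u] by (simp add: M.r_neg a_minus_def)
qed

lemma submodule_finsum:
  assumes "module R M" "submodule U R M" "h \<in> S \<rightarrow> U"
  shows "(\<Oplus>\<^bsub>M\<^esub>i\<in>S. h i) \<in> U"
proof -
  interpret M: module R M by fact
  note U = M.submoduleE[OF assms(2)]
  show ?thesis
    using assms(3)
  proof (induction S rule: infinite_finite_induct)
    case (insert i S)
    then show ?case using U(1) U(5) by (subst M.finsum_insert) (auto simp: Pi_iff)
  qed (auto simp: submodule_zero[OF assms(1,2)])
qed

lemma submodule_Inter:
  assumes "module R M" "\<U> \<noteq> {}" "\<And>U. U \<in> \<U> \<Longrightarrow> submodule U R M"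
  shows "submodule (\<Inter>\<U>) R M"
proof -
  interpret M: module R M by fact
  note U = M.submoduleE[OF assms(3)]
  show ?thesis
  proof (rule M.submoduleI)
    show "\<Inter>\<U> \<subseteq> carrier M"
      using U(1) assms(2) by blast
    show "\<zero>\<^bsub>M\<^esub> \<in> \<Inter>\<U>"
      using submodule_zero[OF assms(1)] assms(3) by blast
    show "\<ominus>\<^bsub>M\<^esub> a \<in> \<Inter>\<U>" if "a \<in> \<Inter>\<U>" for a
      using that by (intro InterI U(3)) auto
    show "a \<oplus>\<^bsub>M\<^esub> b \<in> \<Inter>\<U>" if "a \<in> \<Inter>\<U>" "b \<in> \<Inter>\<U>" for a b
      using that by (intro InterI U(5)) auto
    show "r \<odot>\<^bsub>M\<^esub> a \<in> \<Inter>\<U>" if "r \<in> carrier R" "a \<in> \<Inter>\<U>" for r a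
      using that by (intro InterI U(4)) auto
  qed
qed

lemma submodule_Int:
  assumes "module R M" "submodule U R M" "submodule V R M"
  shows "submodule (U \<inter> V) R M"
proof -
  have "submodule (\<Inter>{U, V}) R M"
    by (rule submodule_Inter[OF assms(1)]) (use assms(2,3) in auto)
  then show ?thesis by simp
qed

lemma submodule_singleton_zero:
  assumes "module R M"
  shows "submodule {\<zero>\<^bsub>M\<^esub>} R M"
proof -
  interpret M: module R M by fact
  show ?thesis by (rule M.submoduleI) auto
qed

lemma submodule_module_span:
  assumes "module R M" "S \<subseteq> carrier M"
  shows "submodule (module_span R M S) R M"
  unfolding module_span_def
  by (rule submodule_Inter[OF assms(1)])
    (use module.carrier_is_submodule[OF assms(1)] assms(2) in blast)+

lemma module_span_superset: "S \<subseteq> module_span R M S"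
  unfolding module_span_def by blast

lemma module_span_minimal:
  assumes "submodule U R M" "S \<subseteq> U"
  shows "module_span R M S \<subseteq> U"
  unfolding module_span_def using assms by blast

lemma submodule_image:
  assumes "module R M" "module R N" "f \<in> mod_hom R M N" "submodule U R M"
  shows "submodule (f ` U) R N"
proof -
  interpret M: module R M by fact
  interpret N: module R N by fact
  note U = M.submoduleE[OF assms(4)] and f = mod_homD[OF assms(3)]
  have Uc: "u \<in> carrier M" if "u \<in> U" for u using U(1) that by blast
  show ?thesis
  proof (rule N.submoduleI)
    show "f ` U \<subseteq> carrier N" using Uc f(1) by blast
    show "\<zero>\<^bsub>N\<^esub> \<in> f ` U"
      using mod_hom_zero[OF assms(1-3)] submodule_zero[OF assms(1,4)] by (metis imageI)
    show "\<ominus>\<^bsub>N\<^esub> a \<in> f ` U" if "a \<in> f ` U" for a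
      using that mod_hom_neg[OF assms(1-3) Uc, symmetric] U(3) by auto
    show "a \<oplus>\<^bsub>N\<^esub> b \<in> f ` U" if "a \<in> f ` U" "b \<in> f ` U" for a b
      using that f(2)[OF Uc Uc, symmetric] U(5) by auto
    show "r \<odot>\<^bsub>N\<^esub> a \<in> f ` U" if "r \<in> carrier R" "a \<in> f ` U" for a r
      using that f(3)[OF _ Uc, symmetric] U(4) by auto
  qed
qed

lemma submodule_vimage:
  assumes "module R M" "module R N" "f \<in> mod_hom R M N" "submodule U R N"
  shows "submodule {x \<in> carrier M. f x \<in> U} R M"
proof -
  interpret M: module R M by fact
  interpret N: module R N by fact
  note U = N.submoduleE[OF assms(4)] and f = mod_homD[OF assms(3)]
  show ?thesis
    by (rule M.submoduleI)
      (auto simp: f U mod_hom_neg[OF assms(1-3)] mod_hom_zero[OF assms(1-3)] submodule_zero[OF assms(2,4)])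
qed

text \<open>Each side says that \<open>M\<close> with its carrier cut down to \<open>V\<close> is a
  module; cutting down to \<open>U\<close> on the way leaves no trace in the record.\<close>

lemma module_submodule_trans:
  assumes "module R M" "submodule U R M" "V \<subseteq> U"
  shows "submodule V R (M\<lparr>carrier := U\<rparr>) \<longleftrightarrow> submodule V R M"
proof -
  interpret M: module R M by fact
  interpret U: module R "M\<lparr>carrier := U\<rparr>"
    by (rule submodule.submodule_is_module[OF assms(2,1)])
  have V: "V \<subseteq> carrier M" using assms(3) M.submoduleE(1)[OF assms(2)] by blast
  have "submodule V R M \<longleftrightarrow> module R (M\<lparr>carrier := V\<rparr>)"
    using M.module_incl_imp_submodule[OF V] submodule.submodule_is_module[OF _ assms(1)] by blast
  moreover have "submodule V R (M\<lparr>carrier := U\<rparr>) \<longleftrightarrow> module R (M\<lparr>carrier := V\<rparr>)"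
    using U.module_incl_imp_submodule[of V] submodule.submodule_is_module[OF _ U.module_axioms, of V] assms(3)
    by auto
  ultimately show ?thesis by simp
qed

section \<open>Chain conditions\<close>

text \<open>Without a maximal member, dependent choice climbs strictly forever. The chain condition
  is asked only for chains inside the family, so the lemma serves for families of submodules as well
  as for annihilator ideals of selected elements.\<close>

lemma chain_condition_maximal:
  assumes chain: "\<And>Y :: nat \<Rightarrow> 'x set. (\<And>n. Y n \<in> \<S>) \<Longrightarrow> (\<And>n. Y n \<subseteq> Y (Suc n)) \<Longrightarrow> \<exists>m. \<forall>n\<ge>m. Y n = Y m"
    and "\<S> \<noteq> {}"
  shows "\<exists>U\<in>\<S>. \<forall>V\<in>\<S>. U \<subseteq> V \<longrightarrow> V = U"
proof (rule ccontr)
  assume "\<not> ?thesis"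
  then have step: "\<exists>V. V \<in> \<S> \<and> U \<subset> V" if "U \<in> \<S>" for U
    using that by blast
  have "\<exists>Y. \<forall>n. Y n \<in> \<S> \<and> Y n \<subset> Y (Suc n)"
    by (rule dependent_nat_choice) (use \<open>\<S> \<noteq> {}\<close> step in auto)
  then obtain Y where Y: "\<And>n. Y n \<in> \<S>" "\<And>n. Y n \<subset> Y (Suc n)"
    by blast
  have "\<exists>m. \<forall>n\<ge>m. Y n = Y m"
    by (rule chain) (use Y in auto)
  then obtain m where "\<forall>n\<ge>m. Y n = Y m" ..
  then have "Y (Suc m) = Y m" by (meson le_SucI order_refl)
  then show False using Y(2)[of m] by blast
qed

text \<open>A countable ascending chain is totally ordered, so its union is one of its terms, and
  from that term on nothing changes.\<close>

lemma (in noetherian_ring) ideal_chain_stabilises: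
  fixes Y :: "nat \<Rightarrow> 'a set"
  assumes "\<And>n. ideal (Y n) R" "\<And>n. Y n \<subseteq> Y (Suc n)"
  shows "\<exists>m. \<forall>n\<ge>m. Y n = Y m"
proof -
  have mono: "Y i \<subseteq> Y j" if "i \<le> j" for i j
    using lift_Suc_mono_le[of Y, OF assms(2) that] .
  have "subset.chain {I. ideal I R} (range Y)"
    unfolding subset_chain_def using assms(1) mono nat_le_linear by blast
  then have "\<Union>(range Y) \<in> range Y"
    using ideal_chain_is_trivial by blast
  then obtain m where m: "\<Union>(range Y) = Y m" by blast
  then have "Y n = Y m" if "n \<ge> m" for n
    using mono[OF that] by blast
  then show ?thesis by blast
qed

section \<open>Submodules stable under a set of operators, and their chain condition\<close>

definition stable_submodule ::
  "('a, 'b) ring_scheme \<Rightarrow> ('a, 'm, 'c) module_scheme \<Rightarrow> ('m \<Rightarrow> 'm) set \<Rightarrow> 'm set \<Rightarrow> bool" where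
  "stable_submodule R M \<Theta> U \<longleftrightarrow> submodule U R M \<and> (\<forall>\<theta>\<in>\<Theta>. \<theta> ` U \<subseteq> U)"

definition stable_span ::
  "('a, 'b) ring_scheme \<Rightarrow> ('a, 'm, 'c) module_scheme \<Rightarrow> ('m \<Rightarrow> 'm) set \<Rightarrow> 'm set \<Rightarrow> 'm set" where
  "stable_span R M \<Theta> S = \<Inter>{U. stable_submodule R M \<Theta> U \<and> S \<subseteq> U}"

text \<open>Stable submodules under commuting operators are the submodules over a polynomial ring in
  these operators, which thus never has to be built. The condition speaks of stable submodules
  inside a set \<open>G\<close> that itself may be neither stable nor a submodule: passing to a
  smaller set is then immediate, and the carrier of \<open>M\<close> never changes.\<close>

definition noetherian_on ::
  "('a, 'b) ring_scheme \<Rightarrow> ('a, 'm, 'c) module_scheme \<Rightarrow> ('m \<Rightarrow> 'm) set \<Rightarrow> 'm set \<Rightarrow> bool" where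
  "noetherian_on R M \<Theta> G \<longleftrightarrow>
     (\<forall>Y :: nat \<Rightarrow> 'm set. (\<forall>n. stable_submodule R M \<Theta> (Y n) \<and> Y n \<subseteq> G \<and> Y n \<subseteq> Y (Suc n)) \<longrightarrow>
        (\<exists>m. \<forall>n\<ge>m. Y n = Y m))"

lemma stable_span_superset: "S \<subseteq> stable_span R M \<Theta> S"
  unfolding stable_span_def by blast

lemma stable_span_minimal:
  assumes "stable_submodule R M \<Theta> U" "S \<subseteq> U"
  shows "stable_span R M \<Theta> S \<subseteq> U"
  unfolding stable_span_def using assms by blast

lemma stable_submodule_span:
  assumes "module R M" "\<Theta> \<subseteq> mod_hom R M M" "S \<subseteq> carrier M"
  shows "stable_submodule R M \<Theta> (stable_span R M \<Theta> S)"
proof -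
  have "stable_submodule R M \<Theta> (carrier M)"
    unfolding stable_submodule_def
    using module.carrier_is_submodule[OF assms(1)] assms(2) by (auto dest: mod_homD(1))
  then have "submodule (stable_span R M \<Theta> S) R M"
    unfolding stable_span_def
    by (intro submodule_Inter[OF assms(1)]) (use assms(3) in \<open>auto simp: stable_submodule_def\<close>)
  moreover have "\<theta> ` stable_span R M \<Theta> S \<subseteq> stable_span R M \<Theta> S" if "\<theta> \<in> \<Theta>" for \<theta>
    using that unfolding stable_span_def stable_submodule_def by blast
  ultimately show ?thesis unfolding stable_submodule_def by blast
qed

lemma noetherian_on_subset:
  assumes "noetherian_on R M \<Theta> G" "H \<subseteq> G"
  shows "noetherian_on R M \<Theta> H"
  unfolding noetherian_on_def
proof (intro allI impI)
  fix Y
  assume "\<forall>n. stable_submodule R M \<Theta> (Y n) \<and> Y n \<subseteq> H \<and> Y n \<subseteq> Y (Suc n)"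
  then have "\<forall>n. stable_submodule R M \<Theta> (Y n) \<and> Y n \<subseteq> G \<and> Y n \<subseteq> Y (Suc n)"
    using assms(2) by blast
  then show "\<exists>m. \<forall>n\<ge>m. Y n = Y m"
    using assms(1) unfolding noetherian_on_def by blast
qed

lemma noetherian_onD:
  assumes "noetherian_on R M \<Theta> G"
    and "\<And>n. stable_submodule R M \<Theta> (Y n)" "\<And>n. Y n \<subseteq> G" "\<And>n. Y n \<subseteq> Y (Suc n)"
  shows "\<exists>m. \<forall>n\<ge>m. Y n = Y m"
  using assms unfolding noetherian_on_def by blast

lemma noetherian_on_maximal:
  assumes "noetherian_on R M \<Theta> G" "\<S> \<noteq> {}"
    and "\<And>U. U \<in> \<S> \<Longrightarrow> stable_submodule R M \<Theta> U \<and> U \<subseteq> G"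
  shows "\<exists>U\<in>\<S>. \<forall>V\<in>\<S>. U \<subseteq> V \<longrightarrow> V = U"
  by (rule chain_condition_maximal[OF _ assms(2)]) (rule noetherian_onD[OF assms(1)], use assms(3) in auto)

text \<open>A maximal member \<open>L k0 n0\<close> of the whole family takes care of all \<open>k \<ge> k0\<close>, so that only the
  finitely many chains with \<open>k < k0\<close> remain.\<close>

lemma noetherian_on_double_chain:
  assumes noeth: "noetherian_on R M \<Theta> G"
    and L: "\<And>k n. stable_submodule R M \<Theta> (L k n)" "\<And>k n. L k n \<subseteq> G"
      "\<And>k n. L k n \<subseteq> L (Suc k) n" "\<And>k n. L k n \<subseteq> L k (Suc n)"
  shows "\<exists>m. \<forall>n\<ge>m. \<forall>k. L k n = L k m"
proof -
  have mk: "L k n \<subseteq> L k' n" if "k \<le> k'" for k k' n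
    using lift_Suc_mono_le[of "\<lambda>k. L k n", OF L(3) that] .
  have mn: "L k n \<subseteq> L k n'" if "n \<le> n'" for k n n'
    using lift_Suc_mono_le[of "L k", OF L(4) that] .
  define \<S> where "\<S> = range (\<lambda>(k, n). L k n)"
  have "\<exists>U\<in>\<S>. \<forall>V\<in>\<S>. U \<subseteq> V \<longrightarrow> V = U"
  proof (rule noetherian_on_maximal[OF noeth])
    show "stable_submodule R M \<Theta> U \<and> U \<subseteq> G" if "U \<in> \<S>" for U
      using that L(1,2) unfolding \<S>_def by force
  qed (simp add: \<S>_def)
  then obtain U where U: "U \<in> \<S>" "\<And>V. V \<in> \<S> \<Longrightarrow> U \<subseteq> V \<Longrightarrow> V = U" by blast
  from U(1) obtain k0 n0 where "U = L k0 n0" unfolding \<S>_def by force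
  then have max: "L k n = L k0 n0" if "L k0 n0 \<subseteq> L k n" for k n
    using U(2)[of "L k n"] that unfolding \<S>_def by force
  have big: "L k n = L k0 n0" if "k \<ge> k0" "n \<ge> n0" for k n
    by (rule max) (use mk[OF that(1), of n] mn[OF that(2), of k0] in blast)
  have "\<exists>m. \<forall>n\<ge>m. L k n = L k m" for k
    by (rule noetherian_onD[OF noeth]) (rule L)+
  then obtain s where s: "\<And>k n. n \<ge> s k \<Longrightarrow> L k n = L k (s k)" by metis
  define m where "m = Max (insert n0 (s ` {..<k0}))"
  have m: "n0 \<le> m" "\<And>k. k < k0 \<Longrightarrow> s k \<le> m"
    unfolding m_def by (auto intro: Max_ge)
  have "L k n = L k m" if "n \<ge> m" for k n
  proof (cases "k < k0")
    case True
    then show ?thesis using s[of k n] s[of k m] m(2)[of k] that by auto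
  next
    case False
    then show ?thesis using big[of k n] big[of k m] m(1) that by auto
  qed
  then show ?thesis by blast
qed

lemma submodule_sum:
  assumes "module R M" "submodule U R M" "submodule V R M"
  shows "submodule {u \<oplus>\<^bsub>M\<^esub> v | u v. u \<in> U \<and> v \<in> V} R M" (is "submodule ?W R M")
proof -
  interpret M: module R M by fact
  note U = M.submoduleE[OF assms(2)] and V = M.submoduleE[OF assms(3)]
  have Uc: "u \<in> carrier M" if "u \<in> U" for u using U(1) that by blast
  have Vc: "v \<in> carrier M" if "v \<in> V" for v using V(1) that by blast
  show ?thesis
  proof (rule M.submoduleI)
    show "?W \<subseteq> carrier M" using Uc Vc by auto
    show "\<zero>\<^bsub>M\<^esub> \<in> ?W"
      using submodule_zero[OF assms(1,2)] submodule_zero[OF assms(1,3)]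
      by (force intro: exI[of _ "\<zero>\<^bsub>M\<^esub>"])
  next
    fix a assume "a \<in> ?W"
    then obtain u v where uv: "u \<in> U" "v \<in> V" "a = u \<oplus>\<^bsub>M\<^esub> v" by blast
    then have "\<ominus>\<^bsub>M\<^esub> a = (\<ominus>\<^bsub>M\<^esub> u) \<oplus>\<^bsub>M\<^esub> (\<ominus>\<^bsub>M\<^esub> v)"
      using Uc Vc by (simp add: M.minus_add)
    then show "\<ominus>\<^bsub>M\<^esub> a \<in> ?W" using U(3) V(3) uv by blast
  next
    fix a b assume "a \<in> ?W" "b \<in> ?W"
    then obtain u v u' v' where uv: "u \<in> U" "v \<in> V" "a = u \<oplus>\<^bsub>M\<^esub> v" "u' \<in> U" "v' \<in> V" "b = u' \<oplus>\<^bsub>M\<^esub> v'"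
      by blast
    then have "a \<oplus>\<^bsub>M\<^esub> b = (u \<oplus>\<^bsub>M\<^esub> u') \<oplus>\<^bsub>M\<^esub> (v \<oplus>\<^bsub>M\<^esub> v')"
      using Uc Vc by (simp add: M.a_ac)
    then show "a \<oplus>\<^bsub>M\<^esub> b \<in> ?W" using U(5) V(5) uv by blast
  next
    fix r a assume r: "r \<in> carrier R" and "a \<in> ?W"
    then obtain u v where uv: "u \<in> U" "v \<in> V" "a = u \<oplus>\<^bsub>M\<^esub> v" by blast
    then have "r \<odot>\<^bsub>M\<^esub> a = r \<odot>\<^bsub>M\<^esub> u \<oplus>\<^bsub>M\<^esub> r \<odot>\<^bsub>M\<^esub> v"
      using Uc Vc r by (simp add: M.smult_r_distr)
    then show "r \<odot>\<^bsub>M\<^esub> a \<in> ?W" using U(4)[OF r] V(4)[OF r] uv by blast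
  qed
qed

text \<open>The ideal \<open>(U : x)\<close>. It serves as an ideal of coefficients, as an
  annihilator modulo \<open>U\<close>, and for extending a statement from generators of an ideal to
  the whole ideal.\<close>

lemma colon_ideal:
  assumes "module R M" "submodule U R M" "x \<in> carrier M"
  shows "ideal {a \<in> carrier R. a \<odot>\<^bsub>M\<^esub> x \<in> U} R"
proof -
  interpret M: module R M by fact
  note U = M.submoduleE[OF assms(2)]
  show ?thesis
  proof (rule idealI)
    show "ring R" by (rule M.ring_axioms)
    show "subgroup {a \<in> carrier R. a \<odot>\<^bsub>M\<^esub> x \<in> U} (add_monoid R)"
      using assms(3) submodule_zero[OF assms(1,2)]
      by unfold_locales
        (auto simp: M.smult_l_distr M.smult_l_minus U a_inv_def[symmetric] M.smult_l_null)
  next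
    fix a r assume a: "a \<in> {a \<in> carrier R. a \<odot>\<^bsub>M\<^esub> x \<in> U}" and r: "r \<in> carrier R"
    then show "r \<otimes>\<^bsub>R\<^esub> a \<in> {a \<in> carrier R. a \<odot>\<^bsub>M\<^esub> x \<in> U}"
      using U(4)[OF r, of "a \<odot>\<^bsub>M\<^esub> x"] assms(3) by (simp add: M.smult_assoc1)
    with a r show "a \<otimes>\<^bsub>R\<^esub> r \<in> {a \<in> carrier R. a \<odot>\<^bsub>M\<^esub> x \<in> U}"
      by (simp add: M.m_comm)
  qed
qed

lemma submodule_linear_combinations:
  assumes "module R M" "submodule U R M" "x \<in> carrier M"
  shows "submodule {a \<odot>\<^bsub>M\<^esub> x \<oplus>\<^bsub>M\<^esub> u | a u. a \<in> carrier R \<and> u \<in> U} R M"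
proof -
  interpret M: module R M by fact
  have "submodule {a \<odot>\<^bsub>M\<^esub> x | a. a \<in> carrier R} R M"
  proof (rule M.submoduleI)
    show "\<zero>\<^bsub>M\<^esub> \<in> {a \<odot>\<^bsub>M\<^esub> x | a. a \<in> carrier R}"
      using assms(3) M.smult_l_null[of x] by (force intro: exI[of _ "\<zero>\<^bsub>R\<^esub>"])
    show "\<ominus>\<^bsub>M\<^esub> u \<in> {a \<odot>\<^bsub>M\<^esub> x | a. a \<in> carrier R}" if "u \<in> {a \<odot>\<^bsub>M\<^esub> x | a. a \<in> carrier R}" for u
      using that assms(3) by (auto simp: M.smult_l_minus[symmetric])
    show "u \<oplus>\<^bsub>M\<^esub> v \<in> {a \<odot>\<^bsub>M\<^esub> x | a. a \<in> carrier R}"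
      if "u \<in> {a \<odot>\<^bsub>M\<^esub> x | a. a \<in> carrier R}" "v \<in> {a \<odot>\<^bsub>M\<^esub> x | a. a \<in> carrier R}" for u v
      using that assms(3) by (auto simp: M.smult_l_distr[symmetric])
    show "r \<odot>\<^bsub>M\<^esub> u \<in> {a \<odot>\<^bsub>M\<^esub> x | a. a \<in> carrier R}"
      if "r \<in> carrier R" "u \<in> {a \<odot>\<^bsub>M\<^esub> x | a. a \<in> carrier R}" for r u
      using that assms(3) by (auto simp: M.smult_assoc1[symmetric])
  qed (use assms(3) in auto)
  from submodule_sum[OF assms(1) this assms(2)]
  have "submodule {v \<oplus>\<^bsub>M\<^esub> u | v u. v \<in> {a \<odot>\<^bsub>M\<^esub> x | a. a \<in> carrier R} \<and> u \<in> U} R M" .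
  also have "{v \<oplus>\<^bsub>M\<^esub> u | v u. v \<in> {a \<odot>\<^bsub>M\<^esub> x | a. a \<in> carrier R} \<and> u \<in> U} =
      {a \<odot>\<^bsub>M\<^esub> x \<oplus>\<^bsub>M\<^esub> u | a u. a \<in> carrier R \<and> u \<in> U}"
    by blast
  finally show ?thesis .
qed

lemma module_span_insert:
  assumes "module R M" "S \<subseteq> carrier M" "x \<in> carrier M" "y \<in> module_span R M (insert x S)"
  shows "\<exists>a\<in>carrier R. \<exists>u\<in>module_span R M S. y = a \<odot>\<^bsub>M\<^esub> x \<oplus>\<^bsub>M\<^esub> u"
proof -
  interpret M: module R M by fact
  let ?U = "module_span R M S" and ?W = "{a \<odot>\<^bsub>M\<^esub> x \<oplus>\<^bsub>M\<^esub> u | a u. a \<in> carrier R \<and> u \<in> module_span R M S}"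
  note U = submodule_module_span[OF assms(1,2)]
  have "x = \<one>\<^bsub>R\<^esub> \<odot>\<^bsub>M\<^esub> x \<oplus>\<^bsub>M\<^esub> \<zero>\<^bsub>M\<^esub>" using assms(3) by simp
  then have "x \<in> ?W" using submodule_zero[OF assms(1) U] by blast
  moreover have "s \<in> ?W" if "s \<in> S" for s
  proof -
    have "s = \<zero>\<^bsub>R\<^esub> \<odot>\<^bsub>M\<^esub> x \<oplus>\<^bsub>M\<^esub> s" using assms(2,3) that by auto
    then show ?thesis using module_span_superset[of S R M] that by blast
  qed
  ultimately have "module_span R M (insert x S) \<subseteq> ?W"
    by (intro module_span_minimal submodule_linear_combinations[OF assms(1) U assms(3)]) auto
  then show ?thesis using assms(4) by blast
qed

text \<open>Induction on the generators: a submodule \<open>V\<close> of \<open>R x + U\<close> is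
  controlled by the ideal \<open>(V + U : x)\<close> and by its intersection with \<open>U\<close>.
  For an ascending chain both stabilise, the ideals because \<open>R\<close> is Noetherian and the
  intersections by induction; nested submodules that agree in both are equal.\<close>

lemma noetherian_on_module_span:
  assumes "noetherian_ring R" "module R M" "finite S" "S \<subseteq> carrier M"
  shows "noetherian_on R M {} (module_span R M S)"
  using assms(3,4)
proof (induction S rule: finite_induct)
  case empty
  have "module_span R M {} \<subseteq> {\<zero>\<^bsub>M\<^esub>}"
    by (rule module_span_minimal[OF submodule_singleton_zero[OF assms(2)]]) simp
  then have *: "V = {\<zero>\<^bsub>M\<^esub>}" if "submodule V R M" "V \<subseteq> module_span R M {}" for V
    using that submodule_zero[OF assms(2) that(1)] by blast
  show ?case
    unfolding noetherian_on_def stable_submodule_def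
  proof (intro allI impI)
    fix Y :: "nat \<Rightarrow> 'c set"
    assume "\<forall>n. (submodule (Y n) R M \<and> (\<forall>\<theta>\<in>{}. \<theta> ` Y n \<subseteq> Y n)) \<and>
      Y n \<subseteq> module_span R M {} \<and> Y n \<subseteq> Y (Suc n)"
    then have "Y n = {\<zero>\<^bsub>M\<^esub>}" for n by (intro *) auto
    then show "\<exists>m. \<forall>n\<ge>m. Y n = Y m" by simp
  qed
next
  case (insert x S)
  interpret R: noetherian_ring R by fact
  interpret M: module R M by fact
  have S: "S \<subseteq> carrier M" and x: "x \<in> carrier M" using insert.prems by auto
  let ?U = "module_span R M S"
  note U = submodule_module_span[OF assms(2) S]
  note Uc = M.submoduleE(1)[OF U]
  show ?case
    unfolding noetherian_on_def stable_submodule_def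
  proof (intro allI impI)
    fix Y :: "nat \<Rightarrow> 'c set"
    assume *: "\<forall>n. (submodule (Y n) R M \<and> (\<forall>\<theta>\<in>{}. \<theta> ` Y n \<subseteq> Y n)) \<and>
      Y n \<subseteq> module_span R M (insert x S) \<and> Y n \<subseteq> Y (Suc n)"
    then have Y: "submodule (Y n) R M" "Y n \<subseteq> module_span R M (insert x S)" "Y n \<subseteq> Y (Suc n)" for n
      by auto
    define W where "W n = {y \<oplus>\<^bsub>M\<^esub> u | y u. y \<in> Y n \<and> u \<in> ?U}" for n
    define I where "I n = {a \<in> carrier R. a \<odot>\<^bsub>M\<^esub> x \<in> W n}" for n
    have "\<exists>m. \<forall>n\<ge>m. I n = I m"
    proof (rule R.ideal_chain_stabilises)
      show "ideal (I n) R" for n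
        unfolding I_def W_def by (rule colon_ideal[OF assms(2) submodule_sum[OF assms(2) Y(1) U] x])
      show "I n \<subseteq> I (Suc n)" for n
        using Y(3)[of n] unfolding I_def W_def by blast
    qed
    then obtain m1 where m1: "\<And>n. n \<ge> m1 \<Longrightarrow> I n = I m1" by blast
    have "\<exists>m. \<forall>n\<ge>m. Y n \<inter> ?U = Y m \<inter> ?U"
      by (rule noetherian_onD[OF insert.IH[OF S]])
        (use Y(3) submodule_Int[OF assms(2) Y(1) U] in \<open>auto simp: stable_submodule_def\<close>)
    then obtain m2 where m2: "\<And>n. n \<ge> m2 \<Longrightarrow> Y n \<inter> ?U = Y m2 \<inter> ?U" by blast
    have mono: "Y i \<subseteq> Y j" if "i \<le> j" for i j
      using lift_Suc_mono_le[of Y, OF Y(3) that] .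
    have "Y n \<subseteq> Y (max m1 m2)" if n: "n \<ge> max m1 m2" for n
    proof
      fix y assume y: "y \<in> Y n"
      let ?m = "max m1 m2"
      note Yn = M.submoduleE[OF Y(1)]
      have yc: "y \<in> carrier M" using Yn(1) y by blast
      obtain a u where au: "a \<in> carrier R" "u \<in> ?U" "y = a \<odot>\<^bsub>M\<^esub> x \<oplus>\<^bsub>M\<^esub> u"
        using module_span_insert[OF assms(2) S x] Y(2) y by blast
      then have uc: "u \<in> carrier M" using Uc by blast
      have "a \<odot>\<^bsub>M\<^esub> x = y \<oplus>\<^bsub>M\<^esub> (\<ominus>\<^bsub>M\<^esub> u)"
        using au(1,3) uc x by (simp add: M.a_assoc M.r_neg)
      then have "a \<in> I n"
        using au y M.submoduleE(3)[OF U] unfolding I_def W_def by blast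
      then have "a \<in> I ?m" using m1[of n] m1[of ?m] n by auto
      \<comment> \<open>\<open>z\<close> has the same coefficient at \<open>x\<close> as
        \<open>y\<close>, modulo \<open>?U\<close>; hence \<open>y - z\<close> lies in the
        intersection with \<open>?U\<close>.\<close>
      then obtain z v where zv: "z \<in> Y ?m" "v \<in> ?U" "a \<odot>\<^bsub>M\<^esub> x = z \<oplus>\<^bsub>M\<^esub> v"
        unfolding I_def W_def by blast
      have zc: "z \<in> carrier M" and vc: "v \<in> carrier M" using zv Yn(1) Uc by blast+
      have "y \<ominus>\<^bsub>M\<^esub> z = v \<oplus>\<^bsub>M\<^esub> u"
        unfolding au(3) zv(3) a_minus_def using zc vc uc by (simp add: M.a_ac M.r_neg2 M.r_neg1 M.r_neg)
      moreover have "v \<oplus>\<^bsub>M\<^esub> u \<in> ?U" by (rule M.submoduleE(5)[OF U zv(2) au(2)])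
      moreover have "y \<ominus>\<^bsub>M\<^esub> z \<in> Y n"
        by (rule submodule_minus[OF assms(2) Y(1) y subsetD[OF mono[OF n] zv(1)]])
      ultimately have "y \<ominus>\<^bsub>M\<^esub> z \<in> Y n \<inter> ?U" by simp
      then have "y \<ominus>\<^bsub>M\<^esub> z \<in> Y ?m" using m2[of n] m2[of ?m] n by auto
      then have "(y \<ominus>\<^bsub>M\<^esub> z) \<oplus>\<^bsub>M\<^esub> z \<in> Y ?m" by (rule Yn(5)[OF _ zv(1)])
      then show "y \<in> Y ?m" using yc zc by (simp add: a_minus_def M.a_assoc M.l_neg)
    qed
    then have "Y n = Y (max m1 m2)" if "n \<ge> max m1 m2" for n
      using mono[OF that] that by blast
    then show "\<exists>m. \<forall>n\<ge>m. Y n = Y m" by blast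
  qed
qed

text \<open>A maximal finitely generated submodule of \<open>U\<close> absorbs every further element
  of \<open>U\<close>.\<close>

lemma noetherian_on_fin_gen:
  assumes "module R M" "submodule U R M" "noetherian_on R M {} U"
  shows "\<exists>S. finite S \<and> S \<subseteq> U \<and> module_span R M S = U"
proof -
  interpret M: module R M by fact
  note Uc = M.submoduleE(1)[OF assms(2)]
  let ?\<S> = "{module_span R M S | S. finite S \<and> S \<subseteq> U}"
  have span: "submodule (module_span R M S) R M" "module_span R M S \<subseteq> U" if "S \<subseteq> U" for S
    using submodule_module_span[OF assms(1)] module_span_minimal[OF assms(2) that] that Uc by blast+
  have "\<exists>V\<in>?\<S>. \<forall>V'\<in>?\<S>. V \<subseteq> V' \<longrightarrow> V' = V"
  proof (rule noetherian_on_maximal[OF assms(3)])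
    show "stable_submodule R M {} V \<and> V \<subseteq> U" if V: "V \<in> ?\<S>" for V
    proof -
      obtain S where "V = module_span R M S" "S \<subseteq> U" using V by blast
      then show ?thesis using span[of S] by (simp add: stable_submodule_def)
    qed
  qed blast
  then obtain V where V: "V \<in> ?\<S>" and max: "\<And>V'. V' \<in> ?\<S> \<Longrightarrow> V \<subseteq> V' \<Longrightarrow> V' = V"
    by auto
  from V obtain S where S: "finite S" "S \<subseteq> U" and VS: "V = module_span R M S" by auto
  have "x \<in> module_span R M S" if "x \<in> U" for x
  proof -
    have "module_span R M S \<subseteq> module_span R M (insert x S)"
      unfolding module_span_def by blast
    moreover have "module_span R M (insert x S) \<in> ?\<S>"
      using S that by blast
    ultimately have "module_span R M (insert x S) = module_span R M S"
      using max unfolding VS by simp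
    then show ?thesis using module_span_superset[of "insert x S" R M] by blast
  qed
  then show ?thesis using S span(2)[OF S(2)] by blast
qed


lemma stable_submodule_chain_Union:
  fixes F :: "nat \<Rightarrow> 'm set"
  assumes "module R M" "\<And>k. stable_submodule R M \<Theta> (F k)" "\<And>k. F k \<subseteq> F (Suc k)"
  shows "stable_submodule R M \<Theta> (\<Union>k. F k)"
proof -
  interpret M: module R M by fact
  have sub: "submodule (F k) R M" and st: "\<theta> \<in> \<Theta> \<Longrightarrow> \<theta> ` F k \<subseteq> F k" for k \<theta>
    using assms(2)[of k] unfolding stable_submodule_def by auto
  note F = M.submoduleE[OF sub]
  have mono: "F i \<subseteq> F j" if "i \<le> j" for i j
    using lift_Suc_mono_le[of F, OF assms(3) that] .
  have "submodule (\<Union>k. F k) R M"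
  proof (rule M.submoduleI)
    show "(\<Union>k. F k) \<subseteq> carrier M" using F(1) by blast
    show "\<zero>\<^bsub>M\<^esub> \<in> (\<Union>k. F k)" using submodule_zero[OF assms(1) sub] by blast
    show "\<ominus>\<^bsub>M\<^esub> a \<in> (\<Union>k. F k)" if a: "a \<in> (\<Union>k. F k)" for a
    proof -
      obtain k where "a \<in> F k" using a by blast
      then show ?thesis using F(3)[of a k] by blast
    qed
    show "r \<odot>\<^bsub>M\<^esub> a \<in> (\<Union>k. F k)" if "r \<in> carrier R" and a: "a \<in> (\<Union>k. F k)" for r a
    proof -
      obtain k where "a \<in> F k" using a by blast
      then show ?thesis using F(4)[OF that(1), of a k] by blast
    qed
    show "a \<oplus>\<^bsub>M\<^esub> b \<in> (\<Union>k. F k)" if a: "a \<in> (\<Union>k. F k)" and b: "b \<in> (\<Union>k. F k)" for a b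
    proof -
      obtain i j where "a \<in> F i" "b \<in> F j" using a b by blast
      then have "a \<in> F (max i j)" "b \<in> F (max i j)"
        using mono[of i "max i j"] mono[of j "max i j"] by auto
      then show ?thesis using F(5) by blast
    qed
  qed
  moreover have "\<theta> ` (\<Union>k. F k) \<subseteq> (\<Union>k. F k)" if "\<theta> \<in> \<Theta>" for \<theta>
    using st[OF that] by blast
  ultimately show ?thesis unfolding stable_submodule_def by blast
qed

text \<open>Hilbert's basis theorem, with the polynomial ring replaced by an operator \<open>z\<close>: the leading
  coefficients of the elements of filtration degree \<open>k\<close> of a submodule form an increasing chain.\<close>

lemma noetherian_on_adjoin:
  assumes M: "module R M" and \<Theta>: "\<Theta> \<subseteq> mod_hom R M M" and z: "z \<in> mod_hom R M M"
    and comm: "\<And>\<theta> x. \<theta> \<in> \<Theta> \<Longrightarrow> x \<in> carrier M \<Longrightarrow> \<theta> (z x) = z (\<theta> x)"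
    and G: "stable_submodule R M \<Theta> G" and noeth: "noetherian_on R M \<Theta> G"
  shows "noetherian_on R M (insert z \<Theta>) (stable_span R M (insert z \<Theta>) G)"
proof -
  interpret M: module R M by fact
  have Gs: "submodule G R M" and G\<Theta>: "\<And>\<theta>. \<theta> \<in> \<Theta> \<Longrightarrow> \<theta> ` G \<subseteq> G"
    using G unfolding stable_submodule_def by auto
  have Gc: "g \<in> carrier M" if "g \<in> G" for g using M.submoduleE(1)[OF Gs] that by blast
  have zk: "z ^^ k \<in> mod_hom R M M" for k
  proof (induction k)
    case 0 show ?case by (rule mod_homI) auto
  next
    case (Suc k) then show ?case using mod_hom_comp[OF Suc z] by (simp add: comp_def)
  qed
  have zkc: "\<theta> ((z ^^ k) x) = (z ^^ k) (\<theta> x)" if "\<theta> \<in> \<Theta>" "x \<in> carrier M" for \<theta> k x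
  proof (induction k)
    case (Suc k)
    have "\<theta> (z ((z ^^ k) x)) = z (\<theta> ((z ^^ k) x))"
      by (rule comm[OF that(1) mod_homD(1)[OF zk that(2)]])
    then show ?case using Suc by simp
  qed simp
  have \<Theta>D: "\<theta> (x \<oplus>\<^bsub>M\<^esub> y) = \<theta> x \<oplus>\<^bsub>M\<^esub> \<theta> y" if "\<theta> \<in> \<Theta>" "x \<in> carrier M" "y \<in> carrier M" for \<theta> x y
    by (rule mod_homD(2)[of \<theta> R M M]) (use \<Theta> that in blast)+
  \<comment> \<open>\<open>F k\<close> is \<open>G + z G + ... + z^(k - 1) G\<close>, the elements
    of degree below \<open>k\<close>.\<close>
  define F where "F = rec_nat {\<zero>\<^bsub>M\<^esub>} (\<lambda>k A. {a \<oplus>\<^bsub>M\<^esub> b | a b. a \<in> A \<and> b \<in> (z ^^ k) ` G})"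
  have F0: "F 0 = {\<zero>\<^bsub>M\<^esub>}" and FS: "F (Suc k) = {a \<oplus>\<^bsub>M\<^esub> b | a b. a \<in> F k \<and> b \<in> (z ^^ k) ` G}" for k
    by (simp_all add: F_def)
  have Fsub: "submodule (F k) R M" for k
  proof (induction k)
    case 0 then show ?case by (simp add: F0 submodule_singleton_zero[OF M])
  next
    case (Suc k) then show ?case unfolding FS
      by (rule submodule_sum[OF M _ submodule_image[OF M M zk Gs]])
  qed
  have Fc: "x \<in> carrier M" if "x \<in> F k" for x k using M.submoduleE(1)[OF Fsub] that by blast
  have F\<Theta>: "\<theta> x \<in> F k" if \<theta>: "\<theta> \<in> \<Theta>" and x: "x \<in> F k" for \<theta> x k
    using x
  proof (induction k arbitrary: x)
    case 0
    then show ?case using \<theta> \<Theta> mod_hom_zero[OF M M] by (auto simp: F0)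
  next
    case (Suc k)
    then obtain a g where ag: "a \<in> F k" "g \<in> G" "x = a \<oplus>\<^bsub>M\<^esub> (z ^^ k) g"
      unfolding FS by blast
    have "\<theta> x = \<theta> a \<oplus>\<^bsub>M\<^esub> (z ^^ k) (\<theta> g)"
      unfolding ag(3) using \<Theta>D[OF \<theta> Fc[OF ag(1)] mod_homD(1)[OF zk Gc[OF ag(2)]]] zkc[OF \<theta> Gc[OF ag(2)]] by simp
    moreover have "\<theta> g \<in> G" using G\<Theta>[OF \<theta>] ag(2) by blast
    ultimately show ?case using Suc.IH[OF ag(1)] unfolding FS by blast
  qed
  have FSuc: "F k \<subseteq> F (Suc k)" for k
  proof
    fix x assume x: "x \<in> F k"
    have "x = x \<oplus>\<^bsub>M\<^esub> (z ^^ k) \<zero>\<^bsub>M\<^esub>" using Fc[OF x] mod_hom_zero[OF M M zk] by simp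
    then show "x \<in> F (Suc k)" using x submodule_zero[OF M Gs] unfolding FS by blast
  qed
  have zF: "z x \<in> F (Suc k)" if "x \<in> F k" for x k
    using that
  proof (induction k arbitrary: x)
    case 0
    then have "z x = \<zero>\<^bsub>M\<^esub>" using mod_hom_zero[OF M M z] by (simp add: F0)
    then show ?case by (simp add: submodule_zero[OF M Fsub])
  next
    case (Suc k)
    then obtain a g where ag: "a \<in> F k" "g \<in> G" "x = a \<oplus>\<^bsub>M\<^esub> (z ^^ k) g"
      unfolding FS by blast
    then have "z x = z a \<oplus>\<^bsub>M\<^esub> (z ^^ Suc k) g"
      using mod_homD(2)[OF z Fc[OF ag(1)] mod_homD(1)[OF zk Gc[OF ag(2)]]] by simp
    then show ?case using Suc.IH[OF ag(1)] ag(2) unfolding FS[of "Suc k"] by blast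
  qed
  have "stable_submodule R M (insert z \<Theta>) (\<Union>k. F k)"
  proof -
    have "stable_submodule R M \<Theta> (\<Union>k. F k)"
    proof (rule stable_submodule_chain_Union[OF M])
      show "F k \<subseteq> F (Suc k)" for k by (rule FSuc)
      show "stable_submodule R M \<Theta> (F k)" for k
        unfolding stable_submodule_def using Fsub[of k] F\<Theta>[of _ _ k] by blast
    qed
    then show ?thesis using zF unfolding stable_submodule_def by blast
  qed
  moreover have "G \<subseteq> (\<Union>k. F k)"
  proof
    fix g assume g: "g \<in> G"
    then have "g = \<zero>\<^bsub>M\<^esub> \<oplus>\<^bsub>M\<^esub> (z ^^ 0) g" using Gc by simp
    then have "g \<in> F (Suc 0)" using g unfolding FS F0 by blast
    then show "g \<in> (\<Union>k. F k)" by blast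
  qed
  ultimately have span: "stable_span R M (insert z \<Theta>) G \<subseteq> (\<Union>k. F k)"
    by (rule stable_span_minimal)
  define L where "L k Y = G \<inter> {g \<in> carrier M. (z ^^ k) g \<in> {y \<oplus>\<^bsub>M\<^esub> a | y a. y \<in> Y \<and> a \<in> F k}}" for k Y
  show ?thesis
    unfolding noetherian_on_def
  proof (intro allI impI)
    fix Y :: "nat \<Rightarrow> 'c set"
    assume *: "\<forall>n. stable_submodule R M (insert z \<Theta>) (Y n) \<and>
      Y n \<subseteq> stable_span R M (insert z \<Theta>) G \<and> Y n \<subseteq> Y (Suc n)"
    have Ysub: "submodule (Y n) R M" and Yst: "\<theta> \<in> insert z \<Theta> \<Longrightarrow> \<theta> ` Y n \<subseteq> Y n"
      and Yspan: "Y n \<subseteq> stable_span R M (insert z \<Theta>) G" and YS: "Y n \<subseteq> Y (Suc n)" for n \<theta>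
      using spec[OF *, of n] unfolding stable_submodule_def by blast+
    have YF: "Y n \<subseteq> (\<Union>k. F k)" for n using Yspan[of n] span by (rule subset_trans)
    have Yc: "y \<in> carrier M" if "y \<in> Y n" for y n using M.submoduleE(1)[OF Ysub] that by blast
    have Lst: "stable_submodule R M \<Theta> (L k (Y n))" for k n
      unfolding stable_submodule_def
    proof (intro conjI ballI)
      show "submodule (L k (Y n)) R M"
        unfolding L_def
        by (intro submodule_Int[OF M Gs] submodule_vimage[OF M M zk] submodule_sum[OF M Ysub Fsub])
      fix \<theta> assume \<theta>: "\<theta> \<in> \<Theta>"
      show "\<theta> ` L k (Y n) \<subseteq> L k (Y n)"
      proof clarify
        fix g assume g: "g \<in> L k (Y n)"
        then obtain y a where ya: "y \<in> Y n" "a \<in> F k" "(z ^^ k) g = y \<oplus>\<^bsub>M\<^esub> a" and gG: "g \<in> G"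
          unfolding L_def by blast
        have "(z ^^ k) (\<theta> g) = \<theta> y \<oplus>\<^bsub>M\<^esub> \<theta> a"
          using zkc[OF \<theta> Gc[OF gG], symmetric] ya(3) \<Theta>D[OF \<theta> Yc[OF ya(1)] Fc[OF ya(2)]] by simp
        moreover have "\<theta> y \<in> Y n" using Yst[of \<theta>] \<theta> ya(1) by blast
        moreover have "\<theta> g \<in> G" using G\<Theta>[OF \<theta>] gG by blast
        ultimately show "\<theta> g \<in> L k (Y n)"
          using F\<Theta>[OF \<theta> ya(2)] Gc[of "\<theta> g"] unfolding L_def by blast
      qed
    qed
    have LS: "L k (Y n) \<subseteq> L (Suc k) (Y n)" for k n
    proof
      fix g assume g: "g \<in> L k (Y n)"
      then obtain y a where ya: "y \<in> Y n" "a \<in> F k" "(z ^^ k) g = y \<oplus>\<^bsub>M\<^esub> a" and gG: "g \<in> G"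
        unfolding L_def by blast
      have "(z ^^ Suc k) g = z y \<oplus>\<^bsub>M\<^esub> z a"
        using ya(3) mod_homD(2)[OF z Yc[OF ya(1)] Fc[OF ya(2)]] by simp
      moreover have "z y \<in> Y n" using Yst[of z] ya(1) by blast
      ultimately show "g \<in> L (Suc k) (Y n)"
        using zF[OF ya(2)] Gc gG unfolding L_def by blast
    qed
    have "\<exists>m. \<forall>n\<ge>m. \<forall>k. L k (Y n) = L k (Y m)"
    proof (rule noetherian_on_double_chain[OF noeth])
      show "stable_submodule R M \<Theta> (L k (Y n))" for k n by (rule Lst)
      show "L k (Y n) \<subseteq> L (Suc k) (Y n)" for k n by (rule LS)
      show "L k (Y n) \<subseteq> G" for k n unfolding L_def by blast
      show "L k (Y n) \<subseteq> L k (Y (Suc n))" for k n using YS[of n] unfolding L_def by blast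
    qed
    then obtain m where m: "\<And>n k. n \<ge> m \<Longrightarrow> L k (Y n) = L k (Y m)" by blast
    have mono: "Y i \<subseteq> Y j" if "i \<le> j" for i j
      using lift_Suc_mono_le[of Y, OF YS that] .
    \<comment> \<open>All leading coefficients of \<open>Y n\<close> already occur in
      \<open>Y m\<close>, so subtracting an element of \<open>Y m\<close> with the same leading
      coefficient lowers the degree.\<close>
    have "Y n \<inter> F k \<subseteq> Y m" if n: "n \<ge> m" for n k
    proof (induction k)
      case 0 then show ?case using submodule_zero[OF M Ysub] by (auto simp: F0)
    next
      case (Suc k)
      show ?case
      proof
        fix y assume y: "y \<in> Y n \<inter> F (Suc k)"
        then obtain a g where ag: "a \<in> F k" "g \<in> G" "y = a \<oplus>\<^bsub>M\<^esub> (z ^^ k) g"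
          unfolding FS by blast
        have c: "a \<in> carrier M" "(z ^^ k) g \<in> carrier M"
          by (rule Fc[OF ag(1)], rule mod_homD(1)[OF zk Gc[OF ag(2)]])
        then have "(z ^^ k) g = y \<oplus>\<^bsub>M\<^esub> (\<ominus>\<^bsub>M\<^esub> a)"
          unfolding ag(3) by (simp add: M.a_ac M.r_neg2 M.r_neg1 M.r_neg)
        then have "g \<in> L k (Y n)"
          using y ag(2) Gc[OF ag(2)] M.submoduleE(3)[OF Fsub ag(1)] unfolding L_def by blast
        then have "g \<in> L k (Y m)" using m[OF n] by simp
        then obtain y' a' where ya: "y' \<in> Y m" "a' \<in> F k" "(z ^^ k) g = y' \<oplus>\<^bsub>M\<^esub> a'"
          unfolding L_def by blast
        have c': "y' \<in> carrier M" "a' \<in> carrier M" "y \<in> carrier M"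
          using Yc[OF ya(1)] Fc[OF ya(2)] Yc[of y n] y by auto
        have "y \<ominus>\<^bsub>M\<^esub> y' = a \<oplus>\<^bsub>M\<^esub> a'"
          unfolding ag(3) ya(3) a_minus_def using c(1) c' by (simp add: M.a_ac M.r_neg2 M.r_neg1 M.r_neg)
        moreover have "a \<oplus>\<^bsub>M\<^esub> a' \<in> F k" by (rule M.submoduleE(5)[OF Fsub ag(1) ya(2)])
        moreover have "y \<ominus>\<^bsub>M\<^esub> y' \<in> Y n"
          by (rule submodule_minus[OF M Ysub _ subsetD[OF mono[OF n] ya(1)]]) (use y in blast)
        ultimately have "y \<ominus>\<^bsub>M\<^esub> y' \<in> Y n \<inter> F k" by simp
        then have "y \<ominus>\<^bsub>M\<^esub> y' \<in> Y m" using Suc.IH by blast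
        then have "(y \<ominus>\<^bsub>M\<^esub> y') \<oplus>\<^bsub>M\<^esub> y' \<in> Y m" by (rule M.submoduleE(5)[OF Ysub _ ya(1)])
        then show "y \<in> Y m" using c' by (simp add: a_minus_def M.a_assoc M.l_neg)
      qed
    qed
    then have "Y n = Y m" if "n \<ge> m" for n
      using YF[of n] mono[OF that] that by blast
    then show "\<exists>m. \<forall>n\<ge>m. Y n = Y m" by blast
  qed
qed

text \<open>The operators are adjoined one at a time, as in Hilbert's theorem for several variables:
  the span under the operators treated so far plays the role of the coefficients, and commutativity
  makes the next operator linear over the previous ones.\<close>

lemma noetherian_on_stable_span:
  assumes M: "module R M" and G: "submodule G R M" and noeth: "noetherian_on R M {} G"
    and \<Theta>: "finite \<Theta>" "\<Theta> \<subseteq> mod_hom R M M"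
    and comm: "\<And>\<theta> \<eta> x. \<theta> \<in> \<Theta> \<Longrightarrow> \<eta> \<in> \<Theta> \<Longrightarrow> x \<in> carrier M \<Longrightarrow> \<theta> (\<eta> x) = \<eta> (\<theta> x)"
  shows "noetherian_on R M \<Theta> (stable_span R M \<Theta> G)"
  using \<Theta> comm
proof (induction \<Theta> rule: finite_induct)
  case empty
  have "stable_span R M {} G \<subseteq> G"
    by (rule stable_span_minimal) (simp_all add: stable_submodule_def G)
  then show ?case by (rule noetherian_on_subset[OF noeth])
next
  case (insert z \<Theta>)
  have Gc: "G \<subseteq> carrier M" by (rule module.submoduleE(1)[OF M G])
  have \<Theta>: "\<Theta> \<subseteq> mod_hom R M M" "z \<in> mod_hom R M M" using insert.prems(1) by auto
  let ?G = "stable_span R M \<Theta> G"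
  have "noetherian_on R M (insert z \<Theta>) (stable_span R M (insert z \<Theta>) ?G)"
  proof (rule noetherian_on_adjoin[OF M \<Theta>])
    show "\<theta> (z x) = z (\<theta> x)" if "\<theta> \<in> \<Theta>" "x \<in> carrier M" for \<theta> x
      using insert.prems(2)[of \<theta> z x] that by simp
    show "stable_submodule R M \<Theta> ?G" by (rule stable_submodule_span[OF M \<Theta>(1) Gc])
    show "noetherian_on R M \<Theta> ?G"
      using insert.prems by (intro insert.IH) auto
  qed
  moreover have "stable_span R M (insert z \<Theta>) G \<subseteq> stable_span R M (insert z \<Theta>) ?G"
    using stable_span_superset[of G R M \<Theta>] unfolding stable_span_def[of R M "insert z \<Theta>"] by blast
  ultimately show ?case by (rule noetherian_on_subset)
qed

text \<open>An element \<open>x\<close> outside \<open>U\<close> with \<open>(U : x)\<close> maximal makes all of \<open>U + \<Theta>x\<close> modulo \<open>U\<close> have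
  the same annihilators, so adding \<open>x\<close> to \<open>U\<close> adds at most one associated prime.\<close>

lemma finite_relative_associated_primes:
  assumes R: "noetherian_ring R" and M: "module R M" and \<Theta>: "\<Theta> \<subseteq> mod_hom R M M"
    and noeth: "noetherian_on R M \<Theta> (carrier M)" and B: "stable_submodule R M \<Theta> B"
  shows "finite {p. primeideal p R \<and> (\<exists>x\<in>carrier M. p = {a \<in> carrier R. a \<odot>\<^bsub>M\<^esub> x \<in> B})}"
proof -
  interpret R: noetherian_ring R by fact
  interpret M: module R M by fact
  define ann where "ann U x = {a \<in> carrier R. a \<odot>\<^bsub>M\<^esub> x \<in> U}" for U x
  define As where "As U = {p. primeideal p R \<and> (\<exists>x\<in>U. p = ann B x)}" for U
  define \<S> where "\<S> = {U. stable_submodule R M \<Theta> U \<and> B \<subseteq> U \<and> finite (As U)}"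
  have one: "\<one>\<^bsub>R\<^esub> \<notin> p" if "primeideal p R" for p
    using ideal.one_imp_carrier[OF primeideal.axioms(1)[OF that]] primeideal.I_notcarr[OF that] by blast
  have Bsub: "submodule B R M" using B unfolding stable_submodule_def by blast
  have "\<one>\<^bsub>R\<^esub> \<in> ann B x" if "x \<in> B" for x
    using that M.submoduleE(1)[OF Bsub] unfolding ann_def by auto
  then have "As B = {}" using one unfolding As_def by blast
  then have "B \<in> \<S>" using B unfolding \<S>_def by simp
  have "\<exists>U\<in>\<S>. \<forall>V\<in>\<S>. U \<subseteq> V \<longrightarrow> V = U"
  proof (rule noetherian_on_maximal[OF noeth])
    show "stable_submodule R M \<Theta> U \<and> U \<subseteq> carrier M" if "U \<in> \<S>" for U
      using that M.submoduleE(1)[of U] unfolding \<S>_def stable_submodule_def by blast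
  qed (use \<open>B \<in> \<S>\<close> in blast)
  then obtain U where U: "U \<in> \<S>" and max: "\<And>V. V \<in> \<S> \<Longrightarrow> U \<subseteq> V \<Longrightarrow> V = U" by blast
  have Ust: "stable_submodule R M \<Theta> U" and BU: "B \<subseteq> U" and fin: "finite (As U)"
    using U unfolding \<S>_def by auto
  then have Usub: "submodule U R M" and U\<Theta>: "\<And>\<theta>. \<theta> \<in> \<Theta> \<Longrightarrow> \<theta> ` U \<subseteq> U"
    unfolding stable_submodule_def by auto
  note UE = M.submoduleE[OF Usub]
  have "U = carrier M"
  proof (rule ccontr)
    assume "U \<noteq> carrier M"
    then have ne: "ann U ` (carrier M - U) \<noteq> {}" using UE(1) by blast
    have "\<exists>J\<in>ann U ` (carrier M - U). \<forall>J'\<in>ann U ` (carrier M - U). J \<subseteq> J' \<longrightarrow> J' = J"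
    proof (rule chain_condition_maximal[OF _ ne])
      fix Y :: "nat \<Rightarrow> 'a set"
      assume Y: "\<And>n. Y n \<in> ann U ` (carrier M - U)" "\<And>n. Y n \<subseteq> Y (Suc n)"
      have "ideal (Y n) R" for n
      proof -
        obtain y where "y \<in> carrier M" "Y n = ann U y" using Y(1)[of n] by blast
        then show ?thesis using colon_ideal[OF M Usub, of y] unfolding ann_def by simp
      qed
      then show "\<exists>m. \<forall>n\<ge>m. Y n = Y m" using Y(2) by (rule R.ideal_chain_stabilises)
    qed
    then obtain J where J: "J \<in> ann U ` (carrier M - U)"
      "\<And>J'. J' \<in> ann U ` (carrier M - U) \<Longrightarrow> J \<subseteq> J' \<Longrightarrow> J' = J"
      by auto
    from J(1) obtain x where x: "x \<in> carrier M" "x \<notin> U" "J = ann U x" by blast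
    have xmax: "ann U y = ann U x" if "y \<in> carrier M - U" "ann U x \<subseteq> ann U y" for y
      using J(2)[of "ann U y"] that x(3) by simp
    let ?V = "stable_span R M \<Theta> (insert x U)"
    have Vst: "stable_submodule R M \<Theta> ?V"
      by (rule stable_submodule_span[OF M \<Theta>]) (use x UE(1) in auto)
    then have Vc: "?V \<subseteq> carrier M" using M.submoduleE(1)[of ?V] unfolding stable_submodule_def by blast
    have UV: "insert x U \<subseteq> ?V" by (rule stable_span_superset)
    \<comment> \<open>The elements that \<open>ann U x\<close> carries into \<open>U\<close>. Since
      the operators are linear, these form a stable submodule, which therefore contains the whole
      span \<open>?V\<close> and not only \<open>x\<close>.\<close>
    let ?W = "{e \<in> carrier M. \<forall>a\<in>ann U x. a \<odot>\<^bsub>M\<^esub> e \<in> U}"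
    have "stable_submodule R M \<Theta> ?W"
      unfolding stable_submodule_def
    proof (intro conjI ballI)
      show "submodule ?W R M"
      proof (rule M.submoduleI)
        fix r e assume r: "r \<in> carrier R" and e: "e \<in> ?W"
        have "a \<odot>\<^bsub>M\<^esub> (r \<odot>\<^bsub>M\<^esub> e) \<in> U" if a: "a \<in> ann U x" for a
        proof -
          have "a \<in> carrier R" using a by (simp add: ann_def)
          then have "a \<odot>\<^bsub>M\<^esub> (r \<odot>\<^bsub>M\<^esub> e) = r \<odot>\<^bsub>M\<^esub> (a \<odot>\<^bsub>M\<^esub> e)"
            using r e by (simp add: M.smult_assoc1[symmetric] M.m_comm)
          then show ?thesis using UE(4)[OF r] a e by simp
        qed
        then show "r \<odot>\<^bsub>M\<^esub> e \<in> ?W" using r e by simp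
      qed (auto simp: ann_def M.smult_r_distr M.smult_r_minus UE submodule_zero[OF M Usub])
      fix \<theta> assume \<theta>: "\<theta> \<in> \<Theta>"
      then have h: "\<theta> \<in> mod_hom R M M" using \<Theta> by blast
      show "\<theta> ` ?W \<subseteq> ?W"
      proof clarify
        fix e assume e: "e \<in> carrier M" "\<forall>a\<in>ann U x. a \<odot>\<^bsub>M\<^esub> e \<in> U"
        have "a \<odot>\<^bsub>M\<^esub> \<theta> e \<in> U" if a: "a \<in> ann U x" for a
        proof -
          have "a \<odot>\<^bsub>M\<^esub> \<theta> e = \<theta> (a \<odot>\<^bsub>M\<^esub> e)"
            using mod_homD(3)[OF h _ e(1)] a by (simp add: ann_def)
          then show ?thesis using U\<Theta>[OF \<theta>] e(2) a by auto
        qed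
        then show "\<theta> e \<in> carrier M \<and> (\<forall>a\<in>ann U x. a \<odot>\<^bsub>M\<^esub> \<theta> e \<in> U)"
          using mod_homD(1)[OF h e(1)] by blast
      qed
    qed
    moreover have "insert x U \<subseteq> ?W"
      using x UE(1) UE(4) unfolding ann_def by auto
    ultimately have VW: "?V \<subseteq> ?W" by (rule stable_span_minimal)
    have annV: "ann U e = ann U x" if "e \<in> ?V" "e \<notin> U" for e
    proof (rule xmax)
      show "e \<in> carrier M - U" using that Vc by blast
      have "e \<in> ?W" using VW that(1) by blast
      then show "ann U x \<subseteq> ann U e" by (auto simp: ann_def)
    qed
    have "As ?V \<subseteq> insert (ann U x) (As U)"
    proof
      fix p assume "p \<in> As ?V"
      then obtain e where p: "primeideal p R" and e: "e \<in> ?V" "p = ann B e"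
        unfolding As_def by blast
      have ec: "e \<in> carrier M" using Vc e(1) by blast
      show "p \<in> insert (ann U x) (As U)"
      \<comment> \<open>If some \<open>a\<close> outside \<open>p\<close> carries \<open>e\<close>
        into \<open>U\<close>, then primality gives \<open>p = (B : a e)\<close>, a prime already
        counted for \<open>U\<close>. Otherwise \<open>(B : e)\<close> and \<open>(U : e)\<close>
        coincide, and the latter is \<open>ann U x\<close>.\<close>
      proof (cases "\<exists>a\<in>carrier R. a \<notin> p \<and> a \<odot>\<^bsub>M\<^esub> e \<in> U")
        case True
        then obtain a where a: "a \<in> carrier R" "a \<notin> p" "a \<odot>\<^bsub>M\<^esub> e \<in> U" by blast
        have "b \<in> p \<longleftrightarrow> b \<otimes>\<^bsub>R\<^esub> a \<in> p" if "b \<in> carrier R" for b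
          using primeideal.I_prime[OF p that a(1)] a(2) ideal.I_r_closed[OF primeideal.axioms(1)[OF p] _ a(1)]
          by blast
        then have "p = ann B (a \<odot>\<^bsub>M\<^esub> e)"
          unfolding e(2) ann_def using a(1) ec by (auto simp: M.smult_assoc1)
        then show ?thesis using p a(3) unfolding As_def by blast
      next
        case False
        then have "ann U e \<subseteq> p" unfolding ann_def by blast
        moreover have "p \<subseteq> ann U e" unfolding e(2) ann_def using BU by blast
        ultimately have "p = ann U e" by blast
        moreover have "e \<notin> U"
          using one[OF p] ec unfolding \<open>p = ann U e\<close> ann_def by auto
        ultimately show ?thesis using annV[OF e(1)] by blast
      qed
    qed
    then have "finite (As ?V)" using fin finite_subset by blast
    then have "?V \<in> \<S>" using Vst BU UV unfolding \<S>_def by blast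
    then have "?V = U" by (rule max) (use UV in blast)
    then show False using UV x(2) by blast
  qed
  then show ?thesis using fin unfolding As_def ann_def by simp
qed

section \<open>Finitely generated projective modules in coordinates\<close>

text \<open>All modules of coordinate vectors share the pointwise operations of free modules and
  differ only in their carriers, so passing to a summand or to a larger index set changes nothing
  but the set \<open>U\<close>.\<close>

definition fmod :: "('a, 'b) ring_scheme \<Rightarrow> ('x \<Rightarrow> 'a) set \<Rightarrow> ('a, 'x \<Rightarrow> 'a) module" where
  "fmod R U = (free_module R UNIV)\<lparr>carrier := U\<rparr>"

lemma fmod_simps [simp]:
  "carrier (fmod R U) = U"
  "\<zero>\<^bsub>fmod R U\<^esub> = (\<lambda>_. \<zero>\<^bsub>R\<^esub>)"
  "v \<oplus>\<^bsub>fmod R U\<^esub> w = (\<lambda>x. v x \<oplus>\<^bsub>R\<^esub> w x)"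
  "a \<odot>\<^bsub>fmod R U\<^esub> v = (\<lambda>x. a \<otimes>\<^bsub>R\<^esub> v x)"
  by (simp_all add: fmod_def free_module_def)

lemma free_module_eq_fmod: "free_module R X = fmod R (carrier (free_module R X))"
  by (simp add: fmod_def free_module_def)

lemma fmod_finsum:
  assumes "module R (fmod R U)" "\<forall>x\<in>U. \<forall>y. x y \<in> carrier R" "h \<in> S \<rightarrow> U"
  shows "(\<Oplus>\<^bsub>fmod R U\<^esub>i\<in>S. h i) y = (\<Oplus>\<^bsub>R\<^esub>i\<in>S. h i y)"
proof -
  interpret U: module R "fmod R U" by fact
  show ?thesis
    using assms(3)
  proof (induction S rule: infinite_finite_induct)
    case (insert i S)
    have "h \<in> S \<rightarrow> carrier (fmod R U)" "h i \<in> carrier (fmod R U)" using insert.prems by auto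
    moreover have "(\<lambda>i. h i y) \<in> S \<rightarrow> carrier R" "h i y \<in> carrier R"
      using insert.prems assms(2) by (auto simp: Pi_iff)
    ultimately show ?case
      using insert by simp
  qed simp_all
qed

lemma fmod_minus:
  assumes "module R (fmod R U)" "\<forall>x\<in>U. \<forall>y. x y \<in> carrier R" "v \<in> U" "w \<in> U"
  shows "(v \<ominus>\<^bsub>fmod R U\<^esub> w) y = v y \<ominus>\<^bsub>R\<^esub> w y"
proof -
  interpret U: module R "fmod R U" by fact
  have w: "\<ominus>\<^bsub>fmod R U\<^esub> w = (\<ominus>\<^bsub>R\<^esub> \<one>\<^bsub>R\<^esub>) \<odot>\<^bsub>fmod R U\<^esub> w"
    using U.smult_l_minus[of "\<one>\<^bsub>R\<^esub>" w] assms(4) U.smult_one[of w] by simp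
  show ?thesis
    unfolding a_minus_def w using assms(2-4) by (simp add: U.l_minus)
qed

text \<open>The elements of \<open>U\<close> are coordinate vectors, so the coordinate functionals and the vectors \<open>W s\<close>
  form a dual basis of \<open>U\<close>.\<close>

definition dual_basis :: "('a, 'b) ring_scheme \<Rightarrow> 'x set \<Rightarrow> ('x \<Rightarrow> 'x \<Rightarrow> 'a) \<Rightarrow> ('x \<Rightarrow> 'a) set \<Rightarrow> bool" where
  "dual_basis R X W U \<longleftrightarrow> finite X \<and> module R (fmod R U) \<and> (\<forall>x\<in>U. \<forall>y. x y \<in> carrier R) \<and>
     W \<in> X \<rightarrow> U \<and> (\<forall>x\<in>U. \<forall>y. x y = (\<Oplus>\<^bsub>R\<^esub>s\<in>X. x s \<otimes>\<^bsub>R\<^esub> W s y))"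

lemma dual_basisD:
  assumes "dual_basis R X W U"
  shows "finite X" "module R (fmod R U)" "x \<in> U \<Longrightarrow> x y \<in> carrier R" "s \<in> X \<Longrightarrow> W s \<in> U"
    and "x \<in> U \<Longrightarrow> x y = (\<Oplus>\<^bsub>R\<^esub>s\<in>X. x s \<otimes>\<^bsub>R\<^esub> W s y)"
  using assms unfolding dual_basis_def by auto

lemma dual_basis_hom:
  assumes U: "dual_basis R X W U" and Z: "module R Z" and g: "g \<in> mod_hom R (fmod R U) Z" and x: "x \<in> U"
  shows "g x = (\<Oplus>\<^bsub>Z\<^esub>s\<in>X. x s \<odot>\<^bsub>Z\<^esub> g (W s))"
proof -
  note UD = dual_basisD[OF U]
  interpret Z: module R Z by fact
  interpret U: module R "fmod R U" by (rule UD(2))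
  have UR: "\<forall>x\<in>U. \<forall>y. x y \<in> carrier R" using UD(3) by blast
  have mem: "(\<lambda>s. x s \<odot>\<^bsub>fmod R U\<^esub> W s) \<in> X \<rightarrow> carrier (fmod R U)"
    using U.smult_closed[OF UD(3)[OF x], of "W _"] UD(4) by auto
  have "x = (\<Oplus>\<^bsub>fmod R U\<^esub>s\<in>X. x s \<odot>\<^bsub>fmod R U\<^esub> W s)"
  proof
    fix y
    show "x y = (\<Oplus>\<^bsub>fmod R U\<^esub>s\<in>X. x s \<odot>\<^bsub>fmod R U\<^esub> W s) y"
      using fmod_finsum[OF UD(2) UR, of "\<lambda>s. x s \<odot>\<^bsub>fmod R U\<^esub> W s" X y] mem UD(5)[OF x, of y] by simp
  qed
  then have "g x = (\<Oplus>\<^bsub>Z\<^esub>s\<in>X. g (x s \<odot>\<^bsub>fmod R U\<^esub> W s))"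
    using mod_hom_finsum[OF UD(2) Z g mem] by simp
  also have "\<dots> = (\<Oplus>\<^bsub>Z\<^esub>s\<in>X. x s \<odot>\<^bsub>Z\<^esub> g (W s))"
  proof (rule Z.finsum_cong'[OF refl])
    show "(\<lambda>s. x s \<odot>\<^bsub>Z\<^esub> g (W s)) \<in> X \<rightarrow> carrier Z"
      using UD(3)[OF x] UD(4) mod_homD(1)[OF g] by auto
    show "g (x s \<odot>\<^bsub>fmod R U\<^esub> W s) = x s \<odot>\<^bsub>Z\<^esub> g (W s)" if "s \<in> X" for s
      using mod_homD(3)[OF g UD(3)[OF x], of "W s" s] UD(4)[OF that] by simp
  qed
  finally show ?thesis .
qed

text \<open>The values \<open>\<eta> s\<close> are unrestricted because the coordinates are linear
  in \<open>x\<close>. In return, the resulting map does not in general send \<open>W s\<close> to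
  \<open>\<eta> s\<close>.\<close>

lemma dual_basis_extend:
  assumes U: "dual_basis R X W U" and Y: "module R Y" and \<eta>: "\<And>s. s \<in> X \<Longrightarrow> \<eta> s \<in> carrier Y"
  shows "(\<lambda>x. \<Oplus>\<^bsub>Y\<^esub>s\<in>X. x s \<odot>\<^bsub>Y\<^esub> \<eta> s) \<in> mod_hom R (fmod R U) Y"
proof -
  note UD = dual_basisD[OF U]
  interpret Y: module R Y by fact
  have mem: "(\<lambda>s. x s \<odot>\<^bsub>Y\<^esub> \<eta> s) \<in> X \<rightarrow> carrier Y" if "x \<in> U" for x
    using UD(3)[OF that] \<eta> by auto
  show ?thesis
  proof (rule mod_homI; unfold fmod_simps)
    show "(\<Oplus>\<^bsub>Y\<^esub>s\<in>X. x s \<odot>\<^bsub>Y\<^esub> \<eta> s) \<in> carrier Y" if "x \<in> U" for x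
      by (rule Y.finsum_closed[OF mem[OF that]])
    show "(\<Oplus>\<^bsub>Y\<^esub>s\<in>X. (v s \<oplus>\<^bsub>R\<^esub> w s) \<odot>\<^bsub>Y\<^esub> \<eta> s) =
        (\<Oplus>\<^bsub>Y\<^esub>s\<in>X. v s \<odot>\<^bsub>Y\<^esub> \<eta> s) \<oplus>\<^bsub>Y\<^esub> (\<Oplus>\<^bsub>Y\<^esub>s\<in>X. w s \<odot>\<^bsub>Y\<^esub> \<eta> s)"
      if "v \<in> U" "w \<in> U" for v w
    proof -
      have "(\<Oplus>\<^bsub>Y\<^esub>s\<in>X. (v s \<oplus>\<^bsub>R\<^esub> w s) \<odot>\<^bsub>Y\<^esub> \<eta> s) =
          (\<Oplus>\<^bsub>Y\<^esub>s\<in>X. v s \<odot>\<^bsub>Y\<^esub> \<eta> s \<oplus>\<^bsub>Y\<^esub> w s \<odot>\<^bsub>Y\<^esub> \<eta> s)"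
        by (rule Y.finsum_cong'[OF refl])
          (use UD(3)[OF that(1)] UD(3)[OF that(2)] \<eta> in \<open>auto simp: Y.smult_l_distr\<close>)
      then show ?thesis using Y.finsum_addf[OF mem[OF that(1)] mem[OF that(2)]] by simp
    qed
    show "(\<Oplus>\<^bsub>Y\<^esub>s\<in>X. (a \<otimes>\<^bsub>R\<^esub> v s) \<odot>\<^bsub>Y\<^esub> \<eta> s) = a \<odot>\<^bsub>Y\<^esub> (\<Oplus>\<^bsub>Y\<^esub>s\<in>X. v s \<odot>\<^bsub>Y\<^esub> \<eta> s)"
      if "a \<in> carrier R" "v \<in> U" for a v
    proof -
      have "(\<Oplus>\<^bsub>Y\<^esub>s\<in>X. (a \<otimes>\<^bsub>R\<^esub> v s) \<odot>\<^bsub>Y\<^esub> \<eta> s) = (\<Oplus>\<^bsub>Y\<^esub>s\<in>X. a \<odot>\<^bsub>Y\<^esub> (v s \<odot>\<^bsub>Y\<^esub> \<eta> s))"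
        by (rule Y.finsum_cong'[OF refl])
          (use UD(3)[OF that(2)] that(1) \<eta> in \<open>auto simp: Y.smult_assoc1\<close>)
      then show ?thesis using Y.finsum_smult_ldistr[OF UD(1) that(1) mem[OF that(2)]] by simp
    qed
  qed
qed

text \<open>Preimages of the vectors \<open>g (W s)\<close>, recombined with the coordinates of the
  argument, give the lift: under \<open>d\<close> they return the expansion of
  \<open>g x\<close>.\<close>

lemma dual_basis_lift:
  assumes U: "dual_basis R X W U" and YZ: "module R Y" "module R Z"
    and d: "d \<in> mod_hom R Y Z" and g: "g \<in> mod_hom R (fmod R U) Z"
    and im: "\<And>x. x \<in> U \<Longrightarrow> g x \<in> d ` carrier Y"
  shows "\<exists>h\<in>mod_hom R (fmod R U) Y. \<forall>x\<in>U. d (h x) = g x"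
proof -
  note UD = dual_basisD[OF U]
  have "\<exists>y\<in>carrier Y. d y = g (W s)" if "s \<in> X" for s
    using im[OF UD(4)[OF that]] by force
  then obtain \<eta> where \<eta>: "\<And>s. s \<in> X \<Longrightarrow> \<eta> s \<in> carrier Y" "\<And>s. s \<in> X \<Longrightarrow> d (\<eta> s) = g (W s)"
    by metis
  interpret Y: module R Y by fact
  interpret Z: module R Z by fact
  let ?h = "\<lambda>x. \<Oplus>\<^bsub>Y\<^esub>s\<in>X. x s \<odot>\<^bsub>Y\<^esub> \<eta> s"
  have "d (?h x) = g x" if x: "x \<in> U" for x
  proof -
    have mem: "(\<lambda>s. x s \<odot>\<^bsub>Y\<^esub> \<eta> s) \<in> X \<rightarrow> carrier Y"
      using UD(3)[OF x] \<eta>(1) by auto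
    have "d (?h x) = (\<Oplus>\<^bsub>Z\<^esub>s\<in>X. d (x s \<odot>\<^bsub>Y\<^esub> \<eta> s))"
      by (rule mod_hom_finsum[OF YZ d mem])
    also have "\<dots> = (\<Oplus>\<^bsub>Z\<^esub>s\<in>X. x s \<odot>\<^bsub>Z\<^esub> g (W s))"
      by (rule Z.finsum_cong'[OF refl])
        (use UD(3)[OF x] UD(4) \<eta> mod_homD(1)[OF g] in \<open>auto simp: mod_homD(3)[OF d]\<close>)
    also have "\<dots> = g x" by (rule dual_basis_hom[OF U YZ(2) g x, symmetric])
    finally show ?thesis .
  qed
  then show ?thesis by (intro bexI[of _ ?h] ballI dual_basis_extend[OF U YZ(1) \<eta>(1)])
qed

definition unit_vector :: "('a, 'b) ring_scheme \<Rightarrow> 'x \<Rightarrow> 'x \<Rightarrow> 'a" where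
  "unit_vector R s = (\<lambda>y. if y = s then \<one>\<^bsub>R\<^esub> else \<zero>\<^bsub>R\<^esub>)"

lemma unit_vector_in_free_module:
  assumes "cring R" "s \<in> X"
  shows "unit_vector R s \<in> carrier (free_module R X)"
proof -
  interpret cring R by fact
  have "{y. unit_vector R s y \<noteq> \<zero>\<^bsub>R\<^esub>} \<subseteq> {s}" by (auto simp: unit_vector_def)
  then show ?thesis
    using assms(2) finite_subset[OF _ finite.insertI[OF finite.emptyI]]
    unfolding free_module_carrier_iff by (auto simp: unit_vector_def)
qed

lemma dual_basis_free_module:
  assumes "cring R" "finite X"
  shows "dual_basis R X (unit_vector R) (carrier (free_module R X))"
proof -
  interpret cring R by fact
  have "x y = (\<Oplus>\<^bsub>R\<^esub>s\<in>X. x s \<otimes>\<^bsub>R\<^esub> unit_vector R s y)" if x: "x \<in> carrier (free_module R X)" for x y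
  proof -
    have xc: "x s \<in> carrier R" for s using x by (simp add: free_module_carrier_iff)
    have "(\<Oplus>\<^bsub>R\<^esub>s\<in>X. x s \<otimes>\<^bsub>R\<^esub> unit_vector R s y) = (\<Oplus>\<^bsub>R\<^esub>s\<in>X. if y = s then x s else \<zero>\<^bsub>R\<^esub>)"
      by (rule finsum_cong'[OF refl]) (auto simp: xc unit_vector_def)
    also have "\<dots> = x y"
    proof (cases "y \<in> X")
      case True
      then show ?thesis using finsum_singleton[OF True assms(2), of x] xc by simp
    next
      case False
      then have "(\<Oplus>\<^bsub>R\<^esub>s\<in>X. if y = s then x s else \<zero>\<^bsub>R\<^esub>) = (\<Oplus>\<^bsub>R\<^esub>s\<in>X. \<zero>\<^bsub>R\<^esub>)"
        by (intro finsum_cong'[OF refl]) auto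
      also have "\<dots> = x y" using False x by (simp add: free_module_carrier_iff)
      finally show ?thesis .
    qed
    finally show ?thesis by simp
  qed
  then show ?thesis
    unfolding dual_basis_def
    using assms free_module_module[OF assms(1), of X] unit_vector_in_free_module[OF assms(1)]
    by (auto simp: free_module_eq_fmod[symmetric]) (simp add: free_module_carrier_iff)
qed

text \<open>The identity lifts through the free module on the set of all elements of
  \<open>U\<close>, a basis in the element type that \<open>projective_module\<close>
  prescribes.\<close>

lemma dual_basis_projective:
  assumes U: "dual_basis R X W U"
  shows "projective_module R (fmod R U)"
proof -
  note UD = dual_basisD[OF U]
  have "cring R" using UD(2) by (simp add: module_def)
  let ?F = "free_module R U"
  obtain h where h: "h \<in> mod_hom R ?F (fmod R U)" "h ` carrier ?F = U"
    using free_module_cover[OF UD(2), of "\<lambda>x. x"] by auto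
  have "(\<lambda>x. x) \<in> mod_hom R (fmod R U) (fmod R U)" by (rule mod_homI) auto
  then obtain s where "s \<in> mod_hom R (fmod R U) ?F" "\<forall>x\<in>U. h (s x) = x"
    using dual_basis_lift[OF U free_module_module[OF \<open>cring R\<close>] UD(2) h(1)] h(2) by blast
  then show ?thesis
    unfolding projective_module_def using UD(2) h(1)
    by (intro conjI exI[of _ U] bexI[of _ s] bexI[of _ h]) simp_all
qed

lemma mod_hom_fmod_mono:
  assumes "f \<in> mod_hom R (fmod R U) Y" "V \<subseteq> U"
  shows "f \<in> mod_hom R (fmod R V) Y"
proof -
  note f = mod_homD[OF assms(1), unfolded fmod_simps]
  show ?thesis
    by (rule mod_homI; unfold fmod_simps) (use f assms(2) in \<open>blast+\<close>)
qed

lemma free_module_mono: "X \<subseteq> X' \<Longrightarrow> carrier (free_module R X) \<subseteq> carrier (free_module R X')"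
  unfolding subset_iff free_module_carrier_iff by blast

lemma free_module_support:
  assumes "v \<in> carrier (free_module R X)" "{x. v x \<noteq> \<zero>\<^bsub>R\<^esub>} \<subseteq> T"
  shows "v \<in> carrier (free_module R T)"
  using assms by (auto simp: free_module_carrier_iff)

text \<open>A vector has finite support, and over a finite set of indices the dual basis of unit
  vectors applies. Linearity is checked over the union of the supports involved.\<close>

lemma free_module_hom_exists:
  assumes Y: "module R Y" and \<eta>: "\<And>s. s \<in> X \<Longrightarrow> \<eta> s \<in> carrier Y"
  shows "\<exists>h\<in>mod_hom R (free_module R X) Y. \<forall>s\<in>X. h (unit_vector R s) = \<eta> s"
proof -
  interpret Y: module R Y by fact
  let ?supp = "\<lambda>v. {x. v x \<noteq> \<zero>\<^bsub>R\<^esub>}"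
  define h where "h v = (\<Oplus>\<^bsub>Y\<^esub>s\<in>?supp v. v s \<odot>\<^bsub>Y\<^esub> \<eta> s)" for v
  have D: "dual_basis R T (unit_vector R) (carrier (free_module R T))" if "finite T" for T
    by (rule dual_basis_free_module[OF Y.is_cring that])
  have vR: "v s \<in> carrier R" and fin: "finite (?supp v)" and sub: "?supp v \<subseteq> X"
    if "v \<in> carrier (free_module R X)" for v s
    using that by (auto simp: free_module_carrier_iff)
  have h_eq: "h v = (\<Oplus>\<^bsub>Y\<^esub>s\<in>T. v s \<odot>\<^bsub>Y\<^esub> \<eta> s)"
    if v: "v \<in> carrier (free_module R X)" and T: "finite T" "?supp v \<subseteq> T" "T \<subseteq> X" for v T
    unfolding h_def using T vR[OF v] \<eta>
    by (intro Y.add.finprod_mono_neutral_cong_left) auto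
  have ext: "(\<lambda>v. \<Oplus>\<^bsub>Y\<^esub>s\<in>T. v s \<odot>\<^bsub>Y\<^esub> \<eta> s) \<in> mod_hom R (free_module R T) Y" if "finite T" "T \<subseteq> X" for T
    using dual_basis_extend[OF D[OF that(1)] Y, of \<eta>] \<eta> that(2)
    by (auto simp: free_module_eq_fmod[symmetric])
  have "h \<in> mod_hom R (free_module R X) Y"
  proof (rule mod_homI)
    fix v assume v: "v \<in> carrier (free_module R X)"
    have v': "v \<in> carrier (free_module R (?supp v))" by (rule free_module_support[OF v]) simp
    show "h v \<in> carrier Y"
      using mod_homD(1)[OF ext[OF fin[OF v] sub[OF v]] v'] by (simp add: h_def)
  next
    fix a v assume a: "a \<in> carrier R" and v: "v \<in> carrier (free_module R X)"
    have v': "v \<in> carrier (free_module R (?supp v))" by (rule free_module_support[OF v]) simp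
    have "a \<odot>\<^bsub>free_module R X\<^esub> v \<in> carrier (free_module R X)"
      using module.smult_closed[OF free_module_module[OF Y.is_cring] a v] .
    moreover have "?supp (a \<odot>\<^bsub>free_module R X\<^esub> v) \<subseteq> ?supp v"
      using a by (auto simp: free_module_ops)
    ultimately have "h (a \<odot>\<^bsub>free_module R X\<^esub> v) = (\<Oplus>\<^bsub>Y\<^esub>s\<in>?supp v. (a \<odot>\<^bsub>free_module R X\<^esub> v) s \<odot>\<^bsub>Y\<^esub> \<eta> s)"
      by (rule h_eq[OF _ fin[OF v] _ sub[OF v]])
    then show "h (a \<odot>\<^bsub>free_module R X\<^esub> v) = a \<odot>\<^bsub>Y\<^esub> h v"
      using mod_homD(3)[OF ext[OF fin[OF v] sub[OF v]] a v'] by (simp add: h_def free_module_ops)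
  next
    fix v w assume v: "v \<in> carrier (free_module R X)" and w: "w \<in> carrier (free_module R X)"
    let ?T = "?supp v \<union> ?supp w"
    have T: "finite ?T" "?T \<subseteq> X" using fin v w sub by auto
    have vw: "v \<oplus>\<^bsub>free_module R X\<^esub> w \<in> carrier (free_module R X)"
    proof -
      interpret F: module R "free_module R X" by (rule free_module_module[OF Y.is_cring])
      show ?thesis using v w by simp
    qed
    have "v \<in> carrier (free_module R ?T)" "w \<in> carrier (free_module R ?T)"
      by (rule free_module_support[OF v], simp, rule free_module_support[OF w], simp)
    note add = mod_homD(2)[OF ext[OF T] this]
    have "?supp (v \<oplus>\<^bsub>free_module R X\<^esub> w) \<subseteq> ?T" by (auto simp: free_module_ops)
    then show "h (v \<oplus>\<^bsub>free_module R X\<^esub> w) = h v \<oplus>\<^bsub>Y\<^esub> h w"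
      using h_eq[OF vw T(1) _ T(2)] h_eq[OF v T(1) _ T(2)] h_eq[OF w T(1) _ T(2)] add
      by (simp add: free_module_ops)
  qed
  moreover have "h (unit_vector R s) = \<eta> s" if s: "s \<in> X" for s
  proof -
    have "h (unit_vector R s) = (\<Oplus>\<^bsub>Y\<^esub>t\<in>{s}. unit_vector R s t \<odot>\<^bsub>Y\<^esub> \<eta> t)"
      by (rule h_eq[OF unit_vector_in_free_module[OF Y.is_cring s]])
        (use s in \<open>auto simp: unit_vector_def split: if_splits\<close>)
    then show ?thesis using \<eta>[OF s] by (simp add: unit_vector_def)
  qed
  ultimately show ?thesis by blast
qed

lemma free_module_hom_eqI:
  assumes Z: "module R Z" and fg: "f \<in> mod_hom R (free_module R X) Z" "g \<in> mod_hom R (free_module R X) Z"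
    and eq: "\<And>s. s \<in> X \<Longrightarrow> f (unit_vector R s) = g (unit_vector R s)"
    and v: "v \<in> carrier (free_module R X)"
  shows "f v = g v"
proof -
  interpret Z: module R Z by fact
  let ?T = "{x. v x \<noteq> \<zero>\<^bsub>R\<^esub>}"
  have T: "finite ?T" "?T \<subseteq> X" using v by (auto simp: free_module_carrier_iff)
  have v': "v \<in> carrier (free_module R ?T)" by (rule free_module_support[OF v]) simp
  have D: "dual_basis R ?T (unit_vector R) (carrier (free_module R ?T))"
    by (rule dual_basis_free_module[OF Z.is_cring T(1)])
  have "k v = (\<Oplus>\<^bsub>Z\<^esub>s\<in>?T. v s \<odot>\<^bsub>Z\<^esub> k (unit_vector R s))" if "k \<in> mod_hom R (free_module R X) Z" for k
    using dual_basis_hom[OF D Z mod_hom_fmod_mono[OF _ free_module_mono[OF T(2)]] v'] that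
    by (simp add: free_module_eq_fmod[symmetric])
  moreover have "(\<Oplus>\<^bsub>Z\<^esub>s\<in>?T. v s \<odot>\<^bsub>Z\<^esub> f (unit_vector R s)) = (\<Oplus>\<^bsub>Z\<^esub>s\<in>?T. v s \<odot>\<^bsub>Z\<^esub> g (unit_vector R s))"
  proof (rule Z.finsum_cong'[OF refl])
    show "(\<lambda>s. v s \<odot>\<^bsub>Z\<^esub> g (unit_vector R s)) \<in> ?T \<rightarrow> carrier Z"
      using T(2) v mod_homD(1)[OF fg(2) unit_vector_in_free_module[OF Z.is_cring]]
      by (auto simp: free_module_carrier_iff)
    show "v s \<odot>\<^bsub>Z\<^esub> f (unit_vector R s) = v s \<odot>\<^bsub>Z\<^esub> g (unit_vector R s)" if "s \<in> ?T" for s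
      using eq T(2) that by auto
  qed
  ultimately show ?thesis using fg by simp
qed

text \<open>The lift is constructed on a free module that has \<open>P\<close> as a summand and is
  pulled back along the section. The hypothesis compares images, as exactness supplies them, instead
  of asking \<open>d\<close> to be surjective.\<close>

lemma projective_lift:
  fixes P :: "('a, 'p, 'c) module_scheme"
  assumes P: "projective_module R P" and YZ: "module R Y" "module R Z"
    and d: "d \<in> mod_hom R Y Z" and g: "g \<in> mod_hom R P Z"
    and im: "\<And>x. x \<in> carrier P \<Longrightarrow> g x \<in> d ` carrier Y"
  shows "\<exists>h\<in>mod_hom R P Y. \<forall>x\<in>carrier P. d (h x) = g x"
proof -
  obtain X :: "'p set" and s r where s: "s \<in> mod_hom R P (free_module R X)" and r: "r \<in> mod_hom R (free_module R X) P"
    and rs: "\<And>x. x \<in> carrier P \<Longrightarrow> r (s x) = x"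
    using P unfolding projective_module_def by blast
  have R: "cring R" using YZ(1) by (simp add: module_def)
  have "\<exists>y\<in>carrier Y. d y = g (r (unit_vector R t))" if "t \<in> X" for t
    using im[OF mod_homD(1)[OF r unit_vector_in_free_module[OF R that]]] by force
  then obtain \<eta> where \<eta>: "\<And>t. t \<in> X \<Longrightarrow> \<eta> t \<in> carrier Y" "\<And>t. t \<in> X \<Longrightarrow> d (\<eta> t) = g (r (unit_vector R t))"
    by metis
  obtain k where k: "k \<in> mod_hom R (free_module R X) Y" "\<And>t. t \<in> X \<Longrightarrow> k (unit_vector R t) = \<eta> t"
    using free_module_hom_exists[OF YZ(1), of X \<eta>] \<eta>(1) by blast
  have "d (k v) = g (r v)" if "v \<in> carrier (free_module R X)" for v
    by (rule free_module_hom_eqI[OF YZ(2) mod_hom_comp[OF k(1) d] mod_hom_comp[OF r g] _ that])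
      (simp add: k(2) \<eta>(2))
  then have "\<forall>x\<in>carrier P. d (k (s x)) = g x"
    using rs mod_homD(1)[OF s] by simp
  then show ?thesis by (intro bexI[of _ "\<lambda>x. k (s x)"] mod_hom_comp[OF s k(1)])
qed

section \<open>Comparison of resolutions\<close>

text \<open>The source need not be a complex: it is enough that homomorphisms to the target kill the
  composites \<open>d \<circ> d\<close>.\<close>

lemma chain_map_exists:
  fixes P :: "nat \<Rightarrow> ('a, 'p) module" and Y :: "nat \<Rightarrow> ('a, 'y) module"
  assumes P: "\<And>i. projective_module R (P i)" and Y: "\<And>i. module R (Y i)" and M: "module R M"
    and dP: "\<And>i. dP i \<in> mod_hom R (P (Suc i)) (P i)" and eP: "eP \<in> mod_hom R (P 0) M"
    and dY: "\<And>i. dY i \<in> mod_hom R (Y (Suc i)) (Y i)" and eY: "eY \<in> mod_hom R (Y 0) M"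
    and edP: "\<And>x. x \<in> carrier (P (Suc 0)) \<Longrightarrow> eP (dP 0 x) = \<zero>\<^bsub>M\<^esub>"
    and ddP: "\<And>i k x. k \<in> mod_hom R (P i) (Y i) \<Longrightarrow> x \<in> carrier (P (Suc (Suc i))) \<Longrightarrow>
      k (dP i (dP (Suc i) x)) = \<zero>\<^bsub>Y i\<^esub>"
    and surj: "\<And>x. x \<in> carrier M \<Longrightarrow> x \<in> eY ` carrier (Y 0)"
    and exact0: "\<And>y. y \<in> carrier (Y 0) \<Longrightarrow> eY y = \<zero>\<^bsub>M\<^esub> \<Longrightarrow> y \<in> dY 0 ` carrier (Y (Suc 0))"
    and exact: "\<And>i y. y \<in> carrier (Y (Suc i)) \<Longrightarrow> dY i y = \<zero>\<^bsub>Y i\<^esub> \<Longrightarrow> y \<in> dY (Suc i) ` carrier (Y (Suc (Suc i)))"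
  shows "\<exists>\<phi>. (\<forall>i. \<phi> i \<in> mod_hom R (P i) (Y i)) \<and> (\<forall>x\<in>carrier (P 0). eY (\<phi> 0 x) = eP x) \<and>
    (\<forall>i. \<forall>x\<in>carrier (P (Suc i)). dY i (\<phi> (Suc i) x) = \<phi> i (dP i x))"
proof -
  \<comment> \<open>The second clause is what the next lift requires, so it is carried along in the
    recursion.\<close>
  define good where "good i f \<longleftrightarrow> f \<in> mod_hom R (P i) (Y i) \<and>
    (\<forall>x\<in>carrier (P (Suc i)). f (dP i x) \<in> dY i ` carrier (Y (Suc i)))" for i f
  have start: "\<exists>f. good 0 f \<and> (\<forall>x\<in>carrier (P 0). eY (f x) = eP x)"
  proof -
    obtain f where f: "f \<in> mod_hom R (P 0) (Y 0)" "\<forall>x\<in>carrier (P 0). eY (f x) = eP x"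
      using projective_lift[OF P Y M eY eP] surj mod_homD(1)[OF eP] by blast
    have "f (dP 0 x) \<in> dY 0 ` carrier (Y (Suc 0))" if "x \<in> carrier (P (Suc 0))" for x
      using f edP[OF that] mod_homD(1)[OF dP that] mod_homD(1)[OF f(1)] by (intro exact0) auto
    then show ?thesis using f unfolding good_def by blast
  qed
  have step: "\<exists>g. good (Suc i) g \<and> (\<forall>x\<in>carrier (P (Suc i)). dY i (g x) = f (dP i x))" if f: "good i f" for i f
  proof -
    have fh: "f \<in> mod_hom R (P i) (Y i)" using f by (simp add: good_def)
    obtain g where g: "g \<in> mod_hom R (P (Suc i)) (Y (Suc i))" "\<forall>x\<in>carrier (P (Suc i)). dY i (g x) = f (dP i x)"
      using projective_lift[OF P Y Y dY mod_hom_comp[OF dP fh]] f unfolding good_def by blast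
    have "g (dP (Suc i) x) \<in> dY (Suc i) ` carrier (Y (Suc (Suc i)))" if x: "x \<in> carrier (P (Suc (Suc i)))" for x
      using g(2) mod_homD(1)[OF dP x] mod_homD(1)[OF g(1)] ddP[OF fh x] by (intro exact) auto
    then show ?thesis using g unfolding good_def by blast
  qed
  have "\<exists>\<phi>. \<forall>i. (good i (\<phi> i) \<and> (i = 0 \<longrightarrow> (\<forall>x\<in>carrier (P 0). eY (\<phi> i x) = eP x))) \<and>
      (\<forall>x\<in>carrier (P (Suc i)). dY i (\<phi> (Suc i) x) = \<phi> i (dP i x))"
  proof (rule dependent_nat_choice)
    show "\<exists>f. good 0 f \<and> (0 = (0 :: nat) \<longrightarrow> (\<forall>x\<in>carrier (P 0). eY (f x) = eP x))"
      using start by simp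
    show "\<exists>g. (good (Suc i) g \<and> (Suc i = 0 \<longrightarrow> (\<forall>x\<in>carrier (P 0). eY (g x) = eP x))) \<and>
        (\<forall>x\<in>carrier (P (Suc i)). dY i (g x) = f (dP i x))"
      if "good i f \<and> (i = 0 \<longrightarrow> (\<forall>x\<in>carrier (P 0). eY (f x) = eP x))" for f i
      using step[of i f] that by simp
  qed
  then obtain \<phi> where \<phi>: "\<forall>i. (good i (\<phi> i) \<and> (i = 0 \<longrightarrow> (\<forall>x\<in>carrier (P 0). eY (\<phi> i x) = eP x))) \<and>
      (\<forall>x\<in>carrier (P (Suc i)). dY i (\<phi> (Suc i) x) = \<phi> i (dP i x))" ..
  show ?thesis
    by (intro exI[of _ \<phi>] conjI allI) (use \<phi> in \<open>simp_all add: good_def\<close>)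
qed

lemma projective_resolutionD:
  assumes "projective_resolution R M P d e"
  shows "projective_module R (P i)" "module R (P i)" "d i \<in> mod_hom R (P (Suc i)) (P i)"
    "e \<in> mod_hom R (P 0) M"
    "x \<in> carrier M \<Longrightarrow> x \<in> e ` carrier (P 0)"
    "y \<in> carrier (P 0) \<Longrightarrow> e y = \<zero>\<^bsub>M\<^esub> \<Longrightarrow> y \<in> d 0 ` carrier (P (Suc 0))"
    "y \<in> carrier (P (Suc i)) \<Longrightarrow> d i y = \<zero>\<^bsub>P i\<^esub> \<Longrightarrow> y \<in> d (Suc i) ` carrier (P (Suc (Suc i)))"
    "z \<in> carrier (P (Suc 0)) \<Longrightarrow> e (d 0 z) = \<zero>\<^bsub>M\<^esub>"
    "z \<in> carrier (P (Suc (Suc i))) \<Longrightarrow> d i (d (Suc i) z) = \<zero>\<^bsub>P i\<^esub>"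
proof -
  have *: "\<forall>i. projective_module R (P i)" "\<forall>i. d i \<in> mod_hom R (P (Suc i)) (P i)"
    "e \<in> mod_hom R (P 0) M" "e ` carrier (P 0) = carrier M" "d 0 ` carrier (P 1) = a_kernel (P 0) M e"
    "\<forall>i. d (Suc i) ` carrier (P (Suc (Suc i))) = a_kernel (P (Suc i)) (P i) (d i)"
    using assms unfolding projective_resolution_def by - (elim conjE, assumption)+
  show "projective_module R (P i)" using *(1) ..
  then show "module R (P i)" by (simp add: projective_module_def)
  show "d i \<in> mod_hom R (P (Suc i)) (P i)" using *(2) ..
  show "e \<in> mod_hom R (P 0) M" by (rule *(3))
  show "x \<in> carrier M \<Longrightarrow> x \<in> e ` carrier (P 0)" unfolding *(4) .
  have k0: "d 0 ` carrier (P (Suc 0)) = {x \<in> carrier (P 0). e x = \<zero>\<^bsub>M\<^esub>}"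
    using *(5) by (simp add: a_kernel_def')
  have k: "d (Suc i) ` carrier (P (Suc (Suc i))) = {x \<in> carrier (P (Suc i)). d i x = \<zero>\<^bsub>P i\<^esub>}"
    using spec[OF *(6), of i] by (simp add: a_kernel_def')
  show "y \<in> carrier (P 0) \<Longrightarrow> e y = \<zero>\<^bsub>M\<^esub> \<Longrightarrow> y \<in> d 0 ` carrier (P (Suc 0))" unfolding k0 by simp
  show "y \<in> carrier (P (Suc i)) \<Longrightarrow> d i y = \<zero>\<^bsub>P i\<^esub> \<Longrightarrow> y \<in> d (Suc i) ` carrier (P (Suc (Suc i)))"
    unfolding k by simp
  show "z \<in> carrier (P (Suc 0)) \<Longrightarrow> e (d 0 z) = \<zero>\<^bsub>M\<^esub>" using k0 by blast
  show "z \<in> carrier (P (Suc (Suc i))) \<Longrightarrow> d i (d (Suc i) z) = \<zero>\<^bsub>P i\<^esub>" using k by blast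
qed

text \<open>The difference of \<open>\<chi>\<close> and the identity induces zero on
  \<open>M\<close>, so it is contracted degree by degree. Two maps of this kind occur: the round
  trip through a bounded projective resolution over \<open>Q\<close>, and the round trip through
  \<open>T\<close> reduced modulo the regular sequence.\<close>

lemma chain_homotopy_exists:
  fixes P :: "nat \<Rightarrow> ('a, 'p) module"
  assumes res: "projective_resolution R M P d e" and M: "module R M"
    and \<chi>: "\<And>i. \<chi> i \<in> mod_hom R (P i) (P i)"
    and \<chi>e: "\<And>x. x \<in> carrier (P 0) \<Longrightarrow> e (\<chi> 0 x) = e x"
    and \<chi>d: "\<And>i x. x \<in> carrier (P (Suc i)) \<Longrightarrow> d i (\<chi> (Suc i) x) = \<chi> i (d i x)"
  shows "\<exists>h. (\<forall>i. h i \<in> mod_hom R (P i) (P (Suc i))) \<and>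
    (\<forall>x\<in>carrier (P 0). d 0 (h 0 x) = \<chi> 0 x \<ominus>\<^bsub>P 0\<^esub> x) \<and>
    (\<forall>i. \<forall>x\<in>carrier (P (Suc i)). d (Suc i) (h (Suc i) x) = (\<chi> (Suc i) x \<ominus>\<^bsub>P (Suc i)\<^esub> x) \<ominus>\<^bsub>P (Suc i)\<^esub> h i (d i x))"
proof -
  note PD = projective_resolutionD[OF res]
  define \<kappa> where "\<kappa> i x = \<chi> i x \<ominus>\<^bsub>P i\<^esub> x" for i x
  have id: "(\<lambda>x. x) \<in> mod_hom R (P i) (P i)" for i by (rule mod_homI) auto
  have \<kappa>: "\<kappa> i \<in> mod_hom R (P i) (P i)" for i
    unfolding \<kappa>_def by (rule mod_hom_diff[OF PD(2) \<chi> id])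
  have \<kappa>e: "e (\<kappa> 0 x) = \<zero>\<^bsub>M\<^esub>" if "x \<in> carrier (P 0)" for x
  proof -
    interpret M: module R M by fact
    show ?thesis
      unfolding \<kappa>_def mod_hom_minus[OF PD(2) M PD(4) mod_homD(1)[OF \<chi> that] that] \<chi>e[OF that]
      using mod_homD(1)[OF PD(4) that] by (simp add: a_minus_def M.r_neg)
  qed
  have \<kappa>d: "d i (\<kappa> (Suc i) x) = \<kappa> i (d i x)" if "x \<in> carrier (P (Suc i))" for i x
    unfolding \<kappa>_def mod_hom_minus[OF PD(2) PD(2) PD(3) mod_homD(1)[OF \<chi> that] that] \<chi>d[OF that] by simp
  define good where "good i f \<longleftrightarrow> f \<in> mod_hom R (P i) (P (Suc i)) \<and>
    (\<forall>x\<in>carrier (P (Suc i)). \<kappa> (Suc i) x \<ominus>\<^bsub>P (Suc i)\<^esub> f (d i x) \<in> d (Suc i) ` carrier (P (Suc (Suc i))))" for i f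
  have ker: "\<kappa> (Suc i) x \<ominus>\<^bsub>P (Suc i)\<^esub> f (d i x) \<in> d (Suc i) ` carrier (P (Suc (Suc i)))"
    if f: "f \<in> mod_hom R (P i) (P (Suc i))" and x: "x \<in> carrier (P (Suc i))"
      and eq: "d i (f (d i x)) = \<kappa> i (d i x)" for i f x
  proof (rule PD(7))
    interpret P': module R "P (Suc i)" by (rule PD(2))
    interpret P: module R "P i" by (rule PD(2))
    note c = mod_homD(1)[OF \<kappa> x] mod_homD(1)[OF f mod_homD(1)[OF PD(3) x]]
    show "\<kappa> (Suc i) x \<ominus>\<^bsub>P (Suc i)\<^esub> f (d i x) \<in> carrier (P (Suc i))" using c by simp
    show "d i (\<kappa> (Suc i) x \<ominus>\<^bsub>P (Suc i)\<^esub> f (d i x)) = \<zero>\<^bsub>P i\<^esub>"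
      unfolding mod_hom_minus[OF PD(2) PD(2) PD(3) c] \<kappa>d[OF x] eq
      using mod_homD(1)[OF \<kappa> mod_homD(1)[OF PD(3) x]] by (simp add: a_minus_def P.r_neg)
  qed
  have start: "\<exists>f. good 0 f \<and> (\<forall>x\<in>carrier (P 0). d 0 (f x) = \<kappa> 0 x)"
  proof -
    have "\<exists>f\<in>mod_hom R (P 0) (P (Suc 0)). \<forall>x\<in>carrier (P 0). d 0 (f x) = \<kappa> 0 x"
      by (rule projective_lift[OF PD(1) PD(2) PD(2) PD(3) \<kappa>]) (rule PD(6)[OF mod_homD(1)[OF \<kappa>] \<kappa>e])
    then obtain f where f: "f \<in> mod_hom R (P 0) (P (Suc 0))" "\<And>x. x \<in> carrier (P 0) \<Longrightarrow> d 0 (f x) = \<kappa> 0 x"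
      by blast
    have "good 0 f" unfolding good_def using ker[OF f(1)] f mod_homD(1)[OF PD(3)] by blast
    then show ?thesis using f(2) by blast
  qed
  have step: "\<exists>g. good (Suc i) g \<and> (\<forall>x\<in>carrier (P (Suc i)). d (Suc i) (g x) = \<kappa> (Suc i) x \<ominus>\<^bsub>P (Suc i)\<^esub> f (d i x))"
    if f: "good i f" for i f
  proof -
    interpret P: module R "P (Suc i)" by (rule PD(2))
    interpret Pi: module R "P i" by (rule PD(2))
    have fh: "f \<in> mod_hom R (P i) (P (Suc i))" using f by (simp add: good_def)
    have "\<exists>g\<in>mod_hom R (P (Suc i)) (P (Suc (Suc i))). \<forall>x\<in>carrier (P (Suc i)).
        d (Suc i) (g x) = \<kappa> (Suc i) x \<ominus>\<^bsub>P (Suc i)\<^esub> f (d i x)"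
      by (rule projective_lift[OF PD(1) PD(2) PD(2) PD(3) mod_hom_diff[OF PD(2) \<kappa> mod_hom_comp[OF PD(3) fh]]])
        (use f in \<open>simp add: good_def\<close>)
    then obtain g where g: "g \<in> mod_hom R (P (Suc i)) (P (Suc (Suc i)))"
      "\<And>x. x \<in> carrier (P (Suc i)) \<Longrightarrow> d (Suc i) (g x) = \<kappa> (Suc i) x \<ominus>\<^bsub>P (Suc i)\<^esub> f (d i x)"
      by blast
    have "d (Suc i) (g (d (Suc i) x)) = \<kappa> (Suc i) (d (Suc i) x)" if x: "x \<in> carrier (P (Suc (Suc i)))" for x
    proof -
      have dx: "d (Suc i) x \<in> carrier (P (Suc i))" by (rule mod_homD(1)[OF PD(3) x])
      show ?thesis
        unfolding g(2)[OF dx] PD(9)[OF x] mod_hom_zero[OF PD(2) PD(2) fh]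
        using mod_homD(1)[OF \<kappa> dx] by (simp add: a_minus_def)
    qed
    then have "good (Suc i) g" unfolding good_def using ker[OF g(1)] g(1) by blast
    then show ?thesis using g(2) by blast
  qed
  have "\<exists>h. \<forall>i. (good i (h i) \<and> (i = 0 \<longrightarrow> (\<forall>x\<in>carrier (P 0). d 0 (h i x) = \<kappa> 0 x))) \<and>
      (\<forall>x\<in>carrier (P (Suc i)). d (Suc i) (h (Suc i) x) = \<kappa> (Suc i) x \<ominus>\<^bsub>P (Suc i)\<^esub> h i (d i x))"
  proof (rule dependent_nat_choice)
    show "\<exists>f. good 0 f \<and> (0 = (0 :: nat) \<longrightarrow> (\<forall>x\<in>carrier (P 0). d 0 (f x) = \<kappa> 0 x))"
      using start by simp
    show "\<exists>g. (good (Suc i) g \<and> (Suc i = 0 \<longrightarrow> (\<forall>x\<in>carrier (P 0). d 0 (g x) = \<kappa> 0 x))) \<and>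
        (\<forall>x\<in>carrier (P (Suc i)). d (Suc i) (g x) = \<kappa> (Suc i) x \<ominus>\<^bsub>P (Suc i)\<^esub> f (d i x))"
      if "good i f \<and> (i = 0 \<longrightarrow> (\<forall>x\<in>carrier (P 0). d 0 (f x) = \<kappa> 0 x))" for f i
      using step[of i f] that by simp
  qed
  then obtain h where h: "\<forall>i. (good i (h i) \<and> (i = 0 \<longrightarrow> (\<forall>x\<in>carrier (P 0). d 0 (h i x) = \<kappa> 0 x))) \<and>
      (\<forall>x\<in>carrier (P (Suc i)). d (Suc i) (h (Suc i) x) = \<kappa> (Suc i) x \<ominus>\<^bsub>P (Suc i)\<^esub> h i (d i x))" ..
  show ?thesis
    by (intro exI[of _ h] conjI allI) (use h in \<open>simp_all add: good_def \<kappa>_def\<close>)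
qed

section \<open>Finite resolutions by finitely generated projective modules\<close>

lemma dual_basis_span:
  assumes U: "dual_basis R X W U"
  shows "module_span R (fmod R U) (W ` X) = U"
proof -
  note UD = dual_basisD[OF U]
  interpret U: module R "fmod R U" by (rule UD(2))
  have W: "W ` X \<subseteq> carrier (fmod R U)" using UD(4) by auto
  note S = submodule_module_span[OF UD(2) W]
  have "x \<in> module_span R (fmod R U) (W ` X)" if x: "x \<in> U" for x
  proof -
    have "(\<lambda>x. x) \<in> mod_hom R (fmod R U) (fmod R U)" by (rule mod_homI) auto
    from dual_basis_hom[OF U UD(2) this x]
    have "x = (\<Oplus>\<^bsub>fmod R U\<^esub>s\<in>X. x s \<odot>\<^bsub>fmod R U\<^esub> W s)" .
    also have "\<dots> \<in> module_span R (fmod R U) (W ` X)"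
    proof (rule submodule_finsum[OF UD(2) S], rule Pi_I)
      fix s assume s: "s \<in> X"
      then have "W s \<in> module_span R (fmod R U) (W ` X)"
        using module_span_superset[of "W ` X" R "fmod R U"] by blast
      then show "x s \<odot>\<^bsub>fmod R U\<^esub> W s \<in> module_span R (fmod R U) (W ` X)"
        by (rule U.submoduleE(4)[OF S UD(3)[OF x]])
    qed
    finally show ?thesis .
  qed
  then show ?thesis using U.submoduleE(1)[OF S] by auto
qed

lemma dual_basis_noetherian:
  assumes "noetherian_ring R" "dual_basis R X W U"
  shows "noetherian_on R (fmod R U) {} U"
proof -
  note UD = dual_basisD[OF assms(2)]
  have "noetherian_on R (fmod R U) {} (module_span R (fmod R U) (W ` X))"
    by (rule noetherian_on_module_span[OF assms(1) UD(2)]) (use UD(1,4) in auto)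
  then show ?thesis unfolding dual_basis_span[OF assms(2)] .
qed

text \<open>The basis consists of natural numbers whatever the types of \<open>R\<close> and
  \<open>M\<close> are; hence all modules of a resolution built from such covers have the same
  type.\<close>

lemma fin_gen_free_cover:
  assumes M: "module R M" and U: "submodule U R M" and S: "finite S" "module_span R M S = U"
  shows "\<exists>(r :: nat) h. h \<in> mod_hom R (free_module R {..<r}) M \<and> h ` carrier (free_module R {..<r}) = U"
proof -
  interpret M: module R M by fact
  have SU: "S \<subseteq> U" using module_span_superset[of S R M] S(2) by simp
  note Uc = M.submoduleE(1)[OF U]
  obtain g where g: "bij_betw g {0..<card S} S" using ex_bij_betw_nat_finite[OF S(1)] by blast
  define r where "r = card S"
  have gS: "g ` {..<r} = S" using g unfolding bij_betw_def r_def by (simp add: lessThan_atLeast0)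
  have gM: "g s \<in> carrier M" if "s \<in> {..<r}" for s using that gS SU Uc by blast
  obtain h where h: "h \<in> mod_hom R (free_module R {..<r}) M" "\<And>s. s \<in> {..<r} \<Longrightarrow> h (unit_vector R s) = g s"
    using free_module_hom_exists[OF M, of "{..<r}" g] gM by blast
  let ?F = "free_module R {..<r}"
  have F: "module R ?F" by (rule free_module_module[OF M.is_cring])
  have D: "dual_basis R {..<r} (unit_vector R) (carrier ?F)"
    by (rule dual_basis_free_module[OF M.is_cring]) simp
  have "h x \<in> U" if x: "x \<in> carrier ?F" for x
  proof -
    have "h x = (\<Oplus>\<^bsub>M\<^esub>s\<in>{..<r}. x s \<odot>\<^bsub>M\<^esub> h (unit_vector R s))"
      by (rule dual_basis_hom[OF D M _ x]) (use h(1) in \<open>simp add: free_module_eq_fmod[symmetric]\<close>)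
    also have "\<dots> \<in> U"
    proof (rule submodule_finsum[OF M U], rule Pi_I)
      fix s assume s: "s \<in> {..<r}"
      then have "h (unit_vector R s) \<in> U" using h(2)[OF s] gS SU by blast
      then show "x s \<odot>\<^bsub>M\<^esub> h (unit_vector R s) \<in> U"
        by (rule M.submoduleE(4)[OF U dual_basisD(3)[OF D x]])
    qed
    finally show ?thesis .
  qed
  moreover have "U \<subseteq> h ` carrier ?F"
  proof -
    have "S \<subseteq> h ` carrier ?F"
    proof
      fix y assume "y \<in> S"
      then obtain s where s: "s \<in> {..<r}" "y = g s" using gS by blast
      then have "y = h (unit_vector R s)" using h(2) by simp
      then show "y \<in> h ` carrier ?F" using unit_vector_in_free_module[OF M.is_cring s(1)] by blast
    qed
    then show ?thesis
      using module_span_minimal[OF submodule_image[OF F M h(1) module.carrier_is_submodule[OF F]]] S(2) by blast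
  qed
  ultimately show ?thesis using h(1) by (intro exI[of _ r] exI[of _ h]) auto
qed

text \<open>Kernels inside finitely generated free modules over a Noetherian ring are finitely
  generated, so every step can again use a finite basis.\<close>

lemma fin_gen_free_resolution:
  fixes M :: "('a, 'm, 'c) module_scheme"
  assumes R: "noetherian_ring R" and M: "fin_gen_module R M"
  shows "\<exists>(r :: nat \<Rightarrow> nat) d e. projective_resolution R M (\<lambda>i. free_module R {..<r i}) d e"
proof -
  have MM: "module R M" using M by (simp add: fin_gen_module_def)
  then have cR: "cring R" by (simp add: module_def)
  let ?F = "\<lambda>r :: nat. free_module R {..<r}"
  have F: "module R (?F r)" for r by (rule free_module_module[OF cR])
  have D: "dual_basis R {..<r} (unit_vector R) (carrier (?F r))" for r
    by (rule dual_basis_free_module[OF cR]) simp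
  obtain S where "finite S" "module_span R M S = carrier M" using M by (auto simp: fin_gen_module_def)
  from fin_gen_free_cover[OF MM module.carrier_is_submodule[OF MM] this]
  obtain r0 e where e: "e \<in> mod_hom R (?F r0) M" "e ` carrier (?F r0) = carrier M" by blast
  define K0 where "K0 = a_kernel (?F r0) M e"
  define sub where "sub t \<longleftrightarrow> submodule (snd t) R (?F (fst t))" for t
  define nxt where "nxt s t \<longleftrightarrow> (\<exists>d. d \<in> mod_hom R (?F (fst t)) (?F (fst s)) \<and>
    d ` carrier (?F (fst t)) = snd s \<and> snd t = a_kernel (?F (fst t)) (?F (fst s)) d)" for s t
  have step: "\<exists>t. sub t \<and> nxt s t" if "sub s" for s
  proof -
    have sK: "submodule (snd s) R (?F (fst s))" using that by (simp add: sub_def)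
    have "noetherian_on R (?F (fst s)) {} (snd s)"
      using dual_basis_noetherian[OF R D, of "fst s"] module.submoduleE(1)[OF F sK]
      by (simp add: free_module_eq_fmod[symmetric] noetherian_on_subset)
    then obtain T where "finite T" "module_span R (?F (fst s)) T = snd s"
      using noetherian_on_fin_gen[OF F sK] by blast
    from fin_gen_free_cover[OF F sK this]
    obtain r d where d: "d \<in> mod_hom R (?F r) (?F (fst s))" "d ` carrier (?F r) = snd s" by blast
    have "sub (r, a_kernel (?F r) (?F (fst s)) d)"
      unfolding sub_def using submodule_kernel[OF F F d(1)] by simp
    moreover have "nxt s (r, a_kernel (?F r) (?F (fst s)) d)"
      unfolding nxt_def fst_conv snd_conv using d by (intro exI[of _ d] conjI refl)
    ultimately show ?thesis by blast
  qed
  have sub0: "sub (r0, K0)"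
    unfolding sub_def fst_conv snd_conv K0_def by (rule submodule_kernel[OF F MM e(1)])
  have "\<exists>t. \<forall>n. (sub (t n) \<and> (n = 0 \<longrightarrow> t n = (r0, K0))) \<and> nxt (t n) (t (Suc n))"
    by (rule dependent_nat_choice) (use sub0 step in auto)
  then obtain t where t0: "t 0 = (r0, K0)" and nxt: "\<And>i. nxt (t i) (t (Suc i))"
    by blast
  define r where "r i = fst (t i)" for i
  from nxt obtain d where d: "\<And>i. d i \<in> mod_hom R (?F (r (Suc i))) (?F (r i))"
    "\<And>i. d i ` carrier (?F (r (Suc i))) = snd (t i)"
    "\<And>i. snd (t (Suc i)) = a_kernel (?F (r (Suc i))) (?F (r i)) (d i)"
    unfolding nxt_def r_def by metis
  have r0: "r 0 = r0" by (simp add: r_def t0)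
  have "projective_resolution R M (\<lambda>i. ?F (r i)) d e"
    unfolding projective_resolution_def
  proof (intro conjI allI)
    show "projective_module R (?F (r i))" for i
      by (rule free_module_projective[OF cR])
    show "d i \<in> mod_hom R (?F (r (Suc i))) (?F (r i))" for i
      by (rule d(1))
    show "e \<in> mod_hom R (?F (r 0)) M" "e ` carrier (?F (r 0)) = carrier M"
      using e by (simp_all add: r0)
    show "d 0 ` carrier (?F (r 1)) = a_kernel (?F (r 0)) M e"
      using d(2)[of 0] by (simp add: t0 r0 K0_def)
    show "d (Suc i) ` carrier (?F (r (Suc (Suc i)))) = a_kernel (?F (r (Suc i))) (?F (r i)) (d i)" for i
      using d(2)[of "Suc i"] d(3)[of i] by simp
  qed
  then show ?thesis by blast
qed

text \<open>Applying \<open>p\<close> to the expansion of \<open>x = p x\<close> replaces the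
  vectors \<open>W s\<close> by \<open>p (W s)\<close>, while the coordinate functionals remain
  those of the larger module.\<close>

lemma dual_basis_retract:
  assumes U: "dual_basis R X W U" and p: "p \<in> mod_hom R (fmod R U) (fmod R U)"
    and idem: "\<And>x. x \<in> U \<Longrightarrow> p (p x) = p x"
  shows "dual_basis R X (\<lambda>s. p (W s)) (p ` U)"
proof -
  note UD = dual_basisD[OF U]
  interpret U: module R "fmod R U" by (rule UD(2))
  have pU: "p x \<in> U" if "x \<in> U" for x using mod_homD(1)[OF p] that by simp
  have "submodule (p ` U) R (fmod R U)"
    using submodule_image[OF UD(2) UD(2) p U.carrier_is_submodule] by simp
  from submodule.submodule_is_module[OF this UD(2)]
  have m: "module R (fmod R (p ` U))" by (simp add: fmod_def)
  have UR: "\<forall>x\<in>U. \<forall>y. x y \<in> carrier R" using UD(3) by blast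
  have "x y = (\<Oplus>\<^bsub>R\<^esub>s\<in>X. x s \<otimes>\<^bsub>R\<^esub> p (W s) y)" if x: "x \<in> p ` U" for x y
  proof -
    have xU: "x \<in> U" and px: "p x = x" using x pU idem by auto
    have "(\<lambda>s. x s \<odot>\<^bsub>fmod R U\<^esub> p (W s)) \<in> X \<rightarrow> U"
      using U.smult_closed[OF UD(3)[OF xU], of "p (W _)"] pU UD(4) by auto
    from fmod_finsum[OF UD(2) UR this, of y] show ?thesis
      using arg_cong[OF dual_basis_hom[OF U UD(2) p xU], of "\<lambda>z. z y"] px by simp
  qed
  moreover have "p ` U \<subseteq> U" using pU by blast
  ultimately show ?thesis
    unfolding dual_basis_def using UD(1) m UR UD(4) by auto
qed

text \<open>Here \<open>d k\<close> starts in degree \<open>k\<close>, one index later than in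
  \<open>projective_resolution\<close>. Since \<open>0 - 1 = 0\<close>, the map \<open>d 0\<close>
  goes from \<open>F 0\<close> to itself and is set to zero; this is why exactness in degree 0 has
  to mention \<open>e\<close>. For \<open>k > n\<close> the dual basis is empty, so
  \<open>F k\<close> is zero.\<close>

locale finite_resolution =
  fixes Q :: "('q, 'b) ring_scheme" and M :: "('q, 'm, 'c) module_scheme"
    and r :: "nat \<Rightarrow> nat" and W :: "nat \<Rightarrow> nat \<Rightarrow> nat \<Rightarrow> 'q" and F :: "nat \<Rightarrow> (nat \<Rightarrow> 'q) set"
    and d :: "nat \<Rightarrow> (nat \<Rightarrow> 'q) \<Rightarrow> nat \<Rightarrow> 'q" and e :: "(nat \<Rightarrow> 'q) \<Rightarrow> 'm" and n :: nat
  assumes M: "module Q M"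
    and basis: "dual_basis Q {..<r k} (W k) (F k)"
    and bounded: "k > n \<Longrightarrow> r k = 0"
    and d_hom: "d k \<in> mod_hom Q (fmod Q (F k)) (fmod Q (F (k - 1)))"
    and d_0: "d 0 x = (\<lambda>_. \<zero>\<^bsub>Q\<^esub>)"
    and e_hom: "e \<in> mod_hom Q (fmod Q (F 0)) M"
    and e_surj: "e ` F 0 = carrier M"
    and e_d: "x \<in> F 1 \<Longrightarrow> e (d 1 x) = \<zero>\<^bsub>M\<^esub>"
    and d_d: "x \<in> F k \<Longrightarrow> d (k - 1) (d k x) = (\<lambda>_. \<zero>\<^bsub>Q\<^esub>)"
    and exact: "x \<in> F k \<Longrightarrow> d k x = (\<lambda>_. \<zero>\<^bsub>Q\<^esub>) \<Longrightarrow> (k = 0 \<Longrightarrow> e x = \<zero>\<^bsub>M\<^esub>) \<Longrightarrow> \<exists>u\<in>F (Suc k). d (Suc k) u = x"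

text \<open>Comparing a resolution \<open>G\<close> by finitely generated free modules with a projective resolution of
  length \<open>n\<close> yields a map \<open>h\<close> such that \<open>x \<mapsto> x + d (h x)\<close> is a projection of \<open>G n\<close> with kernel
  \<open>d (G (n + 1))\<close>. Then \<open>G\<close> is truncated to the image of this projection.\<close>

lemma finite_resolution_exists:
  fixes M :: "('q, 'm) module"
  assumes Q: "noetherian_ring Q" and MM: "fin_gen_module Q M" and pd: "proj_dim Q M < \<infinity>"
  shows "\<exists>r W F d e n. finite_resolution Q M r W F d e n"
proof -
  have M: "module Q M" using MM by (simp add: fin_gen_module_def)
  then have cQ: "cring Q" by (simp add: module_def)
  have "\<exists>n (P :: nat \<Rightarrow> ('q, ('q, 'm) res_elem) module) d e.
      projective_resolution Q M P d e \<and> (\<forall>i>n. carrier (P i) = {\<zero>\<^bsub>P i\<^esub>})"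
  proof (rule ccontr)
    assume "\<not> ?thesis"
    \<comment> \<open>Were there no resolution of finite length, the infimum would range over the
      empty set and be infinite.\<close>
    then have "proj_dim Q M = Inf {}" unfolding proj_dim_def by (intro arg_cong[where f = Inf]) blast
    then show False using pd by (simp add: top_enat_def)
  qed
  then obtain n and P :: "nat \<Rightarrow> ('q, ('q, 'm) res_elem) module" and dP eP where
    P: "projective_resolution Q M P dP eP" and Pn: "\<And>i. i > n \<Longrightarrow> carrier (P i) = {\<zero>\<^bsub>P i\<^esub>}"
    by blast
  obtain r :: "nat \<Rightarrow> nat" and dG eG where
    G: "projective_resolution Q M (\<lambda>i. free_module Q {..<r i}) dG eG"
    using fin_gen_free_resolution[OF Q MM] by blast
  note PD = projective_resolutionD[OF P] and GD = projective_resolutionD[OF G]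
  let ?G = "\<lambda>i. free_module Q {..<r i}"
  define U where "U i = carrier (?G i)" for i
  have GU: "?G i = fmod Q (U i)" for i by (simp add: U_def free_module_eq_fmod[symmetric])
  have basisU: "dual_basis Q {..<r i} (unit_vector Q) (U i)" for i
    unfolding U_def by (rule dual_basis_free_module[OF cQ]) simp
  obtain \<phi> where \<phi>: "\<And>i. \<phi> i \<in> mod_hom Q (?G i) (P i)"
    "\<And>x. x \<in> carrier (?G 0) \<Longrightarrow> eP (\<phi> 0 x) = eG x"
    "\<And>i x. x \<in> carrier (?G (Suc i)) \<Longrightarrow> dP i (\<phi> (Suc i) x) = \<phi> i (dG i x)"
  proof -
    have "\<exists>\<phi>. (\<forall>i. \<phi> i \<in> mod_hom Q (?G i) (P i)) \<and> (\<forall>x\<in>carrier (?G 0). eP (\<phi> 0 x) = eG x) \<and>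
        (\<forall>i. \<forall>x\<in>carrier (?G (Suc i)). dP i (\<phi> (Suc i) x) = \<phi> i (dG i x))"
    proof (rule chain_map_exists)
      show "k (dG i (dG (Suc i) x)) = \<zero>\<^bsub>P i\<^esub>"
        if "k \<in> mod_hom Q (?G i) (P i)" "x \<in> carrier (?G (Suc (Suc i)))" for i k x
        using GD(9)[OF that(2)] mod_hom_zero[OF GD(2) PD(2) that(1)] by simp
    qed (rule GD PD M | assumption)+
    then show ?thesis using that by blast
  qed
  obtain \<psi> where \<psi>: "\<And>i. \<psi> i \<in> mod_hom Q (P i) (?G i)"
    "\<And>x. x \<in> carrier (P 0) \<Longrightarrow> eG (\<psi> 0 x) = eP x"
    "\<And>i x. x \<in> carrier (P (Suc i)) \<Longrightarrow> dG i (\<psi> (Suc i) x) = \<psi> i (dP i x)"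
  proof -
    have "\<exists>\<psi>. (\<forall>i. \<psi> i \<in> mod_hom Q (P i) (?G i)) \<and> (\<forall>x\<in>carrier (P 0). eG (\<psi> 0 x) = eP x) \<and>
        (\<forall>i. \<forall>x\<in>carrier (P (Suc i)). dG i (\<psi> (Suc i) x) = \<psi> i (dP i x))"
    proof (rule chain_map_exists)
      show "k (dP i (dP (Suc i) x)) = \<zero>\<^bsub>?G i\<^esub>"
        if "k \<in> mod_hom Q (P i) (?G i)" "x \<in> carrier (P (Suc (Suc i)))" for i k x
        using PD(9)[OF that(2)] mod_hom_zero[OF PD(2) GD(2) that(1)] by simp
    qed (rule GD PD M | assumption)+
    then show ?thesis using that by blast
  qed
  define \<chi> where "\<chi> i x = \<psi> i (\<phi> i x)" for i x
  have \<chi>: "\<chi> i \<in> mod_hom Q (?G i) (?G i)" for i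
    unfolding \<chi>_def by (rule mod_hom_comp[OF \<phi>(1) \<psi>(1)])
  have "\<exists>h. (\<forall>i. h i \<in> mod_hom Q (?G i) (?G (Suc i))) \<and>
      (\<forall>x\<in>carrier (?G 0). dG 0 (h 0 x) = \<chi> 0 x \<ominus>\<^bsub>?G 0\<^esub> x) \<and>
      (\<forall>i. \<forall>x\<in>carrier (?G (Suc i)). dG (Suc i) (h (Suc i) x) =
        (\<chi> (Suc i) x \<ominus>\<^bsub>?G (Suc i)\<^esub> x) \<ominus>\<^bsub>?G (Suc i)\<^esub> h i (dG i x))"
  proof (rule chain_homotopy_exists[OF G M \<chi>])
    show "eG (\<chi> 0 x) = eG x" if "x \<in> carrier (?G 0)" for x
      unfolding \<chi>_def using \<psi>(2)[OF mod_homD(1)[OF \<phi>(1) that]] \<phi>(2)[OF that] by simp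
    show "dG i (\<chi> (Suc i) x) = \<chi> i (dG i x)" if "x \<in> carrier (?G (Suc i))" for i x
      unfolding \<chi>_def using \<psi>(3)[OF mod_homD(1)[OF \<phi>(1) that]] \<phi>(3)[OF that] by simp
  qed
  then obtain h where h: "\<And>i. h i \<in> mod_hom Q (?G i) (?G (Suc i))"
    "\<And>i x. x \<in> carrier (?G (Suc i)) \<Longrightarrow> dG (Suc i) (h (Suc i) x) =
        (\<chi> (Suc i) x \<ominus>\<^bsub>?G (Suc i)\<^esub> x) \<ominus>\<^bsub>?G (Suc i)\<^esub> h i (dG i x)"
    by blast
  define \<pi> where "\<pi> x = x \<oplus>\<^bsub>?G n\<^esub> dG n (h n x)" for x
  have id: "(\<lambda>x. x) \<in> mod_hom Q (?G i) (?G i)" for i by (rule mod_homI) auto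
  have \<pi>: "\<pi> \<in> mod_hom Q (?G n) (?G n)"
    unfolding \<pi>_def by (rule mod_hom_add[OF GD(2) id mod_hom_comp[OF h(1) GD(3)]])
  have \<pi>d: "\<pi> (dG n x) = \<zero>\<^bsub>?G n\<^esub>" if x: "x \<in> carrier (?G (Suc n))" for x
  proof -
    interpret G: module Q "?G n" by (rule GD(2))
    interpret G': module Q "?G (Suc n)" by (rule GD(2))
    have dx: "dG n x \<in> carrier (?G n)" by (rule mod_homD(1)[OF GD(3) x])
    have hdx: "h n (dG n x) \<in> carrier (?G (Suc n))" by (rule mod_homD(1)[OF h(1) dx])
    have dhdx: "dG n (h n (dG n x)) \<in> carrier (?G n)" by (rule mod_homD(1)[OF GD(3) hdx])
    \<comment> \<open>The module \<open>P (n + 1)\<close> is zero, so \<open>\<chi>\<close> vanishes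
      in degree \<open>n + 1\<close> and the homotopy relation becomes
      \<open>d (h x) = - x - h (d x)\<close>. Applying \<open>d\<close> once more yields
      \<open>d x + d (h (d x)) = 0\<close>, that is, \<open>\<pi> (d x) = 0\<close>.\<close>
    have "\<phi> (Suc n) x = \<zero>\<^bsub>P (Suc n)\<^esub>"
      using mod_homD(1)[OF \<phi>(1) x] Pn[of "Suc n"] by simp
    then have "\<chi> (Suc n) x = \<zero>\<^bsub>?G (Suc n)\<^esub>"
      unfolding \<chi>_def using mod_hom_zero[OF PD(2) GD(2) \<psi>(1)] by simp
    then have "dG (Suc n) (h (Suc n) x) = (\<ominus>\<^bsub>?G (Suc n)\<^esub> x) \<ominus>\<^bsub>?G (Suc n)\<^esub> h n (dG n x)"
      using h(2)[OF x] x by (simp add: a_minus_def)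
    then have "\<zero>\<^bsub>?G n\<^esub> = dG n ((\<ominus>\<^bsub>?G (Suc n)\<^esub> x) \<ominus>\<^bsub>?G (Suc n)\<^esub> h n (dG n x))"
      using GD(9)[OF mod_homD(1)[OF h(1) x]] by simp
    also have "\<dots> = (\<ominus>\<^bsub>?G n\<^esub> dG n x) \<ominus>\<^bsub>?G n\<^esub> dG n (h n (dG n x))"
      using mod_hom_minus[OF GD(2) GD(2) GD(3) _ hdx] mod_hom_neg[OF GD(2) GD(2) GD(3) x] x by simp
    also have "\<dots> = \<ominus>\<^bsub>?G n\<^esub> (dG n x \<oplus>\<^bsub>?G n\<^esub> dG n (h n (dG n x)))"
      using dx dhdx by (simp add: a_minus_def G.minus_add)
    finally have eq: "\<ominus>\<^bsub>?G n\<^esub> (dG n x \<oplus>\<^bsub>?G n\<^esub> dG n (h n (dG n x))) = \<zero>\<^bsub>?G n\<^esub>" by (rule sym)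
    have "dG n x \<oplus>\<^bsub>?G n\<^esub> dG n (h n (dG n x)) = \<ominus>\<^bsub>?G n\<^esub> \<zero>\<^bsub>?G n\<^esub>"
      unfolding eq[symmetric] by (rule G.minus_minus[OF G.a_closed[OF dx dhdx], symmetric])
    also have "\<dots> = \<zero>\<^bsub>?G n\<^esub>" using G.M.add.inv_one by (simp add: a_inv_def)
    finally show ?thesis unfolding \<pi>_def .
  qed
  \<comment> \<open>An idempotent chain endomorphism of \<open>G\<close> that is compatible with the
    augmentation: for such a map, exactness of \<open>G\<close> passes to its image.\<close>
  define p where "p k x = (if k < n then x else if k = n then \<pi> x else \<zero>\<^bsub>?G k\<^esub>)" for k x
  have p: "p k \<in> mod_hom Q (?G k) (?G k)" for k
  proof -
    consider "k < n" | "k = n" | "k > n" by linarith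
    then show ?thesis
    proof cases
      case 1 then show ?thesis using id[of k] by (simp add: p_def[abs_def])
    next
      case 2 then show ?thesis using \<pi> by (simp add: p_def[abs_def])
    next
      case 3 then show ?thesis using mod_hom_const_zero[OF GD(2)[of k]] by (simp add: p_def[abs_def])
    qed
  qed
  have pG: "p k x \<in> carrier (?G k)" if "x \<in> carrier (?G k)" for k x by (rule mod_homD(1)[OF p that])
  have pd: "p k (dG k x) = dG k (p (Suc k) x)" if x: "x \<in> carrier (?G (Suc k))" for k x
  proof -
    interpret G: module Q "?G k" by (rule GD(2))
    note dx = mod_homD(1)[OF GD(3) x]
    consider "Suc k < n" | "Suc k = n" | "k = n" | "k > n" by linarith
    then show ?thesis
    proof cases
      case 1 then show ?thesis by (simp add: p_def)
    next
      case 2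
      have hx: "h n x \<in> carrier (?G (Suc n))" using mod_homD(1)[OF h(1)] x 2 by blast
      have "dG k (\<pi> x) = dG k x \<oplus>\<^bsub>?G k\<^esub> dG k (dG n (h n x))"
        unfolding \<pi>_def using mod_homD(2)[OF GD(3) x] mod_homD(1)[OF GD(3) hx] 2 by simp
      also have "\<dots> = dG k x"
        using GD(9)[of "h n x" k] hx 2 dx by simp
      finally show ?thesis using 2 by (simp add: p_def)
    next
      case 3
      then show ?thesis using \<pi>d x mod_hom_zero[OF GD(2) GD(2) GD(3)] by (simp add: p_def)
    next
      case 4
      then show ?thesis using mod_hom_zero[OF GD(2) GD(2) GD(3)] by (simp add: p_def)
    qed
  qed
  have pp: "p k (p k x) = p k x" if x: "x \<in> carrier (?G k)" for k x
  proof -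
    interpret G: module Q "?G k" by (rule GD(2))
    have "\<pi> (\<pi> x) = \<pi> x" if "k = n"
    proof -
      have x': "x \<in> carrier (?G n)" using x that by simp
      have hx: "h n x \<in> carrier (?G (Suc n))" by (rule mod_homD(1)[OF h(1) x'])
      have "\<pi> (\<pi> x) = \<pi> x \<oplus>\<^bsub>?G n\<^esub> \<pi> (dG n (h n x))"
        using mod_homD(2)[OF \<pi> x' mod_homD(1)[OF GD(3) hx]] by (simp only: \<pi>_def[of x, symmetric])
      then show ?thesis using \<pi>d[OF hx] mod_homD(1)[OF \<pi> x'] G.r_zero that by simp
    qed
    then show ?thesis by (simp add: p_def)
  qed
  have ep: "eG (p 0 x) = eG x" if x: "x \<in> carrier (?G 0)" for x
  proof (cases "n = 0")
    case True
    interpret M: module Q M by (rule M)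
    have hx: "h 0 x \<in> carrier (?G (Suc 0))" by (rule mod_homD(1)[OF h(1) x])
    have "eG (x \<oplus>\<^bsub>?G 0\<^esub> dG 0 (h 0 x)) = eG x \<oplus>\<^bsub>M\<^esub> eG (dG 0 (h 0 x))"
      by (rule mod_homD(2)[OF GD(4) x mod_homD(1)[OF GD(3) hx]])
    then show ?thesis
      using GD(8)[OF hx] mod_homD(1)[OF GD(4) x] True by (simp add: p_def \<pi>_def)
  qed (simp add: p_def)
  define F where "F k = p k ` U k" for k
  have FU: "F k \<subseteq> U k" for k using pG unfolding F_def U_def by blast
  have pF: "p k x = x" if "x \<in> F k" for k x using that pp unfolding F_def U_def by force
  have FI: "p k x \<in> F k" if "x \<in> U k" for k x using that unfolding F_def by blast
  define d where "d k = (if k = 0 then (\<lambda>_ _. \<zero>\<^bsub>Q\<^esub>) else dG (k - 1))" for k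
  have basis': "dual_basis Q {..<r k} (\<lambda>s. p k (unit_vector Q s)) (F k)" for k
    unfolding F_def
  proof (rule dual_basis_retract[OF basisU])
    show "p k \<in> mod_hom Q (fmod Q (U k)) (fmod Q (U k))" using p[of k] unfolding GU .
    show "p k (p k x) = p k x" if "x \<in> U k" for x using pp that unfolding U_def .
  qed
  have Fm: "module Q (fmod Q (F k))" for k by (rule dual_basisD(2)[OF basis'])
  have zero: "\<zero>\<^bsub>?G k\<^esub> = (\<lambda>_. \<zero>\<^bsub>Q\<^esub>)" for k by (simp add: free_module_ops)
  have "finite_resolution Q M (\<lambda>k. if k \<le> n then r k else 0) (\<lambda>k s. p k (unit_vector Q s)) F d eG n"
  proof (rule finite_resolution.intro)
    show "module Q M" by (rule M)
    show "dual_basis Q {..<if k \<le> n then r k else 0} (\<lambda>s. p k (unit_vector Q s)) (F k)" for k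
    proof (cases "k \<le> n")
      case True then show ?thesis using basis' by simp
    next
      case False
      then have "x = (\<lambda>_. \<zero>\<^bsub>Q\<^esub>)" if "x \<in> F k" for x
        using pF[OF that] by (simp add: p_def zero)
      then show ?thesis
        using False Fm dual_basisD(3)[OF basis'] cring.cring_simprules(2)[OF cQ]
        unfolding dual_basis_def
        by (auto simp: abelian_monoid.finsum_empty[OF abelian_group.axioms(1)[OF ring.is_abelian_group[OF cring.axioms(1)[OF cQ]]]])
    qed
    show "n < k \<Longrightarrow> (if k \<le> n then r k else 0) = 0" for k by simp
    show "d 0 x = (\<lambda>_. \<zero>\<^bsub>Q\<^esub>)" for x by (simp add: d_def)
    show "d k \<in> mod_hom Q (fmod Q (F k)) (fmod Q (F (k - 1)))" for k
    proof (cases k)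
      case 0
      then show ?thesis using mod_hom_const_zero[OF Fm[of 0]] by (simp add: d_def)
    next
      case (Suc j)
      have dF: "dG j x \<in> F j" if x: "x \<in> F (Suc j)" for x
      proof -
        have xU: "x \<in> U (Suc j)" using FU x by blast
        then have "dG j x = p j (dG j x)" using pd[of x j] pF[OF x] by (simp add: U_def)
        also have "\<dots> \<in> F j" using mod_homD(1)[OF GD(3)] xU by (intro FI) (simp add: U_def)
        finally show ?thesis .
      qed
      have "dG j \<in> mod_hom Q (fmod Q (F (Suc j))) (fmod Q (U j))"
        using mod_hom_fmod_mono[OF _ FU, of "dG j" Q "Suc j"] GD(3)[of j] unfolding GU .
      then show ?thesis using dF Suc by (auto simp: mod_hom_def d_def)
    qed
    show "eG \<in> mod_hom Q (fmod Q (F 0)) M"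
      using mod_hom_fmod_mono[OF _ FU, of eG Q 0] GD(4) unfolding GU .
    show "eG ` F 0 = carrier M"
    proof
      show "eG ` F 0 \<subseteq> carrier M" using FU[of 0] mod_homD(1)[OF GD(4)] unfolding U_def by blast
      show "carrier M \<subseteq> eG ` F 0"
      proof
        fix m assume "m \<in> carrier M"
        then obtain x where "x \<in> U 0" "m = eG x" using GD(5) unfolding U_def by blast
        then have "m = eG (p 0 x)" "p 0 x \<in> F 0" using ep FI by (simp_all add: U_def)
        then show "m \<in> eG ` F 0" by blast
      qed
    qed
    show "eG (d 1 x) = \<zero>\<^bsub>M\<^esub>" if "x \<in> F 1" for x
      using GD(8)[of x] FU[of 1] that unfolding d_def U_def by auto
    show "d (k - 1) (d k x) = (\<lambda>_. \<zero>\<^bsub>Q\<^esub>)" if x: "x \<in> F k" for k x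
    proof -
      consider "k \<le> 1" | j where "k = Suc (Suc j)" by (metis One_nat_def Suc_le_eq less_2_cases_iff not_less_eq_eq old.nat.exhaust numeral_2_eq_2 le_SucE le_zero_eq)
      then show ?thesis
      proof cases
        case 1 then show ?thesis by (simp add: d_def)
      next
        case 2
        then have "x \<in> carrier (?G (Suc (Suc j)))" using x FU unfolding U_def by blast
        from GD(9)[OF this] show ?thesis using 2 by (simp add: d_def zero)
      qed
    qed
    show "\<exists>u\<in>F (Suc k). d (Suc k) u = x"
      if x: "x \<in> F k" and dx: "d k x = (\<lambda>_. \<zero>\<^bsub>Q\<^esub>)" and ex: "k = 0 \<Longrightarrow> eG x = \<zero>\<^bsub>M\<^esub>" for k x
    proof -
      have xU: "x \<in> carrier (?G k)" using x FU unfolding U_def by blast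
      have "x \<in> dG k ` carrier (?G (Suc k))"
      proof (cases k)
        case 0
        then show ?thesis using GD(6) xU ex by simp
      next
        case (Suc j)
        then show ?thesis using GD(7)[of x j] xU dx by (simp add: d_def zero)
      qed
      then obtain u where u: "u \<in> carrier (?G (Suc k))" "x = dG k u" by blast
      then have "x = dG k (p (Suc k) u)" using pF[OF x] pd[OF u(1)] by simp
      moreover have "p (Suc k) u \<in> F (Suc k)" using FI u(1) unfolding U_def by blast
      ultimately show ?thesis by (intro bexI[of _ "p (Suc k) u"]) (simp_all add: d_def)
    qed
  qed
  then show ?thesis by blast
qed

section \<open>A resolution over the quotient by a regular sequence\<close>

lemma module_fmodI:
  assumes "cring R" "\<And>x y. x \<in> U \<Longrightarrow> x y \<in> carrier R" "(\<lambda>_. \<zero>\<^bsub>R\<^esub>) \<in> U"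
    and "\<And>x y. x \<in> U \<Longrightarrow> y \<in> U \<Longrightarrow> (\<lambda>s. x s \<oplus>\<^bsub>R\<^esub> y s) \<in> U"
    and "\<And>a x. a \<in> carrier R \<Longrightarrow> x \<in> U \<Longrightarrow> (\<lambda>s. a \<otimes>\<^bsub>R\<^esub> x s) \<in> U"
  shows "module R (fmod R U)"
proof -
  interpret cring R by fact
  have "abelian_group (fmod R U)"
  proof (rule abelian_groupI)
    fix x assume x: "x \<in> carrier (fmod R U)"
    have "(\<lambda>s. (\<ominus>\<^bsub>R\<^esub> \<one>\<^bsub>R\<^esub>) \<otimes>\<^bsub>R\<^esub> x s) \<in> carrier (fmod R U)" using assms(5) x by simp
    moreover have "(\<lambda>s. (\<ominus>\<^bsub>R\<^esub> \<one>\<^bsub>R\<^esub>) \<otimes>\<^bsub>R\<^esub> x s) \<oplus>\<^bsub>fmod R U\<^esub> x = \<zero>\<^bsub>fmod R U\<^esub>"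
      using assms(2) x by (simp add: l_minus l_neg)
    ultimately show "\<exists>y\<in>carrier (fmod R U). y \<oplus>\<^bsub>fmod R U\<^esub> x = \<zero>\<^bsub>fmod R U\<^esub>" by blast
  qed (use assms(2-4) in \<open>simp_all add: a_ac\<close>)
  then show ?thesis
    by (intro moduleI[OF assms(1)]) (use assms(2,5) in \<open>simp_all add: l_distr r_distr m_assoc\<close>)
qed

lemma mod_hom_finsum_fun:
  assumes N: "module R N" and f: "\<And>j. j \<in> S \<Longrightarrow> f j \<in> mod_hom R M N"
  shows "(\<lambda>x. \<Oplus>\<^bsub>N\<^esub>j\<in>S. f j x) \<in> mod_hom R M N"
proof -
  interpret N: module R N by fact
  note f' = mod_homD[OF f]
  have mem: "(\<lambda>j. f j x) \<in> S \<rightarrow> carrier N" if "x \<in> carrier M" for x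
    using f'(1) that by blast
  show ?thesis
  proof (cases "finite S")
    case fin: True
    show ?thesis
    proof (rule mod_homI)
      show "(\<Oplus>\<^bsub>N\<^esub>j\<in>S. f j x) \<in> carrier N" if "x \<in> carrier M" for x
        by (rule N.finsum_closed[OF mem[OF that]])
      show "(\<Oplus>\<^bsub>N\<^esub>j\<in>S. f j (x \<oplus>\<^bsub>M\<^esub> y)) = (\<Oplus>\<^bsub>N\<^esub>j\<in>S. f j x) \<oplus>\<^bsub>N\<^esub> (\<Oplus>\<^bsub>N\<^esub>j\<in>S. f j y)"
        if "x \<in> carrier M" "y \<in> carrier M" for x y
        unfolding N.finsum_addf[OF mem[OF that(1)] mem[OF that(2)], symmetric]
        by (rule N.finsum_cong'[OF refl]) (use that f'(1,2) in auto)
      show "(\<Oplus>\<^bsub>N\<^esub>j\<in>S. f j (a \<odot>\<^bsub>M\<^esub> x)) = a \<odot>\<^bsub>N\<^esub> (\<Oplus>\<^bsub>N\<^esub>j\<in>S. f j x)"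
        if "a \<in> carrier R" "x \<in> carrier M" for a x
        unfolding N.finsum_smult_ldistr[OF fin that(1) mem[OF that(2)]]
        by (rule N.finsum_cong'[OF refl]) (use that f'(1,3) in auto)
    qed
  next
    case False
    then show ?thesis using mod_hom_const_zero[OF N] by simp
  qed
qed

lemma fmod_mem:
  assumes "module R (fmod R U)"
  shows "(\<lambda>_. \<zero>\<^bsub>R\<^esub>) \<in> U" "x \<in> U \<Longrightarrow> y \<in> U \<Longrightarrow> (\<lambda>s. x s \<oplus>\<^bsub>R\<^esub> y s) \<in> U"
    "a \<in> carrier R \<Longrightarrow> x \<in> U \<Longrightarrow> (\<lambda>s. a \<otimes>\<^bsub>R\<^esub> x s) \<in> U"
proof -
  interpret U: module R "fmod R U" by fact
  show "(\<lambda>_. \<zero>\<^bsub>R\<^esub>) \<in> U" using U.M.zero_closed by simp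
  show "x \<in> U \<Longrightarrow> y \<in> U \<Longrightarrow> (\<lambda>s. x s \<oplus>\<^bsub>R\<^esub> y s) \<in> U" using U.M.a_closed[of x y] by simp
  show "a \<in> carrier R \<Longrightarrow> x \<in> U \<Longrightarrow> (\<lambda>s. a \<otimes>\<^bsub>R\<^esub> x s) \<in> U" using U.smult_closed[of a x] by simp
qed

lemma finite_bounded_multisets:
  assumes "finite A"
  shows "finite {b. set_mset b \<subseteq> A \<and> size b \<le> n}"
proof (rule finite_subset)
  show "{b. set_mset b \<subseteq> A \<and> size b \<le> n} \<subseteq> mset ` {xs. set xs \<subseteq> A \<and> length xs \<le> n}"
  proof
    fix b assume b: "b \<in> {b. set_mset b \<subseteq> A \<and> size b \<le> n}"
    obtain xs where "mset xs = b" using ex_mset by blast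
    then show "b \<in> mset ` {xs. set xs \<subseteq> A \<and> length xs \<le> n}" using b by force
  qed
  show "finite (mset ` {xs. set xs \<subseteq> A \<and> length xs \<le> n})"
    by (rule finite_imageI[OF finite_lists_length_le[OF assms]])
qed

text \<open>The module \<open>T i\<close> is \<open>\<Oplus>\<^sub>b F (i - 2|b|) y\<^sup>b\<close>, where \<open>y\<^sup>b\<close> runs over the divided power monomials
  in \<open>c\<close> variables of degree \<open>2\<close>, and \<open>shift b\<close> is the contraction \<open>y\<^sup>b\<^sup>' \<mapsto> y\<^sup>b\<^sup>' / y\<^sup>b\<close>. The maps
  \<open>D\<close> commute with the contractions, so they are determined by their components \<open>E\<close> at \<open>y\<^sup>0\<close>; the
  equation \<open>D \<circ> D = \<Sum>\<^sub>j f\<^sub>j shift {#j#}\<close> makes them a differential modulo \<open>(f\<^sub>1, \<dots>, f\<^sub>c)\<close>.\<close>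

locale regular_quotient = finite_resolution Q M r W F d e n
  for Q :: "('q, 'b) ring_scheme" and M :: "('q, 'm, 'c) module_scheme" and r W F d e n +
  fixes fs :: "'q list"
  assumes regular: "regular_sequence Q fs"
    and annihilated: "a \<in> genideal Q (set fs) \<Longrightarrow> x \<in> carrier M \<Longrightarrow> a \<odot>\<^bsub>M\<^esub> x = \<zero>\<^bsub>M\<^esub>"
begin

lemma cring_Q: "cring Q"
  using M by (simp add: module_def)

sublocale Q: cring Q
  by (rule cring_Q)

abbreviation c :: nat where "c \<equiv> length fs"

lemma fs_carrier: "j < c \<Longrightarrow> fs ! j \<in> carrier Q"
  using regular nth_mem[of j fs] unfolding regular_sequence_def by blast

lemma module_F: "module Q (fmod Q (F k))"
  by (rule dual_basisD(2)[OF basis])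

lemmas F_mem = fmod_mem[OF module_F]

lemma F_carrier: "x \<in> F k \<Longrightarrow> x s \<in> carrier Q"
  by (rule dual_basisD(3)[OF basis])

definition slice :: "(nat multiset \<times> nat \<Rightarrow> 'q) \<Rightarrow> nat multiset \<Rightarrow> nat \<Rightarrow> 'q" where
  "slice x b = (\<lambda>s. x (b, s))"

definition T :: "nat \<Rightarrow> (nat multiset \<times> nat \<Rightarrow> 'q) set" where
  "T i = {x. \<forall>b. if set_mset b \<subseteq> {..<c} \<and> 2 * size b \<le> i then slice x b \<in> F (i - 2 * size b)
    else slice x b = (\<lambda>_. \<zero>\<^bsub>Q\<^esub>)}"

definition Idx :: "nat \<Rightarrow> (nat multiset \<times> nat) set" where
  "Idx i = {(b, s). set_mset b \<subseteq> {..<c} \<and> 2 * size b \<le> i \<and> s < r (i - 2 * size b)}"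

definition WT :: "nat \<Rightarrow> nat multiset \<times> nat \<Rightarrow> nat multiset \<times> nat \<Rightarrow> 'q" where
  "WT i = (\<lambda>(b, s) (b', s'). if b' = b then W (i - 2 * size b) s s' else \<zero>\<^bsub>Q\<^esub>)"

definition shift :: "nat multiset \<Rightarrow> (nat multiset \<times> nat \<Rightarrow> 'q) \<Rightarrow> nat multiset \<times> nat \<Rightarrow> 'q" where
  "shift b x = (\<lambda>(b', s). x (b' + b, s))"

definition bottom :: "(nat \<Rightarrow> 'q) \<Rightarrow> nat multiset \<times> nat \<Rightarrow> 'q" where
  "bottom x = (\<lambda>(b, s). if b = {#} then x s else \<zero>\<^bsub>Q\<^esub>)"

text \<open>The coefficient of \<open>D x\<close> at \<open>y^b\<close> is the component at
  \<open>y^0\<close> of \<open>shift b (D x) = D (shift b x)\<close>; commuting with contractions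
  therefore leaves no other choice than to apply \<open>E\<close> to
  \<open>shift b x\<close>.\<close>

definition assemble ::
  "(nat \<Rightarrow> (nat multiset \<times> nat \<Rightarrow> 'q) \<Rightarrow> nat \<Rightarrow> 'q) \<Rightarrow> nat \<Rightarrow> (nat multiset \<times> nat \<Rightarrow> 'q) \<Rightarrow> nat multiset \<times> nat \<Rightarrow> 'q" where
  "assemble E i x = (\<lambda>(b, s). E (i - 2 * size b) (shift b x) s)"

definition curvature :: "(nat multiset \<times> nat \<Rightarrow> 'q) \<Rightarrow> nat multiset \<times> nat \<Rightarrow> 'q" where
  "curvature x = (\<lambda>y. \<Oplus>\<^bsub>Q\<^esub>j\<in>{..<c}. fs ! j \<otimes>\<^bsub>Q\<^esub> shift {#j#} x y)"

lemma T_I: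
  assumes "\<And>b. set_mset b \<subseteq> {..<c} \<Longrightarrow> 2 * size b \<le> i \<Longrightarrow> slice x b \<in> F (i - 2 * size b)"
    and "\<And>b. \<not> (set_mset b \<subseteq> {..<c} \<and> 2 * size b \<le> i) \<Longrightarrow> slice x b = (\<lambda>_. \<zero>\<^bsub>Q\<^esub>)"
  shows "x \<in> T i"
  using assms unfolding T_def by auto

lemma T_slice: "x \<in> T i \<Longrightarrow> set_mset b \<subseteq> {..<c} \<Longrightarrow> 2 * size b \<le> i \<Longrightarrow> slice x b \<in> F (i - 2 * size b)"
  unfolding T_def by (auto dest!: spec[of _ b])

lemma T_zero: "x \<in> T i \<Longrightarrow> \<not> (set_mset b \<subseteq> {..<c} \<and> 2 * size b \<le> i) \<Longrightarrow> x (b, s) = \<zero>\<^bsub>Q\<^esub>"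
  unfolding T_def slice_def by (auto dest!: spec[of _ b] dest: fun_cong split: if_splits)

text \<open>Outside the range of exponents the slice is zero, which lies in every
  \<open>F k\<close>; so truncated subtraction in the degree is harmless, and later arguments can
  avoid the case distinction.\<close>

lemma T_slice': "x \<in> T i \<Longrightarrow> slice x b \<in> F (i - 2 * size b)"
  using T_slice[of x i b] T_zero[of x i b] F_mem(1)[of "i - 2 * size b"]
  by (cases "set_mset b \<subseteq> {..<c} \<and> 2 * size b \<le> i") (auto simp: slice_def)

lemma T_carrier: "x \<in> T i \<Longrightarrow> x y \<in> carrier Q"
  using F_carrier[OF T_slice'[of x i "fst y"], of "snd y"] by (simp add: slice_def)

lemma module_T: "module Q (fmod Q (T i))"
proof (rule module_fmodI[OF cring_Q])
  show "x y \<in> carrier Q" if "x \<in> T i" for x y by (rule T_carrier[OF that])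
  show "(\<lambda>_. \<zero>\<^bsub>Q\<^esub>) \<in> T i"
    by (rule T_I) (simp_all add: slice_def F_mem)
  show "(\<lambda>s. x s \<oplus>\<^bsub>Q\<^esub> y s) \<in> T i" if "x \<in> T i" "y \<in> T i" for x y
    by (rule T_I)
      (use that F_mem(2)[OF T_slice[OF that(1)] T_slice[OF that(2)]] in \<open>simp_all add: slice_def T_zero\<close>)
  show "(\<lambda>s. a \<otimes>\<^bsub>Q\<^esub> x s) \<in> T i" if "a \<in> carrier Q" "x \<in> T i" for a x
    by (rule T_I)
      (use that F_mem(3)[OF that(1) T_slice[OF that(2)]] in \<open>simp_all add: slice_def T_zero\<close>)
qed

lemmas T_mem = fmod_mem[OF module_T]

lemma finite_Idx: "finite (Idx i)"
proof (rule finite_subset)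
  show "Idx i \<subseteq> (SIGMA b:{b. set_mset b \<subseteq> {..<c} \<and> size b \<le> i}. {..<r (i - 2 * size b)})"
    unfolding Idx_def by auto
  show "finite (SIGMA b:{b. set_mset b \<subseteq> {..<c} \<and> size b \<le> i}. {..<r (i - 2 * size b)})"
    by (rule finite_SigmaI[OF finite_bounded_multisets]) auto
qed

lemma WT_T: "y \<in> Idx i \<Longrightarrow> WT i y \<in> T i"
proof (cases y)
  case (Pair b s)
  assume "y \<in> Idx i"
  then have b: "set_mset b \<subseteq> {..<c}" "2 * size b \<le> i" "s < r (i - 2 * size b)"
    using Pair by (auto simp: Idx_def)
  have w: "W (i - 2 * size b) s \<in> F (i - 2 * size b)" by (rule dual_basisD(4)[OF basis]) (use b in simp)
  have "slice (WT i y) b' = (if b' = b then W (i - 2 * size b) s else (\<lambda>_. \<zero>\<^bsub>Q\<^esub>))" for b'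
    by (auto simp: slice_def WT_def Pair)
  then show ?thesis using b w F_mem(1) by (intro T_I) auto
qed

text \<open>\<open>T i\<close> is a finite direct sum of the modules \<open>F (i - 2|b|)\<close>, so
  their dual bases together form one. The pairs \<open>(b, s)\<close> label both the coordinates and
  the basis vectors.\<close>

lemma basis_T: "dual_basis Q (Idx i) (WT i) (T i)"
proof -
  have "x y = (\<Oplus>\<^bsub>Q\<^esub>z\<in>Idx i. x z \<otimes>\<^bsub>Q\<^esub> WT i z y)" if x: "x \<in> T i" for x y
  proof (cases y)
    case (Pair b s)
    have mem: "(\<lambda>z. x z \<otimes>\<^bsub>Q\<^esub> WT i z y) \<in> Idx i \<rightarrow> carrier Q"
      using T_carrier[OF x] T_carrier[OF WT_T] by auto
    show ?thesis
    proof (cases "set_mset b \<subseteq> {..<c} \<and> 2 * size b \<le> i")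
      case True
      have sub: "Pair b ` {..<r (i - 2 * size b)} \<subseteq> Idx i" using True by (auto simp: Idx_def)
      have "x y = (\<Oplus>\<^bsub>Q\<^esub>s'\<in>{..<r (i - 2 * size b)}. x (b, s') \<otimes>\<^bsub>Q\<^esub> W (i - 2 * size b) s' s)"
        using dual_basisD(5)[OF basis T_slice[OF x, of b], of s] True Pair by (simp add: slice_def)
      also have "\<dots> = (\<Oplus>\<^bsub>Q\<^esub>s'\<in>{..<r (i - 2 * size b)}. x (b, s') \<otimes>\<^bsub>Q\<^esub> WT i (b, s') y)"
      proof (rule Q.finsum_cong'[OF refl])
        show "(\<lambda>s'. x (b, s') \<otimes>\<^bsub>Q\<^esub> WT i (b, s') y) \<in> {..<r (i - 2 * size b)} \<rightarrow> carrier Q"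
          using mem sub by auto
      qed (simp add: WT_def Pair)
      also have "\<dots> = (\<Oplus>\<^bsub>Q\<^esub>z\<in>Pair b ` {..<r (i - 2 * size b)}. x z \<otimes>\<^bsub>Q\<^esub> WT i z y)"
        by (rule Q.finsum_reindex[symmetric]) (use mem sub in \<open>auto simp: inj_on_def\<close>)
      also have "\<dots> = (\<Oplus>\<^bsub>Q\<^esub>z\<in>Idx i. x z \<otimes>\<^bsub>Q\<^esub> WT i z y)"
      proof (rule Q.add.finprod_mono_neutral_cong_left[OF finite_Idx sub _ refl])
        show "x z \<otimes>\<^bsub>Q\<^esub> WT i z y = \<zero>\<^bsub>Q\<^esub>" if "z \<in> Idx i - Pair b ` {..<r (i - 2 * size b)}" for z
        proof -
          have "b \<noteq> fst z" using that by (cases z) (auto simp: Idx_def)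
          then have "WT i z y = \<zero>\<^bsub>Q\<^esub>" by (cases z) (simp add: WT_def Pair)
          then show ?thesis using T_carrier[OF x] by simp
        qed
      qed (use mem in auto)
      finally show ?thesis .
    next
      case False
      have "(\<Oplus>\<^bsub>Q\<^esub>z\<in>Idx i. x z \<otimes>\<^bsub>Q\<^esub> WT i z y) = (\<Oplus>\<^bsub>Q\<^esub>z\<in>Idx i. \<zero>\<^bsub>Q\<^esub>)"
      proof (rule Q.finsum_cong'[OF refl])
        show "x z \<otimes>\<^bsub>Q\<^esub> WT i z y = \<zero>\<^bsub>Q\<^esub>" if "z \<in> Idx i" for z
          using that False T_carrier[OF x, of z] by (cases z) (auto simp: WT_def Pair Idx_def)
      qed simp
      then show ?thesis using T_zero[OF x False, of s] Pair by simp
    qed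
  qed
  then show ?thesis
    unfolding dual_basis_def using finite_Idx module_T T_carrier WT_T by blast
qed

lemma shift_empty [simp]: "shift {#} x = x"
  by (auto simp: shift_def)

lemma shift_shift: "shift b (shift b' x) = shift (b + b') x"
  by (auto simp: shift_def ac_simps)

lemma slice_shift: "slice (shift b x) b' = slice x (b' + b)"
  by (simp add: slice_def shift_def)

lemma shift_T: "x \<in> T i \<Longrightarrow> shift b x \<in> T (i - 2 * size b)"
proof (rule T_I)
  fix b' assume x: "x \<in> T i"
  have *: "i - 2 * size b - 2 * size b' = i - 2 * size (b' + b)" by simp
  show "slice (shift b x) b' \<in> F (i - 2 * size b - 2 * size b')"
    unfolding slice_shift * by (rule T_slice'[OF x])
  assume "\<not> (set_mset b' \<subseteq> {..<c} \<and> 2 * size b' \<le> i - 2 * size b)"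
  then have "b' \<noteq> {#}" "\<not> (set_mset (b' + b) \<subseteq> {..<c} \<and> 2 * size (b' + b) \<le> i)"
    by auto
  then show "slice (shift b x) b' = (\<lambda>_. \<zero>\<^bsub>Q\<^esub>)"
    unfolding slice_shift unfolding slice_def using T_zero[OF x, of "b' + b"] by blast
qed

lemma shift_T_zero: "x \<in> T i \<Longrightarrow> \<not> (set_mset b \<subseteq> {..<c} \<and> 2 * size b \<le> i) \<Longrightarrow> shift b x = (\<lambda>_. \<zero>\<^bsub>Q\<^esub>)"
proof
  fix y :: "nat multiset \<times> nat"
  assume x: "x \<in> T i" and b: "\<not> (set_mset b \<subseteq> {..<c} \<and> 2 * size b \<le> i)"
  then have "\<not> (set_mset (fst y + b) \<subseteq> {..<c} \<and> 2 * size (fst y + b) \<le> i)" by auto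
  then show "shift b x y = \<zero>\<^bsub>Q\<^esub>"
    unfolding shift_def using T_zero[OF x, of "fst y + b" "snd y"] by (simp add: case_prod_beta)
qed

lemma shift_hom: "shift b \<in> mod_hom Q (fmod Q (T i)) (fmod Q (T (i - 2 * size b)))"
  by (rule mod_homI) (simp_all add: shift_T, auto simp: shift_def)

lemma slice_hom: "(\<lambda>x. slice x b) \<in> mod_hom Q (fmod Q (T i)) (fmod Q (F (i - 2 * size b)))"
  by (rule mod_homI) (simp_all add: T_slice', auto simp: slice_def)

lemma slice_bottom: "slice (bottom x) b = (if b = {#} then x else (\<lambda>_. \<zero>\<^bsub>Q\<^esub>))"
  by (auto simp: slice_def bottom_def)

lemma bottom_hom: "bottom \<in> mod_hom Q (fmod Q (F i)) (fmod Q (T i))"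
proof (rule mod_homI; unfold fmod_simps)
  show "bottom x \<in> T i" if "x \<in> F i" for x
    by (rule T_I) (use that F_mem(1) in \<open>auto simp: slice_bottom\<close>)
qed (auto simp: bottom_def)

lemma bottom_slice:
  assumes "x \<in> T i" "i < 2"
  shows "x = bottom (slice x {#})"
proof
  fix y
  show "x y = bottom (slice x {#}) y"
    using assms T_zero[OF assms(1), of "fst y" "snd y"]
    by (cases y) (auto simp: bottom_def slice_def dest: nonempty_has_size[THEN iffD1])
qed

lemma shift_bottom: "b \<noteq> {#} \<Longrightarrow> shift b (bottom x) = (\<lambda>_. \<zero>\<^bsub>Q\<^esub>)"
  by (auto simp: shift_def bottom_def)

text \<open>Rewrites the pointwise sum as a sum in the module \<open>T (i - 2)\<close>, to which
  linear maps can be applied.\<close>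

lemma curvature_eq_finsum:
  assumes "x \<in> T i"
  shows "curvature x = (\<Oplus>\<^bsub>fmod Q (T (i - 2))\<^esub>j\<in>{..<c}. fs ! j \<odot>\<^bsub>fmod Q (T (i - 2))\<^esub> shift {#j#} x)"
proof
  fix y
  have mem: "(\<lambda>j. fs ! j \<odot>\<^bsub>fmod Q (T (i - 2))\<^esub> shift {#j#} x) \<in> {..<c} \<rightarrow> T (i - 2)"
    using T_mem(3)[OF fs_carrier shift_T[OF assms, of "{#_#}"]] by auto
  have "\<forall>x\<in>T (i - 2). \<forall>y. x y \<in> carrier Q" using T_carrier by blast
  from fmod_finsum[OF module_T this mem, of y]
  show "curvature x y = (\<Oplus>\<^bsub>fmod Q (T (i - 2))\<^esub>j\<in>{..<c}. fs ! j \<odot>\<^bsub>fmod Q (T (i - 2))\<^esub> shift {#j#} x) y"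
    by (simp add: curvature_def)
qed

lemma curvature_hom: "curvature \<in> mod_hom Q (fmod Q (T i)) (fmod Q (T (i - 2)))"
proof -
  have "(\<lambda>x. \<Oplus>\<^bsub>fmod Q (T (i - 2))\<^esub>j\<in>{..<c}. fs ! j \<odot>\<^bsub>fmod Q (T (i - 2))\<^esub> shift {#j#} x)
      \<in> mod_hom Q (fmod Q (T i)) (fmod Q (T (i - 2)))"
    using shift_hom[of "{#_#}" i]
    by (intro mod_hom_finsum_fun[OF module_T] mod_hom_smult[OF module_T]) (simp_all add: fs_carrier)
  then show ?thesis
    by (subst mod_hom_cong[OF module_T]) (simp_all add: curvature_eq_finsum)
qed

lemma slice_curvature_zero: "x \<in> T i \<Longrightarrow> i < 2 \<Longrightarrow> curvature x = (\<lambda>_. \<zero>\<^bsub>Q\<^esub>)"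
proof
  fix y assume x: "x \<in> T i" "i < 2"
  have "curvature x y = (\<Oplus>\<^bsub>Q\<^esub>j\<in>{..<c}. \<zero>\<^bsub>Q\<^esub>)"
    unfolding curvature_def
    by (rule Q.finsum_cong'[OF refl]) (use shift_T_zero[OF x(1), of "{#_#}"] x(2) fs_carrier in auto)
  then show "curvature x y = \<zero>\<^bsub>Q\<^esub>" by simp
qed

lemma shift_curvature: "shift b (curvature x) = curvature (shift b x)"
  by (auto simp: curvature_def shift_def ac_simps)

end

section \<open>Recursive construction of the maps D with prescribed square\<close>

context regular_quotient
begin

lemma fs_subset: "set fs \<subseteq> carrier Q"
  using regular by (simp add: regular_sequence_def)

text \<open>The third clause is the component at \<open>y^0\<close> of the equation for
  \<open>D \<circ> D\<close> in degree \<open>i\<close>. It involves \<open>E\<close> in degrees up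
  to \<open>i\<close> only, which permits recursion on \<open>i\<close>.\<close>

definition good :: "(nat \<Rightarrow> (nat multiset \<times> nat \<Rightarrow> 'q) \<Rightarrow> nat \<Rightarrow> 'q) \<Rightarrow> nat \<Rightarrow> bool" where
  "good E i \<longleftrightarrow> E i \<in> mod_hom Q (fmod Q (T i)) (fmod Q (F (i - 1))) \<and>
     (\<forall>x\<in>F i. E i (bottom x) = d i x) \<and>
     (\<forall>x\<in>T i. E (i - 1) (assemble E i x) = slice (curvature x) {#})"

lemma goodD:
  assumes "good E i"
  shows "E i \<in> mod_hom Q (fmod Q (T i)) (fmod Q (F (i - 1)))"
    "x \<in> F i \<Longrightarrow> E i (bottom x) = d i x"
    "y \<in> T i \<Longrightarrow> E (i - 1) (assemble E i y) = slice (curvature y) {#}"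
  using assms unfolding good_def by auto

lemma good_zero:
  assumes "good E 0" "x \<in> T 0"
  shows "E 0 x = (\<lambda>_. \<zero>\<^bsub>Q\<^esub>)"
proof -
  have "x = bottom (slice x {#})" by (rule bottom_slice[OF assms(2)]) simp
  moreover have "slice x {#} \<in> F 0" using T_slice'[OF assms(2), of "{#}"] by simp
  ultimately show ?thesis using goodD(2)[OF assms(1)] d_0 by metis
qed

lemma good_cong:
  assumes "\<And>k. k \<le> i \<Longrightarrow> E k = E' k"
  shows "good E i \<longleftrightarrow> good E' i"
proof -
  have "assemble E i = assemble E' i"
    unfolding assemble_def using assms by (intro ext) (simp split: prod.splits)
  then show ?thesis unfolding good_def using assms[of i] assms[of "i - 1"] by simp
qed

lemma shift_T_le:
  assumes "x \<in> T i" "i \<le> 2 * size b"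
  shows "shift b x \<in> T 0"
  using shift_T[OF assms(1), of b] assms(2) by simp

text \<open>The component of \<open>D x\<close> at \<open>y^b\<close> sits in degree
  \<open>i - 1 - 2|b|\<close>. In the boundary case \<open>2|b| = i\<close> there is no such degree,
  and the component vanishes because it is \<open>E 0\<close> applied to an element of
  \<open>T 0\<close>. This is what puts \<open>lower E i x\<close> into
  \<open>T (i - 1)\<close>.\<close>

lemma component_zero:
  assumes good: "\<And>k. k < i \<Longrightarrow> good E k" and b: "b \<noteq> {#}" and x: "x \<in> T i" and i: "i > 0"
    and out: "\<not> (set_mset b \<subseteq> {..<c} \<and> 2 * size b \<le> i - 1)"
  shows "E (i - 2 * size b) (shift b x) = (\<lambda>_. \<zero>\<^bsub>Q\<^esub>)"
proof -
  have lt: "i - 2 * size b < i" using b i by (simp add: nonempty_has_size)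
  show ?thesis
  proof (cases "set_mset b \<subseteq> {..<c} \<and> 2 * size b \<le> i")
    case False
    then have "shift b x = \<zero>\<^bsub>fmod Q (T (i - 2 * size b))\<^esub>" using shift_T_zero[OF x] by simp
    then show ?thesis
      using mod_hom_zero[OF module_T module_F goodD(1)[OF good[OF lt]]] by simp
  next
    case True
    then have "i - 2 * size b = 0" using out by simp
    then show ?thesis using good_zero[OF good[OF i] shift_T_le[OF x]] by simp
  qed
qed

text \<open>The part of \<open>assemble E i x\<close> away from \<open>y^0\<close>. For positive
  \<open>i\<close> it reads \<open>E\<close> in degrees below \<open>i\<close> only, so it is
  available before \<open>E i\<close> is chosen.\<close>

definition lower :: "(nat \<Rightarrow> (nat multiset \<times> nat \<Rightarrow> 'q) \<Rightarrow> nat \<Rightarrow> 'q) \<Rightarrow> nat \<Rightarrow> (nat multiset \<times> nat \<Rightarrow> 'q) \<Rightarrow>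
    nat multiset \<times> nat \<Rightarrow> 'q" where
  "lower E i x = (\<lambda>(b, s). if b = {#} then \<zero>\<^bsub>Q\<^esub> else E (i - 2 * size b) (shift b x) s)"

lemma slice_lower: "slice (lower E i x) b = (if b = {#} then (\<lambda>_. \<zero>\<^bsub>Q\<^esub>) else E (i - 2 * size b) (shift b x))"
  by (auto simp: slice_def lower_def)

lemma lower_hom:
  assumes good: "\<And>k. k < i \<Longrightarrow> good E k" and i: "i > 0"
  shows "lower E i \<in> mod_hom Q (fmod Q (T i)) (fmod Q (T (i - 1)))"
proof (rule mod_homI; unfold fmod_simps)
  have hom: "E (i - 2 * size b) \<in> mod_hom Q (fmod Q (T (i - 2 * size b))) (fmod Q (F (i - 2 * size b - 1)))"
    if "b \<noteq> {#}" for b :: "nat multiset"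
    by (rule goodD(1)[OF good]) (use that i in \<open>simp add: nonempty_has_size\<close>)
  show "lower E i x \<in> T (i - 1)" if x: "x \<in> T i" for x
  proof (rule T_I)
    fix b
    assume "\<not> (set_mset b \<subseteq> {..<c} \<and> 2 * size b \<le> i - 1)"
    then show "slice (lower E i x) b = (\<lambda>_. \<zero>\<^bsub>Q\<^esub>)"
      unfolding slice_lower using component_zero[OF good _ x i, of b] by simp
  next
    fix b :: "nat multiset"
    have "E (i - 2 * size b) (shift b x) \<in> F (i - 2 * size b - 1)" if "b \<noteq> {#}"
      using mod_homD(1)[OF hom[OF that]] shift_T[OF x, of b] by simp
    then show "slice (lower E i x) b \<in> F (i - 1 - 2 * size b)"
      unfolding slice_lower using F_mem(1) by (simp add: diff_commute)
  qed
  show "lower E i (\<lambda>s. x s \<oplus>\<^bsub>Q\<^esub> y s) = (\<lambda>s. lower E i x s \<oplus>\<^bsub>Q\<^esub> lower E i y s)"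
    if x: "x \<in> T i" and y: "y \<in> T i" for x y
  proof
    fix z :: "nat multiset \<times> nat"
    show "lower E i (\<lambda>s. x s \<oplus>\<^bsub>Q\<^esub> y s) z = lower E i x z \<oplus>\<^bsub>Q\<^esub> lower E i y z"
    proof (cases "fst z = {#}")
      case False
      let ?b = "fst z"
      have "shift ?b (\<lambda>s. x s \<oplus>\<^bsub>Q\<^esub> y s) = (\<lambda>s. shift ?b x s \<oplus>\<^bsub>Q\<^esub> shift ?b y s)"
        by (auto simp: shift_def)
      then show ?thesis
        using mod_homD(2)[OF hom[OF False], of "shift ?b x" "shift ?b y"] shift_T[OF x, of ?b] shift_T[OF y, of ?b] False
        by (cases z) (simp add: lower_def)
    qed (cases z, simp add: lower_def)
  qed
  show "lower E i (\<lambda>s. a \<otimes>\<^bsub>Q\<^esub> x s) = (\<lambda>s. a \<otimes>\<^bsub>Q\<^esub> lower E i x s)"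
    if a: "a \<in> carrier Q" and x: "x \<in> T i" for a x
  proof
    fix z :: "nat multiset \<times> nat"
    show "lower E i (\<lambda>s. a \<otimes>\<^bsub>Q\<^esub> x s) z = a \<otimes>\<^bsub>Q\<^esub> lower E i x z"
    proof (cases "fst z = {#}")
      case False
      let ?b = "fst z"
      have "shift ?b (\<lambda>s. a \<otimes>\<^bsub>Q\<^esub> x s) = (\<lambda>s. a \<otimes>\<^bsub>Q\<^esub> shift ?b x s)"
        by (auto simp: shift_def)
      then show ?thesis
        using mod_homD(3)[OF hom[OF False] a, of "shift ?b x"] shift_T[OF x, of ?b] False
        by (cases z) (simp add: lower_def)
    qed (use a in \<open>cases z, simp add: lower_def\<close>)
  qed
qed

lemma shift_apply: "shift b x (b', s) = x (b' + b, s)"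
  by (simp add: shift_def)

text \<open>This holds for any \<open>E\<close>, because contractions compose by adding
  exponents.\<close>

lemma shift_assemble: "shift b (assemble E i x) = assemble E (i - 2 * size b) (shift b x)"
  unfolding assemble_def shift_shift unfolding shift_def[of b "\<lambda>(b', s). _ b' s"]
  by (auto simp: shift_def ac_simps)

lemma assemble_eq_lower:
  assumes "E i x \<in> F k" "lower E i x \<in> T k'"
  shows "assemble E i x = (\<lambda>z. bottom (E i x) z \<oplus>\<^bsub>Q\<^esub> lower E i x z)"
proof
  fix z :: "nat multiset \<times> nat"
  show "assemble E i x z = bottom (E i x) z \<oplus>\<^bsub>Q\<^esub> lower E i x z"
    using F_carrier[OF assms(1)] T_carrier[OF assms(2), of z]
    by (cases z) (auto simp: assemble_def lower_def bottom_def)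
qed

lemma assemble_T:
  assumes "\<And>k. k \<le> i \<Longrightarrow> good E k" "x \<in> T i"
  shows "assemble E i x \<in> T (i - 1)"
proof (cases "i = 0")
  case True
  have "assemble E i x (b, s) = \<zero>\<^bsub>Q\<^esub>" for b s
    using good_zero[OF assms(1), of "shift b x"] shift_T_le[of x 0 b] assms(2) True by (simp add: assemble_def)
  then have "assemble E i x = (\<lambda>_. \<zero>\<^bsub>Q\<^esub>)" by auto
  then show ?thesis using T_mem(1) by simp
next
  case False
  have E: "E i x \<in> F (i - 1)" using mod_homD(1)[OF goodD(1)[OF assms(1)], of i x] assms(2) by simp
  have L: "lower E i x \<in> T (i - 1)"
    using mod_homD(1)[OF lower_hom[of i E], of x] assms False by simp
  have "bottom (E i x) \<in> T (i - 1)" using mod_homD(1)[OF bottom_hom, of "E i x" "i - 1"] E by simp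
  then show ?thesis
    unfolding assemble_eq_lower[OF E L] using T_mem(2)[OF _ L] by simp
qed

text \<open>The condition on \<open>E i\<close> reads \<open>d (E i x) = g x\<close> for a map \<open>g\<close> that depends on the components of
  lower degree only and has its values in the cycles of \<open>F\<close>, which are boundaries.\<close>

lemma good_extend:
  assumes good: "\<And>k. k < i \<Longrightarrow> good E k"
  shows "\<exists>h. good (E(i := h)) i"
proof (cases "i = 0")
  case True
  have "good (E(0 := (\<lambda>_ _. \<zero>\<^bsub>Q\<^esub>))) 0"
    unfolding good_def
    using mod_hom_const_zero[OF module_F[of 0], where M = "fmod Q (T 0)"] d_0 slice_curvature_zero[of _ 0]
    by (simp add: slice_def)
  then show ?thesis unfolding True by blast
next
  case False
  then have i: "i > 0" by simp
  note lh = lower_hom[OF good i]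
  have lT: "lower E i x \<in> T (i - 1)" if "x \<in> T i" for x using mod_homD(1)[OF lh] that by simp
  have Eh: "E (i - 1) \<in> mod_hom Q (fmod Q (T (i - 1))) (fmod Q (F (i - 2)))"
    using goodD(1)[OF good[of "i - 1"]] i by (simp add: numeral_2_eq_2)
  define w where "w x = slice (curvature x) {#}" for x
  have w: "w \<in> mod_hom Q (fmod Q (T i)) (fmod Q (F (i - 2)))"
    using mod_hom_comp[OF curvature_hom[of i] slice_hom[of "{#}" "i - 2"]] by (simp add: w_def[abs_def])
  \<comment> \<open>As \<open>E (i - 1)\<close> is \<open>d\<close> on \<open>y^0\<close>, the
    condition in degree \<open>i\<close> becomes
    \<open>d (E i x) + E (i - 1) (lower E i x) = w x\<close>; so \<open>g x\<close> is the value
    required of \<open>d (E i x)\<close>.\<close>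
  define g where "g x = w x \<ominus>\<^bsub>fmod Q (F (i - 2))\<^esub> E (i - 1) (lower E i x)" for x
  have g: "g \<in> mod_hom Q (fmod Q (T i)) (fmod Q (F (i - 2)))"
    unfolding g_def by (rule mod_hom_diff[OF module_F w mod_hom_comp[OF lh Eh]])
  have gF: "g x \<in> F (i - 2)" if "x \<in> T i" for x using mod_homD(1)[OF g] that by simp
  have ElF: "E (i - 1) (lower E i x) \<in> F (i - 2)" if "x \<in> T i" for x
    using mod_homD(1)[OF Eh] lT[OF that] by simp
  have wF: "w x \<in> F (i - 2)" if "x \<in> T i" for x using mod_homD(1)[OF w] that by simp
  have w_eq: "w x = g x \<oplus>\<^bsub>fmod Q (F (i - 2))\<^esub> E (i - 1) (lower E i x)" if x: "x \<in> T i" for x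
  proof -
    interpret F: module Q "fmod Q (F (i - 2))" by (rule module_F)
    have "w x \<in> carrier (fmod Q (F (i - 2)))" "E (i - 1) (lower E i x) \<in> carrier (fmod Q (F (i - 2)))"
      using wF[OF x] ElF[OF x] by simp_all
    then show ?thesis unfolding g_def a_minus_def by (simp only: F.M.a_assoc F.M.l_neg F.M.r_zero F.M.a_inv_closed)
  qed
  have im: "g x \<in> d (i - 1) ` F (i - 1)" if x: "x \<in> T i" for x
  proof (cases "i = 1")
    case True
    have "lower E i x = (\<lambda>_. \<zero>\<^bsub>Q\<^esub>)"
    proof
      fix z :: "nat multiset \<times> nat" show "lower E i x z = \<zero>\<^bsub>Q\<^esub>"
      proof (cases "fst z = {#}")
        case True then show ?thesis by (cases z) (simp add: lower_def)
      next
        case F: False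
        then have "\<not> 2 * size (fst z) \<le> i - 1" using True by (simp add: nonempty_has_size)
        then show ?thesis using component_zero[OF good F x i] F by (cases z) (simp add: lower_def)
      qed
    qed
    then have "E (i - 1) (lower E i x) = (\<lambda>_. \<zero>\<^bsub>Q\<^esub>)"
      using mod_hom_zero[OF module_T module_F Eh] by simp
    moreover have "w x = (\<lambda>_. \<zero>\<^bsub>Q\<^esub>)" unfolding w_def using slice_curvature_zero[OF x] True by (simp add: slice_def)
    moreover have "(\<lambda>_. \<zero>\<^bsub>Q\<^esub>) \<ominus>\<^bsub>fmod Q (F (i - 2))\<^esub> (\<lambda>_. \<zero>\<^bsub>Q\<^esub>) = (\<lambda>_. \<zero>\<^bsub>Q\<^esub>)"
    proof
      fix y
      have "\<forall>x\<in>F (i - 2). \<forall>y. x y \<in> carrier Q" using F_carrier by blast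
      from fmod_minus[OF module_F this F_mem(1) F_mem(1), of y]
      show "((\<lambda>_. \<zero>\<^bsub>Q\<^esub>) \<ominus>\<^bsub>fmod Q (F (i - 2))\<^esub> (\<lambda>_. \<zero>\<^bsub>Q\<^esub>)) y = \<zero>\<^bsub>Q\<^esub>"
        by (simp add: a_minus_def)
    qed
    ultimately have "g x = (\<lambda>_. \<zero>\<^bsub>Q\<^esub>)" unfolding g_def by simp
    moreover have "d (i - 1) (\<lambda>_. \<zero>\<^bsub>Q\<^esub>) = (\<lambda>_. \<zero>\<^bsub>Q\<^esub>)" using True d_0 by simp
    ultimately show ?thesis using F_mem(1)[of "i - 1"] by (metis image_eqI)
  next
    case False
    then have i2: "i \<ge> 2" using i by simp
    let ?y = "lower E i x"
    have y: "?y \<in> T (i - 1)" by (rule lT[OF x])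
    have g1: "good E (i - 1)" and g2: "good E (i - 2)" using good i i2 by simp_all
    have Eh2: "E (i - 2) \<in> mod_hom Q (fmod Q (T (i - 2))) (fmod Q (F (i - 2 - 1)))" by (rule goodD(1)[OF g2])
    have ay: "assemble E (i - 1) ?y \<in> T (i - 2)"
      using assemble_T[of "i - 1" E ?y] good y i by (simp add: numeral_2_eq_2)
    have bg: "bottom (g x) \<in> T (i - 2)" using mod_homD(1)[OF bottom_hom[of "i - 2"]] gF[OF x] by simp
    \<comment> \<open>At \<open>y^0\<close> this is the definition of \<open>g\<close>; at any other
      \<open>y^b\<close> it is the equation already established in the smaller degree
      \<open>i - 2|b|\<close>, applied to \<open>shift b x\<close>.\<close>
    have "curvature x = bottom (g x) \<oplus>\<^bsub>fmod Q (T (i - 2))\<^esub> assemble E (i - 1) ?y"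
    proof
      fix z :: "nat multiset \<times> nat"
      obtain b s where z: "z = (b, s)" by (cases z)
      show "curvature x z = (bottom (g x) \<oplus>\<^bsub>fmod Q (T (i - 2))\<^esub> assemble E (i - 1) ?y) z"
      proof (cases "b = {#}")
        case True
        have "curvature x z = w x s" by (simp add: w_def slice_def z True)
        then show ?thesis using w_eq[OF x] by (simp add: z True bottom_def assemble_def)
      next
        case b: False
        let ?k = "i - 2 * size b"
        have k: "?k < i" using b i by (simp add: nonempty_has_size)
        have "shift b ?y = assemble E ?k (shift b x)"
        proof
          fix y
          show "shift b ?y y = assemble E ?k (shift b x) y"
            using b by (cases y) (simp add: shift_apply lower_def assemble_def shift_shift ac_simps)
        qed
        then have "assemble E (i - 1) ?y (b, s) = E (?k - 1) (assemble E ?k (shift b x)) s"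
          by (simp add: assemble_def diff_commute)
        also have "\<dots> = slice (curvature (shift b x)) {#} s"
          using goodD(3)[OF good[OF k] shift_T[OF x]] by simp
        also have "\<dots> = curvature x (b, s)"
          unfolding shift_curvature[symmetric] by (simp add: slice_def shift_def)
        finally show ?thesis using T_carrier[OF ay, of z] b
          by (simp add: z bottom_def)
      qed
    qed
    then have "E (i - 2) (curvature x) = E (i - 2) (bottom (g x)) \<oplus>\<^bsub>fmod Q (F (i - 2 - 1))\<^esub> E (i - 2) (assemble E (i - 1) ?y)"
      using mod_homD(2)[OF Eh2, of "bottom (g x)" "assemble E (i - 1) ?y"] bg ay by simp
    also have "E (i - 2) (bottom (g x)) = d (i - 2) (g x)" by (rule goodD(2)[OF g2 gF[OF x]])
    also have "E (i - 2) (assemble E (i - 1) ?y) = slice (curvature ?y) {#}"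
      using goodD(3)[OF g1 y] by (simp add: numeral_2_eq_2)
    finally have eq: "E (i - 2) (curvature x) = d (i - 2) (g x) \<oplus>\<^bsub>fmod Q (F (i - 2 - 1))\<^esub> slice (curvature ?y) {#}" .
    have mem: "(\<lambda>j. fs ! j \<odot>\<^bsub>fmod Q (T (i - 2))\<^esub> shift {#j#} x) \<in> {..<c} \<rightarrow> carrier (fmod Q (T (i - 2)))"
      using T_mem(3)[OF fs_carrier shift_T[OF x, of "{#_#}"]] by auto
    have sx: "shift {#j#} x \<in> T (i - 2)" for j using shift_T[OF x, of "{#j#}"] by simp
    have "E (i - 2) (curvature x) =
        (\<Oplus>\<^bsub>fmod Q (F (i - 2 - 1))\<^esub>j\<in>{..<c}. E (i - 2) (fs ! j \<odot>\<^bsub>fmod Q (T (i - 2))\<^esub> shift {#j#} x))"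
      unfolding curvature_eq_finsum[OF x] by (rule mod_hom_finsum[OF module_T module_F Eh2 mem])
    \<comment> \<open>The coefficient of \<open>?y\<close> at the variable \<open>j\<close> is
      \<open>E (i - 2) (shift {#j#} x)\<close>, so by linearity \<open>E (i - 2)\<close> carries the
      curvature of \<open>x\<close> to the bottom component of the curvature of \<open>?y\<close>.
      Comparison with \<open>eq\<close> leaves \<open>d (g x) = 0\<close>.\<close>
    moreover have "slice (curvature ?y) {#} =
        (\<Oplus>\<^bsub>fmod Q (F (i - 2 - 1))\<^esub>j\<in>{..<c}. E (i - 2) (fs ! j \<odot>\<^bsub>fmod Q (T (i - 2))\<^esub> shift {#j#} x))"
    proof
      fix s
      have mem': "(\<lambda>j. E (i - 2) (fs ! j \<odot>\<^bsub>fmod Q (T (i - 2))\<^esub> shift {#j#} x)) \<in> {..<c} \<rightarrow> F (i - 2 - 1)"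
        using mem mod_homD(1)[OF Eh2] by auto
      have FR: "\<forall>x\<in>F (i - 2 - 1). \<forall>y. x y \<in> carrier Q" using F_carrier by blast
      have "slice (curvature ?y) {#} s = (\<Oplus>\<^bsub>Q\<^esub>j\<in>{..<c}. fs ! j \<otimes>\<^bsub>Q\<^esub> E (i - 2) (shift {#j#} x) s)"
        by (simp add: slice_def curvature_def shift_apply lower_def)
      also have "\<dots> = (\<Oplus>\<^bsub>Q\<^esub>j\<in>{..<c}. E (i - 2) (fs ! j \<odot>\<^bsub>fmod Q (T (i - 2))\<^esub> shift {#j#} x) s)"
      proof (rule Q.finsum_cong'[OF refl])
        show "(\<lambda>j. E (i - 2) (fs ! j \<odot>\<^bsub>fmod Q (T (i - 2))\<^esub> shift {#j#} x) s) \<in> {..<c} \<rightarrow> carrier Q"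
          using mem' F_carrier by blast
        show "fs ! j \<otimes>\<^bsub>Q\<^esub> E (i - 2) (shift {#j#} x) s = E (i - 2) (fs ! j \<odot>\<^bsub>fmod Q (T (i - 2))\<^esub> shift {#j#} x) s"
          if "j \<in> {..<c}" for j
          using mod_homD(3)[OF Eh2 fs_carrier, of j "shift {#j#} x"] that sx by simp
      qed
      also have "\<dots> = (\<Oplus>\<^bsub>fmod Q (F (i - 2 - 1))\<^esub>j\<in>{..<c}. E (i - 2) (fs ! j \<odot>\<^bsub>fmod Q (T (i - 2))\<^esub> shift {#j#} x)) s"
        by (rule fmod_finsum[OF module_F FR mem', symmetric])
      finally show "slice (curvature ?y) {#} s = (\<Oplus>\<^bsub>fmod Q (F (i - 2 - 1))\<^esub>j\<in>{..<c}. E (i - 2) (fs ! j \<odot>\<^bsub>fmod Q (T (i - 2))\<^esub> shift {#j#} x)) s" .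
    qed
    ultimately have eq2: "E (i - 2) (curvature x) = slice (curvature ?y) {#}" by simp
    have "d (i - 2) (g x) = (\<lambda>_. \<zero>\<^bsub>Q\<^esub>)"
    proof -
      interpret F: module Q "fmod Q (F (i - 2 - 1))" by (rule module_F)
      have c1: "d (i - 2) (g x) \<in> carrier (fmod Q (F (i - 2 - 1)))"
        using mod_homD(1)[OF d_hom[of "i - 2"]] gF[OF x] by simp
      have c2: "slice (curvature ?y) {#} \<in> carrier (fmod Q (F (i - 2 - 1)))"
        using mod_homD(1)[OF Eh2, of "curvature x"] mod_homD(1)[OF curvature_hom, of x i] x eq2 by simp
      have "d (i - 2) (g x) = \<zero>\<^bsub>fmod Q (F (i - 2 - 1))\<^esub>"
        by (rule F.M.add.r_cancel_one[THEN iffD1, OF c2 c1]) (simp only: eq[symmetric] eq2)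
      then show ?thesis by simp
    qed
    \<comment> \<open>In the lowest case \<open>g x\<close> is a combination with coefficients
      \<open>fs ! j\<close>, and \<open>e\<close> kills it because the sequence annihilates
      \<open>M\<close>.\<close>
    moreover have "e (g x) = \<zero>\<^bsub>M\<^esub>" if k0: "i - 2 = 0"
    proof -
      have i_eq: "i = 2" using k0 i2 by simp
      have "?y = bottom (slice ?y {#})" by (rule bottom_slice[OF y]) (simp add: i_eq)
      also have "\<dots> = (\<lambda>_. \<zero>\<^bsub>Q\<^esub>)" by (auto simp: slice_lower bottom_def)
      finally have "E (i - 1) ?y = (\<lambda>_. \<zero>\<^bsub>Q\<^esub>)"
        using mod_hom_zero[OF module_T module_F Eh] by simp
      then have "w x = (\<lambda>s. g x s \<oplus>\<^bsub>Q\<^esub> \<zero>\<^bsub>Q\<^esub>)" using w_eq[OF x] by simp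
      then have gw: "g x = w x" using F_carrier[OF gF[OF x]] by (simp add: fun_eq_iff)
      interpret M: module Q M by (rule M)
      have mem: "(\<lambda>j. fs ! j \<odot>\<^bsub>fmod Q (F 0)\<^esub> slice (shift {#j#} x) {#}) \<in> {..<c} \<rightarrow> F 0"
      proof (rule Pi_I)
        fix j assume "j \<in> {..<c}"
        then show "fs ! j \<odot>\<^bsub>fmod Q (F 0)\<^esub> slice (shift {#j#} x) {#} \<in> F 0"
          using F_mem(3)[OF fs_carrier T_slice'[OF shift_T[OF x, of "{#j#}"], of "{#}"], of j] i_eq by simp
      qed
      have FR: "\<forall>x\<in>F 0. \<forall>y. x y \<in> carrier Q" using F_carrier by blast
      have "w x = (\<Oplus>\<^bsub>fmod Q (F 0)\<^esub>j\<in>{..<c}. fs ! j \<odot>\<^bsub>fmod Q (F 0)\<^esub> slice (shift {#j#} x) {#})"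
      proof
        fix s
        show "w x s = (\<Oplus>\<^bsub>fmod Q (F 0)\<^esub>j\<in>{..<c}. fs ! j \<odot>\<^bsub>fmod Q (F 0)\<^esub> slice (shift {#j#} x) {#}) s"
          unfolding fmod_finsum[OF module_F FR mem] by (simp add: w_def slice_def curvature_def)
      qed
      then have "e (w x) = (\<Oplus>\<^bsub>M\<^esub>j\<in>{..<c}. e (fs ! j \<odot>\<^bsub>fmod Q (F 0)\<^esub> slice (shift {#j#} x) {#}))"
        using mod_hom_finsum[OF module_F M e_hom, of _ "{..<c}"] mem by simp
      also have "\<dots> = (\<Oplus>\<^bsub>M\<^esub>j\<in>{..<c}. \<zero>\<^bsub>M\<^esub>)"
      proof (rule M.finsum_cong'[OF refl])
        show "e (fs ! j \<odot>\<^bsub>fmod Q (F 0)\<^esub> slice (shift {#j#} x) {#}) = \<zero>\<^bsub>M\<^esub>" if j: "j \<in> {..<c}" for j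
        proof -
          have sl: "slice (shift {#j#} x) {#} \<in> carrier (fmod Q (F 0))"
            using T_slice'[OF shift_T[OF x, of "{#j#}"], of "{#}"] i_eq by simp
          have "fs ! j \<in> genideal Q (set fs)"
            using Q.genideal_self[OF fs_subset] nth_mem[of j fs] j by blast
          then show ?thesis
            using mod_homD(3)[OF e_hom fs_carrier sl, of j] j annihilated mod_homD(1)[OF e_hom sl] by simp
        qed
      qed simp
      finally show ?thesis using gw by simp
    qed
    ultimately have "\<exists>u\<in>F (Suc (i - 2)). d (Suc (i - 2)) u = g x" by (intro exact[OF gF[OF x]])
    moreover have "Suc (i - 2) = i - 1" using i2 by simp
    ultimately show ?thesis by (metis image_eqI)
  qed
  have dh: "d (i - 1) \<in> mod_hom Q (fmod Q (F (i - 1))) (fmod Q (F (i - 2)))"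
    using d_hom[of "i - 1"] by (simp add: numeral_2_eq_2)
  obtain E' where E': "E' \<in> mod_hom Q (fmod Q (T i)) (fmod Q (F (i - 1)))"
    "\<And>x. x \<in> T i \<Longrightarrow> d (i - 1) (E' x) = g x"
    using dual_basis_lift[OF basis_T module_F module_F dh g] im by auto
  \<comment> \<open>\<open>E'\<close> solves the equation for \<open>d\<close>, but it may fail to
    restrict to \<open>d\<close> on \<open>y^0\<close>. Since \<open>g\<close> ignores the component
    at \<open>y^0\<close> and \<open>d d = 0\<close>, that component can be treated separately:
    \<open>h\<close> is \<open>d\<close> there and \<open>E'\<close> on the rest.\<close>
  define upper where "upper x = (\<lambda>(b, s). if b = {#} then \<zero>\<^bsub>Q\<^esub> else x (b, s))" for x :: "nat multiset \<times> nat \<Rightarrow> 'q"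
  have upper_slice: "slice (upper x) b = (if b = {#} then (\<lambda>_. \<zero>\<^bsub>Q\<^esub>) else slice x b)" for x b
    by (auto simp: slice_def upper_def)
  have upper_T: "upper x \<in> T i" if x: "x \<in> T i" for x
  proof (rule T_I)
    fix b
    show "slice (upper x) b \<in> F (i - 2 * size b)"
      unfolding upper_slice using T_slice'[OF x, of b] F_mem(1) by simp
    assume "\<not> (set_mset b \<subseteq> {..<c} \<and> 2 * size b \<le> i)"
    then show "slice (upper x) b = (\<lambda>_. \<zero>\<^bsub>Q\<^esub>)"
      unfolding upper_slice using T_zero[OF x] by (auto simp: slice_def)
  qed
  have upper: "upper \<in> mod_hom Q (fmod Q (T i)) (fmod Q (T i))"
    by (rule mod_homI) (auto simp: upper_T, auto simp: upper_def)
  define h where "h x = d i (slice x {#}) \<oplus>\<^bsub>fmod Q (F (i - 1))\<^esub> E' (upper x)" for x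
  have slice0: "(\<lambda>x. slice x {#}) \<in> mod_hom Q (fmod Q (T i)) (fmod Q (F i))"
    using slice_hom[of "{#}" i] by simp
  have h: "h \<in> mod_hom Q (fmod Q (T i)) (fmod Q (F (i - 1)))"
    unfolding h_def
    by (rule mod_hom_add[OF module_F mod_hom_comp[OF slice0 d_hom] mod_hom_comp[OF upper E'(1)]])
  let ?E = "E(i := h)"
  have "good ?E i"
    unfolding good_def
  proof (intro conjI ballI)
    show "?E i \<in> mod_hom Q (fmod Q (T i)) (fmod Q (F (i - 1)))" using h by simp
    show "?E i (bottom x) = d i x" if x: "x \<in> F i" for x
    proof -
      have "upper (bottom x) = (\<lambda>_. \<zero>\<^bsub>Q\<^esub>)" by (auto simp: upper_def bottom_def)
      then have "E' (upper (bottom x)) = (\<lambda>_. \<zero>\<^bsub>Q\<^esub>)"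
        using mod_hom_zero[OF module_T module_F E'(1)] by simp
      moreover have "d i x \<in> F (i - 1)" using mod_homD(1)[OF d_hom] x by simp
      ultimately show ?thesis using F_carrier by (simp add: h_def slice_bottom fun_eq_iff)
    qed
    fix x assume x: "x \<in> T i"
    have ne: "i - 1 \<noteq> i" using i by simp
    have lower_E: "lower ?E i = lower E i"
      unfolding lower_def using i by (intro ext) (auto simp: nonempty_has_size)
    have lower_upper: "lower E i (upper x) = lower E i x"
    proof -
      have "shift b (upper x) = shift b x" if "b \<noteq> {#}" for b
        using that by (auto simp: shift_def upper_def)
      then show ?thesis unfolding lower_def by (intro ext) auto
    qed
    have "slice (curvature (upper x)) {#} = slice (curvature x) {#}"
      by (simp add: slice_def curvature_def shift_def upper_def)
    then have g_upper: "g (upper x) = g x" unfolding g_def w_def lower_upper by simp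
    have hx: "h x \<in> F (i - 1)" using mod_homD(1)[OF h] x by simp
    have s0: "slice x {#} \<in> F i" using T_slice'[OF x, of "{#}"] by simp
    have "d (i - 1) (h x) = d (i - 1) (d i (slice x {#})) \<oplus>\<^bsub>fmod Q (F (i - 2))\<^esub> d (i - 1) (E' (upper x))"
      unfolding h_def
      by (rule mod_homD(2)[OF dh]) (use mod_homD(1)[OF d_hom, of "slice x {#}" i] s0 mod_homD(1)[OF E'(1)] upper_T[OF x] in simp_all)
    also have "\<dots> = g x"
      using d_d[OF s0] E'(2)[OF upper_T[OF x]] g_upper F_carrier[OF gF[OF x]] by (simp add: fun_eq_iff)
    finally have dhx: "d (i - 1) (h x) = g x" .
    have bh: "bottom (h x) \<in> T (i - 1)" using mod_homD(1)[OF bottom_hom[of "i - 1"]] hx by simp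
    have "assemble ?E i x = bottom (h x) \<oplus>\<^bsub>fmod Q (T (i - 1))\<^esub> lower E i x"
      using assemble_eq_lower[of ?E i x "i - 1" "i - 1"] hx lT[OF x] by (simp add: lower_E)
    then have "?E (i - 1) (assemble ?E i x) = E (i - 1) (bottom (h x)) \<oplus>\<^bsub>fmod Q (F (i - 2))\<^esub> E (i - 1) (lower E i x)"
      using mod_homD(2)[OF Eh, of "bottom (h x)" "lower E i x"] bh lT[OF x] ne by simp
    also have "E (i - 1) (bottom (h x)) = d (i - 1) (h x)" by (rule goodD(2)[OF good hx]) (use i in simp)
    also have "d (i - 1) (h x) \<oplus>\<^bsub>fmod Q (F (i - 2))\<^esub> E (i - 1) (lower E i x) = slice (curvature x) {#}"
      unfolding dhx using w_eq[OF x] by (simp add: w_def)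
    finally show "?E (i - 1) (assemble ?E i x) = slice (curvature x) {#}" .
  qed
  then show ?thesis by blast
qed

text \<open>The condition in degree \<open>i\<close> does not see later values of \<open>E\<close>,
  so the maps can be chosen by well-founded recursion.\<close>

lemma good_exists: "\<exists>E. \<forall>i. good E i"
proof -
  have "\<exists>E. \<forall>i. good (E(i := E i)) i"
  proof (rule dependent_wf_choice[OF wf_less_than, of "\<lambda>E i h. good (E(i := h)) i"])
    show "good (E(i := h)) i = good (E'(i := h)) i" if "\<And>k. (k, i) \<in> less_than \<Longrightarrow> E k = E' k" for E E' i h
      by (rule good_cong) (use that in auto)
    fix i and E :: "nat \<Rightarrow> (nat multiset \<times> nat \<Rightarrow> 'q) \<Rightarrow> nat \<Rightarrow> 'q"
    assume "\<And>k. (k, i) \<in> less_than \<Longrightarrow> good (E(k := E k)) k"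
    then show "\<exists>h. good (E(i := h)) i" by (intro good_extend) simp
  qed
  then show ?thesis by simp
qed

definition E :: "nat \<Rightarrow> (nat multiset \<times> nat \<Rightarrow> 'q) \<Rightarrow> nat \<Rightarrow> 'q" where
  "E = (SOME E. \<forall>i. good E i)"

definition D :: "nat \<Rightarrow> (nat multiset \<times> nat \<Rightarrow> 'q) \<Rightarrow> nat multiset \<times> nat \<Rightarrow> 'q" where
  "D = assemble E"

lemma good_E: "good E i"
  using someI_ex[OF good_exists] unfolding E_def by blast

lemma E_hom: "E i \<in> mod_hom Q (fmod Q (T i)) (fmod Q (F (i - 1)))"
  by (rule goodD(1)[OF good_E])

lemma D_T: "x \<in> T i \<Longrightarrow> D i x \<in> T (i - 1)"
  unfolding D_def by (rule assemble_T[OF good_E])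

lemma D_hom: "D i \<in> mod_hom Q (fmod Q (T i)) (fmod Q (T (i - 1)))"
proof (rule mod_homI; unfold fmod_simps)
  show "D i x \<in> T (i - 1)" if "x \<in> T i" for x by (rule D_T[OF that])
  show "D i (\<lambda>s. x s \<oplus>\<^bsub>Q\<^esub> y s) = (\<lambda>s. D i x s \<oplus>\<^bsub>Q\<^esub> D i y s)" if x: "x \<in> T i" and y: "y \<in> T i" for x y
  proof
    fix z :: "nat multiset \<times> nat"
    have "shift (fst z) (\<lambda>s. x s \<oplus>\<^bsub>Q\<^esub> y s) = (\<lambda>s. shift (fst z) x s \<oplus>\<^bsub>Q\<^esub> shift (fst z) y s)"
      by (auto simp: shift_def)
    then show "D i (\<lambda>s. x s \<oplus>\<^bsub>Q\<^esub> y s) z = D i x z \<oplus>\<^bsub>Q\<^esub> D i y z"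
      using mod_homD(2)[OF E_hom, of "shift (fst z) x" "i - 2 * size (fst z)" "shift (fst z) y"] shift_T[OF x] shift_T[OF y]
      by (simp add: D_def assemble_def case_prod_beta)
  qed
  show "D i (\<lambda>s. a \<otimes>\<^bsub>Q\<^esub> x s) = (\<lambda>s. a \<otimes>\<^bsub>Q\<^esub> D i x s)" if a: "a \<in> carrier Q" and x: "x \<in> T i" for a x
  proof
    fix z :: "nat multiset \<times> nat"
    have "shift (fst z) (\<lambda>s. a \<otimes>\<^bsub>Q\<^esub> x s) = (\<lambda>s. a \<otimes>\<^bsub>Q\<^esub> shift (fst z) x s)"
      by (auto simp: shift_def)
    then show "D i (\<lambda>s. a \<otimes>\<^bsub>Q\<^esub> x s) z = a \<otimes>\<^bsub>Q\<^esub> D i x z"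
      using mod_homD(3)[OF E_hom a, of "shift (fst z) x" "i - 2 * size (fst z)"] shift_T[OF x]
      by (simp add: D_def assemble_def case_prod_beta)
  qed
qed

lemma shift_D: "shift b (D i x) = D (i - 2 * size b) (shift b x)"
  unfolding D_def by (rule shift_assemble)

text \<open>As \<open>D\<close> commutes with contractions, the component at \<open>y^b\<close> is
  the component at \<open>y^0\<close> for \<open>shift b x\<close>, where the equation holds by
  construction.\<close>

lemma D_D: "x \<in> T i \<Longrightarrow> D (i - 1) (D i x) = curvature x"
proof
  fix z :: "nat multiset \<times> nat" assume x: "x \<in> T i"
  obtain b s where z: "z = (b, s)" by (cases z)
  have "D (i - 1) (D i x) z = E (i - 2 * size b - 1) (assemble E (i - 2 * size b) (shift b x)) s"
    using shift_D[of b i x] by (simp add: D_def assemble_def z diff_commute)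
  also have "\<dots> = slice (curvature (shift b x)) {#} s"
    using goodD(3)[OF good_E shift_T[OF x]] by simp
  also have "\<dots> = curvature x z"
    unfolding shift_curvature[symmetric] by (simp add: slice_def shift_def z)
  finally show "D (i - 1) (D i x) z = curvature x z" .
qed

lemma D_bottom: "x \<in> F i \<Longrightarrow> D i (bottom x) = bottom (d i x)"
proof
  fix z :: "nat multiset \<times> nat" assume x: "x \<in> F i"
  obtain b s where z: "z = (b, s)" by (cases z)
  show "D i (bottom x) z = bottom (d i x) z"
  proof (cases "b = {#}")
    case True
    then show ?thesis using goodD(2)[OF good_E x] by (simp add: D_def assemble_def z bottom_def)
  next
    case False
    then have "E (i - 2 * size b) (shift b (bottom x)) = (\<lambda>_. \<zero>\<^bsub>Q\<^esub>)"
      using mod_hom_zero[OF module_T module_F E_hom] shift_bottom[OF False] by simp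
    then show ?thesis using False by (simp add: D_def assemble_def z bottom_def)
  qed
qed

lemma D_0: "x \<in> T 0 \<Longrightarrow> D 0 x = (\<lambda>_. \<zero>\<^bsub>Q\<^esub>)"
proof -
  assume x: "x \<in> T 0"
  have "x = bottom (slice x {#})" by (rule bottom_slice[OF x]) simp
  moreover have "slice x {#} \<in> F 0" using T_slice'[OF x, of "{#}"] by simp
  ultimately have "D 0 x = bottom (d 0 (slice x {#}))" using D_bottom by metis
  then show ?thesis using d_0 by (auto simp: bottom_def)
qed

end

lemma ideal_finsum:
  assumes "cring R" "ideal I R" "h \<in> S \<rightarrow> I"
  shows "(\<Oplus>\<^bsub>R\<^esub>s\<in>S. h s) \<in> I"
proof -
  interpret cring R by fact
  interpret I: ideal I R by fact
  show ?thesis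
    using assms(3)
  proof (induction S rule: infinite_finite_induct)
    case (insert s S)
    then show ?case using I.Icarr by (subst finsum_insert) (auto simp: Pi_iff I.a_closed)
  qed simp_all
qed

section \<open>Exactness of T modulo the regular sequence, one variable at a time\<close>

context regular_quotient
begin

definition J :: "nat \<Rightarrow> 'q set" where
  "J j = genideal Q (set (take j fs))"

lemma J_ideal: "ideal (J j) Q"
  unfolding J_def by (rule Q.genideal_ideal) (use fs_subset set_take_subset in fast)

lemma J_mem:
  shows "\<zero>\<^bsub>Q\<^esub> \<in> J j" "a \<in> J j \<Longrightarrow> b \<in> J j \<Longrightarrow> a \<oplus>\<^bsub>Q\<^esub> b \<in> J j" "a \<in> J j \<Longrightarrow> \<ominus>\<^bsub>Q\<^esub> a \<in> J j"
    "q \<in> carrier Q \<Longrightarrow> a \<in> J j \<Longrightarrow> q \<otimes>\<^bsub>Q\<^esub> a \<in> J j" "q \<in> carrier Q \<Longrightarrow> a \<in> J j \<Longrightarrow> a \<otimes>\<^bsub>Q\<^esub> q \<in> J j"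
    "a \<in> J j \<Longrightarrow> a \<in> carrier Q" "a \<in> J j \<Longrightarrow> b \<in> J j \<Longrightarrow> a \<ominus>\<^bsub>Q\<^esub> b \<in> J j"
proof -
  interpret J: ideal "J j" Q by (rule J_ideal)
  show "\<zero>\<^bsub>Q\<^esub> \<in> J j" "a \<in> J j \<Longrightarrow> b \<in> J j \<Longrightarrow> a \<oplus>\<^bsub>Q\<^esub> b \<in> J j" "a \<in> J j \<Longrightarrow> \<ominus>\<^bsub>Q\<^esub> a \<in> J j"
    "q \<in> carrier Q \<Longrightarrow> a \<in> J j \<Longrightarrow> q \<otimes>\<^bsub>Q\<^esub> a \<in> J j" "q \<in> carrier Q \<Longrightarrow> a \<in> J j \<Longrightarrow> a \<otimes>\<^bsub>Q\<^esub> q \<in> J j"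
    "a \<in> J j \<Longrightarrow> a \<in> carrier Q"
    by (simp_all add: J.a_closed J.I_l_closed J.I_r_closed J.Icarr)
  then show "a \<in> J j \<Longrightarrow> b \<in> J j \<Longrightarrow> a \<ominus>\<^bsub>Q\<^esub> b \<in> J j"
    unfolding a_minus_def by (meson J.a_closed J.a_inv_closed)
qed

lemma J_Suc_subset: "J j \<subseteq> J (Suc j)"
proof -
  have "set (take (Suc j) fs) \<subseteq> carrier Q" using fs_subset set_take_subset by fast
  then have "set (take j fs) \<subseteq> J (Suc j)"
    unfolding J_def using Q.genideal_self[of "set (take (Suc j) fs)"] set_take_subset_set_take[of j "Suc j" fs] by auto
  then show ?thesis unfolding J_def[of j] by (rule Q.genideal_minimal[OF J_ideal])
qed

lemma fs_J: "l < j \<Longrightarrow> l < c \<Longrightarrow> fs ! l \<in> J j"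
proof -
  assume l: "l < j" "l < c"
  then have "fs ! l \<in> set (take j fs)" by (auto simp: in_set_conv_nth intro!: exI[of _ l])
  moreover have "set (take j fs) \<subseteq> carrier Q" using fs_subset set_take_subset by fast
  ultimately show ?thesis unfolding J_def using Q.genideal_self by blast
qed

lemma J_regular: "j < c \<Longrightarrow> a \<in> carrier Q \<Longrightarrow> fs ! j \<otimes>\<^bsub>Q\<^esub> a \<in> J j \<Longrightarrow> a \<in> J j"
  using regular unfolding regular_sequence_def J_def by blast

text \<open>\<open>J (Suc j)\<close> is the sum of \<open>J j\<close> and the principal ideal of
  \<open>fs ! j\<close>, positions being counted from 0.\<close>

lemma J_Suc:
  assumes "j < c" "a \<in> J (Suc j)"
  shows "\<exists>w\<in>carrier Q. a \<ominus>\<^bsub>Q\<^esub> fs ! j \<otimes>\<^bsub>Q\<^esub> w \<in> J j"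
proof -
  have f: "fs ! j \<in> carrier Q" by (rule fs_carrier[OF assms(1)])
  have id: "ideal (J j <+>\<^bsub>Q\<^esub> PIdl\<^bsub>Q\<^esub> (fs ! j)) Q"
    by (rule Q.add_ideals[OF J_ideal Q.cgenideal_ideal[OF f]])
  have "set (take (Suc j) fs) = insert (fs ! j) (set (take j fs))"
    using assms(1) by (simp add: take_Suc_conv_app_nth)
  moreover have "fs ! j \<in> J j <+>\<^bsub>Q\<^esub> PIdl\<^bsub>Q\<^esub> (fs ! j)"
  proof -
    have "fs ! j = \<zero>\<^bsub>Q\<^esub> \<oplus>\<^bsub>Q\<^esub> fs ! j" using f by simp
    then show ?thesis using J_mem(1)[of j] Q.cgenideal_self[OF f] by (auto simp: set_add_def')
  qed
  moreover have "set (take j fs) \<subseteq> J j <+>\<^bsub>Q\<^esub> PIdl\<^bsub>Q\<^esub> (fs ! j)"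
  proof
    fix g assume "g \<in> set (take j fs)"
    moreover have "set (take j fs) \<subseteq> carrier Q" using fs_subset set_take_subset by fast
    ultimately have g: "g \<in> J j" unfolding J_def using Q.genideal_self by blast
    have "\<zero>\<^bsub>Q\<^esub> \<in> PIdl\<^bsub>Q\<^esub> (fs ! j)"
      using additive_subgroup.zero_closed[OF ideal.axioms(1)[OF Q.cgenideal_ideal[OF f]]] .
    moreover have "g = g \<oplus>\<^bsub>Q\<^esub> \<zero>\<^bsub>Q\<^esub>" using J_mem(6)[OF g] by simp
    ultimately show "g \<in> J j <+>\<^bsub>Q\<^esub> PIdl\<^bsub>Q\<^esub> (fs ! j)" using g unfolding set_add_def' by blast
  qed
  ultimately have "J (Suc j) \<subseteq> J j <+>\<^bsub>Q\<^esub> PIdl\<^bsub>Q\<^esub> (fs ! j)"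
    unfolding J_def[of "Suc j"] by (intro Q.genideal_minimal[OF id]) simp
  then obtain a0 w where a: "a0 \<in> J j" "w \<in> carrier Q" "a = a0 \<oplus>\<^bsub>Q\<^esub> w \<otimes>\<^bsub>Q\<^esub> fs ! j"
    using assms(2) unfolding set_add_def' cgenideal_def by blast
  then have "a \<ominus>\<^bsub>Q\<^esub> fs ! j \<otimes>\<^bsub>Q\<^esub> w = a0"
    using f J_mem(6)[OF a(1)] by (simp add: a_minus_def Q.m_comm Q.a_assoc Q.r_neg)
  then show ?thesis using a(1,2) by (intro bexI[of _ w]) simp_all
qed

lemma J_0: "J 0 = {\<zero>\<^bsub>Q\<^esub>}"
proof -
  have "J 0 \<subseteq> {\<zero>\<^bsub>Q\<^esub>}" unfolding J_def by (rule Q.genideal_minimal[OF Q.zeroideal]) simp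
  then show ?thesis using J_mem(1) by blast
qed

lemma J_c: "J c = genideal Q (set fs)"
  by (simp add: J_def)

text \<open>\<open>ST j\<close> is the part of \<open>T\<close> that involves only the first \<open>j\<close> variables, \<open>JT j\<close> is
  \<open>(f\<^sub>1, \<dots>, f\<^sub>j) T\<close>, and \<open>cg j\<close> is congruence modulo \<open>JT j\<close>.\<close>

definition ST :: "nat \<Rightarrow> nat \<Rightarrow> (nat multiset \<times> nat \<Rightarrow> 'q) set" where
  "ST j i = {x \<in> T i. \<forall>b s. \<not> set_mset b \<subseteq> {..<j} \<longrightarrow> x (b, s) = \<zero>\<^bsub>Q\<^esub>}"

definition JT :: "nat \<Rightarrow> nat \<Rightarrow> (nat multiset \<times> nat \<Rightarrow> 'q) set" where
  "JT j i = {x \<in> T i. \<forall>y. x y \<in> J j}"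

definition cg :: "nat \<Rightarrow> nat \<Rightarrow> (nat multiset \<times> nat \<Rightarrow> 'q) \<Rightarrow> (nat multiset \<times> nat \<Rightarrow> 'q) \<Rightarrow> bool" where
  "cg j i x y \<longleftrightarrow> x \<in> T i \<and> y \<in> T i \<and> (\<forall>z. x z \<ominus>\<^bsub>Q\<^esub> y z \<in> J j)"

definition padd :: "(nat multiset \<times> nat \<Rightarrow> 'q) \<Rightarrow> (nat multiset \<times> nat \<Rightarrow> 'q) \<Rightarrow> nat multiset \<times> nat \<Rightarrow> 'q" where
  "padd x y = (\<lambda>z. x z \<oplus>\<^bsub>Q\<^esub> y z)"

definition pscale :: "'q \<Rightarrow> (nat multiset \<times> nat \<Rightarrow> 'q) \<Rightarrow> nat multiset \<times> nat \<Rightarrow> 'q" where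
  "pscale a x = (\<lambda>z. a \<otimes>\<^bsub>Q\<^esub> x z)"

definition psub :: "(nat multiset \<times> nat \<Rightarrow> 'q) \<Rightarrow> (nat multiset \<times> nat \<Rightarrow> 'q) \<Rightarrow> nat multiset \<times> nat \<Rightarrow> 'q" where
  "psub x y = (\<lambda>z. x z \<ominus>\<^bsub>Q\<^esub> y z)"

abbreviation pzero :: "nat multiset \<times> nat \<Rightarrow> 'q" where
  "pzero \<equiv> (\<lambda>_. \<zero>\<^bsub>Q\<^esub>)"

lemma padd_T: "x \<in> T i \<Longrightarrow> y \<in> T i \<Longrightarrow> padd x y \<in> T i"
  unfolding padd_def by (rule T_mem(2))

lemma pscale_T: "a \<in> carrier Q \<Longrightarrow> x \<in> T i \<Longrightarrow> pscale a x \<in> T i"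
  unfolding pscale_def by (rule T_mem(3))

lemma psub_eq: "x \<in> T i \<Longrightarrow> y \<in> T i \<Longrightarrow> psub x y = padd x (pscale (\<ominus>\<^bsub>Q\<^esub> \<one>\<^bsub>Q\<^esub>) y)"
  using T_carrier[of y i] by (auto simp: psub_def padd_def pscale_def a_minus_def Q.l_minus)

lemma psub_T: "x \<in> T i \<Longrightarrow> y \<in> T i \<Longrightarrow> psub x y \<in> T i"
  by (simp add: psub_eq padd_T pscale_T)

lemma D_padd: "x \<in> T i \<Longrightarrow> y \<in> T i \<Longrightarrow> D i (padd x y) = padd (D i x) (D i y)"
  using mod_homD(2)[OF D_hom, of x i y] by (simp add: padd_def)

lemma D_pscale: "a \<in> carrier Q \<Longrightarrow> x \<in> T i \<Longrightarrow> D i (pscale a x) = pscale a (D i x)"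
  using mod_homD(3)[OF D_hom, of a x i] by (simp add: pscale_def)

lemma D_psub: "x \<in> T i \<Longrightarrow> y \<in> T i \<Longrightarrow> D i (psub x y) = psub (D i x) (D i y)"
  by (simp add: psub_eq D_padd D_pscale pscale_T psub_eq[OF D_T D_T])

text \<open>\<open>JT j\<close> is defined by coordinates, and expansion in the dual basis shows
  that linear maps respect it, just as they respect multiples by an ideal.\<close>

lemma hom_JT:
  assumes "module Q (fmod Q V)" "\<And>x y. x \<in> V \<Longrightarrow> x y \<in> carrier Q"
    and g: "g \<in> mod_hom Q (fmod Q (T i)) (fmod Q V)" and x: "x \<in> JT j i"
  shows "g x y \<in> J j"
proof -
  have xT: "x \<in> T i" and xJ: "\<And>z. x z \<in> J j" using x by (auto simp: JT_def)
  have gV: "g (WT i s) \<in> V" if "s \<in> Idx i" for s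
    using mod_homD(1)[OF g, of "WT i s"] dual_basisD(4)[OF basis_T that] by simp
  have "(\<lambda>s. x s \<odot>\<^bsub>fmod Q V\<^esub> g (WT i s)) \<in> Idx i \<rightarrow> V"
    using fmod_mem(3)[OF assms(1) T_carrier[OF xT]] gV by auto
  moreover have "\<forall>x\<in>V. \<forall>y. x y \<in> carrier Q" using assms(2) by blast
  ultimately have "g x y = (\<Oplus>\<^bsub>Q\<^esub>s\<in>Idx i. x s \<otimes>\<^bsub>Q\<^esub> g (WT i s) y)"
    using fmod_finsum[OF assms(1), of "\<lambda>s. x s \<odot>\<^bsub>fmod Q V\<^esub> g (WT i s)" "Idx i" y]
    by (simp add: dual_basis_hom[OF basis_T assms(1) g xT])
  also have "\<dots> \<in> J j"
    by (rule ideal_finsum[OF cring_Q J_ideal]) (use xJ gV assms(2) J_mem(5) in blast)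
  finally show ?thesis .
qed

lemma D_JT: "x \<in> JT j i \<Longrightarrow> D i x \<in> JT j (i - 1)"
  using hom_JT[OF module_T _ D_hom, of i x j] D_T[of x i] T_carrier unfolding JT_def by blast

text \<open>A contraction by a variable beyond the first \<open>j\<close> kills \<open>x\<close>; as
  it commutes with \<open>D\<close>, it kills \<open>D x\<close> too.\<close>

lemma D_ST:
  assumes x: "x \<in> ST j i" shows "D i x \<in> ST j (i - 1)"
proof -
  have xT: "x \<in> T i" using x by (simp add: ST_def)
  have "D i x (b, s) = \<zero>\<^bsub>Q\<^esub>" if b: "\<not> set_mset b \<subseteq> {..<j}" for b s
  proof -
    have "shift b x = pzero" using x b by (auto simp: shift_def ST_def)
    then show ?thesis
      using mod_hom_zero[OF module_T module_F E_hom, of "i - 2 * size b"] by (simp add: D_def assemble_def)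
  qed
  then show ?thesis using D_T[OF xT] by (simp add: ST_def)
qed

lemma shift_ST: "x \<in> ST j i \<Longrightarrow> shift b x \<in> ST j (i - 2 * size b)"
  using shift_T[of x i b] by (auto simp: ST_def shift_apply)

lemma shift_JT: "x \<in> JT j i \<Longrightarrow> shift b x \<in> JT j (i - 2 * size b)"
  using shift_T[of x i b] by (auto simp: JT_def shift_def)

lemma JT_Suc_subset: "JT j i \<subseteq> JT (Suc j) i"
  using J_Suc_subset by (auto simp: JT_def)

lemma ST_Suc_subset: "ST j i \<subseteq> ST (Suc j) i"
  unfolding ST_def using lessThan_subset_iff[of j "Suc j"] by fastforce

lemma ST_c: "ST c i = T i"
  unfolding ST_def using T_zero by blast

lemma ST_T: "x \<in> ST j i \<Longrightarrow> x \<in> T i"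
  by (simp add: ST_def)

lemma JT_T: "x \<in> JT j i \<Longrightarrow> x \<in> T i"
  by (simp add: JT_def)

lemma padd_ST: "x \<in> ST j i \<Longrightarrow> y \<in> ST j i \<Longrightarrow> padd x y \<in> ST j i"
  using padd_T[of x i y] by (auto simp: ST_def padd_def)

lemma psub_ST: "x \<in> ST j i \<Longrightarrow> y \<in> ST j i \<Longrightarrow> psub x y \<in> ST j i"
  using psub_T[of x i y] by (auto simp: ST_def psub_def a_minus_def)

lemma ST_low_degree:
  assumes "x \<in> T i" "i < 2" shows "x \<in> ST j i"
proof -
  have "x (b, s) = \<zero>\<^bsub>Q\<^esub>" if "\<not> set_mset b \<subseteq> {..<j}" for b s
  proof -
    have "b \<noteq> {#}" using that by auto
    then have "\<not> 2 * size b \<le> i" using assms(2) by (simp add: nonempty_has_size)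
    then show ?thesis using T_zero[OF assms(1)] by blast
  qed
  then show ?thesis using assms(1) by (simp add: ST_def)
qed

lemma cg_sym: "cg j i x y \<Longrightarrow> cg j i y x"
proof -
  assume xy: "cg j i x y"
  then have T: "x \<in> T i" "y \<in> T i" and xyJ: "\<And>z. x z \<ominus>\<^bsub>Q\<^esub> y z \<in> J j" by (auto simp: cg_def)
  have "y z \<ominus>\<^bsub>Q\<^esub> x z = \<ominus>\<^bsub>Q\<^esub> (x z \<ominus>\<^bsub>Q\<^esub> y z)" for z
    using T_carrier[OF T(1), of z] T_carrier[OF T(2), of z] by (simp add: a_minus_def Q.minus_add Q.a_comm)
  then show ?thesis unfolding cg_def using T J_mem(3)[OF xyJ] by simp
qed

lemma cg_trans: "cg j i x y \<Longrightarrow> cg j i y z \<Longrightarrow> cg j i x z"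
proof -
  assume xy: "cg j i x y" and yz: "cg j i y z"
  then have T: "x \<in> T i" "y \<in> T i" "z \<in> T i"
    and J: "\<And>s. x s \<ominus>\<^bsub>Q\<^esub> y s \<in> J j" "\<And>s. y s \<ominus>\<^bsub>Q\<^esub> z s \<in> J j" by (auto simp: cg_def)
  have "x s \<ominus>\<^bsub>Q\<^esub> z s = (x s \<ominus>\<^bsub>Q\<^esub> y s) \<oplus>\<^bsub>Q\<^esub> (y s \<ominus>\<^bsub>Q\<^esub> z s)" for s
    using T_carrier[OF T(1), of s] T_carrier[OF T(2), of s] T_carrier[OF T(3), of s]
    by (simp add: a_minus_def Q.a_ac Q.r_neg1 Q.r_neg2)
  then show ?thesis unfolding cg_def using T J_mem(2)[OF J(1) J(2)] by simp
qed

lemma cg_refl: "x \<in> T i \<Longrightarrow> cg j i x x"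
  using T_carrier[of x i] J_mem(1) by (simp add: cg_def a_minus_def Q.r_neg)

lemma cg_padd: "cg j i x y \<Longrightarrow> cg j i x' y' \<Longrightarrow> cg j i (padd x x') (padd y y')"
proof -
  assume xy: "cg j i x y" and xy': "cg j i x' y'"
  then have T: "x \<in> T i" "y \<in> T i" "x' \<in> T i" "y' \<in> T i"
    and J: "\<And>s. x s \<ominus>\<^bsub>Q\<^esub> y s \<in> J j" "\<And>s. x' s \<ominus>\<^bsub>Q\<^esub> y' s \<in> J j" by (auto simp: cg_def)
  have "padd x x' s \<ominus>\<^bsub>Q\<^esub> padd y y' s = (x s \<ominus>\<^bsub>Q\<^esub> y s) \<oplus>\<^bsub>Q\<^esub> (x' s \<ominus>\<^bsub>Q\<^esub> y' s)" for s
    using T_carrier[OF T(1), of s] T_carrier[OF T(2), of s] T_carrier[OF T(3), of s] T_carrier[OF T(4), of s]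
    by (simp add: padd_def a_minus_def Q.a_ac Q.minus_add)
  then show ?thesis unfolding cg_def using T J_mem(2)[OF J(1) J(2)] padd_T by simp
qed

lemma cg_pzero: "cg j i x pzero \<longleftrightarrow> x \<in> JT j i"
proof -
  have "x z \<ominus>\<^bsub>Q\<^esub> \<zero>\<^bsub>Q\<^esub> = x z" if "x \<in> T i" for z
    using T_carrier[OF that, of z] by (simp add: a_minus_def)
  then show ?thesis unfolding cg_def JT_def using T_mem(1) by auto
qed

lemma cg_psub: "x \<in> T i \<Longrightarrow> y \<in> T i \<Longrightarrow> cg j i x y \<longleftrightarrow> psub x y \<in> JT j i"
  using psub_T[of x i y] by (simp add: cg_def JT_def psub_def)

lemma cg_D: "cg j i x y \<Longrightarrow> cg j (i - 1) (D i x) (D i y)"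
proof -
  assume xy: "cg j i x y"
  then have T: "x \<in> T i" "y \<in> T i" by (auto simp: cg_def)
  have "psub (D i x) (D i y) \<in> JT j (i - 1)"
    using D_JT[of "psub x y" j i] xy T by (simp add: cg_psub D_psub)
  then show ?thesis using D_T[OF T(1)] D_T[OF T(2)] by (simp add: cg_psub)
qed

lemma cg_JT: "cg j i x y \<Longrightarrow> x \<in> JT j i \<Longrightarrow> y \<in> JT j i"
  using cg_trans[OF cg_sym, of j i x y pzero] cg_pzero by blast

text \<open>Regularity applied to every coordinate: \<open>fs ! j\<close> is a nonzerodivisor on
  \<open>T i\<close> modulo \<open>J j\<close>.\<close>

lemma cg_regular: "j < c \<Longrightarrow> x \<in> T i \<Longrightarrow> y \<in> T i \<Longrightarrow> cg j i (pscale (fs ! j) x) (pscale (fs ! j) y) \<Longrightarrow> cg j i x y"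
proof -
  assume j: "j < c" and T: "x \<in> T i" "y \<in> T i" and cg: "cg j i (pscale (fs ! j) x) (pscale (fs ! j) y)"
  have "x z \<ominus>\<^bsub>Q\<^esub> y z \<in> J j" for z
  proof (rule J_regular[OF j])
    note c = T_carrier[OF T(1), of z] T_carrier[OF T(2), of z] fs_carrier[OF j]
    show "x z \<ominus>\<^bsub>Q\<^esub> y z \<in> carrier Q" using c by simp
    have "fs ! j \<otimes>\<^bsub>Q\<^esub> (x z \<ominus>\<^bsub>Q\<^esub> y z) = pscale (fs ! j) x z \<ominus>\<^bsub>Q\<^esub> pscale (fs ! j) y z"
      using c by (simp add: pscale_def a_minus_def Q.r_distr Q.r_minus)
    also have "\<dots> \<in> J j" using cg unfolding cg_def by blast
    finally show "fs ! j \<otimes>\<^bsub>Q\<^esub> (x z \<ominus>\<^bsub>Q\<^esub> y z) \<in> J j" .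
  qed
  then show ?thesis using T by (simp add: cg_def)
qed

text \<open>Dividing the coordinates of \<open>x\<close> by \<open>fs ! j\<close> modulo
  \<open>J j\<close> gives a vector \<open>v\<close> that may lie outside \<open>T i\<close>, which
  is only a summand of a module of coordinate vectors. Recombining \<open>v\<close> with the vectors
  \<open>WT i z\<close> projects it into \<open>T i\<close>, and the congruence survives because
  \<open>x\<close> is its own projection. Coordinates beyond the first \<open>j\<close> variables
  are taken to be zero, which keeps \<open>w\<close> in \<open>ST j\<close>.\<close>

lemma lift_cg:
  assumes j: "j < c" and x: "x \<in> ST j i" "x \<in> JT (Suc j) i"
  shows "\<exists>w\<in>ST j i. cg j i x (pscale (fs ! j) w)"
proof -
  have xT: "x \<in> T i" using x(1) by (rule ST_T)
  have "\<exists>w\<in>carrier Q. x z \<ominus>\<^bsub>Q\<^esub> fs ! j \<otimes>\<^bsub>Q\<^esub> w \<in> J j \<and> (\<not> set_mset (fst z) \<subseteq> {..<j} \<longrightarrow> w = \<zero>\<^bsub>Q\<^esub>)" for z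
  proof (cases "set_mset (fst z) \<subseteq> {..<j}")
    case True
    moreover have "x z \<in> J (Suc j)" using x(2) unfolding JT_def by blast
    ultimately show ?thesis using J_Suc[OF j, of "x z"] by blast
  next
    case False
    then have "x z = \<zero>\<^bsub>Q\<^esub>" using x(1) by (cases z) (auto simp: ST_def)
    then show ?thesis using J_mem(1)[of j] fs_carrier[OF j] by (intro bexI[of _ "\<zero>\<^bsub>Q\<^esub>"]) (simp_all add: a_minus_def)
  qed
  then obtain v where v: "\<And>z. v z \<in> carrier Q" "\<And>z. x z \<ominus>\<^bsub>Q\<^esub> fs ! j \<otimes>\<^bsub>Q\<^esub> v z \<in> J j"
    "\<And>z. \<not> set_mset (fst z) \<subseteq> {..<j} \<Longrightarrow> v z = \<zero>\<^bsub>Q\<^esub>"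
    by metis
  define w where "w y = (\<Oplus>\<^bsub>Q\<^esub>z\<in>Idx i. v z \<otimes>\<^bsub>Q\<^esub> WT i z y)" for y
  have WTc: "WT i z y \<in> carrier Q" if "z \<in> Idx i" for z y by (rule T_carrier[OF WT_T[OF that]])
  have mem: "(\<lambda>z. v z \<odot>\<^bsub>fmod Q (T i)\<^esub> WT i z) \<in> Idx i \<rightarrow> T i"
    using T_mem(3)[OF v(1) WT_T] by auto
  have TR: "\<forall>x\<in>T i. \<forall>y. x y \<in> carrier Q" using T_carrier by blast
  interpret T: module Q "fmod Q (T i)" by (rule module_T)
  have "w = (\<Oplus>\<^bsub>fmod Q (T i)\<^esub>z\<in>Idx i. v z \<odot>\<^bsub>fmod Q (T i)\<^esub> WT i z)"
    unfolding w_def using fmod_finsum[OF module_T TR mem] by auto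
  then have wT: "w \<in> T i" using T.M.finsum_closed[of "\<lambda>z. v z \<odot>\<^bsub>fmod Q (T i)\<^esub> WT i z" "Idx i"] mem by simp
  have "w (b, s) = \<zero>\<^bsub>Q\<^esub>" if b: "\<not> set_mset b \<subseteq> {..<j}" for b s
  proof -
    have "w (b, s) = (\<Oplus>\<^bsub>Q\<^esub>z\<in>Idx i. \<zero>\<^bsub>Q\<^esub>)"
      unfolding w_def
    proof (rule Q.finsum_cong'[OF refl])
      show "v z \<otimes>\<^bsub>Q\<^esub> WT i z (b, s) = \<zero>\<^bsub>Q\<^esub>" if z: "z \<in> Idx i" for z
      proof (cases "fst z = b")
        case True then show ?thesis using v(3)[of z] b WTc[OF z] by simp
      next
        case False then show ?thesis using v(1)[of z] by (cases z) (auto simp: WT_def)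
      qed
    qed simp
    then show ?thesis by simp
  qed
  then have wST: "w \<in> ST j i" using wT by (simp add: ST_def)
  have "x y \<ominus>\<^bsub>Q\<^esub> fs ! j \<otimes>\<^bsub>Q\<^esub> w y \<in> J j" for y
  proof -
    have m1: "(\<lambda>z. x z \<otimes>\<^bsub>Q\<^esub> WT i z y) \<in> Idx i \<rightarrow> carrier Q" using T_carrier[OF xT] WTc by auto
    have m2: "(\<lambda>z. v z \<otimes>\<^bsub>Q\<^esub> WT i z y) \<in> Idx i \<rightarrow> carrier Q" using v(1) WTc by auto
    have m3: "(\<lambda>z. (x z \<ominus>\<^bsub>Q\<^esub> fs ! j \<otimes>\<^bsub>Q\<^esub> v z) \<otimes>\<^bsub>Q\<^esub> WT i z y) \<in> Idx i \<rightarrow> J j"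
      using v(2) WTc J_mem(5) by blast
    have m3': "(\<lambda>z. (x z \<ominus>\<^bsub>Q\<^esub> fs ! j \<otimes>\<^bsub>Q\<^esub> v z) \<otimes>\<^bsub>Q\<^esub> WT i z y) \<in> Idx i \<rightarrow> carrier Q"
      using m3 J_mem(6) by blast
    have m4: "(\<lambda>z. fs ! j \<otimes>\<^bsub>Q\<^esub> (v z \<otimes>\<^bsub>Q\<^esub> WT i z y)) \<in> Idx i \<rightarrow> carrier Q"
      using m2 fs_carrier[OF j] by auto
    have "x y = (\<Oplus>\<^bsub>Q\<^esub>z\<in>Idx i. x z \<otimes>\<^bsub>Q\<^esub> WT i z y)" by (rule dual_basisD(5)[OF basis_T xT])
    also have "\<dots> = (\<Oplus>\<^bsub>Q\<^esub>z\<in>Idx i. (x z \<ominus>\<^bsub>Q\<^esub> fs ! j \<otimes>\<^bsub>Q\<^esub> v z) \<otimes>\<^bsub>Q\<^esub> WT i z y \<oplus>\<^bsub>Q\<^esub> fs ! j \<otimes>\<^bsub>Q\<^esub> (v z \<otimes>\<^bsub>Q\<^esub> WT i z y))"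
    proof (rule Q.finsum_cong'[OF refl])
      show "x z \<otimes>\<^bsub>Q\<^esub> WT i z y = (x z \<ominus>\<^bsub>Q\<^esub> fs ! j \<otimes>\<^bsub>Q\<^esub> v z) \<otimes>\<^bsub>Q\<^esub> WT i z y \<oplus>\<^bsub>Q\<^esub> fs ! j \<otimes>\<^bsub>Q\<^esub> (v z \<otimes>\<^bsub>Q\<^esub> WT i z y)"
        if z: "z \<in> Idx i" for z
        using T_carrier[OF xT, of z] v(1)[of z] WTc[OF z, of y] fs_carrier[OF j]
        by (simp add: a_minus_def Q.l_distr Q.l_minus Q.m_assoc Q.a_assoc Q.l_neg)
    qed (use m3' m4 in auto)
    also have "\<dots> = (\<Oplus>\<^bsub>Q\<^esub>z\<in>Idx i. (x z \<ominus>\<^bsub>Q\<^esub> fs ! j \<otimes>\<^bsub>Q\<^esub> v z) \<otimes>\<^bsub>Q\<^esub> WT i z y) \<oplus>\<^bsub>Q\<^esub> fs ! j \<otimes>\<^bsub>Q\<^esub> w y"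
      unfolding w_def Q.finsum_addf[OF m3' m4] Q.finsum_rdistr[OF finite_Idx fs_carrier[OF j] m2] ..
    finally have eq: "x y = (\<Oplus>\<^bsub>Q\<^esub>z\<in>Idx i. (x z \<ominus>\<^bsub>Q\<^esub> fs ! j \<otimes>\<^bsub>Q\<^esub> v z) \<otimes>\<^bsub>Q\<^esub> WT i z y) \<oplus>\<^bsub>Q\<^esub> fs ! j \<otimes>\<^bsub>Q\<^esub> w y" .
    have sJ: "(\<Oplus>\<^bsub>Q\<^esub>z\<in>Idx i. (x z \<ominus>\<^bsub>Q\<^esub> fs ! j \<otimes>\<^bsub>Q\<^esub> v z) \<otimes>\<^bsub>Q\<^esub> WT i z y) \<in> J j"
      by (rule ideal_finsum[OF cring_Q J_ideal m3])
    have "x y \<ominus>\<^bsub>Q\<^esub> fs ! j \<otimes>\<^bsub>Q\<^esub> w y = (\<Oplus>\<^bsub>Q\<^esub>z\<in>Idx i. (x z \<ominus>\<^bsub>Q\<^esub> fs ! j \<otimes>\<^bsub>Q\<^esub> v z) \<otimes>\<^bsub>Q\<^esub> WT i z y)"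
      unfolding eq using J_mem(6)[OF sJ] T_carrier[OF wT, of y] fs_carrier[OF j]
      by (simp add: a_minus_def Q.a_assoc Q.r_neg)
    then show ?thesis using sJ by simp
  qed
  then have "cg j i x (pscale (fs ! j) w)"
    unfolding cg_def using xT pscale_T[OF fs_carrier[OF j] wT] by (simp add: pscale_def)
  then show ?thesis using wST by blast
qed

text \<open>Multiplication by \<open>y^b\<close> as a mere relabelling of monomials, without divided
  power coefficients; this makes it a right inverse of \<open>shift b\<close>.\<close>

definition up :: "nat multiset \<Rightarrow> (nat multiset \<times> nat \<Rightarrow> 'q) \<Rightarrow> nat multiset \<times> nat \<Rightarrow> 'q" where
  "up b x = (\<lambda>(b', s). if b \<subseteq># b' then x (b' - b, s) else \<zero>\<^bsub>Q\<^esub>)"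

definition low :: "nat \<Rightarrow> (nat multiset \<times> nat \<Rightarrow> 'q) \<Rightarrow> nat multiset \<times> nat \<Rightarrow> 'q" where
  "low j x = (\<lambda>(b, s). if j \<in># b then \<zero>\<^bsub>Q\<^esub> else x (b, s))"

lemma slice_up: "slice (up b x) b' = (if b \<subseteq># b' then slice x (b' - b) else (\<lambda>_. \<zero>\<^bsub>Q\<^esub>))"
  by (auto simp: slice_def up_def)

lemma up_T:
  assumes x: "x \<in> T i" and b: "set_mset b \<subseteq> {..<c}"
  shows "up b x \<in> T (i + 2 * size b)"
proof (rule T_I)
  fix b'
  show "slice (up b x) b' \<in> F (i + 2 * size b - 2 * size b')"
  proof (cases "b \<subseteq># b'")
    case True
    then obtain a where a: "b' = b + a" by (auto simp: mset_subset_eq_exists_conv)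
    then show ?thesis using T_slice'[OF x, of a] by (simp add: slice_up)
  qed (simp add: slice_up F_mem)
  assume out: "\<not> (set_mset b' \<subseteq> {..<c} \<and> 2 * size b' \<le> i + 2 * size b)"
  show "slice (up b x) b' = (\<lambda>_. \<zero>\<^bsub>Q\<^esub>)"
  proof (cases "b \<subseteq># b'")
    case True
    then obtain a where a: "b' = b + a" by (auto simp: mset_subset_eq_exists_conv)
    then have "\<not> (set_mset a \<subseteq> {..<c} \<and> 2 * size a \<le> i)" using out b by auto
    then have "x (a, s) = \<zero>\<^bsub>Q\<^esub>" for s by (rule T_zero[OF x])
    then show ?thesis using a by (simp add: slice_up) (simp add: slice_def)
  qed (simp add: slice_up)
qed

lemma shift_up: "shift b (up b x) = x"
  by (auto simp: shift_def up_def)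

lemma up_ST:
  assumes "x \<in> ST j i" "set_mset b \<subseteq> {..<j}" "j \<le> c"
  shows "up b x \<in> ST j (i + 2 * size b)"
proof -
  have "up b x (b', s) = \<zero>\<^bsub>Q\<^esub>" if b': "\<not> set_mset b' \<subseteq> {..<j}" for b' s
  proof (cases "b \<subseteq># b'")
    case True
    then obtain a where a: "b' = b + a" by (auto simp: mset_subset_eq_exists_conv)
    then have "\<not> set_mset a \<subseteq> {..<j}" using b' assms(2) by auto
    then show ?thesis using assms(1) a by (auto simp: up_def ST_def)
  qed (simp add: up_def)
  moreover have "set_mset b \<subseteq> {..<c}" using assms(2,3) by auto
  ultimately show ?thesis using up_T[OF ST_T[OF assms(1)]] by (simp add: ST_def)
qed

lemma up_JT:
  assumes "x \<in> JT j i" "set_mset b \<subseteq> {..<c}"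
  shows "up b x \<in> JT j (i + 2 * size b)"
  using up_T[OF JT_T[OF assms(1)] assms(2)] assms(1) J_mem(1) by (auto simp: JT_def up_def)

lemma low_T: "x \<in> T i \<Longrightarrow> low j x \<in> T i"
proof (rule T_I)
  fix b assume x: "x \<in> T i"
  have sl: "slice (low j x) b = (if j \<in># b then (\<lambda>_. \<zero>\<^bsub>Q\<^esub>) else slice x b)" by (auto simp: slice_def low_def)
  show "slice (low j x) b \<in> F (i - 2 * size b)" unfolding sl using T_slice'[OF x, of b] F_mem(1) by simp
  assume "\<not> (set_mset b \<subseteq> {..<c} \<and> 2 * size b \<le> i)"
  then show "slice (low j x) b = (\<lambda>_. \<zero>\<^bsub>Q\<^esub>)" unfolding sl using T_zero[OF x] by (auto simp: slice_def)
qed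

lemma low_ST: "x \<in> ST (Suc j) i \<Longrightarrow> low j x \<in> ST j i"
proof -
  assume x: "x \<in> ST (Suc j) i"
  have "low j x (b, s) = \<zero>\<^bsub>Q\<^esub>" if b: "\<not> set_mset b \<subseteq> {..<j}" for b s
  proof (cases "j \<in># b")
    case False
    then have "\<not> set_mset b \<subseteq> {..<Suc j}" using b by (auto simp: less_Suc_eq)
    then show ?thesis using x False by (simp add: low_def ST_def)
  qed (simp add: low_def)
  then show ?thesis using low_T[OF ST_T[OF x]] by (simp add: ST_def)
qed

lemma low_shift_zero: "shift {#j#} x = pzero \<Longrightarrow> low j x = x"
proof
  fix y :: "nat multiset \<times> nat" assume x: "shift {#j#} x = pzero"
  obtain b s where y: "y = (b, s)" by (cases y)
  show "low j x y = x y"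
  proof (cases "j \<in># b")
    case True
    then obtain a where a: "b = add_mset j a" by (metis multi_member_split)
    then show ?thesis using fun_cong[OF x, of "(a, s)"] by (simp add: low_def y shift_apply)
  qed (simp add: low_def y)
qed

lemma low_decompose: "x \<in> T i \<Longrightarrow> x = padd (up {#j#} (shift {#j#} x)) (low j x)"
proof
  fix y :: "nat multiset \<times> nat" assume x: "x \<in> T i"
  obtain b s where y: "y = (b, s)" by (cases y)
  show "x y = padd (up {#j#} (shift {#j#} x)) (low j x) y"
    using T_carrier[OF x, of y] by (simp add: y padd_def up_def low_def shift_apply)
qed

lemma low_cg:
  assumes x: "x \<in> T i" and "\<And>y. shift {#j#} x y \<in> J k"
  shows "cg k i x (low j x)"
proof -
  have "x y \<ominus>\<^bsub>Q\<^esub> low j x y \<in> J k" for y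
  proof -
    obtain b s where y: "y = (b, s)" by (cases y)
    show ?thesis
    proof (cases "j \<in># b")
      case True
      then obtain a where a: "b = add_mset j a" by (metis multi_member_split)
      then have "x y = shift {#j#} x (a, s)" by (simp add: y shift_apply)
      then show ?thesis using assms(2)[of "(a, s)"] T_carrier[OF x, of y] True
        by (simp add: low_def y a_minus_def)
    next
      case False
      then show ?thesis using T_carrier[OF x, of y] J_mem(1) by (simp add: low_def y a_minus_def Q.r_neg)
    qed
  qed
  then show ?thesis using x low_T[OF x] by (simp add: cg_def)
qed

lemma curvature_T: "x \<in> T i \<Longrightarrow> curvature x \<in> T (i - 2)"
  using mod_homD(1)[OF curvature_hom, of x i] by simp

text \<open>On \<open>ST j\<close> only the terms \<open>fs ! l\<close> with \<open>l < j\<close>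
  survive. Thus \<open>D\<close> is a differential on \<open>ST j\<close> modulo
  \<open>J j\<close>.\<close>

lemma curvature_JT:
  assumes x: "x \<in> ST j i" and j: "j \<le> c"
  shows "curvature x \<in> JT j (i - 2)"
proof -
  have "curvature x y \<in> J j" for y
    unfolding curvature_def
  proof (rule ideal_finsum[OF cring_Q J_ideal], rule Pi_I)
    fix l assume l: "l \<in> {..<c}"
    have c: "shift {#l#} x y \<in> carrier Q" by (rule T_carrier[OF shift_T[OF ST_T[OF x]]])
    show "fs ! l \<otimes>\<^bsub>Q\<^esub> shift {#l#} x y \<in> J j"
    proof (cases "l < j")
      case True
      then show ?thesis using J_mem(5)[OF c fs_J[OF True]] l by simp
    next
      case False
      then have "\<not> set_mset (fst y + {#l#}) \<subseteq> {..<j}" by auto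
      then have "shift {#l#} x y = \<zero>\<^bsub>Q\<^esub>" using x by (cases y) (auto simp: shift_apply ST_def)
      then show ?thesis using fs_carrier l J_mem(1) by simp
    qed
  qed
  then show ?thesis using curvature_T[OF ST_T[OF x]] by (simp add: JT_def)
qed

text \<open>Modulo \<open>J j\<close> only the term of the variable \<open>j\<close> survives, and
  its contraction undoes \<open>up\<close>. Since the curvature is the square of \<open>D\<close>,
  this exhibits \<open>fs ! j\<close> times \<open>w\<close> as a boundary modulo
  \<open>J j\<close>: the new variable compensates the new relation.\<close>

lemma curvature_up:
  assumes w: "w \<in> ST j i" and j: "j < c"
  shows "cg j i (curvature (up {#j#} w)) (pscale (fs ! j) w)"
proof -
  have wT: "w \<in> T i" by (rule ST_T[OF w])
  have u: "up {#j#} w \<in> ST (Suc j) (i + 2)"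
    using up_ST[of w "Suc j" i "{#j#}"] ST_Suc_subset w j by auto
  have uT: "up {#j#} w \<in> T (i + 2)" by (rule ST_T[OF u])
  have "curvature (up {#j#} w) y \<ominus>\<^bsub>Q\<^esub> fs ! j \<otimes>\<^bsub>Q\<^esub> w y \<in> J j" for y
  proof -
    let ?t = "\<lambda>l. fs ! l \<otimes>\<^bsub>Q\<^esub> shift {#l#} (up {#j#} w) y"
    have c: "shift {#l#} (up {#j#} w) y \<in> carrier Q" for l by (rule T_carrier[OF shift_T[OF uT]])
    have tc: "?t l \<in> carrier Q" if "l < c" for l using c[of l] fs_carrier[OF that] by simp
    have "{..<c} = insert j ({..<c} - {j})" using j by auto
    then have "curvature (up {#j#} w) y = (\<Oplus>\<^bsub>Q\<^esub>l\<in>insert j ({..<c} - {j}). ?t l)"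
      unfolding curvature_def by simp
    also have "\<dots> = ?t j \<oplus>\<^bsub>Q\<^esub> (\<Oplus>\<^bsub>Q\<^esub>l\<in>{..<c} - {j}. ?t l)"
      by (rule Q.finsum_insert) (use tc j in auto)
    finally have eq: "curvature (up {#j#} w) y = fs ! j \<otimes>\<^bsub>Q\<^esub> w y \<oplus>\<^bsub>Q\<^esub> (\<Oplus>\<^bsub>Q\<^esub>l\<in>{..<c} - {j}. ?t l)"
      by (simp add: shift_up)
    have sJ: "(\<Oplus>\<^bsub>Q\<^esub>l\<in>{..<c} - {j}. ?t l) \<in> J j"
    proof (rule ideal_finsum[OF cring_Q J_ideal], rule Pi_I)
      fix l assume l: "l \<in> {..<c} - {j}"
      show "?t l \<in> J j"
      proof (cases "l < j")
        case True
        then show ?thesis using J_mem(5)[OF c fs_J[OF True]] l by simp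
      next
        case False
        then have "\<not> set_mset (fst y + {#l#}) \<subseteq> {..<Suc j}" using l by auto
        then have "shift {#l#} (up {#j#} w) y = \<zero>\<^bsub>Q\<^esub>" using u by (cases y) (auto simp: shift_apply ST_def)
        then show ?thesis using fs_carrier l J_mem(1) by simp
      qed
    qed
    have "curvature (up {#j#} w) y \<ominus>\<^bsub>Q\<^esub> fs ! j \<otimes>\<^bsub>Q\<^esub> w y = (\<Oplus>\<^bsub>Q\<^esub>l\<in>{..<c} - {j}. ?t l)"
      unfolding eq using J_mem(6)[OF sJ] T_carrier[OF wT, of y] fs_carrier[OF j]
      by (simp add: a_minus_def Q.a_ac Q.r_neg1 Q.r_neg2 Q.r_neg)
    then show ?thesis using sJ by simp
  qed
  then show ?thesis
    using curvature_T[OF uT] pscale_T[OF fs_carrier[OF j] wT] by (simp add: cg_def pscale_def)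
qed

text \<open>Modulo \<open>J j\<close>, and with the first \<open>j\<close> variables only, the
  complex resolves \<open>M\<close> over \<open>Q / (f_1, ..., f_j)\<close>. For
  \<open>j = 0\<close> this is the resolution \<open>F\<close>, for \<open>j = c\<close> the one
  wanted over the quotient. In degree 0, where \<open>D\<close> is zero, the cycles are the elements
  killed by \<open>e\<close>.\<close>

definition exact_mod :: "nat \<Rightarrow> bool" where
  "exact_mod j \<longleftrightarrow> (\<forall>i x. x \<in> ST j i \<longrightarrow> D i x \<in> JT j (i - 1) \<longrightarrow> (i = 0 \<longrightarrow> e (slice x {#}) = \<zero>\<^bsub>M\<^esub>) \<longrightarrow>
     (\<exists>u\<in>ST j (Suc i). cg j i x (D (Suc i) u)))"

lemma exact_bottom:
  assumes y: "y \<in> F i" and dy: "d i y = (\<lambda>_. \<zero>\<^bsub>Q\<^esub>)" and ey: "i = 0 \<Longrightarrow> e y = \<zero>\<^bsub>M\<^esub>"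
  shows "\<exists>u\<in>ST j (Suc i). cg j i (bottom y) (D (Suc i) u)"
proof -
  obtain u where u: "u \<in> F (Suc i)" "d (Suc i) u = y" using exact[OF y dy ey] by blast
  have "bottom u \<in> T (Suc i)" using mod_homD(1)[OF bottom_hom] u(1) by simp
  then have "bottom u \<in> ST j (Suc i)" by (auto simp: ST_def bottom_def)
  moreover have "D (Suc i) (bottom u) = bottom y" using D_bottom[OF u(1)] u(2) by simp
  moreover have "bottom y \<in> T i" using mod_homD(1)[OF bottom_hom] y by simp
  ultimately show ?thesis using cg_refl by (intro bexI[of _ "bottom u"]) simp_all
qed

lemma exact_mod_0: "exact_mod 0"
  unfolding exact_mod_def
proof (intro allI impI)
  fix i x assume x: "x \<in> ST 0 i" and Dx: "D i x \<in> JT 0 (i - 1)" and ex: "i = 0 \<longrightarrow> e (slice x {#}) = \<zero>\<^bsub>M\<^esub>"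
  have xb: "x = bottom (slice x {#})"
  proof
    fix y show "x y = bottom (slice x {#}) y"
      using x by (cases y) (auto simp: ST_def bottom_def slice_def)
  qed
  have s: "slice x {#} \<in> F i" using T_slice'[OF ST_T[OF x], of "{#}"] by simp
  have "bottom (d i (slice x {#})) = D i x" using D_bottom[OF s] xb by simp
  then have "bottom (d i (slice x {#})) ({#}, t) = \<zero>\<^bsub>Q\<^esub>" for t
    using Dx J_0 unfolding JT_def by auto
  then have dz: "d i (slice x {#}) = (\<lambda>_. \<zero>\<^bsub>Q\<^esub>)"
    by (simp add: bottom_def fun_eq_iff)
  show "\<exists>u\<in>ST 0 (Suc i). cg 0 i x (D (Suc i) u)"
    using exact_bottom[OF s dz, of 0] ex xb by simp
qed

text \<open>The coefficient \<open>x\<close> of the highest power of the last variable \<open>y\<close> in a cycle does not involve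
  \<open>y\<close>. If \<open>D x\<close> is congruent to \<open>fs ! j\<close> times \<open>w\<close> modulo \<open>J j\<close>, then \<open>D w\<close> vanishes modulo \<open>J j\<close> by
  regularity, because \<open>D (D x)\<close> does; hence subtracting \<open>D (w y)\<close> from \<open>x\<close> leaves a cycle modulo \<open>J j\<close>
  that does not involve \<open>y\<close>.\<close>

lemma exact_mod_core:
  assumes ex: "exact_mod j" and j: "j < c"
    and z: "z \<in> ST (Suc j) i" and Dz: "D i z \<in> JT (Suc j) (i - 1)" and i: "i \<noteq> 0"
    and m: "shift (replicate_mset (Suc m) j) z = pzero" "2 * m \<le> i"
  shows "\<exists>v\<in>ST (Suc j) (Suc (i - 2 * m)). cg j (i - 2 * m) (shift (replicate_mset m j) z) (D (Suc (i - 2 * m)) v)"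
proof -
  let ?k = "i - 2 * m" and ?f = "fs ! j"
  define x where "x = shift (replicate_mset m j) z"
  have f: "?f \<in> carrier Q" by (rule fs_carrier[OF j])
  have sx: "shift {#j#} x = pzero" using m(1) by (simp add: x_def shift_shift)
  have xS: "x \<in> ST (Suc j) ?k" using shift_ST[OF z, of "replicate_mset m j"] by (simp add: x_def)
  have x: "x \<in> ST j ?k" using low_ST[OF xS] low_shift_zero[OF sx] by simp
  have xT: "x \<in> T ?k" by (rule ST_T[OF x])
  have "\<exists>v\<in>ST (Suc j) (Suc ?k). cg j ?k x (D (Suc ?k) v)"
  proof (cases "?k = 0")
    case True
    \<comment> \<open>In degree 0 the cycle condition on \<open>x\<close> is void, so the
      coefficient \<open>x'\<close> of the next lower power is used. It has degree 2, and
      \<open>D x'\<close> is congruent to \<open>fs ! j\<close> times some \<open>w\<close>.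
      Applying \<open>D\<close> gives \<open>fs ! j\<close> times \<open>x\<close> on one side and
      \<open>fs ! j\<close> times \<open>D w\<close> on the other; regularity cancels the
      factor.\<close>
    then obtain m' where m': "m = Suc m'" using i by (cases m) auto
    have im: "i - 2 * m' = 2" using True m(2) m' by simp
    define x' where "x' = shift (replicate_mset m' j) z"
    have x'S: "x' \<in> ST (Suc j) 2" using shift_ST[OF z, of "replicate_mset m' j"] im by (simp add: x'_def)
    have x'T: "x' \<in> T 2" by (rule ST_T[OF x'S])
    have sx': "shift {#j#} x' = x" by (simp add: x'_def x_def shift_shift m')
    have uT: "up {#j#} x \<in> T 2" using up_T[OF xT, of "{#j#}"] j True by (simp add: numeral_2_eq_2)
    have lS: "low j x' \<in> ST j 2" by (rule low_ST[OF x'S])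
    have dec: "x' = padd (up {#j#} x) (low j x')" using low_decompose[OF x'T, of j] sx' by simp
    have "i - 1 - 2 * m' = 1" using im by simp
    then have "D 2 x' \<in> JT (Suc j) 1"
      using shift_JT[OF Dz, of "replicate_mset m' j"] shift_D[of "replicate_mset m' j" i z] im
      by (simp add: x'_def del: diff_diff_left)
    moreover have "D 2 x' \<in> ST j 1" using ST_low_degree[OF D_T[OF x'T]] by simp
    ultimately obtain w where w: "w \<in> ST j 1" "cg j 1 (D 2 x') (pscale ?f w)"
      using lift_cg[OF j] by blast
    have wT: "w \<in> T 1" by (rule ST_T[OF w(1)])
    have "cg j 0 (D 1 (D 2 x')) (pscale ?f (D 1 w))" using cg_D[OF w(2)] D_pscale[OF f wT] by simp
    moreover have "D 1 (D 2 x') = padd (curvature (up {#j#} x)) (curvature (low j x'))"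
      using D_D[OF x'T] mod_homD(2)[OF curvature_hom, of "up {#j#} x" 2 "low j x'"] uT ST_T[OF lS] dec
      by (simp add: padd_def)
    moreover have "cg j 0 (padd (curvature (up {#j#} x)) (curvature (low j x'))) (padd (pscale ?f x) pzero)"
    proof (rule cg_padd)
      show "cg j 0 (curvature (up {#j#} x)) (pscale ?f x)" using curvature_up[OF x j] True by simp
      show "cg j 0 (curvature (low j x')) pzero" using curvature_JT[OF lS] j by (simp add: cg_pzero)
    qed
    moreover have "padd (pscale ?f x) pzero = pscale ?f x"
      using T_carrier[OF xT] f by (simp add: padd_def pscale_def)
    ultimately have "cg j 0 (pscale ?f x) (pscale ?f (D 1 w))"
      using cg_trans cg_sym by metis
    then have "cg j 0 x (D 1 w)" using cg_regular[OF j, of x 0 "D 1 w"] xT True D_T[OF wT] by simp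
    then show ?thesis using True w(1) ST_Suc_subset by auto
  next
    case False
    have DxJ: "D ?k x \<in> JT (Suc j) (?k - 1)"
      using shift_JT[OF Dz, of "replicate_mset m j"] shift_D[of "replicate_mset m j" i z]
      by (simp add: x_def diff_commute)
    obtain w where w: "w \<in> ST j (?k - 1)" "cg j (?k - 1) (D ?k x) (pscale ?f w)"
      using lift_cg[OF j D_ST[OF x] DxJ] by blast
    have wT: "w \<in> T (?k - 1)" by (rule ST_T[OF w(1)])
    have "cg j (?k - 1 - 1) (curvature x) (pscale ?f (D (?k - 1) w))"
      using cg_D[OF w(2)] D_pscale[OF f wT] D_D[OF xT] by simp
    moreover have "curvature x \<in> JT j (?k - 1 - 1)" using curvature_JT[OF x] j by (simp add: numeral_2_eq_2)
    ultimately have "pscale ?f (D (?k - 1) w) \<in> JT j (?k - 1 - 1)" by (rule cg_JT)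
    then have DwJ: "\<And>y. D (?k - 1) w y \<in> J j"
      using J_regular[OF j T_carrier[OF D_T[OF wT]]] unfolding JT_def pscale_def by blast
    let ?u = "up {#j#} w"
    have k1: "?k - 1 + 2 * size {#j#} = Suc ?k" using False by simp
    have uS: "?u \<in> ST (Suc j) (Suc ?k)"
      unfolding k1[symmetric] by (rule up_ST) (use ST_Suc_subset[of j "?k - 1"] w(1) j in auto)
    have uT: "?u \<in> T (Suc ?k)" by (rule ST_T[OF uS])
    \<comment> \<open>\<open>?u\<close> is \<open>w\<close> times the variable. Contracting its
      boundary by that variable gives \<open>D w\<close>, which is zero modulo \<open>J j\<close>,
      so the boundary may be replaced by its part \<open>low j s0\<close> in
      \<open>ST j\<close>.\<close>
    define s0 where "s0 = D (Suc ?k) ?u"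
    have s0S: "s0 \<in> ST (Suc j) ?k" using D_ST[OF uS] by (simp add: s0_def)
    have s0T: "s0 \<in> T ?k" by (rule ST_T[OF s0S])
    have "shift {#j#} s0 = D (?k - 1) w"
      using shift_D[of "{#j#}" "Suc ?k" ?u] shift_up[of "{#j#}" w] by (simp add: s0_def)
    then have s01: "cg j ?k s0 (low j s0)" using low_cg[OF s0T] DwJ by simp
    have lS: "low j s0 \<in> ST j ?k" by (rule low_ST[OF s0S])
    have lT: "low j s0 \<in> T ?k" by (rule ST_T[OF lS])
    have "D ?k s0 = curvature ?u" using D_D[OF uT] by (simp add: s0_def)
    then have "cg j (?k - 1) (D ?k s0) (pscale ?f w)" using curvature_up[OF w(1) j] by simp
    then have "cg j (?k - 1) (D ?k x) (D ?k (low j s0))"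
      using cg_trans[OF w(2) cg_trans[OF cg_sym cg_D[OF s01]]] by blast
    then have "D ?k (psub x (low j s0)) \<in> JT j (?k - 1)"
      using cg_psub[OF D_T[OF xT] D_T[OF lT]] D_psub[OF xT lT] by simp
    then obtain v where v: "v \<in> ST j (Suc ?k)" "cg j ?k (psub x (low j s0)) (D (Suc ?k) v)"
      using ex[unfolded exact_mod_def, rule_format, OF psub_ST[OF x lS]] False by blast
    have vT: "v \<in> T (Suc ?k)" by (rule ST_T[OF v(1)])
    have "x = padd (psub x (low j s0)) (low j s0)"
    proof
      fix y show "x y = padd (psub x (low j s0)) (low j s0) y"
        using T_carrier[OF xT, of y] T_carrier[OF lT, of y]
        by (simp add: padd_def psub_def a_minus_def Q.a_assoc Q.l_neg)
    qed
    moreover have "cg j ?k (padd (psub x (low j s0)) (low j s0)) (padd (D (Suc ?k) v) s0)"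
      by (rule cg_padd[OF v(2) cg_sym[OF s01]])
    moreover have "padd (D (Suc ?k) v) s0 = D (Suc ?k) (padd v ?u)"
      using D_padd[OF vT uT] by (simp add: s0_def)
    ultimately have "cg j ?k x (D (Suc ?k) (padd v ?u))" by simp
    moreover have "padd v ?u \<in> ST (Suc j) (Suc ?k)" using padd_ST[OF _ uS] v(1) ST_Suc_subset by blast
    ultimately show ?thesis by blast
  qed
  then show ?thesis unfolding x_def .
qed

text \<open>Induction on a bound \<open>m\<close> for the powers of the variable \<open>j\<close> in
  a cycle: the top coefficient is a boundary modulo \<open>J j\<close>, and subtracting the boundary
  of \<open>v\<close> times the top power removes it up to \<open>J j\<close>. Degree 0 is treated
  apart, since \<open>T 0\<close> is a copy of \<open>F 0\<close> and the exactness of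
  \<open>F\<close> at the augmentation applies there.\<close>

lemma exact_mod_Suc:
  assumes ex: "exact_mod j" and j: "j < c"
  shows "exact_mod (Suc j)"
proof -
  have main: "\<exists>u\<in>ST (Suc j) (Suc i). cg (Suc j) i z (D (Suc i) u)"
    if "z \<in> ST (Suc j) i" "D i z \<in> JT (Suc j) (i - 1)" "i \<noteq> 0" "shift (replicate_mset m j) z = pzero" for i z m
    using that
  proof (induction m arbitrary: z)
    case 0
    then have z: "z = pzero" by simp
    have "pzero \<in> ST (Suc j) (Suc i)" using T_mem(1) by (simp add: ST_def)
    moreover have "D (Suc i) pzero = pzero" using mod_hom_zero[OF module_T module_T D_hom] by simp
    ultimately show ?case using z cg_refl[OF T_mem(1)] by (intro bexI[of _ pzero]) simp_all
  next
    case (Suc m)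
    let ?B = "replicate_mset m j"
    have zT: "z \<in> T i" by (rule ST_T[OF Suc.prems(1)])
    have Bc: "set_mset ?B \<subseteq> {..<c}" "set_mset ?B \<subseteq> {..<Suc j}" using j by auto
    show ?case
    proof (cases "2 * m \<le> i")
      case False
      then have "shift ?B z = pzero" using shift_T_zero[OF zT, of ?B] by simp
      then show ?thesis using Suc.IH Suc.prems by blast
    next
      case True
      let ?k = "i - 2 * m"
      obtain v where v: "v \<in> ST (Suc j) (Suc ?k)" "cg j ?k (shift ?B z) (D (Suc ?k) v)"
        using exact_mod_core[OF ex j Suc.prems(1-4) True] by blast
      define u1 where "u1 = up ?B v"
      have "Suc ?k + 2 * m = Suc i" using True by simp
      then have u1: "u1 \<in> ST (Suc j) (Suc i)"
        using up_ST[OF v(1) Bc(2)] j by (simp add: u1_def)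
      have u1T: "u1 \<in> T (Suc i)" by (rule ST_T[OF u1])
      have Du1: "D (Suc i) u1 \<in> ST (Suc j) i" using D_ST[OF u1] by simp
      have Du1T: "D (Suc i) u1 \<in> T i" by (rule ST_T[OF Du1])
      have sDu1: "shift ?B (D (Suc i) u1) = D (Suc ?k) v"
        using shift_D[of ?B "Suc i" u1] shift_up[of ?B v] True by (simp add: u1_def Suc_diff_le)
      define z1 where "z1 = psub z (D (Suc i) u1)"
      have z1: "z1 \<in> ST (Suc j) i" unfolding z1_def by (rule psub_ST[OF Suc.prems(1) Du1])
      have z1T: "z1 \<in> T i" by (rule ST_T[OF z1])
      have "shift ?B z1 = psub (shift ?B z) (D (Suc ?k) v)"
        unfolding z1_def sDu1[symmetric] by (auto simp: psub_def shift_def)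
      moreover have "shift ?B z \<in> T ?k" "D (Suc ?k) v \<in> T ?k" using v(2) by (auto simp: cg_def)
      ultimately have t: "shift ?B z1 \<in> JT j ?k" using v(2) by (simp add: cg_psub)
      \<comment> \<open>The top coefficient of \<open>z1\<close> lies in \<open>JT j\<close> but may
        be nonzero, while the induction asks for zero. It is split off as \<open>q\<close>, which
        vanishes modulo \<open>J (Suc j)\<close> and so does not affect the claim.\<close>
      define q where "q = up ?B (shift ?B z1)"
      have ki: "?k + 2 * m = i" using True by simp
      have qJ: "q \<in> JT j i" using up_JT[OF t Bc(1)] ki by (simp add: q_def)
      have qJ': "q \<in> JT (Suc j) i" using qJ JT_Suc_subset by blast
      have qT: "q \<in> T i" by (rule JT_T[OF qJ])
      have qS: "q \<in> ST (Suc j) i"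
        using up_ST[OF shift_ST[OF z1, of ?B] Bc(2)] j ki by (simp add: q_def)
      have z2: "psub z1 q \<in> ST (Suc j) i" by (rule psub_ST[OF z1 qS])
      have "shift ?B (psub z1 q) = psub (shift ?B z1) (shift ?B q)" by (auto simp: psub_def shift_def)
      also have "\<dots> = pzero"
        using T_carrier[OF JT_T[OF t]] by (simp add: q_def shift_up psub_def a_minus_def Q.r_neg)
      finally have sz2: "shift ?B (psub z1 q) = pzero" .
      have "D i (psub z1 q) = psub (psub (D i z) (curvature u1)) (D i q)"
        using D_psub[OF z1T qT] D_psub[OF zT Du1T] D_D[OF u1T] by (simp add: z1_def)
      moreover have "psub (psub (D i z) (curvature u1)) (D i q) \<in> JT (Suc j) (i - 1)"
      proof -
        have "curvature u1 \<in> JT (Suc j) (i - 1)" using curvature_JT[OF u1] j by simp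
        then show ?thesis
          using Suc.prems(2) D_JT[OF qJ'] psub_T J_mem(7) by (auto simp: JT_def psub_def[abs_def])
      qed
      ultimately have "D i (psub z1 q) \<in> JT (Suc j) (i - 1)" by simp
      then obtain u2 where u2: "u2 \<in> ST (Suc j) (Suc i)" "cg (Suc j) i (psub z1 q) (D (Suc i) u2)"
        using Suc.IH[OF z2 _ Suc.prems(3) sz2] by blast
      have u2T: "u2 \<in> T (Suc i)" by (rule ST_T[OF u2(1)])
      have "z = padd (D (Suc i) u1) (padd (psub z1 q) q)"
      proof
        fix y show "z y = padd (D (Suc i) u1) (padd (psub z1 q) q) y"
          using T_carrier[OF zT, of y] T_carrier[OF Du1T, of y] T_carrier[OF qT, of y]
          by (simp add: z1_def padd_def psub_def a_minus_def Q.a_assoc Q.l_neg)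
            (simp add: Q.a_ac Q.r_neg1 Q.r_neg2 Q.r_neg)
      qed
      moreover have "cg (Suc j) i (padd (D (Suc i) u1) (padd (psub z1 q) q)) (padd (D (Suc i) u1) (padd (D (Suc i) u2) pzero))"
        using qJ' cg_pzero by (intro cg_padd cg_refl[OF Du1T] u2(2)) blast
      moreover have "padd (D (Suc i) u2) pzero = D (Suc i) u2"
        using T_carrier[OF D_T[OF u2T]] by (simp add: padd_def)
      ultimately have "cg (Suc j) i z (D (Suc i) (padd u1 u2))"
        using D_padd[OF u1T u2T] by simp
      then show ?thesis using padd_ST[OF u1 u2(1)] by blast
    qed
  qed
  show ?thesis
    unfolding exact_mod_def
  proof (intro allI impI)
    fix i x assume x: "x \<in> ST (Suc j) i" and Dx: "D i x \<in> JT (Suc j) (i - 1)"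
      and ex: "i = 0 \<longrightarrow> e (slice x {#}) = \<zero>\<^bsub>M\<^esub>"
    show "\<exists>u\<in>ST (Suc j) (Suc i). cg (Suc j) i x (D (Suc i) u)"
    proof (cases "i = 0")
      case True
      have "x = bottom (slice x {#})" by (rule bottom_slice[OF ST_T[OF x]]) (simp add: True)
      moreover have "slice x {#} \<in> F i" using T_slice'[OF ST_T[OF x], of "{#}"] by simp
      ultimately show ?thesis using exact_bottom[of "slice x {#}" i "Suc j"] ex d_0 True by auto
    next
      case False
      \<comment> \<open>A monomial of size \<open>i + 1\<close> has degree \<open>2 (i + 1)\<close>,
        above \<open>i\<close>, so \<open>Suc i\<close> bounds the powers that occur.\<close>
      have "shift (replicate_mset (Suc i) j) x = pzero"
        by (rule shift_T_zero[OF ST_T[OF x]]) simp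
      then show ?thesis using main[OF x Dx False] by blast
    qed
  qed
qed

text \<open>With all \<open>c\<close> variables \<open>ST c i\<close> is the whole of
  \<open>T i\<close>. This is the exactness on which the comparison maps into the reduction of
  \<open>T\<close> rely.\<close>

lemma exact_T:
  assumes x: "x \<in> T i" and Dx: "\<And>y. D i x y \<in> J c" and ex: "i = 0 \<Longrightarrow> e (slice x {#}) = \<zero>\<^bsub>M\<^esub>"
  shows "\<exists>u\<in>T (Suc i). \<forall>y. x y \<ominus>\<^bsub>Q\<^esub> D (Suc i) u y \<in> J c"
proof -
  have "j \<le> c \<Longrightarrow> exact_mod j" for j
    by (induction j) (auto intro: exact_mod_0 exact_mod_Suc)
  then have "exact_mod c" by simp
  then show ?thesis
    unfolding exact_mod_def ST_c using x Dx ex D_T[OF x] unfolding JT_def cg_def by blast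
qed

end

section \<open>Ext over the quotient ring\<close>

lemma restrict_scalars_simps [simp]:
  "carrier (restrict_scalars \<phi> Y) = carrier Y"
  "\<zero>\<^bsub>restrict_scalars \<phi> Y\<^esub> = \<zero>\<^bsub>Y\<^esub>"
  "x \<oplus>\<^bsub>restrict_scalars \<phi> Y\<^esub> y = x \<oplus>\<^bsub>Y\<^esub> y"
  "a \<odot>\<^bsub>restrict_scalars \<phi> Y\<^esub> x = \<phi> a \<odot>\<^bsub>Y\<^esub> x"
  by (simp_all add: restrict_scalars_def)

lemma restrict_scalars_minus [simp]: "x \<ominus>\<^bsub>restrict_scalars \<phi> Y\<^esub> y = x \<ominus>\<^bsub>Y\<^esub> y"
  by (simp add: a_minus_def a_inv_def m_inv_def restrict_scalars_def)

lemma restrict_scalars_module: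
  assumes "cring R" "\<phi> \<in> ring_hom R S" "module S Y"
  shows "module R (restrict_scalars \<phi> Y)"
proof -
  interpret R: cring R by fact
  interpret Y: module S Y by fact
  have "abelian_group (restrict_scalars \<phi> Y)"
  proof (rule abelian_groupI)
    fix x assume "x \<in> carrier (restrict_scalars \<phi> Y)"
    then show "\<exists>y\<in>carrier (restrict_scalars \<phi> Y). y \<oplus>\<^bsub>restrict_scalars \<phi> Y\<^esub> x = \<zero>\<^bsub>restrict_scalars \<phi> Y\<^esub>"
      using Y.M.l_neg[of x] by (intro bexI[of _ "\<ominus>\<^bsub>Y\<^esub> x"]) simp_all
  qed (simp_all add: Y.M.a_ac)
  then show ?thesis
    using ring_hom_memE[OF assms(2)]
    by (intro moduleI[OF assms(1)]) (simp_all add: Y.smult_l_distr Y.smult_r_distr Y.smult_assoc1)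
qed

lemma mod_hom_restrict_scalars:
  assumes "\<phi> \<in> ring_hom R S" "f \<in> mod_hom S X Y"
  shows "f \<in> mod_hom R (restrict_scalars \<phi> X) (restrict_scalars \<phi> Y)"
  using mod_homD[OF assms(2)] ring_hom_memE(1)[OF assms(1)] by (intro mod_homI) simp_all

lemma Hom_module_simps [simp]:
  "carrier (Hom_module R M N) = mod_hom R M N \<inter> extensional (carrier M)"
  "\<zero>\<^bsub>Hom_module R M N\<^esub> = (\<lambda>x\<in>carrier M. \<zero>\<^bsub>N\<^esub>)"
  "f \<oplus>\<^bsub>Hom_module R M N\<^esub> g = (\<lambda>x\<in>carrier M. f x \<oplus>\<^bsub>N\<^esub> g x)"
  "a \<odot>\<^bsub>Hom_module R M N\<^esub> f = (\<lambda>x\<in>carrier M. a \<odot>\<^bsub>N\<^esub> f x)"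
  by (simp_all add: Hom_module_def)

lemma restrict_mod_hom:
  assumes "module R M" "f \<in> mod_hom R M N"
  shows "restrict f (carrier M) \<in> mod_hom R M N"
  using mod_hom_cong[OF assms(1), of "restrict f (carrier M)" f N] assms(2) by simp

lemma precomposition_hom:
  assumes P: "module R P" and P': "module R P'" and N: "module R N" and d: "d \<in> mod_hom R P P'"
  shows "(\<lambda>f. \<lambda>x\<in>carrier P. f (d x)) \<in> mod_hom R (Hom_module R P' N) (Hom_module R P N)"
proof (rule mod_homI)
  note d' = mod_homD(1)[OF d]
  show "(\<lambda>x\<in>carrier P. f (d x)) \<in> carrier (Hom_module R P N)" if "f \<in> carrier (Hom_module R P' N)" for f
  proof -
    have "f \<in> mod_hom R P' N" using that by simp
    from mod_hom_comp[OF d this] have "(\<lambda>x. f (d x)) \<in> mod_hom R P N" .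
    from restrict_mod_hom[OF P this] show ?thesis by simp
  qed
qed (auto simp: fun_eq_iff restrict_def dest: mod_homD(1)[OF d])

text \<open>The zero of the quotient is \<open>B\<close> itself, so a multiple of the coset of
  \<open>f\<close> vanishes exactly when the multiple of \<open>f\<close> lies in \<open>B\<close>:
  annihilators of classes are colon ideals of representatives.\<close>

lemma quotient_module_annihilator:
  assumes H: "module R H" and Z: "submodule Z R H" and B: "submodule B R H" and BZ: "B \<subseteq> Z"
    and C: "C \<in> carrier (quotient_module (H\<lparr>carrier := Z\<rparr>) B)"
  shows "\<exists>f\<in>Z. module_ann R (quotient_module (H\<lparr>carrier := Z\<rparr>) B) C = {a \<in> carrier R. a \<odot>\<^bsub>H\<^esub> f \<in> B}"
proof -
  let ?H = "H\<lparr>carrier := Z\<rparr>"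
  have HZ: "module R ?H" by (rule submodule.submodule_is_module[OF Z H])
  have BH: "submodule B R ?H" using module_submodule_trans[OF H Z BZ] B by simp
  interpret HZ: module R ?H by (rule HZ)
  interpret B: abelian_subgroup B ?H
    by (rule abelian_subgroupI3)
      (use submodule.axioms(1)[OF BH] HZ.M.abelian_group_axioms in \<open>auto simp: additive_subgroup_def\<close>)
  obtain f where f: "f \<in> Z" "C = B +>\<^bsub>?H\<^esub> f"
    using C by (auto simp: quotient_module_def A_RCOSETS_def')
  have "a \<odot>\<^bsub>quotient_module ?H B\<^esub> C = \<zero>\<^bsub>quotient_module ?H B\<^esub> \<longleftrightarrow> a \<odot>\<^bsub>H\<^esub> f \<in> B" if a: "a \<in> carrier R" for a
  proof -
    have af: "a \<odot>\<^bsub>?H\<^esub> f \<in> carrier ?H" using HZ.smult_closed[OF a, of f] f(1) by simp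
    have "a \<odot>\<^bsub>quotient_module ?H B\<^esub> C = B +>\<^bsub>?H\<^esub> (a \<odot>\<^bsub>?H\<^esub> f)"
      unfolding f(2) using quotient_module_module(2)[OF HZ BH a, of f] f(1) by simp
    moreover have "B +>\<^bsub>?H\<^esub> (a \<odot>\<^bsub>?H\<^esub> f) = B \<longleftrightarrow> a \<odot>\<^bsub>?H\<^esub> f \<in> B"
      using B.a_rcos_self[OF af] B.a_rcos_const[of "a \<odot>\<^bsub>?H\<^esub> f"] by auto
    ultimately show ?thesis by (simp add: quotient_module_def)
  qed
  then show ?thesis using f(1) by (intro bexI[of _ f]) (auto simp: module_ann_def)
qed

text \<open>Stated by values on the carriers and for arbitrary functions, so that extensionality of
  the elements of \<open>Hom\<close> is dealt with once, in the passage from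
  \<open>Hom_coboundaries\<close>.\<close>

definition is_coboundary ::
  "('a, 'b) ring_scheme \<Rightarrow> (nat \<Rightarrow> ('a, 'p) module) \<Rightarrow> (nat \<Rightarrow> 'p \<Rightarrow> 'p) \<Rightarrow> ('a, 'n, 'd) module_scheme \<Rightarrow>
    nat \<Rightarrow> ('p \<Rightarrow> 'n) \<Rightarrow> bool" where
  "is_coboundary R P d N i f \<longleftrightarrow> (case i of
     0 \<Rightarrow> \<forall>x\<in>carrier (P 0). f x = \<zero>\<^bsub>N\<^esub>
   | Suc j \<Rightarrow> \<exists>g\<in>mod_hom R (P j) N. \<forall>x\<in>carrier (P (Suc j)). f x = g (d j x))"

text \<open>Cocycles and coboundaries are kernel and image of precomposition with the differential
  (in degree 0 the coboundaries are zero), hence submodules; an annihilator in their quotient is the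
  colon ideal of a cocycle.\<close>

lemma Ass_Hom_cohomology:
  fixes P :: "nat \<Rightarrow> ('a, 'p) module" and N :: "('a, 'n, 'd) module_scheme"
  assumes res: "projective_resolution R M P d e" and N: "module R N"
    and p: "p \<in> Ass R (Hom_cohomology R P d N i)"
  shows "primeideal p R \<and> (\<exists>f\<in>mod_hom R (P i) N. (\<forall>x\<in>carrier (P (Suc i)). f (d i x) = \<zero>\<^bsub>N\<^esub>) \<and>
    p = {a \<in> carrier R. is_coboundary R P d N i (\<lambda>x. a \<odot>\<^bsub>N\<^esub> f x)})"
proof -
  note PD = projective_resolutionD[OF res]
  let ?H = "\<lambda>i. Hom_module R (P i) N"
  have H: "module R (?H i)" for i by (rule Hom_module_module[OF PD(2) N])
  have pre: "(\<lambda>f. \<lambda>x\<in>carrier (P (Suc i)). f (d i x)) \<in> mod_hom R (?H i) (?H (Suc i))" for i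
    by (rule precomposition_hom[OF PD(2) PD(2) N PD(3)])
  let ?Z = "Hom_cocycles R P d N i" and ?B = "Hom_coboundaries R P d N i"
  have Zeq: "?Z = {f \<in> carrier (?H i). (\<lambda>x\<in>carrier (P (Suc i)). f (d i x)) \<in> {\<zero>\<^bsub>?H (Suc i)\<^esub>}}"
    by (auto simp: Hom_cocycles_def fun_eq_iff restrict_def)
  have Z: "submodule ?Z R (?H i)"
    unfolding Zeq by (rule submodule_vimage[OF H H pre submodule_singleton_zero[OF H]])
  have B: "submodule ?B R (?H i)"
  proof (cases i)
    case 0
    then show ?thesis unfolding Hom_coboundaries_def by (simp only: nat.case submodule_singleton_zero[OF H])
  next
    case (Suc j)
    then show ?thesis
      unfolding Hom_coboundaries_def
      using submodule_image[OF H H pre module.carrier_is_submodule[OF H], of j] by simp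
  qed
  interpret N: module R N by fact
  have BZ: "?B \<subseteq> ?Z"
  proof (cases i)
    case 0
    then show ?thesis
      using submodule_zero[OF H Z] by (simp add: Hom_coboundaries_def)
  next
    case (Suc j)
    show ?thesis
    proof
      fix f assume f: "f \<in> ?B"
      then obtain g where g: "g \<in> mod_hom R (P j) N" "f = (\<lambda>x\<in>carrier (P (Suc j)). g (d j x))"
        unfolding Hom_coboundaries_def Suc by auto
      have "f (d i x) = \<zero>\<^bsub>N\<^esub>" if x: "x \<in> carrier (P (Suc i))" for x
        using PD(9)[of x j] x mod_homD(1)[OF PD(3), of x "Suc j"] mod_hom_zero[OF PD(2) N g(1)]
        by (simp add: g(2) Suc)
      then show "f \<in> ?Z" using module.submoduleE(1)[OF H B] f unfolding Hom_cocycles_def by blast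
    qed
  qed
  have Bmem: "f \<in> ?B \<longleftrightarrow> is_coboundary R P d N i f" if f: "f \<in> carrier (?H i)" for f
  proof (cases i)
    case 0
    have "f \<in> extensional (carrier (P 0))" using f 0 by simp
    then have "f = (\<lambda>x\<in>carrier (P 0). \<zero>\<^bsub>N\<^esub>) \<longleftrightarrow> (\<forall>x\<in>carrier (P 0). f x = \<zero>\<^bsub>N\<^esub>)"
      by (auto simp: fun_eq_iff restrict_def extensional_def)
    then show ?thesis by (simp add: Hom_coboundaries_def is_coboundary_def 0)
  next
    case (Suc j)
    have fe: "f \<in> extensional (carrier (P (Suc j)))" using f Suc by simp
    show ?thesis
    proof
      assume "f \<in> ?B"
      then obtain g where "g \<in> mod_hom R (P j) N" "f = (\<lambda>x\<in>carrier (P (Suc j)). g (d j x))"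
        unfolding Hom_coboundaries_def Suc by auto
      then show "is_coboundary R P d N i f" by (auto simp: is_coboundary_def Suc)
    next
      assume "is_coboundary R P d N i f"
      then obtain g where g: "g \<in> mod_hom R (P j) N" "\<forall>x\<in>carrier (P (Suc j)). f x = g (d j x)"
        by (auto simp: is_coboundary_def Suc)
      let ?g = "restrict g (carrier (P j))"
      have "?g \<in> carrier (?H j)" using restrict_mod_hom[OF PD(2) g(1)] by simp
      moreover have "f = (\<lambda>x\<in>carrier (P (Suc j)). ?g (d j x))"
        using fe g(2) mod_homD(1)[OF PD(3)] by (auto simp: fun_eq_iff restrict_def extensional_def)
      ultimately show "f \<in> ?B" unfolding Hom_coboundaries_def Suc nat.case by - (rule image_eqI[where x = ?g], assumption+)
    qed
  qed
  obtain C where pr: "primeideal p R" and C: "C \<in> carrier (Hom_cohomology R P d N i)"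
    "p = module_ann R (Hom_cohomology R P d N i) C"
    using p unfolding Ass_def by blast
  obtain f where f: "f \<in> ?Z" "p = {a \<in> carrier R. a \<odot>\<^bsub>?H i\<^esub> f \<in> ?B}"
    using quotient_module_annihilator[OF H Z B BZ C(1)[unfolded Hom_cohomology_def]]
    unfolding C(2) Hom_cohomology_def by blast
  have fH: "f \<in> carrier (?H i)" using f(1) by (simp add: Hom_cocycles_def)
  have cong: "is_coboundary R P d N i (\<lambda>x\<in>carrier (P i). k x) \<longleftrightarrow> is_coboundary R P d N i k" for k
    by (auto simp: is_coboundary_def split: nat.splits)
  have "a \<odot>\<^bsub>?H i\<^esub> f \<in> ?B \<longleftrightarrow> is_coboundary R P d N i (\<lambda>x. a \<odot>\<^bsub>N\<^esub> f x)" if a: "a \<in> carrier R" for a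
  proof -
    have "a \<odot>\<^bsub>?H i\<^esub> f \<in> carrier (?H i)" by (rule module.smult_closed[OF H a fH])
    from Bmem[OF this] show ?thesis using cong[of "\<lambda>x. a \<odot>\<^bsub>N\<^esub> f x"] by simp
  qed
  then have "p = {a \<in> carrier R. is_coboundary R P d N i (\<lambda>x. a \<odot>\<^bsub>N\<^esub> f x)}" using f(2) by blast
  moreover have "f \<in> mod_hom R (P i) N" "\<forall>x\<in>carrier (P (Suc i)). f (d i x) = \<zero>\<^bsub>N\<^esub>"
    using f(1) by (auto simp: Hom_cocycles_def)
  ultimately show ?thesis using pr by blast
qed

lemma chosen_resolution_exists:
  fixes M :: "('a, 'm, 'c) module_scheme"
  assumes "module R M"
  shows "\<exists>P d e. chosen_resolution R M = (P, d) \<and> projective_resolution R M P d e"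
proof -
  obtain P d e where "projective_resolution R M (P :: nat \<Rightarrow> ('a, ('a, 'm) res_elem) module) d e"
    using projective_resolution_exists[OF assms] by blast
  then have "\<exists>z. case z of (P :: nat \<Rightarrow> ('a, ('a, 'm) res_elem) module, d) \<Rightarrow> \<exists>e. projective_resolution R M P d e"
    by auto
  from someI_ex[OF this] show ?thesis
    unfolding chosen_resolution_def by (auto split: prod.splits)
qed

section \<open>Reduction of T to the quotient ring and comparison with an arbitrary
  resolution\<close>

locale complete_intersection =
  fixes Q :: "'q ring" and fs :: "'q list" and A :: "'q set ring" and M :: "('q set, 'm) module"
    and r W F d e n
  assumes A: "A = Q Quot (genideal Q (set fs))" and MA: "module A M"
    and resolution: "regular_quotient Q (restrict_scalars (\<lambda>q. genideal Q (set fs) +>\<^bsub>Q\<^esub> q) M) r W F d e n fs"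
begin

definition \<pi> :: "'q \<Rightarrow> 'q set" where
  "\<pi> q = genideal Q (set fs) +>\<^bsub>Q\<^esub> q"

sublocale regular_quotient Q "restrict_scalars \<pi> M" r W F d e n fs
  using resolution unfolding \<pi>_def[abs_def] .

lemma ideal_fs: "ideal (genideal Q (set fs)) Q"
  by (rule Q.genideal_ideal[OF fs_subset])

lemma pi_hom: "\<pi> \<in> ring_hom Q A"
  unfolding A \<pi>_def[abs_def] by (rule ideal.rcos_ring_hom[OF ideal_fs])

lemmas pi_mem = ring_hom_memE[OF pi_hom]

lemma cring_A: "cring A"
  using MA by (simp add: module_def)

lemma pi_surj: "a \<in> carrier A \<Longrightarrow> \<exists>q\<in>carrier Q. \<pi> q = a"
  unfolding A FactRing_def \<pi>_def by (auto simp: A_RCOSETS_def')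

lemma pi_eq_iff: "a \<in> carrier Q \<Longrightarrow> b \<in> carrier Q \<Longrightarrow> \<pi> a = \<pi> b \<longleftrightarrow> a \<ominus>\<^bsub>Q\<^esub> b \<in> J c"
  unfolding \<pi>_def J_c using Q.quotient_eq_iff_same_a_r_cos[OF ideal_fs] by simp

lemma pi_zero: "\<pi> \<zero>\<^bsub>Q\<^esub> = \<zero>\<^bsub>A\<^esub>"
proof -
  interpret A: cring A by (rule cring_A)
  have "\<pi> \<zero>\<^bsub>Q\<^esub> = \<pi> \<zero>\<^bsub>Q\<^esub> \<oplus>\<^bsub>A\<^esub> \<pi> \<zero>\<^bsub>Q\<^esub>" using pi_mem(3)[of "\<zero>\<^bsub>Q\<^esub>" "\<zero>\<^bsub>Q\<^esub>"] by simp
  then show ?thesis using pi_mem(1)[of "\<zero>\<^bsub>Q\<^esub>"] A.add.r_cancel_one' by simp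
qed

lemma pi_zero_iff: "a \<in> carrier Q \<Longrightarrow> \<pi> a = \<zero>\<^bsub>A\<^esub> \<longleftrightarrow> a \<in> J c"
  using pi_eq_iff[of a "\<zero>\<^bsub>Q\<^esub>"] pi_zero by (simp add: a_minus_def)

abbreviation rs :: "('q set, 'y) module \<Rightarrow> ('q, 'y) module" where
  "rs Y \<equiv> restrict_scalars \<pi> Y"

lemma rs_module: "module A Y \<Longrightarrow> module Q (rs Y)"
  by (rule restrict_scalars_module[OF cring_Q pi_hom])

lemma rs_hom: "f \<in> mod_hom A X Y \<Longrightarrow> f \<in> mod_hom Q (rs X) (rs Y)"
  by (rule mod_hom_restrict_scalars[OF pi_hom])

definition red :: "(nat multiset \<times> nat \<Rightarrow> 'q) \<Rightarrow> nat multiset \<times> nat \<Rightarrow> 'q set" where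
  "red x = (\<lambda>y. \<pi> (x y))"

text \<open>This is \<open>T i\<close> tensored with \<open>A\<close>, realised by reducing
  coordinates. The expansion in the dual basis shows that an element of \<open>T i\<close> with all
  coordinates in the ideal is a combination of basis vectors with coefficients in the ideal, so the
  reduction has the kernel of the tensor product.\<close>

definition TA :: "nat \<Rightarrow> ('q set, nat multiset \<times> nat \<Rightarrow> 'q set) module" where
  "TA i = fmod A (red ` T i)"

lemma red_padd: "x \<in> T i \<Longrightarrow> y \<in> T i \<Longrightarrow> red (\<lambda>s. x s \<oplus>\<^bsub>Q\<^esub> y s) = (\<lambda>s. red x s \<oplus>\<^bsub>A\<^esub> red y s)"
  using T_carrier pi_mem(3) by (auto simp: red_def)

lemma red_pscale: "q \<in> carrier Q \<Longrightarrow> x \<in> T i \<Longrightarrow> red (\<lambda>s. q \<otimes>\<^bsub>Q\<^esub> x s) = (\<lambda>s. \<pi> q \<otimes>\<^bsub>A\<^esub> red x s)"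
  using T_carrier pi_mem(2) by (auto simp: red_def)

lemma TA_module: "module A (TA i)"
  unfolding TA_def
proof (rule module_fmodI[OF cring_A])
  show "u y \<in> carrier A" if "u \<in> red ` T i" for u y
    using that pi_mem(1)[OF T_carrier] unfolding red_def by blast
  show "(\<lambda>_. \<zero>\<^bsub>A\<^esub>) \<in> red ` T i"
    using T_mem(1) pi_zero by (intro image_eqI[of _ _ pzero]) (auto simp: red_def)
  show "(\<lambda>s. u s \<oplus>\<^bsub>A\<^esub> v s) \<in> red ` T i" if "u \<in> red ` T i" "v \<in> red ` T i" for u v
  proof -
    obtain x y where "x \<in> T i" "u = red x" "y \<in> T i" "v = red y" using \<open>u \<in> red ` T i\<close> \<open>v \<in> red ` T i\<close> by auto
    then show ?thesis
      by (intro image_eqI[of _ red "\<lambda>s. x s \<oplus>\<^bsub>Q\<^esub> y s"]) (simp_all add: red_padd T_mem(2))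
  qed
  show "(\<lambda>s. a \<otimes>\<^bsub>A\<^esub> u s) \<in> red ` T i" if a: "a \<in> carrier A" and u: "u \<in> red ` T i" for a u
  proof -
    obtain q where "q \<in> carrier Q" "\<pi> q = a" using pi_surj[OF a] by auto
    moreover obtain x where "x \<in> T i" "u = red x" using u by auto
    ultimately show ?thesis
      by (intro image_eqI[of _ red "\<lambda>s. q \<otimes>\<^bsub>Q\<^esub> x s"]) (simp_all add: red_pscale T_mem(3))
  qed
qed

lemma TA_carrier: "carrier (TA i) = red ` T i"
  by (simp add: TA_def)

lemma red_hom: "red \<in> mod_hom Q (fmod Q (T i)) (rs (TA i))"
  by (rule mod_homI) (simp_all add: TA_def red_padd red_pscale)

lemma red_eq_iff: "x \<in> T i \<Longrightarrow> x' \<in> T i \<Longrightarrow> red x = red x' \<longleftrightarrow> (\<forall>y. x y \<ominus>\<^bsub>Q\<^esub> x' y \<in> J c)"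
  using pi_eq_iff[OF T_carrier T_carrier] unfolding red_def fun_eq_iff by blast

lemma red_zero_iff: "x \<in> T i \<Longrightarrow> red x = \<zero>\<^bsub>TA j\<^esub> \<longleftrightarrow> (\<forall>y. x y \<in> J c)"
  using pi_zero_iff[OF T_carrier] unfolding red_def fun_eq_iff TA_def by simp

lemma hom_kills_J:
  assumes Y: "module A Y" and k: "k \<in> mod_hom Q (fmod Q (T i)) (rs Y)" and x: "x \<in> T i" "\<And>y. x y \<in> J c"
  shows "k x = \<zero>\<^bsub>Y\<^esub>"
proof -
  interpret Y: module Q "rs Y" by (rule rs_module[OF Y])
  interpret YA: module A Y by (rule Y)
  have kY: "k (WT i s) \<in> carrier Y" if "s \<in> Idx i" for s
    using mod_homD(1)[OF k, of "WT i s"] WT_T[OF that] by simp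
  have "k x = (\<Oplus>\<^bsub>rs Y\<^esub>s\<in>Idx i. x s \<odot>\<^bsub>rs Y\<^esub> k (WT i s))"
    by (rule dual_basis_hom[OF basis_T rs_module[OF Y] k x(1)])
  also have "\<dots> = (\<Oplus>\<^bsub>rs Y\<^esub>s\<in>Idx i. \<zero>\<^bsub>rs Y\<^esub>)"
  proof (rule Y.M.finsum_cong'[OF refl])
    show "x s \<odot>\<^bsub>rs Y\<^esub> k (WT i s) = \<zero>\<^bsub>rs Y\<^esub>" if "s \<in> Idx i" for s
      using pi_zero_iff[OF T_carrier[OF x(1)], of s] x(2)[of s] kY[OF that] by simp
  qed simp
  also have "\<dots> = \<zero>\<^bsub>Y\<^esub>" using Y.M.finsum_zero by simp
  finally show ?thesis .
qed

text \<open>Elements with the same reduction differ by one with all coordinates in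
  \<open>J c\<close>, whose expansion in the dual basis is killed in an \<open>A\<close>-module.
  Thus homs over \<open>Q\<close> from \<open>T i\<close> to \<open>A\<close>-modules are the homs
  over \<open>A\<close> from \<open>TA i\<close>.\<close>

lemma factor_through_red:
  assumes Y: "module A Y" and k: "k \<in> mod_hom Q (fmod Q (T i)) (rs Y)"
  shows "\<exists>k'\<in>mod_hom A (TA i) Y. \<forall>x\<in>T i. k' (red x) = k x"
proof -
  interpret Y: module A Y by (rule Y)
  have wd: "k x = k x'" if x: "x \<in> T i" "x' \<in> T i" "red x = red x'" for x x'
  proof -
    have c: "k x \<in> carrier Y" "k x' \<in> carrier Y"
      using mod_homD(1)[OF k, of x] mod_homD(1)[OF k, of x'] x by simp_all
    have "k (psub x x') = \<zero>\<^bsub>Y\<^esub>"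
      by (rule hom_kills_J[OF Y k psub_T[OF x(1,2)]]) (use red_eq_iff[OF x(1,2)] x(3) in \<open>simp add: psub_def del: split_paired_All\<close>)
    moreover have "psub x x' = x \<ominus>\<^bsub>fmod Q (T i)\<^esub> x'"
      using fmod_minus[OF module_T _ x(1,2)] T_carrier by (auto simp: psub_def)
    ultimately have "k x \<ominus>\<^bsub>Y\<^esub> k x' = \<zero>\<^bsub>Y\<^esub>"
      using mod_hom_minus[OF module_T rs_module[OF Y] k, of x x'] x by simp
    moreover have "k x = (k x \<ominus>\<^bsub>Y\<^esub> k x') \<oplus>\<^bsub>Y\<^esub> k x'"
      using c by (simp add: a_minus_def Y.M.a_assoc Y.M.l_neg)
    ultimately show ?thesis using c by simp
  qed
  define k' where "k' u = k (SOME x. x \<in> T i \<and> red x = u)" for u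
  have k': "k' (red x) = k x" if "x \<in> T i" for x
  proof -
    have "\<exists>x'. x' \<in> T i \<and> red x' = red x" using that by blast
    from someI_ex[OF this] show ?thesis unfolding k'_def using wd that by blast
  qed
  have "k' \<in> mod_hom A (TA i) Y"
  proof (rule mod_homI; unfold TA_carrier)
    show "k' u \<in> carrier Y" if "u \<in> red ` T i" for u
      using that k' mod_homD(1)[OF k] by auto
    show "k' (u \<oplus>\<^bsub>TA i\<^esub> v) = k' u \<oplus>\<^bsub>Y\<^esub> k' v" if uv: "u \<in> red ` T i" "v \<in> red ` T i" for u v
    proof -
      obtain x y where xy: "x \<in> T i" "u = red x" "y \<in> T i" "v = red y" using uv by auto
      then have "u \<oplus>\<^bsub>TA i\<^esub> v = red (\<lambda>s. x s \<oplus>\<^bsub>Q\<^esub> y s)" using red_padd by (simp add: TA_def)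
      then show ?thesis using xy k' T_mem(2)[of x i y] mod_homD(2)[OF k, of x y] by simp
    qed
    show "k' (a \<odot>\<^bsub>TA i\<^esub> u) = a \<odot>\<^bsub>Y\<^esub> k' u" if a: "a \<in> carrier A" and u: "u \<in> red ` T i" for a u
    proof -
      obtain q x where q: "q \<in> carrier Q" "\<pi> q = a" and x: "x \<in> T i" "u = red x" using pi_surj[OF a] u by auto
      then have "a \<odot>\<^bsub>TA i\<^esub> u = red (\<lambda>s. q \<otimes>\<^bsub>Q\<^esub> x s)" using red_pscale[of q x i] by (simp add: TA_def)
      then show ?thesis using q x k' T_mem(3)[of q x i] mod_homD(3)[OF k, of q x] by simp
    qed
  qed
  then show ?thesis using k' by blast
qed

definition eps :: "(nat multiset \<times> nat \<Rightarrow> 'q) \<Rightarrow> 'm" where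
  "eps x = e (slice x {#})"

lemma eps_hom: "eps \<in> mod_hom Q (fmod Q (T 0)) (rs M)"
  unfolding eps_def[abs_def] using mod_hom_comp[OF slice_hom[of "{#}" 0]] e_hom by simp

lemma eps_surj: "m \<in> carrier M \<Longrightarrow> \<exists>x\<in>T 0. eps x = m"
proof -
  assume "m \<in> carrier M"
  then have "m \<in> e ` F 0" using e_surj by simp
  then obtain y where y: "y \<in> F 0" "e y = m" by blast
  then have "bottom y \<in> T 0" using mod_homD(1)[OF bottom_hom, of y 0] by simp
  then show ?thesis using y by (intro bexI[of _ "bottom y"]) (simp_all add: eps_def slice_bottom)
qed

lemma eps_D: "x \<in> T (Suc 0) \<Longrightarrow> eps (D (Suc 0) x) = \<zero>\<^bsub>M\<^esub>"
proof -
  assume x: "x \<in> T (Suc 0)"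
  have "x = bottom (slice x {#})" by (rule bottom_slice[OF x]) simp
  moreover have s: "slice x {#} \<in> F (Suc 0)" using T_slice'[OF x, of "{#}"] by simp
  ultimately have "D (Suc 0) x = bottom (d (Suc 0) (slice x {#}))" using D_bottom by metis
  then show ?thesis using e_d[of "slice x {#}"] s by (simp add: eps_def slice_bottom)
qed

lemma DA_exists:
  "\<exists>DA. (\<forall>i. DA i \<in> mod_hom A (TA (Suc i)) (TA i)) \<and> (\<forall>i. \<forall>x\<in>T (Suc i). DA i (red x) = red (D (Suc i) x))"
proof -
  have "\<exists>k\<in>mod_hom A (TA (Suc i)) (TA i). \<forall>x\<in>T (Suc i). k (red x) = red (D (Suc i) x)" for i
    by (rule factor_through_red[OF TA_module])
      (use mod_hom_comp[OF D_hom[of "Suc i"] red_hom] in simp)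
  then show ?thesis by metis
qed

text \<open>\<open>Ext\<close> is computed from a chosen resolution, so \<open>P\<close> is
  arbitrary. The map \<open>\<phi>\<close> starts at \<open>T\<close> itself, where
  \<open>D \<circ> D\<close> is killed by homs to the \<open>A\<close>-modules \<open>P i\<close>;
  the map \<open>\<psi>\<close> into the reductions uses the exactness of \<open>T\<close>; and
  \<open>h\<close> contracts the round trip on \<open>P\<close>. The clauses speak of
  representatives \<open>t\<close> of \<open>\<psi> i x\<close>, which hides the reduced
  differential and the factorisation of \<open>\<phi>\<close>.\<close>

lemma comparison:
  assumes P: "projective_resolution A M P dP eP"
  shows "\<exists>\<phi> \<psi> h. (\<forall>i. \<phi> i \<in> mod_hom Q (fmod Q (T i)) (rs (P i))) \<and>
    (\<forall>i. \<forall>x\<in>T (Suc i). dP i (\<phi> (Suc i) x) = \<phi> i (D (Suc i) x)) \<and>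
    (\<forall>i. \<psi> i \<in> mod_hom A (P i) (TA i)) \<and>
    (\<forall>i. \<forall>x\<in>carrier (P (Suc i)). \<forall>t\<in>T (Suc i). \<psi> (Suc i) x = red t \<longrightarrow> \<psi> i (dP i x) = red (D (Suc i) t)) \<and>
    (\<forall>i. h i \<in> mod_hom A (P i) (P (Suc i))) \<and>
    (\<forall>x\<in>carrier (P 0). \<forall>t\<in>T 0. \<psi> 0 x = red t \<longrightarrow> dP 0 (h 0 x) = \<phi> 0 t \<ominus>\<^bsub>P 0\<^esub> x) \<and>
    (\<forall>i. \<forall>x\<in>carrier (P (Suc i)). \<forall>t\<in>T (Suc i). \<psi> (Suc i) x = red t \<longrightarrow>
       dP (Suc i) (h (Suc i) x) = (\<phi> (Suc i) t \<ominus>\<^bsub>P (Suc i)\<^esub> x) \<ominus>\<^bsub>P (Suc i)\<^esub> h i (dP i x))"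
proof -
  note PD = projective_resolutionD[OF P]
  have rsP: "module Q (rs (P i))" for i by (rule rs_module[OF PD(2)])
  obtain DA where DA: "\<And>i. DA i \<in> mod_hom A (TA (Suc i)) (TA i)"
    "\<And>i x. x \<in> T (Suc i) \<Longrightarrow> DA i (red x) = red (D (Suc i) x)" using DA_exists by blast
  obtain eA where eA: "eA \<in> mod_hom A (TA 0) M" "\<And>x. x \<in> T 0 \<Longrightarrow> eA (red x) = eps x"
    using factor_through_red[OF MA eps_hom] by blast
  have "\<exists>\<phi>. (\<forall>i. \<phi> i \<in> mod_hom Q (fmod Q (T i)) (rs (P i))) \<and> (\<forall>x\<in>carrier (fmod Q (T 0)). eP (\<phi> 0 x) = eps x) \<and>
      (\<forall>i. \<forall>x\<in>carrier (fmod Q (T (Suc i))). dP i (\<phi> (Suc i) x) = \<phi> i (D (Suc i) x))"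
  proof (rule chain_map_exists)
    show "projective_module Q (fmod Q (T i))" for i by (rule dual_basis_projective[OF basis_T])
    show "module Q (rs (P i))" for i by (rule rsP)
    show "module Q (rs M)" by (rule rs_module[OF MA])
    show "D (Suc i) \<in> mod_hom Q (fmod Q (T (Suc i))) (fmod Q (T i))" for i using D_hom[of "Suc i"] by simp
    show "eps \<in> mod_hom Q (fmod Q (T 0)) (rs M)" by (rule eps_hom)
    show "dP i \<in> mod_hom Q (rs (P (Suc i))) (rs (P i))" for i by (rule rs_hom[OF PD(3)])
    show "eP \<in> mod_hom Q (rs (P 0)) (rs M)" by (rule rs_hom[OF PD(4)])
    show "eps (D (Suc 0) x) = \<zero>\<^bsub>rs M\<^esub>" if "x \<in> carrier (fmod Q (T (Suc 0)))" for x
      using eps_D that by simp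
    \<comment> \<open>The square of \<open>D\<close> is the curvature, whose coordinates lie in
      \<open>J c\<close>; so a hom into an \<open>A\<close>-module does not see that
      \<open>D\<close> fails to be a differential over \<open>Q\<close>.\<close>
    show "k (D (Suc i) (D (Suc (Suc i)) x)) = \<zero>\<^bsub>rs (P i)\<^esub>"
      if k: "k \<in> mod_hom Q (fmod Q (T i)) (rs (P i))" and x: "x \<in> carrier (fmod Q (T (Suc (Suc i))))" for i k x
    proof -
      have xT: "x \<in> T (Suc (Suc i))" using x by simp
      have "curvature x \<in> JT c i" using curvature_JT[of x c "Suc (Suc i)"] xT by (simp add: ST_c)
      then have "k (curvature x) = \<zero>\<^bsub>P i\<^esub>"
        by (intro hom_kills_J[OF PD(2) k]) (auto simp: JT_def simp del: split_paired_All)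
      then show ?thesis using D_D[OF xT] by simp
    qed
    show "x \<in> eP ` carrier (rs (P 0))" if "x \<in> carrier (rs M)" for x using PD(5) that by simp
    show "y \<in> dP 0 ` carrier (rs (P (Suc 0)))" if "y \<in> carrier (rs (P 0))" "eP y = \<zero>\<^bsub>rs M\<^esub>" for y
      using PD(6) that by simp
    show "y \<in> dP (Suc i) ` carrier (rs (P (Suc (Suc i))))"
      if "y \<in> carrier (rs (P (Suc i)))" "dP i y = \<zero>\<^bsub>rs (P i)\<^esub>" for i y
      using PD(7) that by simp
  qed
  then obtain \<phi> where \<phi>: "\<And>i. \<phi> i \<in> mod_hom Q (fmod Q (T i)) (rs (P i))"
    "\<And>x. x \<in> T 0 \<Longrightarrow> eP (\<phi> 0 x) = eps x"
    "\<And>i x. x \<in> T (Suc i) \<Longrightarrow> dP i (\<phi> (Suc i) x) = \<phi> i (D (Suc i) x)"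
    unfolding fmod_simps by (elim exE conjE) blast
  have "\<exists>\<psi>. (\<forall>i. \<psi> i \<in> mod_hom A (P i) (TA i)) \<and> (\<forall>x\<in>carrier (P 0). eA (\<psi> 0 x) = eP x) \<and>
      (\<forall>i. \<forall>x\<in>carrier (P (Suc i)). DA i (\<psi> (Suc i) x) = \<psi> i (dP i x))"
  proof (rule chain_map_exists)
    show "k (dP i (dP (Suc i) x)) = \<zero>\<^bsub>TA i\<^esub>"
      if "k \<in> mod_hom A (P i) (TA i)" "x \<in> carrier (P (Suc (Suc i)))" for i k x
      using PD(9)[OF that(2)] mod_hom_zero[OF PD(2) TA_module that(1)] by simp
    show "m \<in> eA ` carrier (TA 0)" if "m \<in> carrier M" for m
    proof -
      obtain x where x: "x \<in> T 0" "eps x = m" using eps_surj[OF \<open>m \<in> carrier M\<close>] by blast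
      then have "m = eA (red x)" using eA(2) by simp
      then show ?thesis using x(1) by (auto simp: TA_carrier)
    qed
    show "y \<in> DA 0 ` carrier (TA (Suc 0))" if y: "y \<in> carrier (TA 0)" "eA y = \<zero>\<^bsub>M\<^esub>" for y
    proof -
      obtain x where x: "x \<in> T 0" "y = red x" using y(1) by (auto simp: TA_carrier)
      then have ex: "e (slice x {#}) = \<zero>\<^bsub>rs M\<^esub>" using y(2) eA(2) by (simp add: eps_def)
      obtain u where u: "u \<in> T (Suc 0)" "\<forall>y. x y \<ominus>\<^bsub>Q\<^esub> D (Suc 0) u y \<in> J c"
        using exact_T[OF x(1)] D_0[OF x(1)] J_mem(1) ex by auto
      have "D (Suc 0) u \<in> T 0" using D_T[OF u(1)] by simp
      then have "red x = red (D (Suc 0) u)" using red_eq_iff[OF x(1)] u(2) by simp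
      then have "y = DA 0 (red u)" using DA(2)[OF u(1)] x(2) by simp
      then show ?thesis using u(1) by (auto simp: TA_carrier)
    qed
    show "y \<in> DA (Suc i) ` carrier (TA (Suc (Suc i)))" if y: "y \<in> carrier (TA (Suc i))" "DA i y = \<zero>\<^bsub>TA i\<^esub>" for i y
    proof -
      obtain x where x: "x \<in> T (Suc i)" "y = red x" using y(1) by (auto simp: TA_carrier)
      have Dx: "D (Suc i) x \<in> T i" using D_T[OF x(1)] by simp
      have "red (D (Suc i) x) = \<zero>\<^bsub>TA i\<^esub>" using y(2) DA(2)[OF x(1)] x(2) by simp
      then have DJ: "\<forall>y. D (Suc i) x y \<in> J c" using red_zero_iff[OF Dx] by blast
      obtain u where u: "u \<in> T (Suc (Suc i))" "\<forall>y. x y \<ominus>\<^bsub>Q\<^esub> D (Suc (Suc i)) u y \<in> J c"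
        using exact_T[OF x(1)] DJ by blast
      have "D (Suc (Suc i)) u \<in> T (Suc i)" using D_T[OF u(1)] by simp
      then have "red x = red (D (Suc (Suc i)) u)" using red_eq_iff[OF x(1)] u(2) by simp
      then have "y = DA (Suc i) (red u)" using DA(2)[OF u(1)] x(2) by simp
      then show ?thesis using u(1) by (auto simp: TA_carrier)
    qed
  qed (rule PD TA_module MA DA eA | assumption)+
  then obtain \<psi> where \<psi>: "\<And>i. \<psi> i \<in> mod_hom A (P i) (TA i)"
    "\<And>x. x \<in> carrier (P 0) \<Longrightarrow> eA (\<psi> 0 x) = eP x"
    "\<And>i x. x \<in> carrier (P (Suc i)) \<Longrightarrow> DA i (\<psi> (Suc i) x) = \<psi> i (dP i x)"
    by (elim exE conjE) blast
  have "\<forall>i. \<exists>k\<in>mod_hom A (TA i) (P i). \<forall>x\<in>T i. k (red x) = \<phi> i x"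
    using factor_through_red[OF PD(2) \<phi>(1)] by blast
  then obtain \<phi>A where \<phi>A: "\<And>i. \<phi>A i \<in> mod_hom A (TA i) (P i)" "\<And>i x. x \<in> T i \<Longrightarrow> \<phi>A i (red x) = \<phi> i x"
    by metis
  have \<psi>r: "\<exists>t\<in>T i. \<psi> i x = red t" if "x \<in> carrier (P i)" for i x
    using mod_homD(1)[OF \<psi>(1) that] by (auto simp: TA_carrier)
  have "\<exists>h. (\<forall>i. h i \<in> mod_hom A (P i) (P (Suc i))) \<and>
      (\<forall>x\<in>carrier (P 0). dP 0 (h 0 x) = \<phi>A 0 (\<psi> 0 x) \<ominus>\<^bsub>P 0\<^esub> x) \<and>
      (\<forall>i. \<forall>x\<in>carrier (P (Suc i)). dP (Suc i) (h (Suc i) x) =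
        (\<phi>A (Suc i) (\<psi> (Suc i) x) \<ominus>\<^bsub>P (Suc i)\<^esub> x) \<ominus>\<^bsub>P (Suc i)\<^esub> h i (dP i x))"
  proof (rule chain_homotopy_exists[OF P MA])
    show "(\<lambda>x. \<phi>A i (\<psi> i x)) \<in> mod_hom A (P i) (P i)" for i by (rule mod_hom_comp[OF \<psi>(1) \<phi>A(1)])
    show "eP (\<phi>A 0 (\<psi> 0 x)) = eP x" if x: "x \<in> carrier (P 0)" for x
    proof -
      obtain t where t: "t \<in> T 0" "\<psi> 0 x = red t" using \<psi>r[OF x] by blast
      then show ?thesis using \<phi>A(2) \<phi>(2) eA(2) \<psi>(2)[OF x] by simp
    qed
    show "dP i (\<phi>A (Suc i) (\<psi> (Suc i) x)) = \<phi>A i (\<psi> i (dP i x))" if x: "x \<in> carrier (P (Suc i))" for i x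
    proof -
      obtain t where t: "t \<in> T (Suc i)" "\<psi> (Suc i) x = red t" using \<psi>r[OF x] by blast
      have "D (Suc i) t \<in> T i" using D_T[OF t(1)] by simp
      then have "\<phi>A i (red (D (Suc i) t)) = \<phi> i (D (Suc i) t)" by (rule \<phi>A(2))
      moreover have "\<psi> i (dP i x) = red (D (Suc i) t)" using DA(2)[OF t(1)] \<psi>(3)[OF x] t(2) by simp
      ultimately show ?thesis using t \<phi>A(2)[OF t(1)] \<phi>(3)[OF t(1)] by simp
    qed
  qed
  then obtain h where h: "\<And>i. h i \<in> mod_hom A (P i) (P (Suc i))"
    "\<And>x. x \<in> carrier (P 0) \<Longrightarrow> dP 0 (h 0 x) = \<phi>A 0 (\<psi> 0 x) \<ominus>\<^bsub>P 0\<^esub> x"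
    "\<And>i x. x \<in> carrier (P (Suc i)) \<Longrightarrow> dP (Suc i) (h (Suc i) x) =
        (\<phi>A (Suc i) (\<psi> (Suc i) x) \<ominus>\<^bsub>P (Suc i)\<^esub> x) \<ominus>\<^bsub>P (Suc i)\<^esub> h i (dP i x)"
    by blast
  show ?thesis
  proof (intro exI[of _ \<phi>] exI[of _ \<psi>] exI[of _ h] conjI allI ballI impI)
    show "\<psi> i (dP i x) = red (D (Suc i) t)"
      if "x \<in> carrier (P (Suc i))" "t \<in> T (Suc i)" "\<psi> (Suc i) x = red t" for i x t
      using \<psi>(3)[OF that(1)] DA(2)[OF that(2)] that(3) by simp
    show "dP 0 (h 0 x) = \<phi> 0 t \<ominus>\<^bsub>P 0\<^esub> x" if "x \<in> carrier (P 0)" "t \<in> T 0" "\<psi> 0 x = red t" for x t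
      using h(2)[OF that(1)] \<phi>A(2)[OF that(2)] that(3) by simp
    show "dP (Suc i) (h (Suc i) x) = (\<phi> (Suc i) t \<ominus>\<^bsub>P (Suc i)\<^esub> x) \<ominus>\<^bsub>P (Suc i)\<^esub> h i (dP i x)"
      if "x \<in> carrier (P (Suc i))" "t \<in> T (Suc i)" "\<psi> (Suc i) x = red t" for i x t
      using h(3)[OF that(1)] \<phi>A(2)[OF that(2)] that(3) by simp
  qed (use \<phi> \<psi> h in auto)
qed

text \<open>Forwards, the hom that makes \<open>f\<close> a coboundary is composed with
  \<open>\<phi>\<close>. Backwards, applying the cocycle \<open>f\<close> to the homotopy relation
  kills the term \<open>d h\<close> and leaves \<open>f x = g (D t) - f (h (d x))\<close> for a
  representative \<open>t\<close> of \<open>\<psi> x\<close>. Hence \<open>f\<close> is the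
  composite of \<open>d\<close> with \<open>g' \<psi> - f h\<close>, where \<open>g'\<close> is the
  factorisation of \<open>g\<close> through the reduction.\<close>

lemma coboundary_iff:
  assumes P: "projective_resolution A M P dP eP" and V: "module A V"
  shows "\<exists>\<phi>. \<phi> \<in> mod_hom Q (fmod Q (T i)) (rs (P i)) \<and>
    (\<forall>f\<in>mod_hom A (P i) V. (\<forall>x\<in>carrier (P (Suc i)). f (dP i x) = \<zero>\<^bsub>V\<^esub>) \<longrightarrow>
      (is_coboundary A P dP V i f \<longleftrightarrow>
       (\<exists>g\<in>mod_hom Q (fmod Q (T (i - 1))) (rs V). \<forall>x\<in>T i. f (\<phi> x) = g (D i x))))"
proof -
  note PD = projective_resolutionD[OF P]
  interpret V: module A V by (rule V)
  obtain \<phi> \<psi> h where \<phi>: "\<And>i. \<phi> i \<in> mod_hom Q (fmod Q (T i)) (rs (P i))"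
    "\<And>i x. x \<in> T (Suc i) \<Longrightarrow> dP i (\<phi> (Suc i) x) = \<phi> i (D (Suc i) x)"
    and \<psi>: "\<And>i. \<psi> i \<in> mod_hom A (P i) (TA i)"
    "\<And>i x t. x \<in> carrier (P (Suc i)) \<Longrightarrow> t \<in> T (Suc i) \<Longrightarrow> \<psi> (Suc i) x = red t \<Longrightarrow> \<psi> i (dP i x) = red (D (Suc i) t)"
    and h: "\<And>i. h i \<in> mod_hom A (P i) (P (Suc i))"
    "\<And>x t. x \<in> carrier (P 0) \<Longrightarrow> t \<in> T 0 \<Longrightarrow> \<psi> 0 x = red t \<Longrightarrow> dP 0 (h 0 x) = \<phi> 0 t \<ominus>\<^bsub>P 0\<^esub> x"
    "\<And>i x t. x \<in> carrier (P (Suc i)) \<Longrightarrow> t \<in> T (Suc i) \<Longrightarrow> \<psi> (Suc i) x = red t \<Longrightarrow>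
       dP (Suc i) (h (Suc i) x) = (\<phi> (Suc i) t \<ominus>\<^bsub>P (Suc i)\<^esub> x) \<ominus>\<^bsub>P (Suc i)\<^esub> h i (dP i x)"
    using comparison[OF P] by (elim exE conjE) blast
  have \<psi>r: "\<exists>t\<in>T i. \<psi> i x = red t" if "x \<in> carrier (P i)" for i x
    using mod_homD(1)[OF \<psi>(1) that] by (auto simp: TA_carrier)
  have \<phi>P: "\<phi> i t \<in> carrier (P i)" if "t \<in> T i" for i t using mod_homD(1)[OF \<phi>(1), of t i] that by simp
  have "is_coboundary A P dP V i f \<longleftrightarrow>
      (\<exists>g\<in>mod_hom Q (fmod Q (T (i - 1))) (rs V). \<forall>x\<in>T i. f (\<phi> i x) = g (D i x))"
    if f: "f \<in> mod_hom A (P i) V" and cocyc: "\<forall>x\<in>carrier (P (Suc i)). f (dP i x) = \<zero>\<^bsub>V\<^esub>" for f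
  proof
    assume cob: "is_coboundary A P dP V i f"
    show "\<exists>g\<in>mod_hom Q (fmod Q (T (i - 1))) (rs V). \<forall>x\<in>T i. f (\<phi> i x) = g (D i x)"
    proof (cases i)
      case 0
      then have "\<forall>x\<in>T i. f (\<phi> i x) = \<zero>\<^bsub>V\<^esub>" using cob \<phi>P[of _ 0] by (simp add: is_coboundary_def)
      moreover have "(\<lambda>_. \<zero>\<^bsub>V\<^esub>) \<in> mod_hom Q (fmod Q (T (i - 1))) (rs V)"
        using mod_hom_const_zero[OF rs_module[OF V]] by simp
      ultimately show ?thesis by (intro bexI[of _ "\<lambda>_. \<zero>\<^bsub>V\<^esub>"]) simp_all
    next
      case (Suc j)
      then obtain g where g: "g \<in> mod_hom A (P j) V" "\<forall>x\<in>carrier (P (Suc j)). f x = g (dP j x)"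
        using cob by (auto simp: is_coboundary_def)
      have "\<forall>x\<in>T i. f (\<phi> i x) = g (\<phi> j (D i x))"
        using g(2) \<phi>P[of _ "Suc j"] \<phi>(2)[of _ j] Suc by simp
      moreover have "(\<lambda>x. g (\<phi> j x)) \<in> mod_hom Q (fmod Q (T (i - 1))) (rs V)"
        using mod_hom_comp[OF \<phi>(1) rs_hom[OF g(1)]] Suc by simp
      ultimately show ?thesis by (intro bexI[of _ "\<lambda>x. g (\<phi> j x)"])
    qed
  next
    assume "\<exists>g\<in>mod_hom Q (fmod Q (T (i - 1))) (rs V). \<forall>x\<in>T i. f (\<phi> i x) = g (D i x)"
    then obtain g where g: "g \<in> mod_hom Q (fmod Q (T (i - 1))) (rs V)" "\<And>x. x \<in> T i \<Longrightarrow> f (\<phi> i x) = g (D i x)"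
      by blast
    show "is_coboundary A P dP V i f"
    proof (cases i)
      case 0
      have "f x = \<zero>\<^bsub>V\<^esub>" if x: "x \<in> carrier (P 0)" for x
      proof -
        obtain t where t: "t \<in> T 0" "\<psi> 0 x = red t" using \<psi>r[OF x] by blast
        have fx: "f x \<in> carrier V" using mod_homD(1)[OF f] x 0 by simp
        have "f (\<phi> 0 t) = \<zero>\<^bsub>V\<^esub>"
          using g(2)[of t] t(1) D_0[OF t(1)] mod_hom_zero[OF module_T rs_module[OF V] g(1)] 0 by simp
        moreover have "f (\<phi> 0 t \<ominus>\<^bsub>P 0\<^esub> x) = f (\<phi> 0 t) \<ominus>\<^bsub>V\<^esub> f x"
          using mod_hom_minus[OF PD(2) V f, of "\<phi> 0 t" x] \<phi>P[OF t(1)] x 0 by simp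
        moreover have "f (dP 0 (h 0 x)) = \<zero>\<^bsub>V\<^esub>" using cocyc mod_homD(1)[OF h(1) x] 0 by simp
        ultimately have "\<ominus>\<^bsub>V\<^esub> f x = \<zero>\<^bsub>V\<^esub>" using h(2)[OF x t] fx by (simp add: a_minus_def)
        then show ?thesis using fx V.M.minus_minus[OF fx] by (metis V.M.add.inv_one a_inv_def)
      qed
      then show ?thesis by (simp add: is_coboundary_def 0)
    next
      case (Suc j)
      obtain g' where g': "g' \<in> mod_hom A (TA j) V" "\<And>x. x \<in> T j \<Longrightarrow> g' (red x) = g x"
        using factor_through_red[OF V, of g j] g(1) Suc by auto
      have f': "f \<in> mod_hom A (P (Suc j)) V" using f Suc by simp
      let ?k = "\<lambda>x. g' (\<psi> j x) \<ominus>\<^bsub>V\<^esub> f (h j x)"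
      have "?k \<in> mod_hom A (P j) V"
        by (rule mod_hom_diff[OF V mod_hom_comp[OF \<psi>(1) g'(1)] mod_hom_comp[OF h(1) f']])
      moreover have "f x = ?k (dP j x)" if x: "x \<in> carrier (P (Suc j))" for x
      proof -
        obtain t where t: "t \<in> T (Suc j)" "\<psi> (Suc j) x = red t" using \<psi>r[OF x] by blast
        have dx: "dP j x \<in> carrier (P j)" by (rule mod_homD(1)[OF PD(3) x])
        have hdx: "h j (dP j x) \<in> carrier (P (Suc j))" by (rule mod_homD(1)[OF h(1) dx])
        have \<phi>t: "\<phi> (Suc j) t \<in> carrier (P (Suc j))" by (rule \<phi>P[OF t(1)])
        have Dt: "D (Suc j) t \<in> T j" using D_T[OF t(1)] by simp
        interpret Pj: module A "P (Suc j)" by (rule PD(2))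
        have "g' (\<psi> j (dP j x)) = g (D (Suc j) t)" using \<psi>(2)[OF x t] g'(2)[OF Dt] by simp
        also have "\<dots> = f (\<phi> (Suc j) t)" using g(2)[of t] t(1) Suc by simp
        finally have e1: "g' (\<psi> j (dP j x)) = f (\<phi> (Suc j) t)" .
        have "f (dP (Suc j) (h (Suc j) x)) = \<zero>\<^bsub>V\<^esub>" using cocyc mod_homD(1)[OF h(1) x] Suc by simp
        then have "f ((\<phi> (Suc j) t \<ominus>\<^bsub>P (Suc j)\<^esub> x) \<ominus>\<^bsub>P (Suc j)\<^esub> h j (dP j x)) = \<zero>\<^bsub>V\<^esub>"
          using h(3)[OF x t] by simp
        moreover have "f ((\<phi> (Suc j) t \<ominus>\<^bsub>P (Suc j)\<^esub> x) \<ominus>\<^bsub>P (Suc j)\<^esub> h j (dP j x)) =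
            (f (\<phi> (Suc j) t) \<ominus>\<^bsub>V\<^esub> f x) \<ominus>\<^bsub>V\<^esub> f (h j (dP j x))"
          using mod_hom_minus[OF PD(2) V f' _ hdx] mod_hom_minus[OF PD(2) V f' \<phi>t x] \<phi>t x by simp
        ultimately have eq: "(f (\<phi> (Suc j) t) \<ominus>\<^bsub>V\<^esub> f x) \<ominus>\<^bsub>V\<^esub> f (h j (dP j x)) = \<zero>\<^bsub>V\<^esub>" by simp
        note c = mod_homD(1)[OF f' \<phi>t] mod_homD(1)[OF f' x] mod_homD(1)[OF f' hdx]
        have "f (\<phi> (Suc j) t) \<ominus>\<^bsub>V\<^esub> f (h j (dP j x)) =
            ((f (\<phi> (Suc j) t) \<ominus>\<^bsub>V\<^esub> f x) \<ominus>\<^bsub>V\<^esub> f (h j (dP j x))) \<oplus>\<^bsub>V\<^esub> f x"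
          using c by (simp add: a_minus_def V.M.a_ac V.M.r_neg1 V.M.r_neg2 V.M.r_neg V.M.l_neg)
        then show ?thesis unfolding e1 using eq c by simp
      qed
      ultimately show ?thesis unfolding is_coboundary_def Suc by auto
    qed
  qed
  then show ?thesis using \<phi>(1)[of i] by blast
qed

text \<open>Composing the cocycle with \<open>\<phi>\<close> expresses \<open>p\<close> by homs on
  \<open>T\<close>, and the chosen resolution disappears. Membership is tested for
  \<open>\<pi> q\<close> with \<open>q\<close> in \<open>Q\<close>, since all further work takes
  place over \<open>Q\<close>.\<close>

lemma Ass_Ext:
  fixes V :: "('q set, 'v) module"
  assumes V: "module A V" and p: "p \<in> Ass A (Ext A i M V)"
  shows "primeideal p A \<and> (\<exists>k\<in>mod_hom Q (fmod Q (T i)) (rs V).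
    \<forall>q\<in>carrier Q. \<pi> q \<in> p \<longleftrightarrow>
      (\<exists>g\<in>mod_hom Q (fmod Q (T (i - 1))) (rs V). \<forall>x\<in>T i. \<pi> q \<odot>\<^bsub>V\<^esub> k x = g (D i x)))"
proof -
  obtain P dP eP where ch: "chosen_resolution A M = (P, dP)" and P: "projective_resolution A M P dP eP"
    using chosen_resolution_exists[OF MA] by blast
  have "p \<in> Ass A (Hom_cohomology A P dP V i)" using p by (simp add: Ext_def ch)
  from Ass_Hom_cohomology[OF P V this] obtain f where pr: "primeideal p A"
    and f: "f \<in> mod_hom A (P i) V" "\<forall>x\<in>carrier (P (Suc i)). f (dP i x) = \<zero>\<^bsub>V\<^esub>"
    and peq: "p = {a \<in> carrier A. is_coboundary A P dP V i (\<lambda>x. a \<odot>\<^bsub>V\<^esub> f x)}" by blast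
  interpret V: module A V by (rule V)
  obtain \<phi> where \<phi>: "\<phi> \<in> mod_hom Q (fmod Q (T i)) (rs (P i))"
    and iff: "\<And>f. f \<in> mod_hom A (P i) V \<Longrightarrow> (\<forall>x\<in>carrier (P (Suc i)). f (dP i x) = \<zero>\<^bsub>V\<^esub>) \<Longrightarrow>
      is_coboundary A P dP V i f \<longleftrightarrow>
       (\<exists>g\<in>mod_hom Q (fmod Q (T (i - 1))) (rs V). \<forall>x\<in>T i. f (\<phi> x) = g (D i x))"
    using coboundary_iff[OF P V, of i] by blast
  have "\<pi> q \<in> p \<longleftrightarrow>
      (\<exists>g\<in>mod_hom Q (fmod Q (T (i - 1))) (rs V). \<forall>x\<in>T i. \<pi> q \<odot>\<^bsub>V\<^esub> f (\<phi> x) = g (D i x))" if q: "q \<in> carrier Q" for q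
  proof -
    have "\<pi> q \<in> carrier A" by (rule pi_mem(1)[OF q])
    then show ?thesis
      using iff[OF mod_hom_smult[OF V f(1)], of "\<pi> q"] f(2) by (simp add: peq)
  qed
  then show ?thesis
    using pr mod_hom_comp[OF \<phi> rs_hom[OF f(1)]] by (intro conjI bexI[of _ "\<lambda>x. f (\<phi> x)"]) simp_all
qed

end

section \<open>Noetherianity of the cochains\<close>

text \<open>The entry at \<open>(m, b, k, s)\<close> belongs to the power \<open>I^m\<close>, the
  monomial \<open>y^b\<close> and the basis vector \<open>s\<close> of \<open>F k\<close>; so it
  contributes to the degree \<open>k + 2|b|\<close>.\<close>

type_synonym cochain_index = "nat \<times> nat multiset \<times> nat \<times> nat"

definition pmod :: "('a, 'n, 'd) module_scheme \<Rightarrow> ('x \<Rightarrow> 'n) set \<Rightarrow> ('a, 'x \<Rightarrow> 'n) module" where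
  "pmod N U = \<lparr>carrier = U, monoid.mult = undefined, one = undefined, zero = (\<lambda>_. \<zero>\<^bsub>N\<^esub>),
     add = (\<lambda>u v x. u x \<oplus>\<^bsub>N\<^esub> v x), smult = (\<lambda>a u x. a \<odot>\<^bsub>N\<^esub> u x)\<rparr>"

lemma pmod_simps [simp]:
  "carrier (pmod N U) = U"
  "\<zero>\<^bsub>pmod N U\<^esub> = (\<lambda>_. \<zero>\<^bsub>N\<^esub>)"
  "u \<oplus>\<^bsub>pmod N U\<^esub> v = (\<lambda>x. u x \<oplus>\<^bsub>N\<^esub> v x)"
  "a \<odot>\<^bsub>pmod N U\<^esub> u = (\<lambda>x. a \<odot>\<^bsub>N\<^esub> u x)"
  by (simp_all add: pmod_def)

lemma module_pmodI:
  assumes "module R N" "\<And>u x. u \<in> U \<Longrightarrow> u x \<in> carrier N" "(\<lambda>_. \<zero>\<^bsub>N\<^esub>) \<in> U"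
    and "\<And>u v. u \<in> U \<Longrightarrow> v \<in> U \<Longrightarrow> (\<lambda>x. u x \<oplus>\<^bsub>N\<^esub> v x) \<in> U"
    and "\<And>a u. a \<in> carrier R \<Longrightarrow> u \<in> U \<Longrightarrow> (\<lambda>x. a \<odot>\<^bsub>N\<^esub> u x) \<in> U"
  shows "module R (pmod N U)"
proof -
  interpret N: module R N by fact
  have "abelian_group (pmod N U)"
  proof (rule abelian_groupI)
    fix u assume u: "u \<in> carrier (pmod N U)"
    have "(\<lambda>x. (\<ominus>\<^bsub>R\<^esub> \<one>\<^bsub>R\<^esub>) \<odot>\<^bsub>N\<^esub> u x) \<in> carrier (pmod N U)" using assms(5) u by simp
    moreover have "(\<lambda>x. (\<ominus>\<^bsub>R\<^esub> \<one>\<^bsub>R\<^esub>) \<odot>\<^bsub>N\<^esub> u x) \<oplus>\<^bsub>pmod N U\<^esub> u = \<zero>\<^bsub>pmod N U\<^esub>"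
      using assms(2) u by (simp add: N.smult_l_minus N.M.l_neg)
    ultimately show "\<exists>v\<in>carrier (pmod N U). v \<oplus>\<^bsub>pmod N U\<^esub> u = \<zero>\<^bsub>pmod N U\<^esub>" by blast
  qed (use assms(2-4) in \<open>simp_all add: N.M.a_ac\<close>)
  then show ?thesis
    by (intro moduleI[OF N.is_cring])
      (use assms(2,5) in \<open>simp_all add: N.smult_l_distr N.smult_r_distr N.smult_assoc1\<close>)
qed

text \<open>\<open>L m\<close> stands for \<open>I\<^sup>m N\<close>, and \<open>G\<close> for generators of the preimage of \<open>I\<close> in \<open>Q\<close>.\<close>

locale ext_filtration = complete_intersection Q fs A M r W F d e n
  for Q :: "'q ring" and fs :: "'q list" and A :: "'q set ring" and M :: "('q set, 'm) module" and r W F d e n +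
  fixes N :: "('q set, 'n) module" and L :: "nat \<Rightarrow> 'n set" and G :: "'q set"
  assumes Q_noetherian: "noetherian_ring Q"
    and NA: "module A N"
    and N_fin_gen: "\<exists>S. finite S \<and> module_span Q (restrict_scalars \<pi> N) S = carrier N"
    and L_submodule: "submodule (L m) Q (restrict_scalars \<pi> N)"
    and L_0: "L 0 = carrier N"
    and G: "finite G" "G \<subseteq> carrier Q"
    and L_mult: "u \<in> G \<Longrightarrow> x \<in> L m \<Longrightarrow> \<pi> u \<odot>\<^bsub>N\<^esub> x \<in> L (Suc m)"
    and L_gen: "L (Suc m) \<subseteq> module_span Q (restrict_scalars \<pi> N) {\<pi> u \<odot>\<^bsub>N\<^esub> x | u x. u \<in> G \<and> x \<in> L m}"
begin

lemma NQ: "module Q (rs N)"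
  by (rule rs_module[OF NA])

sublocale N: module Q "rs N"
  by (rule NQ)

lemma L_carrier: "x \<in> L m \<Longrightarrow> x \<in> carrier N"
  using N.submoduleE(1)[OF L_submodule] by auto

lemma L_mem:
  "\<zero>\<^bsub>N\<^esub> \<in> L m" "x \<in> L m \<Longrightarrow> y \<in> L m \<Longrightarrow> x \<oplus>\<^bsub>N\<^esub> y \<in> L m"
  "q \<in> carrier Q \<Longrightarrow> x \<in> L m \<Longrightarrow> \<pi> q \<odot>\<^bsub>N\<^esub> x \<in> L m" "x \<in> L m \<Longrightarrow> y \<in> L m \<Longrightarrow> x \<ominus>\<^bsub>N\<^esub> y \<in> L m"
  using submodule_zero[OF NQ L_submodule] N.submoduleE(5)[OF L_submodule, of x m y]
    N.submoduleE(4)[OF L_submodule, of q x m] submodule_minus[OF NQ L_submodule, of x m y] by simp_all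

lemma L_decreasing: "L (Suc m) \<subseteq> L m"
proof -
  have "module_span Q (rs N) {\<pi> u \<odot>\<^bsub>N\<^esub> x | u x. u \<in> G \<and> x \<in> L m} \<subseteq> L m"
    by (rule module_span_minimal[OF L_submodule]) (use G(2) L_mem(3) in blast)
  then show ?thesis using L_gen[of m] by blast
qed

definition allowed :: "cochain_index \<Rightarrow> bool" where
  "allowed = (\<lambda>(m, b, k, s). set_mset b \<subseteq> {..<c} \<and> s < r k)"

text \<open>The direct sum of copies of \<open>L m\<close>, one for each allowed index of level
  \<open>m\<close>. Since the entries are chosen independently, generators are easy to find. Every
  hom from \<open>T i\<close> with values in \<open>L m\<close> comes from such a family, but in
  general from more than one.\<close>

definition X :: "(cochain_index \<Rightarrow> 'n) set" where
  "X = {u. finite {z. u z \<noteq> \<zero>\<^bsub>N\<^esub>} \<and> (\<forall>z. u z \<in> L (fst z)) \<and> (\<forall>z. \<not> allowed z \<longrightarrow> u z = \<zero>\<^bsub>N\<^esub>)}"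

lemma X_I:
  assumes "finite {z. u z \<noteq> \<zero>\<^bsub>N\<^esub>}" "\<And>z. u z \<in> L (fst z)" "\<And>z. \<not> allowed z \<Longrightarrow> u z = \<zero>\<^bsub>N\<^esub>"
  shows "u \<in> X"
  unfolding X_def using assms by blast

lemma X_D:
  assumes "u \<in> X"
  shows "finite {z. u z \<noteq> \<zero>\<^bsub>N\<^esub>}" "u z \<in> L (fst z)" "\<not> allowed z \<Longrightarrow> u z = \<zero>\<^bsub>N\<^esub>" "u z \<in> carrier N"
proof -
  show "finite {z. u z \<noteq> \<zero>\<^bsub>N\<^esub>}" "\<not> allowed z \<Longrightarrow> u z = \<zero>\<^bsub>N\<^esub>" using assms unfolding X_def by blast+
  show "u z \<in> L (fst z)" using assms unfolding X_def by blast
  then show "u z \<in> carrier N" by (rule L_carrier)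
qed

lemma X_module: "module Q (pmod (rs N) X)"
proof (rule module_pmodI[OF NQ])
  show "u z \<in> carrier (rs N)" if "u \<in> X" for u z using X_D(4)[OF that] by simp
  show "(\<lambda>_. \<zero>\<^bsub>rs N\<^esub>) \<in> X" by (rule X_I) (simp_all add: L_mem)
  show "(\<lambda>x. u x \<oplus>\<^bsub>rs N\<^esub> v x) \<in> X" if u: "u \<in> X" and v: "v \<in> X" for u v
  proof (rule X_I)
    have "{z. u z \<oplus>\<^bsub>rs N\<^esub> v z \<noteq> \<zero>\<^bsub>N\<^esub>} \<subseteq> {z. u z \<noteq> \<zero>\<^bsub>N\<^esub>} \<union> {z. v z \<noteq> \<zero>\<^bsub>N\<^esub>}"
      using N.M.r_zero[OF N.M.zero_closed] by auto
    then show "finite {z. u z \<oplus>\<^bsub>rs N\<^esub> v z \<noteq> \<zero>\<^bsub>N\<^esub>}"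
      by (rule finite_subset) (simp add: X_D(1)[OF u] X_D(1)[OF v])
    show "u z \<oplus>\<^bsub>rs N\<^esub> v z \<in> L (fst z)" for z using L_mem(2)[OF X_D(2)[OF u] X_D(2)[OF v]] by simp
    show "u z \<oplus>\<^bsub>rs N\<^esub> v z = \<zero>\<^bsub>N\<^esub>" if "\<not> allowed z" for z
      using X_D(3)[OF u that] X_D(3)[OF v that] N.M.r_zero[OF N.M.zero_closed] by simp
  qed
  show "(\<lambda>x. q \<odot>\<^bsub>rs N\<^esub> u x) \<in> X" if q: "q \<in> carrier Q" and u: "u \<in> X" for q u
  proof (rule X_I)
    have z: "q \<odot>\<^bsub>rs N\<^esub> \<zero>\<^bsub>N\<^esub> = \<zero>\<^bsub>N\<^esub>" using N.smult_r_null[OF q] by simp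
    have "{z. q \<odot>\<^bsub>rs N\<^esub> u z \<noteq> \<zero>\<^bsub>N\<^esub>} \<subseteq> {z. u z \<noteq> \<zero>\<^bsub>N\<^esub>}" using z by auto
    then show "finite {z. q \<odot>\<^bsub>rs N\<^esub> u z \<noteq> \<zero>\<^bsub>N\<^esub>}" by (rule finite_subset) (rule X_D(1)[OF u])
    show "q \<odot>\<^bsub>rs N\<^esub> u z \<in> L (fst z)" for z using L_mem(3)[OF q X_D(2)[OF u]] by simp
    show "q \<odot>\<^bsub>rs N\<^esub> u z = \<zero>\<^bsub>N\<^esub>" if "\<not> allowed z" for z using X_D(3)[OF u that] z by simp
  qed
qed

text \<open>The transpose of the contraction by the variable \<open>j\<close>, that is, the
  cohomology operator of \<open>fs ! j\<close> on cochains.\<close>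

definition raise :: "nat \<Rightarrow> (cochain_index \<Rightarrow> 'n) \<Rightarrow> cochain_index \<Rightarrow> 'n" where
  "raise j u = (\<lambda>(m, b, k, s). if j \<in># b then u (m, b - {#j#}, k, s) else \<zero>\<^bsub>N\<^esub>)"

text \<open>Multiplication by \<open>v\<close> as an element of degree one in the Rees algebra: it
  moves level \<open>m\<close> to level \<open>m + 1\<close>, so nothing arrives at level 0.\<close>

definition mult :: "'q \<Rightarrow> (cochain_index \<Rightarrow> 'n) \<Rightarrow> cochain_index \<Rightarrow> 'n" where
  "mult v u = (\<lambda>(m, b, k, s). case m of 0 \<Rightarrow> \<zero>\<^bsub>N\<^esub> | Suc m' \<Rightarrow> \<pi> v \<odot>\<^bsub>N\<^esub> u (m', b, k, s))"

definition operators :: "((cochain_index \<Rightarrow> 'n) \<Rightarrow> cochain_index \<Rightarrow> 'n) set" where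
  "operators = raise ` {..<c} \<union> mult ` G"

lemma pi_smult_zero: "q \<in> carrier Q \<Longrightarrow> \<pi> q \<odot>\<^bsub>N\<^esub> \<zero>\<^bsub>N\<^esub> = \<zero>\<^bsub>N\<^esub>"
  using N.smult_r_null by simp

lemma raise_hom:
  assumes j: "j < c"
  shows "raise j \<in> mod_hom Q (pmod (rs N) X) (pmod (rs N) X)"
proof (rule mod_homI; unfold pmod_simps)
  show "raise j u \<in> X" if u: "u \<in> X" for u
  proof (rule X_I)
    have "{z. raise j u z \<noteq> \<zero>\<^bsub>N\<^esub>} \<subseteq> (\<lambda>(m, b, k, s). (m, add_mset j b, k, s)) ` {z. u z \<noteq> \<zero>\<^bsub>N\<^esub>}"
    proof
      fix z assume z: "z \<in> {z. raise j u z \<noteq> \<zero>\<^bsub>N\<^esub>}"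
      obtain m b k s where zz: "z = (m, b, k, s)" by (metis prod_cases4)
      then have "j \<in># b" "u (m, b - {#j#}, k, s) \<noteq> \<zero>\<^bsub>N\<^esub>" using z by (auto simp: raise_def split: if_splits)
      then show "z \<in> (\<lambda>(m, b, k, s). (m, add_mset j b, k, s)) ` {z. u z \<noteq> \<zero>\<^bsub>N\<^esub>}"
        unfolding zz by (intro image_eqI[of _ _ "(m, b - {#j#}, k, s)"]) auto
    qed
    then show "finite {z. raise j u z \<noteq> \<zero>\<^bsub>N\<^esub>}"
      by (rule finite_subset) (rule finite_imageI[OF X_D(1)[OF u]])
    fix z :: cochain_index
    obtain m b k s where zz: "z = (m, b, k, s)" by (metis prod_cases4)
    show "raise j u z \<in> L (fst z)"
      using X_D(2)[OF u, of "(m, b - {#j#}, k, s)"] L_mem(1) by (simp add: zz raise_def)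
    show "raise j u z = \<zero>\<^bsub>N\<^esub>" if na: "\<not> allowed z"
    proof (cases "j \<in># b")
      case True
      then obtain b' where b': "b = add_mset j b'" by (metis multi_member_split)
      then have "\<not> allowed (m, b', k, s)" using na j by (auto simp: zz allowed_def)
      then show ?thesis using X_D(3)[OF u] b' by (simp add: zz raise_def)
    qed (simp add: zz raise_def)
  qed
  have "\<zero>\<^bsub>N\<^esub> = \<zero>\<^bsub>rs N\<^esub> \<oplus>\<^bsub>rs N\<^esub> \<zero>\<^bsub>rs N\<^esub>" by (simp only: N.M.r_zero N.M.zero_closed) simp
  then show "raise j (\<lambda>x. u x \<oplus>\<^bsub>rs N\<^esub> v x) = (\<lambda>x. raise j u x \<oplus>\<^bsub>rs N\<^esub> raise j v x)" for u v
    by (auto simp: raise_def fun_eq_iff)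
  show "raise j (\<lambda>x. q \<odot>\<^bsub>rs N\<^esub> u x) = (\<lambda>x. q \<odot>\<^bsub>rs N\<^esub> raise j u x)" if "q \<in> carrier Q" for q u
    using pi_smult_zero[OF that] by (auto simp: raise_def fun_eq_iff)
qed

lemma mult_hom:
  assumes v: "v \<in> G"
  shows "mult v \<in> mod_hom Q (pmod (rs N) X) (pmod (rs N) X)"
proof (rule mod_homI; unfold pmod_simps)
  have vQ: "v \<in> carrier Q" using v G(2) by blast
  show "mult v u \<in> X" if u: "u \<in> X" for u
  proof (rule X_I)
    have "{z. mult v u z \<noteq> \<zero>\<^bsub>N\<^esub>} \<subseteq> (\<lambda>(m, b, k, s). (Suc m, b, k, s)) ` {z. u z \<noteq> \<zero>\<^bsub>N\<^esub>}"
    proof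
      fix z assume z: "z \<in> {z. mult v u z \<noteq> \<zero>\<^bsub>N\<^esub>}"
      obtain m b k s where zz: "z = (m, b, k, s)" by (metis prod_cases4)
      then obtain m' where m': "m = Suc m'" "\<pi> v \<odot>\<^bsub>N\<^esub> u (m', b, k, s) \<noteq> \<zero>\<^bsub>N\<^esub>"
        using z by (cases m) (auto simp: mult_def)
      then have "u (m', b, k, s) \<noteq> \<zero>\<^bsub>N\<^esub>" using pi_smult_zero[OF vQ] by auto
      then show "z \<in> (\<lambda>(m, b, k, s). (Suc m, b, k, s)) ` {z. u z \<noteq> \<zero>\<^bsub>N\<^esub>}"
        unfolding zz m'(1) by (intro image_eqI[of _ _ "(m', b, k, s)"]) auto
    qed
    then show "finite {z. mult v u z \<noteq> \<zero>\<^bsub>N\<^esub>}"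
      by (rule finite_subset) (rule finite_imageI[OF X_D(1)[OF u]])
    fix z :: cochain_index
    obtain m b k s where zz: "z = (m, b, k, s)" by (metis prod_cases4)
    show "mult v u z \<in> L (fst z)"
    proof (cases m)
      case 0 then show ?thesis using L_mem(1) by (simp add: zz mult_def)
    next
      case (Suc m')
      then show ?thesis using L_mult[OF v X_D(2)[OF u, of "(m', b, k, s)"]] by (simp add: zz mult_def)
    qed
    show "mult v u z = \<zero>\<^bsub>N\<^esub>" if na: "\<not> allowed z"
    proof (cases m)
      case (Suc m')
      have "\<not> allowed (m', b, k, s)" using na by (simp add: zz allowed_def)
      then show ?thesis using X_D(3)[OF u] pi_smult_zero[OF vQ] Suc by (simp add: zz mult_def)
    qed (simp add: zz mult_def)
  qed
  have zz: "\<zero>\<^bsub>N\<^esub> = \<zero>\<^bsub>N\<^esub> \<oplus>\<^bsub>N\<^esub> \<zero>\<^bsub>N\<^esub>" using N.M.r_zero[of "\<zero>\<^bsub>N\<^esub>"] N.M.zero_closed by simp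
  show "mult v (\<lambda>x. u x \<oplus>\<^bsub>rs N\<^esub> w x) = (\<lambda>x. mult v u x \<oplus>\<^bsub>rs N\<^esub> mult v w x)" if u: "u \<in> X" and w: "w \<in> X" for u w
    using N.smult_r_distr[OF vQ] X_D(4)[OF u] X_D(4)[OF w] zz
    by (auto simp: mult_def fun_eq_iff split: nat.splits)
  show "mult v (\<lambda>x. q \<odot>\<^bsub>rs N\<^esub> u x) = (\<lambda>x. q \<odot>\<^bsub>rs N\<^esub> mult v u x)" if q: "q \<in> carrier Q" and u: "u \<in> X" for q u
  proof
    fix z :: cochain_index
    obtain m b k s where z: "z = (m, b, k, s)" by (metis prod_cases4)
    have "v \<odot>\<^bsub>rs N\<^esub> (q \<odot>\<^bsub>rs N\<^esub> u y) = q \<odot>\<^bsub>rs N\<^esub> (v \<odot>\<^bsub>rs N\<^esub> u y)" for y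
      using N.smult_assoc1[OF vQ q, of "u y"] N.smult_assoc1[OF q vQ, of "u y"] X_D(4)[OF u] Q.m_comm[OF vQ q] by simp
    then show "mult v (\<lambda>x. q \<odot>\<^bsub>rs N\<^esub> u x) z = q \<odot>\<^bsub>rs N\<^esub> mult v u z"
      using pi_smult_zero[OF q] by (cases m) (simp_all add: z mult_def)
  qed
qed

lemma operators_hom: "operators \<subseteq> mod_hom Q (pmod (rs N) X) (pmod (rs N) X)"
  unfolding operators_def using raise_hom mult_hom by auto

lemma operators_finite: "finite operators"
  unfolding operators_def using G(1) by simp

lemma raise_raise: "raise j (raise l u) = raise l (raise j u)"
proof
  fix z :: cochain_index
  obtain m b k s where z: "z = (m, b, k, s)" by (metis prod_cases4)
  have "j \<in># b \<and> l \<in># b - {#j#} \<longleftrightarrow> l \<in># b \<and> j \<in># b - {#l#}"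
    by (metis add_mset_commute insert_subset_eq_iff mset_subset_eq_single single_subset_iff)
  then show "raise j (raise l u) z = raise l (raise j u) z"
    by (auto simp: z raise_def diff_diff_add_mset ac_simps)
qed

lemma raise_mult:
  assumes "v \<in> carrier Q" shows "raise j (mult v u) = mult v (raise j u)"
proof
  fix z :: cochain_index
  obtain m b k s where z: "z = (m, b, k, s)" by (metis prod_cases4)
  show "raise j (mult v u) z = mult v (raise j u) z"
    using pi_smult_zero[OF assms] by (cases m) (simp_all add: z raise_def mult_def)
qed

lemma mult_mult:
  assumes vw: "v \<in> carrier Q" "w \<in> carrier Q" and u: "u \<in> X"
  shows "mult v (mult w u) = mult w (mult v u)"
proof
  fix z :: cochain_index
  obtain m b k s where z: "z = (m, b, k, s)" by (metis prod_cases4)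
  have "v \<odot>\<^bsub>rs N\<^esub> (w \<odot>\<^bsub>rs N\<^esub> u y) = w \<odot>\<^bsub>rs N\<^esub> (v \<odot>\<^bsub>rs N\<^esub> u y)" for y
    using N.smult_assoc1[OF vw, of "u y"] N.smult_assoc1[OF vw(2,1), of "u y"] X_D(4)[OF u] Q.m_comm[OF vw] by simp
  then show "mult v (mult w u) z = mult w (mult v u) z"
    using pi_smult_zero[OF vw(1)] pi_smult_zero[OF vw(2)]
    by (auto simp: z mult_def split: nat.splits)
qed

lemma operators_commute:
  assumes "\<theta> \<in> operators" "\<eta> \<in> operators" "u \<in> X"
  shows "\<theta> (\<eta> u) = \<eta> (\<theta> u)"
  using assms raise_raise raise_mult mult_mult G(2) unfolding operators_def
  by (elim UnE imageE) (simp_all add: subset_iff)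

definition single :: "cochain_index \<Rightarrow> 'n \<Rightarrow> cochain_index \<Rightarrow> 'n" where
  "single z v = (\<lambda>z'. if z' = z then v else \<zero>\<^bsub>N\<^esub>)"

lemma single_X:
  assumes "allowed z" "v \<in> L (fst z)"
  shows "single z v \<in> X"
proof (rule X_I)
  have "{z'. single z v z' \<noteq> \<zero>\<^bsub>N\<^esub>} \<subseteq> {z}" by (auto simp: single_def)
  then show "finite {z'. single z v z' \<noteq> \<zero>\<^bsub>N\<^esub>}" by (rule finite_subset) simp
qed (use assms L_mem(1) in \<open>auto simp: single_def\<close>)

text \<open>A family is the finite sum of its single entries; these are removed one by one.\<close>

lemma X_support_induct:
  assumes Y: "submodule Y Q (pmod (rs N) X)" and u: "u \<in> X" and s: "\<And>z. u z \<noteq> \<zero>\<^bsub>N\<^esub> \<Longrightarrow> single z (u z) \<in> Y"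
  shows "u \<in> Y"
proof -
  interpret X: module Q "pmod (rs N) X" by (rule X_module)
  have "\<forall>u. u \<in> X \<longrightarrow> {z. u z \<noteq> \<zero>\<^bsub>N\<^esub>} \<subseteq> Z \<longrightarrow> (\<forall>z. u z \<noteq> \<zero>\<^bsub>N\<^esub> \<longrightarrow> single z (u z) \<in> Y) \<longrightarrow> u \<in> Y" if "finite Z" for Z
    using that
  proof (induction Z rule: finite_induct)
    case empty
    have "u = \<zero>\<^bsub>pmod (rs N) X\<^esub>" if "{z. u z \<noteq> \<zero>\<^bsub>N\<^esub>} \<subseteq> {}" for u using that by auto
    then show ?case using submodule_zero[OF X_module Y] by metis
  next
    case (insert z Z)
    show ?case
    proof (intro allI impI)
      fix u assume u: "u \<in> X" and supp: "{z. u z \<noteq> \<zero>\<^bsub>N\<^esub>} \<subseteq> insert z Z"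
        and s: "\<forall>z. u z \<noteq> \<zero>\<^bsub>N\<^esub> \<longrightarrow> single z (u z) \<in> Y"
      let ?u = "u(z := \<zero>\<^bsub>N\<^esub>)"
      have u': "?u \<in> X"
      proof (rule X_I)
        show "finite {z'. ?u z' \<noteq> \<zero>\<^bsub>N\<^esub>}" by (rule finite_subset[OF _ X_D(1)[OF u]]) auto
      qed (use X_D(2,3)[OF u] L_mem(1) in auto)
      moreover have "{z'. ?u z' \<noteq> \<zero>\<^bsub>N\<^esub>} \<subseteq> Z" using supp by auto
      moreover have "\<forall>z'. ?u z' \<noteq> \<zero>\<^bsub>N\<^esub> \<longrightarrow> single z' (?u z') \<in> Y" using s by auto
      ultimately have uY: "?u \<in> Y" using insert.IH by blast
      show "u \<in> Y"
      proof (cases "u z = \<zero>\<^bsub>N\<^esub>")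
        case True
        then have "?u = u" by auto
        then show ?thesis using uY by simp
      next
        case False
        have "u = ?u \<oplus>\<^bsub>pmod (rs N) X\<^esub> single z (u z)"
        proof
          fix y show "u y = (?u \<oplus>\<^bsub>pmod (rs N) X\<^esub> single z (u z)) y"
            using N.M.r_zero[of "u y"] N.M.l_zero[of "u y"] X_D(4)[OF u, of y] by (cases "y = z") (simp_all add: single_def)
        qed
        then show ?thesis using X.submoduleE(5)[OF Y uY] s False by metis
      qed
    qed
  qed
  from this[OF X_D(1)[OF u]] show ?thesis using u s by blast
qed

lemma single_hom:
  assumes z: "allowed z"
  shows "single z \<in> mod_hom Q ((rs N)\<lparr>carrier := L (fst z)\<rparr>) (pmod (rs N) X)"
proof (rule mod_homI)
  show "single z x \<in> carrier (pmod (rs N) X)" if "x \<in> carrier ((rs N)\<lparr>carrier := L (fst z)\<rparr>)" for x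
    using single_X[OF z] that by simp
  have zz: "\<zero>\<^bsub>N\<^esub> = \<zero>\<^bsub>N\<^esub> \<oplus>\<^bsub>N\<^esub> \<zero>\<^bsub>N\<^esub>" using N.M.r_zero[of "\<zero>\<^bsub>N\<^esub>"] N.M.zero_closed by simp
  then show "single z (x \<oplus>\<^bsub>(rs N)\<lparr>carrier := L (fst z)\<rparr>\<^esub> y) = single z x \<oplus>\<^bsub>pmod (rs N) X\<^esub> single z y" for x y
    by (auto simp: single_def fun_eq_iff)
  show "single z (a \<odot>\<^bsub>(rs N)\<lparr>carrier := L (fst z)\<rparr>\<^esub> x) = a \<odot>\<^bsub>pmod (rs N) X\<^esub> single z x" if "a \<in> carrier Q" for a x
    using pi_smult_zero[OF that] by (auto simp: single_def fun_eq_iff)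
qed

text \<open>Turns the question which single entries lie in \<open>Y\<close> into one about a
  submodule of \<open>N\<close>, so that it can be answered on generators of \<open>N\<close> or of
  \<open>L (Suc m)\<close>.\<close>

lemma single_vimage:
  assumes Y: "submodule Y Q (pmod (rs N) X)" and z: "allowed z"
  shows "submodule {v \<in> L (fst z). single z v \<in> Y} Q (rs N)"
proof -
  have m: "module Q ((rs N)\<lparr>carrier := L (fst z)\<rparr>)" by (rule submodule.submodule_is_module[OF L_submodule NQ])
  have "submodule {v \<in> L (fst z). single z v \<in> Y} Q ((rs N)\<lparr>carrier := L (fst z)\<rparr>)"
    using submodule_vimage[OF m X_module single_hom[OF z] Y] by simp
  then show ?thesis
    using module_submodule_trans[OF NQ L_submodule, of "{v \<in> L (fst z). single z v \<in> Y}" "fst z"] by blast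
qed

text \<open>Level 0 and the monomial 1. This is a finite sum of copies of \<open>N\<close>, because
  \<open>r k\<close> is zero for \<open>k > n\<close>: here the finiteness of the resolution over
  \<open>Q\<close> enters.\<close>

definition X0 :: "(cochain_index \<Rightarrow> 'n) set" where
  "X0 = {u \<in> X. \<forall>z. u z \<noteq> \<zero>\<^bsub>N\<^esub> \<longrightarrow> fst z = 0 \<and> fst (snd z) = {#}}"

lemma X0_noetherian: "submodule X0 Q (pmod (rs N) X) \<and> noetherian_on Q (pmod (rs N) X) {} X0"
proof -
  obtain S where S: "finite S" "module_span Q (rs N) S = carrier N" using N_fin_gen by blast
  define Z where "Z = (\<lambda>(k, s). (0 :: nat, {#} :: nat multiset, k, s)) ` (SIGMA k:{..n}. {..<r k})"
  define S' where "S' = (\<lambda>(z, g). single z g) ` (Z \<times> S)"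
  have SN: "S \<subseteq> carrier N" using module_span_superset[of S Q "rs N"] S(2) by simp
  have Zal: "allowed z" and Z0: "fst z = 0" "fst (snd z) = {#}" if "z \<in> Z" for z
    using that by (auto simp: Z_def allowed_def)
  have fin: "finite S'" unfolding S'_def Z_def using S(1) by auto
  have S'X: "S' \<subseteq> X0"
    unfolding S'_def X0_def using single_X[OF Zal] Z0 SN L_0 by (auto simp: single_def split: if_splits)
  have X0X: "X0 \<subseteq> X" by (auto simp: X0_def)
  interpret X: module Q "pmod (rs N) X" by (rule X_module)
  have S'c: "S' \<subseteq> carrier (pmod (rs N) X)" using S'X X0X by simp
  note sub = submodule_module_span[OF X_module S'c]
  have "X0 \<subseteq> module_span Q (pmod (rs N) X) S'"
  proof
    fix u assume u: "u \<in> X0"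
    then have uX: "u \<in> X" using X0X by blast
    show "u \<in> module_span Q (pmod (rs N) X) S'"
    proof (rule X_support_induct[OF sub uX])
      fix z assume uz: "u z \<noteq> \<zero>\<^bsub>N\<^esub>"
      obtain m b k s where z: "z = (m, b, k, s)" by (metis prod_cases4)
      have "m = 0" "b = {#}" using u uz unfolding X0_def z by auto
      moreover have "s < r k" using X_D(3)[OF uX, of z] uz by (auto simp: z allowed_def)
      moreover from this have "k \<le> n" using bounded[of k] by (cases "k \<le> n") auto
      ultimately have zZ: "z \<in> Z" unfolding Z_def z by auto
      have "submodule {v \<in> L (fst z). single z v \<in> module_span Q (pmod (rs N) X) S'} Q (rs N)"
        by (rule single_vimage[OF sub Zal[OF zZ]])
      moreover have "S \<subseteq> {v \<in> L (fst z). single z v \<in> module_span Q (pmod (rs N) X) S'}"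
      proof
        fix g assume g: "g \<in> S"
        then have "single z g \<in> S'" unfolding S'_def using zZ by force
        then have "single z g \<in> module_span Q (pmod (rs N) X) S'"
          using module_span_superset[of S' Q "pmod (rs N) X"] by blast
        then show "g \<in> {v \<in> L (fst z). single z v \<in> module_span Q (pmod (rs N) X) S'}"
          using g SN Z0(1)[OF zZ] L_0 by auto
      qed
      ultimately have "module_span Q (rs N) S \<subseteq> {v \<in> L (fst z). single z v \<in> module_span Q (pmod (rs N) X) S'}"
        by (rule module_span_minimal)
      then have "carrier N \<subseteq> {v \<in> L (fst z). single z v \<in> module_span Q (pmod (rs N) X) S'}"
        unfolding S(2) .
      then show "single z (u z) \<in> module_span Q (pmod (rs N) X) S'" using X_D(4)[OF uX] by blast
    qed
  qed
  then have "noetherian_on Q (pmod (rs N) X) {} X0"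
    using noetherian_on_subset[OF noetherian_on_module_span[OF Q_noetherian X_module fin S'c]] by blast
  moreover have "submodule X0 Q (pmod (rs N) X)"
  proof -
    have uminus: "\<ominus>\<^bsub>pmod (rs N) X\<^esub> u = (\<ominus>\<^bsub>Q\<^esub> \<one>\<^bsub>Q\<^esub>) \<odot>\<^bsub>pmod (rs N) X\<^esub> u" if "u \<in> X" for u
      using X.smult_l_minus[of "\<one>\<^bsub>Q\<^esub>" u] X.smult_one[of u] that by simp
    have zz: "\<zero>\<^bsub>N\<^esub> \<oplus>\<^bsub>N\<^esub> \<zero>\<^bsub>N\<^esub> = \<zero>\<^bsub>N\<^esub>" using N.M.r_zero[of "\<zero>\<^bsub>N\<^esub>"] N.M.zero_closed by simp
    have sm: "q \<odot>\<^bsub>pmod (rs N) X\<^esub> u \<in> X0" if q: "q \<in> carrier Q" and u: "u \<in> X0" for q u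
    proof -
      have "q \<odot>\<^bsub>pmod (rs N) X\<^esub> u \<in> X" using X.smult_closed[OF q, of u] u X0X by auto
      moreover have "u z \<noteq> \<zero>\<^bsub>N\<^esub>" if "(q \<odot>\<^bsub>pmod (rs N) X\<^esub> u) z \<noteq> \<zero>\<^bsub>N\<^esub>" for z
        using that pi_smult_zero[OF q] by auto
      ultimately show ?thesis using u unfolding X0_def by blast
    qed
    show ?thesis
    proof (rule X.submoduleI)
      show "X0 \<subseteq> carrier (pmod (rs N) X)" using X0X by simp
      show "\<zero>\<^bsub>pmod (rs N) X\<^esub> \<in> X0" using X.M.zero_closed by (simp add: X0_def)
      show "q \<odot>\<^bsub>pmod (rs N) X\<^esub> u \<in> X0" if "q \<in> carrier Q" "u \<in> X0" for q u by (rule sm[OF that])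
      show "\<ominus>\<^bsub>pmod (rs N) X\<^esub> u \<in> X0" if "u \<in> X0" for u
        using uminus[of u] sm[of "\<ominus>\<^bsub>Q\<^esub> \<one>\<^bsub>Q\<^esub>" u] that X0X by auto
      show "u \<oplus>\<^bsub>pmod (rs N) X\<^esub> v \<in> X0" if u: "u \<in> X0" and v: "v \<in> X0" for u v
      proof -
        have "u \<oplus>\<^bsub>pmod (rs N) X\<^esub> v \<in> X" using X.M.a_closed[of u v] u v X0X by auto
        moreover have "u z \<noteq> \<zero>\<^bsub>N\<^esub> \<or> v z \<noteq> \<zero>\<^bsub>N\<^esub>" if "(u \<oplus>\<^bsub>pmod (rs N) X\<^esub> v) z \<noteq> \<zero>\<^bsub>N\<^esub>" for z
          using that zz by auto
        ultimately show ?thesis using u v unfolding X0_def by blast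
      qed
    qed
  qed
  ultimately show ?thesis by blast
qed

text \<open>\<open>raise\<close> adds the variables of \<open>b\<close> one at a time, starting from
  the monomial 1; \<open>mult\<close> climbs from \<open>L m\<close> to \<open>L (Suc m)\<close>,
  which lies in the span of the products with elements of \<open>G\<close>.\<close>

lemma X_generated: "stable_span Q (pmod (rs N) X) operators X0 = X"
proof
  have X0X: "X0 \<subseteq> carrier (pmod (rs N) X)" by (auto simp: X0_def)
  interpret X: module Q "pmod (rs N) X" by (rule X_module)
  let ?Y = "stable_span Q (pmod (rs N) X) operators X0"
  have st: "stable_submodule Q (pmod (rs N) X) operators ?Y"
    by (rule stable_submodule_span[OF X_module operators_hom X0X])
  then have Y: "submodule ?Y Q (pmod (rs N) X)" unfolding stable_submodule_def by blast
  have op: "\<theta> u \<in> ?Y" if "\<theta> \<in> operators" "u \<in> ?Y" for \<theta> u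
    using st that unfolding stable_submodule_def by blast
  show "?Y \<subseteq> X" using X.submoduleE(1)[OF Y] by simp
  have single: "\<forall>b v. allowed (m, b, k, s) \<longrightarrow> v \<in> L m \<longrightarrow> single (m, b, k, s) v \<in> ?Y" for m k s
  proof (induction m)
    case 0
    show ?case
    proof (intro allI impI)
      fix b v assume b: "allowed (0, b, k, s)" and v: "v \<in> L 0"
      from b show "single (0, b, k, s) v \<in> ?Y"
      proof (induction b)
        case empty
        then have "single (0, {#}, k, s) v \<in> X0"
          using single_X[OF empty, of v] v by (auto simp: X0_def single_def)
        then show ?case by (rule subsetD[OF stable_span_superset])
      next
        case (add j b)
        have j: "j < c" and b: "allowed (0, b, k, s)" using add.prems by (auto simp: allowed_def)
        have "single (0, add_mset j b, k, s) v = raise j (single (0, b, k, s) v)"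
        proof
          fix z :: cochain_index
          obtain m' b' k' s' where z: "z = (m', b', k', s')" by (metis prod_cases4)
          show "single (0, add_mset j b, k, s) v z = raise j (single (0, b, k, s) v) z"
            by (auto simp: single_def raise_def z dest: multi_member_split)
        qed
        then show ?case using op[OF _ add.IH[OF b], of "raise j"] j by (simp add: operators_def)
      qed
    qed
  next
    case (Suc m)
    show ?case
    proof (intro allI impI)
      fix b v assume b: "allowed (Suc m, b, k, s)" and v: "v \<in> L (Suc m)"
      have b': "allowed (m, b, k, s)" using b by (simp add: allowed_def)
      let ?V = "{v \<in> L (Suc m). single (Suc m, b, k, s) v \<in> ?Y}"
      have "submodule ?V Q (rs N)" using single_vimage[OF Y b] by simp
      moreover have "{\<pi> u \<odot>\<^bsub>N\<^esub> x | u x. u \<in> G \<and> x \<in> L m} \<subseteq> ?V"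
      proof clarify
        fix u x assume u: "u \<in> G" and x: "x \<in> L m"
        have uQ: "u \<in> carrier Q" using u G(2) by blast
        have "single (Suc m, b, k, s) (\<pi> u \<odot>\<^bsub>N\<^esub> x) = mult u (single (m, b, k, s) x)"
          using pi_smult_zero[OF uQ] by (auto simp: single_def mult_def fun_eq_iff split: nat.splits)
        moreover have "mult u (single (m, b, k, s) x) \<in> ?Y"
          by (rule op) (use u Suc.IH b' x in \<open>auto simp: operators_def\<close>)
        ultimately show "\<pi> u \<odot>\<^bsub>N\<^esub> x \<in> L (Suc m) \<and> single (Suc m, b, k, s) (\<pi> u \<odot>\<^bsub>N\<^esub> x) \<in> ?Y"
          using L_mult[OF u x] by simp
      qed
      ultimately have "module_span Q (rs N) {\<pi> u \<odot>\<^bsub>N\<^esub> x | u x. u \<in> G \<and> x \<in> L m} \<subseteq> ?V"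
        by (rule module_span_minimal)
      then show "single (Suc m, b, k, s) v \<in> ?Y" using v L_gen[of m] by blast
    qed
  qed
  show "X \<subseteq> ?Y"
  proof
    fix u assume u: "u \<in> X"
    show "u \<in> ?Y"
    proof (rule X_support_induct[OF Y u])
      fix z assume uz: "u z \<noteq> \<zero>\<^bsub>N\<^esub>"
      obtain m b k s where z: "z = (m, b, k, s)" by (metis prod_cases4)
      have "allowed z" using X_D(3)[OF u] uz by blast
      then show "single z (u z) \<in> ?Y" using single X_D(2)[OF u, of z] by (simp add: z)
    qed
  qed
qed

lemma X_noetherian: "noetherian_on Q (pmod (rs N) X) operators X"
  using noetherian_on_stable_span[OF X_module _ _ operators_finite operators_hom, of X0]
    X0_noetherian operators_commute unfolding X_generated by simp

end

section \<open>Cochains that are coboundaries modulo a term of the filtration\<close>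

context ext_filtration
begin

text \<open>\<open>g\<close> takes values in all of \<open>N\<close>, not in \<open>L m\<close>:
  this is the condition to be a coboundary with coefficients in \<open>N / L m\<close>, with the
  homs lifted to \<open>N\<close>. In degree 0 truncated subtraction pairs \<open>T 0\<close> with
  itself, and as \<open>D 0\<close> vanishes there, the condition says that \<open>f\<close> has its
  values in \<open>L m\<close>.\<close>

definition coboundary_mod :: "nat \<Rightarrow> nat \<Rightarrow> ((nat multiset \<times> nat \<Rightarrow> 'q) \<Rightarrow> 'n) \<Rightarrow> bool" where
  "coboundary_mod i m f \<longleftrightarrow>
     (\<exists>g\<in>mod_hom Q (fmod Q (T (i - 1))) (rs N). \<forall>x\<in>T i. f x \<ominus>\<^bsub>N\<^esub> g (D i x) \<in> L m)"

lemma coboundary_mod_cong: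
  assumes "\<And>x. x \<in> T i \<Longrightarrow> f x = f' x"
  shows "coboundary_mod i m f \<longleftrightarrow> coboundary_mod i m f'"
  unfolding coboundary_mod_def using assms by auto

lemma L_antimono: "m \<le> m' \<Longrightarrow> L m' \<subseteq> L m"
  using L_decreasing by (rule lift_Suc_antimono_le)

lemma coboundary_mod_antimono: "m \<le> m' \<Longrightarrow> coboundary_mod i m' f \<Longrightarrow> coboundary_mod i m f"
  unfolding coboundary_mod_def using L_antimono by blast

lemma hom_T: "g \<in> mod_hom Q (fmod Q (T i)) (rs N) \<Longrightarrow> x \<in> T i \<Longrightarrow> g x \<in> carrier N"
  using mod_homD(1)[of g Q "fmod Q (T i)" "rs N" x] by simp

lemma add_minus_add:
  assumes "x \<in> carrier N" "y \<in> carrier N" "x' \<in> carrier N" "y' \<in> carrier N"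
  shows "(x \<oplus>\<^bsub>N\<^esub> y) \<ominus>\<^bsub>N\<^esub> (x' \<oplus>\<^bsub>N\<^esub> y') = (x \<ominus>\<^bsub>N\<^esub> x') \<oplus>\<^bsub>N\<^esub> (y \<ominus>\<^bsub>N\<^esub> y')"
proof -
  interpret NA: module A N by (rule NA)
  show ?thesis using assms by (simp add: a_minus_def NA.M.minus_add NA.M.a_ac)
qed

lemma smult_diff:
  assumes "q \<in> carrier Q" "x \<in> carrier N" "y \<in> carrier N"
  shows "\<pi> q \<odot>\<^bsub>N\<^esub> (x \<ominus>\<^bsub>N\<^esub> y) = \<pi> q \<odot>\<^bsub>N\<^esub> x \<ominus>\<^bsub>N\<^esub> \<pi> q \<odot>\<^bsub>N\<^esub> y"
proof -
  interpret NA: module A N by (rule NA)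
  show ?thesis using assms pi_mem(1) by (simp add: a_minus_def NA.smult_r_distr NA.smult_r_minus)
qed

lemma coboundary_mod_add:
  assumes f: "\<And>x. x \<in> T i \<Longrightarrow> f x \<in> carrier N" "\<And>x. x \<in> T i \<Longrightarrow> f' x \<in> carrier N"
    and "coboundary_mod i m f" "coboundary_mod i m f'"
  shows "coboundary_mod i m (\<lambda>x. f x \<oplus>\<^bsub>N\<^esub> f' x)"
proof -
  obtain g g' where g: "g \<in> mod_hom Q (fmod Q (T (i - 1))) (rs N)" "\<And>x. x \<in> T i \<Longrightarrow> f x \<ominus>\<^bsub>N\<^esub> g (D i x) \<in> L m"
    and g': "g' \<in> mod_hom Q (fmod Q (T (i - 1))) (rs N)" "\<And>x. x \<in> T i \<Longrightarrow> f' x \<ominus>\<^bsub>N\<^esub> g' (D i x) \<in> L m"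
    using assms(3,4) unfolding coboundary_mod_def by blast
  have "(f x \<oplus>\<^bsub>N\<^esub> f' x) \<ominus>\<^bsub>N\<^esub> (g (D i x) \<oplus>\<^bsub>N\<^esub> g' (D i x)) \<in> L m" if x: "x \<in> T i" for x
    using add_minus_add[OF f[OF x] hom_T[OF g(1) D_T[OF x]] hom_T[OF g'(1) D_T[OF x]]]
      L_mem(2)[OF g(2)[OF x] g'(2)[OF x]] by simp
  then show ?thesis
    unfolding coboundary_mod_def using mod_hom_add[OF NQ g(1) g'(1)] by (intro bexI[of _ "\<lambda>x. g x \<oplus>\<^bsub>N\<^esub> g' x"]) simp_all
qed

text \<open>Two levels appear because a scalar keeps the level, while an element of \<open>G\<close>
  raises it by one.\<close>

lemma coboundary_mod_scale:
  assumes q: "q \<in> carrier Q" and f: "\<And>x. x \<in> T i \<Longrightarrow> f x \<in> carrier N"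
    and L: "\<And>x. x \<in> L m \<Longrightarrow> \<pi> q \<odot>\<^bsub>N\<^esub> x \<in> L m'" and b: "coboundary_mod i m f"
  shows "coboundary_mod i m' (\<lambda>x. \<pi> q \<odot>\<^bsub>N\<^esub> f x)"
proof -
  obtain g where g: "g \<in> mod_hom Q (fmod Q (T (i - 1))) (rs N)" "\<And>x. x \<in> T i \<Longrightarrow> f x \<ominus>\<^bsub>N\<^esub> g (D i x) \<in> L m"
    using b unfolding coboundary_mod_def by blast
  have "\<pi> q \<odot>\<^bsub>N\<^esub> f x \<ominus>\<^bsub>N\<^esub> \<pi> q \<odot>\<^bsub>N\<^esub> g (D i x) \<in> L m'" if x: "x \<in> T i" for x
    using smult_diff[OF q f[OF x] hom_T[OF g(1) D_T[OF x]]] L[OF g(2)[OF x]] by simp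
  then show ?thesis
    unfolding coboundary_mod_def using mod_hom_smult[OF NQ g(1) q] by (intro bexI[of _ "\<lambda>x. \<pi> q \<odot>\<^bsub>N\<^esub> g x"]) simp_all
qed

lemma coboundary_mod_smult:
  assumes "q \<in> carrier Q" "\<And>x. x \<in> T i \<Longrightarrow> f x \<in> carrier N" "coboundary_mod i m f"
  shows "coboundary_mod i m (\<lambda>x. \<pi> q \<odot>\<^bsub>N\<^esub> f x)"
  using coboundary_mod_scale[OF assms(1,2) L_mem(3)[OF assms(1)] assms(3)] .

lemma coboundary_mod_small:
  assumes "\<And>x. x \<in> T i \<Longrightarrow> f x \<in> L m"
  shows "coboundary_mod i m f"
proof -
  have "f x \<ominus>\<^bsub>N\<^esub> \<zero>\<^bsub>N\<^esub> \<in> L m" if "x \<in> T i" for x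
    using L_mem(4)[OF assms[OF that] L_mem(1)] .
  then show ?thesis
    unfolding coboundary_mod_def using mod_hom_const_zero[OF NQ] by (intro bexI[of _ "\<lambda>_. \<zero>\<^bsub>N\<^esub>"]) simp_all
qed

lemma coboundary_mod_coboundary:
  assumes g: "g \<in> mod_hom Q (fmod Q (T (i - 1))) (rs N)"
  shows "coboundary_mod i m (\<lambda>x. g (D i x))"
proof -
  interpret NA: module A N by (rule NA)
  have "g (D i x) \<ominus>\<^bsub>N\<^esub> g (D i x) \<in> L m" if "x \<in> T i" for x
    using hom_T[OF g D_T[OF that]] L_mem(1) by (simp add: a_minus_def NA.M.r_neg)
  then show ?thesis unfolding coboundary_mod_def using g by blast
qed

text \<open>\<open>D\<close> commutes with the contractions, so composing the hom \<open>g\<close>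
  for degree \<open>i - 2\<close> with a contraction gives one for degree \<open>i\<close>.\<close>

lemma coboundary_mod_shift:
  assumes "coboundary_mod (i - 2) m f"
  shows "coboundary_mod i m (\<lambda>x. f (shift {#j#} x))"
proof -
  obtain g where g: "g \<in> mod_hom Q (fmod Q (T (i - 2 - 1))) (rs N)"
    "\<And>x. x \<in> T (i - 2) \<Longrightarrow> f x \<ominus>\<^bsub>N\<^esub> g (D (i - 2) x) \<in> L m"
    using assms unfolding coboundary_mod_def by blast
  have i: "i - 2 - 1 = i - 1 - 2" by simp
  have "(\<lambda>x. g (shift {#j#} x)) \<in> mod_hom Q (fmod Q (T (i - 1))) (rs N)"
    using mod_hom_comp[OF _ g(1)[unfolded i], of "shift {#j#}"] shift_hom[of "{#j#}" "i - 1"] by simp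
  moreover have "f (shift {#j#} x) \<ominus>\<^bsub>N\<^esub> g (shift {#j#} (D i x)) \<in> L m" if "x \<in> T i" for x
    using g(2)[of "shift {#j#} x"] shift_T[OF that, of "{#j#}"] shift_D[of "{#j#}" i x] by simp
  ultimately show ?thesis
    unfolding coboundary_mod_def by (intro bexI[of _ "\<lambda>x. g (shift {#j#} x)"] ballI)
qed

text \<open>Extends the entries of level \<open>m\<close> to a hom on \<open>T i\<close> through the
  coordinates. The index \<open>i - 2|b|\<close> into the resolution is forced by the total degree,
  so one family carries cochains of all degrees.\<close>

definition cochain :: "(cochain_index \<Rightarrow> 'n) \<Rightarrow> nat \<Rightarrow> nat \<Rightarrow> (nat multiset \<times> nat \<Rightarrow> 'q) \<Rightarrow> 'n" where
  "cochain u i m x = (\<Oplus>\<^bsub>rs N\<^esub>y\<in>Idx i. x y \<odot>\<^bsub>rs N\<^esub> u (m, fst y, i - 2 * size (fst y), snd y))"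

lemma cochain_hom: "u \<in> X \<Longrightarrow> cochain u i m \<in> mod_hom Q (fmod Q (T i)) (rs N)"
  unfolding cochain_def[abs_def]
  by (rule dual_basis_extend[OF basis_T NQ]) (simp add: X_D(4))

lemma cochain_add:
  assumes u: "u \<in> X" and v: "v \<in> X" and x: "x \<in> T i"
  shows "cochain (u \<oplus>\<^bsub>pmod (rs N) X\<^esub> v) i m x = cochain u i m x \<oplus>\<^bsub>N\<^esub> cochain v i m x"
proof -
  have "cochain (u \<oplus>\<^bsub>pmod (rs N) X\<^esub> v) i m x =
      (\<Oplus>\<^bsub>rs N\<^esub>y\<in>Idx i. x y \<odot>\<^bsub>rs N\<^esub> u (m, fst y, i - 2 * size (fst y), snd y) \<oplus>\<^bsub>rs N\<^esub> x y \<odot>\<^bsub>rs N\<^esub> v (m, fst y, i - 2 * size (fst y), snd y))"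
    unfolding cochain_def pmod_simps
    by (rule N.M.finsum_cong'[OF refl])
      (use N.smult_r_distr[OF T_carrier[OF x]] N.smult_closed[OF T_carrier[OF x]] X_D(4)[OF u] X_D(4)[OF v] N.M.a_closed in simp_all)
  also have "\<dots> = cochain u i m x \<oplus>\<^bsub>rs N\<^esub> cochain v i m x"
    unfolding cochain_def
    by (rule N.M.finsum_addf) (use N.smult_closed[OF T_carrier[OF x]] X_D(4)[OF u] X_D(4)[OF v] in auto)
  finally show ?thesis by simp
qed

lemma cochain_smult:
  assumes q: "q \<in> carrier Q" and u: "u \<in> X" and x: "x \<in> T i"
    and u': "\<And>b k s. u' (m', b, k, s) = \<pi> q \<odot>\<^bsub>N\<^esub> u (m, b, k, s)"
  shows "cochain u' i m' x = \<pi> q \<odot>\<^bsub>N\<^esub> cochain u i m x"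
proof -
  have "cochain u' i m' x = (\<Oplus>\<^bsub>rs N\<^esub>y\<in>Idx i. q \<odot>\<^bsub>rs N\<^esub> (x y \<odot>\<^bsub>rs N\<^esub> u (m, fst y, i - 2 * size (fst y), snd y)))"
    unfolding cochain_def
  proof (rule N.M.finsum_cong'[OF refl])
    fix y :: "nat multiset \<times> nat"
    let ?v = "u (m, fst y, i - 2 * size (fst y), snd y)"
    have v: "?v \<in> carrier (rs N)" using X_D(4)[OF u] by simp
    show "x y \<odot>\<^bsub>rs N\<^esub> u' (m', fst y, i - 2 * size (fst y), snd y) = q \<odot>\<^bsub>rs N\<^esub> (x y \<odot>\<^bsub>rs N\<^esub> ?v)"
      using N.smult_assoc1[OF q T_carrier[OF x] v] N.smult_assoc1[OF T_carrier[OF x] q v] Q.m_comm[OF q T_carrier[OF x]]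
      by (simp add: u')
  qed (use N.smult_closed[OF T_carrier[OF x]] N.smult_closed[OF q] X_D(4)[OF u] in simp)
  also have "\<dots> = q \<odot>\<^bsub>rs N\<^esub> cochain u i m x"
    unfolding cochain_def
    by (rule N.finsum_smult_ldistr[symmetric, OF finite_Idx q]) (use N.smult_closed[OF T_carrier[OF x]] X_D(4)[OF u] in auto)
  finally show ?thesis by simp
qed

lemma cochain_eq_0:
  assumes x: "x \<in> T i" and u: "\<And>b s. (b, s) \<in> Idx i \<Longrightarrow> u (m, b, i - 2 * size b, s) = \<zero>\<^bsub>N\<^esub>"
  shows "cochain u i m x = \<zero>\<^bsub>N\<^esub>"
proof -
  have "cochain u i m x = (\<Oplus>\<^bsub>rs N\<^esub>y\<in>Idx i. \<zero>\<^bsub>rs N\<^esub>)"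
    unfolding cochain_def
    by (rule N.M.finsum_cong'[OF refl]) (use u pi_smult_zero[OF T_carrier[OF x]] N.M.zero_closed in auto)
  then show ?thesis using N.M.finsum_zero by simp
qed

lemma cochain_mult:
  assumes v: "v \<in> G" and u: "u \<in> X" and x: "x \<in> T i"
  shows "cochain (mult v u) i (Suc m) x = \<pi> v \<odot>\<^bsub>N\<^esub> cochain u i m x" "cochain (mult v u) i 0 x = \<zero>\<^bsub>N\<^esub>"
proof -
  show "cochain (mult v u) i (Suc m) x = \<pi> v \<odot>\<^bsub>N\<^esub> cochain u i m x"
    by (rule cochain_smult[OF _ u x]) (use v G(2) in \<open>auto simp: mult_def\<close>)
  show "cochain (mult v u) i 0 x = \<zero>\<^bsub>N\<^esub>"
    by (rule cochain_eq_0[OF x]) (simp add: mult_def)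
qed

text \<open>Only monomials divisible by the variable \<open>j\<close> contribute to the sum, and
  dividing by it is a reindexing. For \<open>i < 2\<close> truncated subtraction yields degree 0,
  but both sides vanish then.\<close>

lemma cochain_raise:
  assumes j: "j < c" and u: "u \<in> X" and x: "x \<in> T i"
  shows "cochain (raise j u) i m x = cochain u (i - 2) m (shift {#j#} x)"
proof (cases "i < 2")
  case True
  have "shift {#j#} x = \<zero>\<^bsub>fmod Q (T (i - 2))\<^esub>" using shift_T_zero[OF x, of "{#j#}"] True by simp
  then have "cochain u (i - 2) m (shift {#j#} x) = \<zero>\<^bsub>N\<^esub>"
    using mod_hom_zero[OF module_T NQ cochain_hom[OF u, of "i - 2" m]] by simp
  moreover have "cochain (raise j u) i m x = \<zero>\<^bsub>N\<^esub>"
  proof (rule cochain_eq_0[OF x])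
    fix b s assume "(b, s) \<in> Idx i"
    then have "2 * size b \<le> i" by (simp add: Idx_def)
    then have "2 * size b < 2" using True by linarith
    then have "size b = 0" by linarith
    then show "raise j u (m, b, i - 2 * size b, s) = \<zero>\<^bsub>N\<^esub>" by (simp add: raise_def)
  qed
  ultimately show ?thesis by simp
next
  case False
  define \<phi> where "\<phi> = (\<lambda>(b, s :: nat). (add_mset j b, s))"
  define t where "t y = x y \<odot>\<^bsub>rs N\<^esub> raise j u (m, fst y, i - 2 * size (fst y), snd y)" for y
  have t: "t y \<in> carrier (rs N)" for y
    unfolding t_def using N.smult_closed[OF T_carrier[OF x, of y], of "raise j u (m, fst y, i - 2 * size (fst y), snd y)"]
      X_D(4)[OF u] N.M.zero_closed by (simp add: raise_def)
  have inj: "inj_on \<phi> (Idx (i - 2))" by (auto simp: \<phi>_def inj_on_def)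
  have sub: "\<phi> ` Idx (i - 2) \<subseteq> Idx i" using False j by (auto simp: \<phi>_def Idx_def)
  have zero: "t y = \<zero>\<^bsub>rs N\<^esub>" if y: "y \<in> Idx i - \<phi> ` Idx (i - 2)" for y
  proof -
    obtain b s where bs: "y = (b, s)" by (cases y)
    have "j \<notin># b"
    proof
      assume "j \<in># b"
      then obtain b' where b': "b = add_mset j b'" by (metis multi_member_split)
      have "(b', s) \<in> Idx (i - 2)" using y False by (auto simp: Idx_def bs b')
      then have "y \<in> \<phi> ` Idx (i - 2)" by (intro image_eqI[of _ _ "(b', s)"]) (simp_all add: \<phi>_def bs b')
      then show False using y by blast
    qed
    then show ?thesis using pi_smult_zero[OF T_carrier[OF x]] by (simp add: t_def bs raise_def)
  qed
  have "cochain (raise j u) i m x = (\<Oplus>\<^bsub>rs N\<^esub>y\<in>Idx i. t y)" by (simp add: cochain_def t_def)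
  also have "\<dots> = (\<Oplus>\<^bsub>rs N\<^esub>y\<in>\<phi> ` Idx (i - 2). t y)"
    using t zero by (intro N.M.add.finprod_mono_neutral_cong_left[symmetric, OF finite_Idx sub]) auto
  also have "\<dots> = (\<Oplus>\<^bsub>rs N\<^esub>y\<in>Idx (i - 2). t (\<phi> y))"
    by (rule N.M.add.finprod_reindex) (use t inj in auto)
  also have "\<dots> = cochain u (i - 2) m (shift {#j#} x)"
    unfolding cochain_def
  proof (rule N.M.finsum_cong'[OF refl])
    fix y :: "nat multiset \<times> nat"
    obtain b s where bs: "y = (b, s)" by (cases y)
    show "t (\<phi> y) = shift {#j#} x y \<odot>\<^bsub>rs N\<^esub> u (m, fst y, i - 2 - 2 * size (fst y), snd y)"
      by (simp add: t_def bs \<phi>_def raise_def shift_def)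
  qed (use N.smult_closed[OF T_carrier[OF shift_T[OF x]]] X_D(4)[OF u] in simp)
  finally show ?thesis .
qed

text \<open>Level \<open>m\<close> is tested modulo level \<open>m + 1\<close>: modulo
  \<open>L m\<close> every cochain of level \<open>m\<close> would be trivial, having its values
  there.\<close>

definition B :: "(cochain_index \<Rightarrow> 'n) set" where
  "B = {u \<in> X. \<forall>i m. coboundary_mod i (Suc m) (cochain u i m)}"

lemma B_submodule: "submodule B Q (pmod (rs N) X)"
proof -
  interpret X: module Q "pmod (rs N) X" by (rule X_module)
  have sm: "q \<odot>\<^bsub>pmod (rs N) X\<^esub> u \<in> B" if q: "q \<in> carrier Q" and u: "u \<in> B" for q u
  proof -
    have uX: "u \<in> X" and ub: "coboundary_mod i (Suc m) (cochain u i m)" for i m using u by (auto simp: B_def)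
    have "coboundary_mod i (Suc m) (cochain (q \<odot>\<^bsub>pmod (rs N) X\<^esub> u) i m)" for i m
      using coboundary_mod_smult[OF q hom_T[OF cochain_hom[OF uX]] ub, of i m]
        coboundary_mod_cong[of i "cochain (q \<odot>\<^bsub>pmod (rs N) X\<^esub> u) i m" "\<lambda>x. \<pi> q \<odot>\<^bsub>N\<^esub> cochain u i m x" "Suc m"]
        cochain_smult[OF q uX, of _ i "q \<odot>\<^bsub>pmod (rs N) X\<^esub> u" m m] by simp
    then show ?thesis using X.smult_closed[OF q, of u] uX by (simp add: B_def)
  qed
  show ?thesis
  proof (rule X.submoduleI)
    show "B \<subseteq> carrier (pmod (rs N) X)" by (auto simp: B_def)
    have "coboundary_mod i (Suc m) (cochain \<zero>\<^bsub>pmod (rs N) X\<^esub> i m)" for i m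
      by (rule coboundary_mod_small) (use cochain_eq_0[of _ i "\<zero>\<^bsub>pmod (rs N) X\<^esub>" m] L_mem(1) in simp)
    then show "\<zero>\<^bsub>pmod (rs N) X\<^esub> \<in> B" using X.M.zero_closed by (simp add: B_def)
    show "q \<odot>\<^bsub>pmod (rs N) X\<^esub> u \<in> B" if "q \<in> carrier Q" "u \<in> B" for q u by (rule sm[OF that])
    show "\<ominus>\<^bsub>pmod (rs N) X\<^esub> u \<in> B" if u: "u \<in> B" for u
    proof -
      have "u \<in> carrier (pmod (rs N) X)" using u by (simp add: B_def)
      then have "\<ominus>\<^bsub>pmod (rs N) X\<^esub> u = (\<ominus>\<^bsub>Q\<^esub> \<one>\<^bsub>Q\<^esub>) \<odot>\<^bsub>pmod (rs N) X\<^esub> u"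
        using X.smult_l_minus[of "\<one>\<^bsub>Q\<^esub>" u] X.smult_one[of u] by simp
      then show ?thesis using sm[of "\<ominus>\<^bsub>Q\<^esub> \<one>\<^bsub>Q\<^esub>" u] u by simp
    qed
    show "u \<oplus>\<^bsub>pmod (rs N) X\<^esub> v \<in> B" if u: "u \<in> B" and v: "v \<in> B" for u v
    proof -
      have uX: "u \<in> X" and ub: "coboundary_mod i (Suc m) (cochain u i m)" for i m using u by (auto simp: B_def)
      have vX: "v \<in> X" and vb: "coboundary_mod i (Suc m) (cochain v i m)" for i m using v by (auto simp: B_def)
      have "coboundary_mod i (Suc m) (cochain (u \<oplus>\<^bsub>pmod (rs N) X\<^esub> v) i m)" for i m
        using coboundary_mod_add[OF hom_T[OF cochain_hom[OF uX]] hom_T[OF cochain_hom[OF vX]] ub vb, of i m]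
          coboundary_mod_cong[of i "cochain (u \<oplus>\<^bsub>pmod (rs N) X\<^esub> v) i m" "\<lambda>x. cochain u i m x \<oplus>\<^bsub>N\<^esub> cochain v i m x" "Suc m"]
          cochain_add[OF uX vX, of _ i m] by blast
      then show ?thesis using X.M.a_closed[of u v] uX vX by (simp add: B_def)
    qed
  qed
qed

text \<open>\<open>raise\<close> preserves triviality because \<open>D\<close> commutes with the
  contractions, and \<open>mult\<close> because it raises the level of the cochain and the modulus
  together.\<close>

lemma B_stable: "stable_submodule Q (pmod (rs N) X) operators B"
proof -
  have "\<theta> u \<in> B" if \<theta>: "\<theta> \<in> operators" and u: "u \<in> B" for \<theta> u
  proof -
    have uX: "u \<in> X" and ub: "coboundary_mod i (Suc m) (cochain u i m)" for i m using u by (auto simp: B_def)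
    have "\<theta> \<in> mod_hom Q (pmod (rs N) X) (pmod (rs N) X)" using operators_hom \<theta> by blast
    then have X: "\<theta> u \<in> X" using mod_homD(1)[of \<theta> Q "pmod (rs N) X" "pmod (rs N) X" u] uX by simp
    have "coboundary_mod i (Suc m) (cochain (\<theta> u) i m)" for i m
    proof -
      consider j where "j < c" "\<theta> = raise j" | v where "v \<in> G" "\<theta> = mult v"
        using \<theta> unfolding operators_def by blast
      then show ?thesis
      proof cases
        case 1
        have "coboundary_mod i (Suc m) (\<lambda>x. cochain u (i - 2) m (shift {#j#} x))"
          by (rule coboundary_mod_shift[OF ub])
        moreover have "cochain (\<theta> u) i m x = cochain u (i - 2) m (shift {#j#} x)" if "x \<in> T i" for x
          unfolding 1(2) by (rule cochain_raise[OF 1(1) uX that])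
        ultimately show ?thesis by (subst coboundary_mod_cong) 
      next
        case 2
        have vQ: "v \<in> carrier Q" using 2(1) G(2) by blast
        show ?thesis
        proof (cases m)
          case 0
          have "coboundary_mod i (Suc m) (cochain (mult v u) i 0)"
            by (rule coboundary_mod_small) (simp add: cochain_mult(2)[OF 2(1) uX] L_mem(1))
          then show ?thesis by (simp add: 0 2(2))
        next
          case (Suc m')
          have "coboundary_mod i (Suc m) (\<lambda>x. \<pi> v \<odot>\<^bsub>N\<^esub> cochain u i m' x)"
            by (rule coboundary_mod_scale[OF vQ hom_T[OF cochain_hom[OF uX]] _ ub[of i m']]) (use L_mult[OF 2(1)] Suc in simp_all)
          moreover have "cochain (\<theta> u) i m x = \<pi> v \<odot>\<^bsub>N\<^esub> cochain u i m' x" if "x \<in> T i" for x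
            unfolding 2(2) Suc by (rule cochain_mult(1)[OF 2(1) uX that])
          ultimately show ?thesis by (subst coboundary_mod_cong)
        qed
      qed
    qed
    then show ?thesis using X by (simp add: B_def)
  qed
  then show ?thesis using B_submodule unfolding stable_submodule_def by blast
qed

section \<open>The finite set of primes that receives all associated primes\<close>

definition prime_set :: "'q set set" where
  "prime_set = {p. primeideal p Q \<and> (\<exists>u\<in>X. p = {q \<in> carrier Q. q \<odot>\<^bsub>pmod (rs N) X\<^esub> u \<in> B})}"

lemma finite_prime_set: "finite prime_set"
proof -
  have "noetherian_on Q (pmod (rs N) X) operators (carrier (pmod (rs N) X))" using X_noetherian by simp
  from finite_relative_associated_primes[OF Q_noetherian X_module operators_hom this B_stable]
  show ?thesis unfolding prime_set_def by simp
qed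

text \<open>The values of \<open>h\<close> on the dual basis are placed at level \<open>m\<close> in
  total degree \<open>i\<close>, with all other entries zero; they form an element of
  \<open>X\<close> because they lie in \<open>L m\<close>. Then \<open>h\<close> is the only cochain
  of this family that can be nonzero, and membership of a multiple in \<open>B\<close> reduces to a
  single condition.\<close>

lemma small_cochain_prime:
  assumes p: "primeideal p Q" and h: "h \<in> mod_hom Q (fmod Q (T i)) (rs N)" "\<And>x. x \<in> T i \<Longrightarrow> h x \<in> L m"
    and eq: "p = {q \<in> carrier Q. coboundary_mod i (Suc m) (\<lambda>x. \<pi> q \<odot>\<^bsub>N\<^esub> h x)}"
  shows "p \<in> prime_set"
proof -
  \<comment> \<open>The degree condition is written as a sum, so that the entry for a pair
    \<open>(b, s)\<close> is not seen in any other degree.\<close>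
  define u :: "cochain_index \<Rightarrow> 'n" where "u = (\<lambda>(m', b, k, s).
    if m' = m \<and> (b, s) \<in> Idx i \<and> k + 2 * size b = i then h (WT i (b, s)) else \<zero>\<^bsub>N\<^esub>)"
  have uX: "u \<in> X"
  proof (rule X_I)
    have "{z. u z \<noteq> \<zero>\<^bsub>N\<^esub>} \<subseteq> (\<lambda>(b, s). (m, b, i - 2 * size b, s)) ` Idx i"
    proof
      fix z assume z: "z \<in> {z. u z \<noteq> \<zero>\<^bsub>N\<^esub>}"
      obtain m' b k s where zz: "z = (m', b, k, s)" by (metis prod_cases4)
      have "m' = m" "(b, s) \<in> Idx i" "k = i - 2 * size b" using z by (auto simp: u_def zz split: if_splits)
      then show "z \<in> (\<lambda>(b, s). (m, b, i - 2 * size b, s)) ` Idx i" unfolding zz by force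
    qed
    then show "finite {z. u z \<noteq> \<zero>\<^bsub>N\<^esub>}" by (rule finite_subset) (rule finite_imageI[OF finite_Idx])
    fix z :: cochain_index
    obtain m' b k s where zz: "z = (m', b, k, s)" by (metis prod_cases4)
    show "u z \<in> L (fst z)" using h(2)[OF WT_T, of "(b, s)"] L_mem(1) by (simp add: u_def zz)
    show "u z = \<zero>\<^bsub>N\<^esub>" if "\<not> allowed z"
      using that by (auto simp: u_def zz allowed_def Idx_def)
  qed
  have ch: "cochain u i m x = h x" if x: "x \<in> T i" for x
  proof -
    have "cochain u i m x = (\<Oplus>\<^bsub>rs N\<^esub>y\<in>Idx i. x y \<odot>\<^bsub>rs N\<^esub> h (WT i y))"
      unfolding cochain_def
    proof (rule N.M.finsum_cong'[OF refl])
      show "x y \<odot>\<^bsub>rs N\<^esub> u (m, fst y, i - 2 * size (fst y), snd y) = x y \<odot>\<^bsub>rs N\<^esub> h (WT i y)" if "y \<in> Idx i" for y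
        using that by (auto simp: u_def Idx_def)
      show "(\<lambda>y. x y \<odot>\<^bsub>rs N\<^esub> h (WT i y)) \<in> Idx i \<rightarrow> carrier (rs N)"
        using N.smult_closed[OF T_carrier[OF x]] hom_T[OF h(1) WT_T] by auto
    qed
    then show ?thesis using dual_basis_hom[OF basis_T NQ h(1) x] by simp
  qed
  have c0: "cochain u i' m' x = \<zero>\<^bsub>N\<^esub>" if "i' \<noteq> i \<or> m' \<noteq> m" and x: "x \<in> T i'" for i' m' x
    by (rule cochain_eq_0[OF x]) (use that(1) in \<open>auto simp: u_def Idx_def\<close>)
  have "q \<odot>\<^bsub>pmod (rs N) X\<^esub> u \<in> B \<longleftrightarrow> coboundary_mod i (Suc m) (\<lambda>x. \<pi> q \<odot>\<^bsub>N\<^esub> h x)" if q: "q \<in> carrier Q" for q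
  proof -
    interpret X: module Q "pmod (rs N) X" by (rule X_module)
    have X: "q \<odot>\<^bsub>pmod (rs N) X\<^esub> u \<in> X" using X.smult_closed[OF q, of u] uX by simp
    have eq: "cochain (q \<odot>\<^bsub>pmod (rs N) X\<^esub> u) i' m' x = \<pi> q \<odot>\<^bsub>N\<^esub> cochain u i' m' x" if "x \<in> T i'" for i' m' x
      by (rule cochain_smult[OF q uX that]) simp
    have "coboundary_mod i (Suc m) (cochain (q \<odot>\<^bsub>pmod (rs N) X\<^esub> u) i m) \<longleftrightarrow> coboundary_mod i (Suc m) (\<lambda>x. \<pi> q \<odot>\<^bsub>N\<^esub> h x)"
      by (rule coboundary_mod_cong) (simp only: eq ch)
    moreover have "coboundary_mod i' (Suc m') (cochain (q \<odot>\<^bsub>pmod (rs N) X\<^esub> u) i' m')" if "i' \<noteq> i \<or> m' \<noteq> m" for i' m'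
      by (rule coboundary_mod_small) (simp only: eq c0[OF that] pi_smult_zero[OF q] L_mem(1))
    then have "(\<forall>i' m'. coboundary_mod i' (Suc m') (cochain (q \<odot>\<^bsub>pmod (rs N) X\<^esub> u) i' m')) \<longleftrightarrow>
        coboundary_mod i (Suc m) (cochain (q \<odot>\<^bsub>pmod (rs N) X\<^esub> u) i m)" by metis
    ultimately show ?thesis unfolding B_def using X by simp
  qed
  then have "p = {q \<in> carrier Q. q \<odot>\<^bsub>pmod (rs N) X\<^esub> u \<in> B}" using eq by blast
  then show ?thesis unfolding prime_set_def using p uX by blast
qed

text \<open>A class modulo \<open>L m\<close> is traded, after multiplying by some \<open>a \<notin> p\<close>, for one represented by a
  cochain with values in \<open>L m0\<close>, for the largest possible \<open>m0 < m\<close>.\<close>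

lemma cochain_prime:
  assumes p: "primeideal p Q" and f: "f \<in> mod_hom Q (fmod Q (T i)) (rs N)"
    and eq: "p = {q \<in> carrier Q. coboundary_mod i m (\<lambda>x. \<pi> q \<odot>\<^bsub>N\<^esub> f x)}"
  shows "p \<in> prime_set"
proof -
  interpret p: primeideal p Q by fact
  interpret NA: module A N by (rule NA)
  have fN: "f x \<in> carrier N" if "x \<in> T i" for x by (rule hom_T[OF f that])
  \<comment> \<open>Some multiple of \<open>f\<close> by an element outside \<open>p\<close> is
    trivial modulo \<open>L m'\<close>. For \<open>m' = 0\<close> this always holds, because
    \<open>L 0\<close> is all of \<open>N\<close>; for \<open>m' = m\<close> it never does, because
    \<open>p\<close> collects exactly the multipliers that make \<open>f\<close> trivial modulo
    \<open>L m\<close>. Hence it switches from true to false after some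
    \<open>m0 < m\<close>.\<close>
  define P where "P m' \<longleftrightarrow> (\<exists>a\<in>carrier Q. a \<notin> p \<and> coboundary_mod i m' (\<lambda>x. \<pi> a \<odot>\<^bsub>N\<^esub> f x))" for m'
  have "\<one>\<^bsub>Q\<^esub> \<notin> p" using p.I_notcarr p.one_imp_carrier by blast
  moreover have "coboundary_mod i 0 (\<lambda>x. \<pi> \<one>\<^bsub>Q\<^esub> \<odot>\<^bsub>N\<^esub> f x)"
    by (rule coboundary_mod_small) (use fN N.smult_closed[OF Q.one_closed] L_0 in simp)
  ultimately have "P 0" unfolding P_def by blast
  moreover have "\<not> P m" unfolding P_def using eq by blast
  ultimately have "\<exists>m0<m. P m0 \<and> \<not> P (Suc m0)"
    by (metis dec_induct[of 0 m P] le0)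
  then obtain m0 where m0: "m0 < m" "P m0" "\<not> P (Suc m0)" by blast
  obtain a where a: "a \<in> carrier Q" "a \<notin> p" "coboundary_mod i m0 (\<lambda>x. \<pi> a \<odot>\<^bsub>N\<^esub> f x)"
    using m0(2) unfolding P_def by blast
  obtain g where g: "g \<in> mod_hom Q (fmod Q (T (i - 1))) (rs N)"
    "\<And>x. x \<in> T i \<Longrightarrow> \<pi> a \<odot>\<^bsub>N\<^esub> f x \<ominus>\<^bsub>N\<^esub> g (D i x) \<in> L m0"
    using a(3) unfolding coboundary_mod_def by blast
  define h where "h x = \<pi> a \<odot>\<^bsub>N\<^esub> f x \<ominus>\<^bsub>N\<^esub> g (D i x)" for x
  have gD: "(\<lambda>x. g (D i x)) \<in> mod_hom Q (fmod Q (T i)) (rs N)" by (rule mod_hom_comp[OF D_hom g(1)])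
  have h: "h \<in> mod_hom Q (fmod Q (T i)) (rs N)"
    using mod_hom_diff[OF NQ mod_hom_smult[OF NQ f a(1)] gD] by (simp add: h_def[abs_def])
  have hN: "h x \<in> carrier N" and gN: "g (D i x) \<in> carrier N" if "x \<in> T i" for x
    using hom_T[OF h that] hom_T[OF gD that] .
  \<comment> \<open>\<open>h\<close> differs from \<open>a f\<close> by a coboundary, so
    \<open>q h\<close> is trivial modulo \<open>L (m0 + 1)\<close> iff \<open>q a f\<close> is. For
    \<open>q\<close> in \<open>p\<close> it is, even modulo \<open>L m\<close>. For \<open>q\<close>
    outside \<open>p\<close> the product \<open>q a\<close> is outside \<open>p\<close> as well, and
    the choice of \<open>m0\<close> excludes triviality modulo \<open>L (m0 + 1)\<close>.\<close>
  have "q \<in> p \<longleftrightarrow> coboundary_mod i (Suc m0) (\<lambda>x. \<pi> q \<odot>\<^bsub>N\<^esub> h x)" if q: "q \<in> carrier Q" for q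
  proof
    have qa: "\<pi> (q \<otimes>\<^bsub>Q\<^esub> a) \<odot>\<^bsub>N\<^esub> f x = \<pi> q \<odot>\<^bsub>N\<^esub> (\<pi> a \<odot>\<^bsub>N\<^esub> f x)" if "x \<in> T i" for x
      using N.smult_assoc1[OF q a(1), of "f x"] fN[OF that] by simp
    have gq: "(\<lambda>x. \<pi> q \<odot>\<^bsub>N\<^esub> g x) \<in> mod_hom Q (fmod Q (T (i - 1))) (rs N)"
      using mod_hom_smult[OF NQ g(1) q] by simp
    have sN: "\<pi> q' \<odot>\<^bsub>N\<^esub> y \<in> carrier N" if "q' \<in> carrier Q" "y \<in> carrier N" for q' y
      using N.smult_closed[OF that(1), of y] that(2) by simp
    have dec: "\<pi> q \<odot>\<^bsub>N\<^esub> h x = \<pi> (q \<otimes>\<^bsub>Q\<^esub> a) \<odot>\<^bsub>N\<^esub> f x \<ominus>\<^bsub>N\<^esub> \<pi> q \<odot>\<^bsub>N\<^esub> g (D i x)" if x: "x \<in> T i" for x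
      unfolding h_def qa[OF x] by (rule smult_diff[OF q sN[OF a(1) fN[OF x]] gN[OF x]])
    show "coboundary_mod i (Suc m0) (\<lambda>x. \<pi> q \<odot>\<^bsub>N\<^esub> h x)" if "q \<in> p"
    proof -
      have "q \<otimes>\<^bsub>Q\<^esub> a \<in> p" using p.I_r_closed[OF that a(1)] .
      then have "coboundary_mod i m (\<lambda>x. \<pi> (q \<otimes>\<^bsub>Q\<^esub> a) \<odot>\<^bsub>N\<^esub> f x)" using eq by blast
      then have c: "coboundary_mod i (Suc m0) (\<lambda>x. \<pi> (q \<otimes>\<^bsub>Q\<^esub> a) \<odot>\<^bsub>N\<^esub> f x)"
        using coboundary_mod_antimono[of "Suc m0" m] m0(1) by simp
      have gu: "(\<lambda>x. \<ominus>\<^bsub>N\<^esub> (\<pi> q \<odot>\<^bsub>N\<^esub> g x)) \<in> mod_hom Q (fmod Q (T (i - 1))) (rs N)"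
        using mod_hom_uminus[OF NQ gq] by (simp add: a_inv_def m_inv_def restrict_scalars_def)
      have "coboundary_mod i (Suc m0) (\<lambda>x. \<pi> (q \<otimes>\<^bsub>Q\<^esub> a) \<odot>\<^bsub>N\<^esub> f x \<oplus>\<^bsub>N\<^esub> \<ominus>\<^bsub>N\<^esub> (\<pi> q \<odot>\<^bsub>N\<^esub> g (D i x)))"
        by (rule coboundary_mod_add[OF _ _ c coboundary_mod_coboundary[OF gu]])
          (use sN[OF _ fN] sN[OF q gN] q a(1) in auto)
      then show ?thesis
        by (subst coboundary_mod_cong[of i _ "\<lambda>x. \<pi> (q \<otimes>\<^bsub>Q\<^esub> a) \<odot>\<^bsub>N\<^esub> f x \<oplus>\<^bsub>N\<^esub> \<ominus>\<^bsub>N\<^esub> (\<pi> q \<odot>\<^bsub>N\<^esub> g (D i x))"])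
          (simp_all add: dec a_minus_def)
    qed
    show "q \<in> p" if c: "coboundary_mod i (Suc m0) (\<lambda>x. \<pi> q \<odot>\<^bsub>N\<^esub> h x)"
    proof (rule ccontr)
      assume "q \<notin> p"
      then have qap: "q \<otimes>\<^bsub>Q\<^esub> a \<notin> p" using p.I_prime[OF q a(1)] a(2) by blast
      have "coboundary_mod i (Suc m0) (\<lambda>x. \<pi> q \<odot>\<^bsub>N\<^esub> h x \<oplus>\<^bsub>N\<^esub> \<pi> q \<odot>\<^bsub>N\<^esub> g (D i x))"
        by (rule coboundary_mod_add[OF _ _ c coboundary_mod_coboundary[OF gq]]) (use sN[OF q hN] sN[OF q gN] in auto)
      moreover have "\<pi> (q \<otimes>\<^bsub>Q\<^esub> a) \<odot>\<^bsub>N\<^esub> f x = \<pi> q \<odot>\<^bsub>N\<^esub> h x \<oplus>\<^bsub>N\<^esub> \<pi> q \<odot>\<^bsub>N\<^esub> g (D i x)" if x: "x \<in> T i" for x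
        unfolding dec[OF x] using sN[OF _ fN[OF x], of "q \<otimes>\<^bsub>Q\<^esub> a"] sN[OF q gN[OF x]] q a(1)
        by (simp add: a_minus_def NA.M.a_assoc NA.M.l_neg)
      ultimately have "coboundary_mod i (Suc m0) (\<lambda>x. \<pi> (q \<otimes>\<^bsub>Q\<^esub> a) \<odot>\<^bsub>N\<^esub> f x)"
        by (subst coboundary_mod_cong)
      then show False using m0(3) qap q a(1) unfolding P_def by blast
    qed
  qed
  moreover have "p \<subseteq> carrier Q" using p.a_subset .
  ultimately have "p = {q \<in> carrier Q. coboundary_mod i (Suc m0) (\<lambda>x. \<pi> q \<odot>\<^bsub>N\<^esub> h x)}" by blast
  from small_cochain_prime[OF p h _ this] show ?thesis using g(2) by (simp add: h_def)
qed

end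

section \<open>Quotients by I^m N, change of scalars and powers of ideals\<close>

lemma quotient_module_projection:
  assumes V: "module R V" and U: "submodule U R V"
  shows "(\<lambda>x. U +>\<^bsub>V\<^esub> x) \<in> mod_hom R V (quotient_module V U)"
    and "(\<lambda>x. U +>\<^bsub>V\<^esub> x) ` carrier V = carrier (quotient_module V U)"
    and "x \<in> carrier V \<Longrightarrow> y \<in> carrier V \<Longrightarrow> U +>\<^bsub>V\<^esub> x = U +>\<^bsub>V\<^esub> y \<longleftrightarrow> x \<ominus>\<^bsub>V\<^esub> y \<in> U"
proof -
  interpret V: module R V by (rule V)
  interpret U: abelian_subgroup U V
    by (rule abelian_subgroupI3)
      (use submodule.axioms(1)[OF U] V.M.abelian_group_axioms in \<open>auto simp: additive_subgroup_def\<close>)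
  show *: "(\<lambda>x. U +>\<^bsub>V\<^esub> x) ` carrier V = carrier (quotient_module V U)"
    by (auto simp: quotient_module_def A_RCOSETS_def')
  show "(\<lambda>x. U +>\<^bsub>V\<^esub> x) \<in> mod_hom R V (quotient_module V U)"
    using * quotient_module_module(2,3)[OF V U] by (intro mod_homI) auto
  assume x: "x \<in> carrier V" and y: "y \<in> carrier V"
  show "U +>\<^bsub>V\<^esub> x = U +>\<^bsub>V\<^esub> y \<longleftrightarrow> x \<ominus>\<^bsub>V\<^esub> y \<in> U"
    using U.a_rcos_module[OF y x] U.a_repr_independence'[OF _ y, of x] U.a_repr_independenceD[OF x, of y]
    unfolding a_minus_def by blast
qed

text \<open>The scalars of \<open>S\<close> are exactly the images of those of \<open>R\<close>, so
  closure under multiplication means the same on both sides.\<close>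

lemma submodule_restrict_scalars:
  assumes "\<phi> ` carrier R = carrier S"
  shows "submodule U R (restrict_scalars \<phi> V) \<longleftrightarrow> submodule U S V"
proof -
  have "subgroup U (add_monoid (restrict_scalars \<phi> V)) \<longleftrightarrow> subgroup U (add_monoid V)"
    by (simp add: subgroup_def m_inv_def restrict_scalars_def)
  moreover have "(\<forall>a x. a \<in> carrier S \<longrightarrow> x \<in> U \<longrightarrow> a \<odot>\<^bsub>V\<^esub> x \<in> U) \<longleftrightarrow>
      (\<forall>a x. a \<in> carrier R \<longrightarrow> x \<in> U \<longrightarrow> \<phi> a \<odot>\<^bsub>V\<^esub> x \<in> U)"
    unfolding assms[symmetric] by blast
  ultimately show ?thesis
    unfolding submodule_def submodule_axioms_def by (simp only: restrict_scalars_simps)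
qed

lemma module_span_restrict_scalars:
  "\<phi> ` carrier R = carrier S \<Longrightarrow> module_span R (restrict_scalars \<phi> V) U = module_span S V U"
  unfolding module_span_def by (simp add: submodule_restrict_scalars)

lemma ideals_set_simps:
  "carrier (ideals_set R) = {I. ideal I R}" "monoid.mult (ideals_set R) = ideal_prod R" "\<one>\<^bsub>ideals_set R\<^esub> = carrier R"
  by (simp_all add: ideals_set_def)

context ext_filtration
begin

text \<open>Homs from \<open>T\<close> into the quotient by \<open>L m\<close> lift to
  \<open>N\<close> along the dual basis, which translates coboundaries with coefficients in the
  quotient into coboundaries modulo \<open>L m\<close>. The prime is pulled back to
  \<open>Q\<close>, and as \<open>\<pi>\<close> is surjective, \<open>p\<close> is recovered as an
  image.\<close>

lemma prime_of_Ext: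
  assumes p: "p \<in> Ass A (Ext A i M (quotient_module N (L m)))" and L: "submodule (L m) A N"
  shows "\<exists>p'\<in>prime_set. p = \<pi> ` p'"
proof -
  let ?V = "quotient_module N (L m)" and ?\<kappa> = "\<lambda>x. L m +>\<^bsub>N\<^esub> x"
  note \<kappa> = quotient_module_projection[OF NA L]
  have V: "module A ?V" by (rule quotient_module_module(1)[OF NA L])
  have \<kappa>Q: "?\<kappa> \<in> mod_hom Q (rs N) (rs ?V)" by (rule rs_hom[OF \<kappa>(1)])
  note AE = Ass_Ext[OF V p]
  have pr: "primeideal p A" by (rule AE[THEN conjunct1])
  from AE[THEN conjunct2] obtain k where k1: "k \<in> mod_hom Q (fmod Q (T i)) (rs ?V)"
    and k2: "\<forall>q\<in>carrier Q. \<pi> q \<in> p \<longleftrightarrow>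
      (\<exists>g\<in>mod_hom Q (fmod Q (T (i - 1))) (rs ?V). \<forall>x\<in>T i. \<pi> q \<odot>\<^bsub>?V\<^esub> k x = g (D i x))"
    by (rule bexE)
  note k = k1 bspec[OF k2]
  have lift: "\<exists>h\<in>mod_hom Q (fmod Q (T l)) (rs N). \<forall>x\<in>T l. ?\<kappa> (h x) = g x"
    if "g \<in> mod_hom Q (fmod Q (T l)) (rs ?V)" for g l
  proof (rule dual_basis_lift[OF basis_T NQ rs_module[OF V] \<kappa>Q that])
    show "g x \<in> ?\<kappa> ` carrier (rs N)" if x: "x \<in> T l" for x
      using mod_homD(1)[OF \<open>g \<in> _\<close>, of x] x \<kappa>(2) by simp
  qed
  obtain f where f: "f \<in> mod_hom Q (fmod Q (T i)) (rs N)" "\<And>x. x \<in> T i \<Longrightarrow> ?\<kappa> (f x) = k x"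
    using lift[OF k(1)] by blast
  have iff: "\<pi> q \<in> p \<longleftrightarrow> coboundary_mod i m (\<lambda>x. \<pi> q \<odot>\<^bsub>N\<^esub> f x)" if q: "q \<in> carrier Q" for q
  proof -
    have qf: "(\<lambda>x. \<pi> q \<odot>\<^bsub>N\<^esub> f x) \<in> mod_hom Q (fmod Q (T i)) (rs N)"
      using mod_hom_smult[OF NQ f(1) q] by simp
    have \<kappa>qf: "?\<kappa> (\<pi> q \<odot>\<^bsub>N\<^esub> f x) = \<pi> q \<odot>\<^bsub>?V\<^esub> k x" if x: "x \<in> T i" for x
      using mod_homD(3)[OF \<kappa>(1) pi_mem(1)[OF q] hom_T[OF f(1) x]] f(2)[OF x] by simp
    have eq: "\<pi> q \<odot>\<^bsub>?V\<^esub> k x = ?\<kappa> (g (D i x)) \<longleftrightarrow> \<pi> q \<odot>\<^bsub>N\<^esub> f x \<ominus>\<^bsub>N\<^esub> g (D i x) \<in> L m"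
      if g: "g \<in> mod_hom Q (fmod Q (T (i - 1))) (rs N)" and x: "x \<in> T i" for g x
      using \<kappa>(3)[OF hom_T[OF qf x] hom_T[OF g D_T[OF x]]] \<kappa>qf[OF x] by simp
    show ?thesis
      unfolding k(2)[OF q] coboundary_mod_def
    proof
      assume "\<exists>g\<in>mod_hom Q (fmod Q (T (i - 1))) (rs ?V). \<forall>x\<in>T i. \<pi> q \<odot>\<^bsub>?V\<^esub> k x = g (D i x)"
      then obtain g where g: "g \<in> mod_hom Q (fmod Q (T (i - 1))) (rs ?V)" "\<And>x. x \<in> T i \<Longrightarrow> \<pi> q \<odot>\<^bsub>?V\<^esub> k x = g (D i x)"
        by blast
      obtain h where h: "h \<in> mod_hom Q (fmod Q (T (i - 1))) (rs N)" "\<And>x. x \<in> T (i - 1) \<Longrightarrow> ?\<kappa> (h x) = g x"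
        using lift[OF g(1)] by blast
      have "\<pi> q \<odot>\<^bsub>N\<^esub> f x \<ominus>\<^bsub>N\<^esub> h (D i x) \<in> L m" if x: "x \<in> T i" for x
        using eq[OF h(1) x] g(2)[OF x] h(2)[OF D_T[OF x]] by simp
      then show "\<exists>g\<in>mod_hom Q (fmod Q (T (i - 1))) (rs N). \<forall>x\<in>T i. \<pi> q \<odot>\<^bsub>N\<^esub> f x \<ominus>\<^bsub>N\<^esub> g (D i x) \<in> L m"
        using h(1) by (intro bexI[of _ h] ballI)
    next
      assume "\<exists>g\<in>mod_hom Q (fmod Q (T (i - 1))) (rs N). \<forall>x\<in>T i. \<pi> q \<odot>\<^bsub>N\<^esub> f x \<ominus>\<^bsub>N\<^esub> g (D i x) \<in> L m"
      then obtain g where g: "g \<in> mod_hom Q (fmod Q (T (i - 1))) (rs N)" "\<And>x. x \<in> T i \<Longrightarrow> \<pi> q \<odot>\<^bsub>N\<^esub> f x \<ominus>\<^bsub>N\<^esub> g (D i x) \<in> L m"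
        by blast
      have "(\<lambda>x. ?\<kappa> (g x)) \<in> mod_hom Q (fmod Q (T (i - 1))) (rs ?V)" by (rule mod_hom_comp[OF g(1) \<kappa>Q])
      moreover have "\<pi> q \<odot>\<^bsub>?V\<^esub> k x = ?\<kappa> (g (D i x))" if x: "x \<in> T i" for x
        using eq[OF g(1) x] g(2)[OF x] by simp
      ultimately show "\<exists>g\<in>mod_hom Q (fmod Q (T (i - 1))) (rs ?V). \<forall>x\<in>T i. \<pi> q \<odot>\<^bsub>?V\<^esub> k x = g (D i x)"
        by (intro bexI[of _ "\<lambda>x. ?\<kappa> (g x)"] ballI)
    qed
  qed
  define p' where "p' = {q \<in> carrier Q. \<pi> q \<in> p}"
  interpret A: cring A by (rule cring_A)
  interpret \<pi>: ring_hom_ring Q A \<pi>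
    by (rule ring_hom_ringI2) (use pi_hom Q.ring_axioms A.ring_axioms in auto)
  have "primeideal p' Q" unfolding p'_def by (rule \<pi>.primeideal_vimage[OF cring_Q pr])
  moreover have "p' = {q \<in> carrier Q. coboundary_mod i m (\<lambda>x. \<pi> q \<odot>\<^bsub>N\<^esub> f x)}"
    unfolding p'_def using iff by blast
  ultimately have "p' \<in> prime_set" using cochain_prime[OF _ f(1)] by blast
  moreover have "p \<subseteq> carrier A"
    using ideal.axioms(1)[OF primeideal.axioms(1)[OF pr]] additive_subgroup.a_subset by blast
  then have "p = \<pi> ` p'" using pi_surj unfolding p'_def by blast
  ultimately show ?thesis by blast
qed

end

lemma ideal_smult_submodule:
  assumes V: "module R V" and I: "ideal I R"
  shows "submodule (ideal_smult R I V) R V"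
proof -
  interpret V: module R V by (rule V)
  show ?thesis
    unfolding ideal_smult_def
    by (rule submodule_module_span[OF V]) (use ideal.Icarr[OF I] V.smult_closed in auto)
qed

lemma ideal_smult_mem: "a \<in> I \<Longrightarrow> x \<in> carrier V \<Longrightarrow> a \<odot>\<^bsub>V\<^esub> x \<in> ideal_smult R I V"
  unfolding ideal_smult_def by (rule subsetD[OF module_span_superset]) blast

lemma ideal_smult_carrier:
  assumes V: "module R V"
  shows "ideal_smult R (carrier R) V = carrier V"
proof
  interpret V: module R V by (rule V)
  show "ideal_smult R (carrier R) V \<subseteq> carrier V"
    using V.submoduleE(1)[OF ideal_smult_submodule[OF V V.oneideal]] .
  show "carrier V \<subseteq> ideal_smult R (carrier R) V"
  proof
    fix x assume x: "x \<in> carrier V"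
    then show "x \<in> ideal_smult R (carrier R) V" using ideal_smult_mem[OF V.one_closed x, of R] by simp
  qed
qed

text \<open>In \<open>I^(m + 1) = I^m I\<close> the new factor stands on the right, so it is
  \<open>K\<close> that acts on \<open>I V\<close>. With \<open>I^m\<close> for \<open>I\<close>,
  this makes the generators of the original ideal carry \<open>I^m N\<close> into
  \<open>I^(m + 1) N\<close>.\<close>

lemma ideal_smult_prod:
  assumes V: "module R V" and I: "ideal I R" and K: "ideal K R" and a: "a \<in> K" and x: "x \<in> ideal_smult R I V"
  shows "a \<odot>\<^bsub>V\<^esub> x \<in> ideal_smult R (ideal_prod R I K) V"
proof -
  interpret V: module R V by (rule V)
  note aR = ideal.Icarr[OF K a]
  have IK: "ideal (ideal_prod R I K) R" by (rule V.ideal_prod_is_ideal[OF I K])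
  let ?U = "{x \<in> carrier V. a \<odot>\<^bsub>V\<^esub> x \<in> ideal_smult R (ideal_prod R I K) V}"
  have "(\<lambda>x. x) \<in> mod_hom R V V" by (rule mod_homI) simp_all
  then have "(\<lambda>x. a \<odot>\<^bsub>V\<^esub> x) \<in> mod_hom R V V" by (rule mod_hom_smult[OF V _ aR])
  then have "submodule ?U R V" by (rule submodule_vimage[OF V V _ ideal_smult_submodule[OF V IK]])
  moreover have "{b \<odot>\<^bsub>V\<^esub> y | b y. b \<in> I \<and> y \<in> carrier V} \<subseteq> ?U"
  proof clarify
    fix b y assume b: "b \<in> I" and y: "y \<in> carrier V"
    note bR = ideal.Icarr[OF I b]
    have "a \<odot>\<^bsub>V\<^esub> (b \<odot>\<^bsub>V\<^esub> y) = (b \<otimes>\<^bsub>R\<^esub> a) \<odot>\<^bsub>V\<^esub> y"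
      using V.smult_assoc1[OF aR bR y] V.m_comm[OF aR bR] by simp
    moreover have "(b \<otimes>\<^bsub>R\<^esub> a) \<odot>\<^bsub>V\<^esub> y \<in> ideal_smult R (ideal_prod R I K) V"
      by (rule ideal_smult_mem[OF ideal_prod.prod[OF b a] y])
    ultimately show "b \<odot>\<^bsub>V\<^esub> y \<in> carrier V \<and> a \<odot>\<^bsub>V\<^esub> (b \<odot>\<^bsub>V\<^esub> y) \<in> ideal_smult R (ideal_prod R I K) V"
      using V.smult_closed[OF bR y] by simp
  qed
  ultimately have "ideal_smult R I V \<subseteq> ?U" unfolding ideal_smult_def by (rule module_span_minimal)
  then show ?thesis using x by blast
qed

text \<open>Elements of the product ideal are sums of products \<open>b a\<close>, and
  \<open>(b a) x = a (b x)\<close> with \<open>b x\<close> in \<open>I V\<close>.\<close>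

lemma ideal_smult_prod_subset:
  assumes V: "module R V" and I: "ideal I R" and K: "ideal K R" and U: "submodule U R V"
    and KU: "\<And>a x. a \<in> K \<Longrightarrow> x \<in> ideal_smult R I V \<Longrightarrow> a \<odot>\<^bsub>V\<^esub> x \<in> U"
  shows "ideal_smult R (ideal_prod R I K) V \<subseteq> U"
  unfolding ideal_smult_def
proof (rule module_span_minimal[OF U], clarify)
  interpret V: module R V by (rule V)
  fix a x assume a: "a \<in> ideal_prod R I K" and x: "x \<in> carrier V"
  then show "a \<odot>\<^bsub>V\<^esub> x \<in> U"
  proof (induction a rule: ideal_prod.induct)
    case (prod b a)
    have "(b \<otimes>\<^bsub>R\<^esub> a) \<odot>\<^bsub>V\<^esub> x = a \<odot>\<^bsub>V\<^esub> (b \<odot>\<^bsub>V\<^esub> x)"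
      using V.smult_assoc1[of a b x] V.m_comm[of a b] ideal.Icarr[OF I prod(1)] ideal.Icarr[OF K prod(2)] prod(3) by simp
    then show ?case using KU[OF prod(2) ideal_smult_mem[OF prod(1,3)]] by simp
  next
    case (sum a b)
    have "a \<in> carrier R" "b \<in> carrier R" using V.ideal_prod_in_carrier[OF I K] sum(1,2) by blast+
    then show ?case using V.smult_l_distr[of a b x] sum V.submoduleE(5)[OF U] by simp
  qed
qed

theorem theorem3p2p1:
  fixes Q :: "'q ring" and fs :: "'q list" and A :: "'q set ring"
    and M :: "('q set, 'm) module" and N :: "('q set, 'n) module" and I :: "'q set set"
  assumes "cring Q" and "noetherian_ring Q" and "krull_dim Q < \<infinity>"
    and "regular_sequence Q fs"
    and "A = Q Quot (genideal Q (set fs))"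
    and "fin_gen_module A M" and "fin_gen_module A N"
    and "proj_dim Q (restrict_scalars (\<lambda>q. genideal Q (set fs) +>\<^bsub>Q\<^esub> q) M) < \<infinity>"
    and "ideal I A"
  shows "finite (\<Union>n\<in>{1::nat..}. \<Union>i::nat.
    Ass A (Ext A i M (quotient_module N (ideal_smult A (I [^]\<^bsub>ideals_set A\<^esub> n) N))))"
proof -
  interpret Q: cring Q by fact
  interpret QN: noetherian_ring Q by fact
  let ?J = "genideal Q (set fs)"
  let ?\<phi> = "\<lambda>q. ?J +>\<^bsub>Q\<^esub> q"
  have J: "ideal ?J Q" using assms(4) by (intro Q.genideal_ideal) (simp add: regular_sequence_def)
  have hom: "?\<phi> \<in> ring_hom Q A" unfolding assms(5) by (rule ideal.rcos_ring_hom[OF J])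
  have surj: "?\<phi> ` carrier Q = carrier A" unfolding assms(5) FactRing_def by (auto simp: A_RCOSETS_def')
  have M: "module A M" and N: "module A N" using assms(6,7) by (simp_all add: fin_gen_module_def)
  interpret N: module A N by (rule N)
  interpret M: module A M by (rule M)
  have fg: "fin_gen_module Q (restrict_scalars ?\<phi> Y)" if Y: "fin_gen_module A Y" for Y :: "('q set, 'y) module"
    using Y restrict_scalars_module[OF assms(1) hom, of Y] unfolding fin_gen_module_def
    by (simp add: module_span_restrict_scalars[OF surj])
  obtain r W F d e n where res: "finite_resolution Q (restrict_scalars ?\<phi> M) r W F d e n"
    using finite_resolution_exists[OF assms(2) fg[OF assms(6)] assms(8)] by blast
  have ann: "a \<odot>\<^bsub>restrict_scalars ?\<phi> M\<^esub> x = \<zero>\<^bsub>restrict_scalars ?\<phi> M\<^esub>"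
    if "a \<in> ?J" "x \<in> carrier (restrict_scalars ?\<phi> M)" for a x
  proof -
    have "?\<phi> a = \<zero>\<^bsub>A\<^esub>"
      unfolding assms(5) FactRing_def
      using abelian_subgroup.a_rcos_const[OF ideal.axioms(1)[THEN abelian_subgroupI3] that(1)] J Q.abelian_group_axioms by auto
    then show ?thesis using M.smult_l_null that(2) by simp
  qed
  interpret CI: complete_intersection Q fs A M r W F d e n
    by (intro complete_intersection.intro assms(5) M regular_quotient.intro[OF res] regular_quotient_axioms.intro assms(4) ann)
  have \<pi>: "CI.\<pi> = ?\<phi>" by (simp add: CI.\<pi>_def fun_eq_iff)
  interpret \<pi>: ring_hom_ring Q A CI.\<pi>
    by (rule ring_hom_ringI2) (use CI.pi_hom Q.ring_axioms N.ring_axioms in auto)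
  \<comment> \<open>The operators have to be finitely many and linear over \<open>Q\<close>, so
    generators are taken for the preimage of \<open>I\<close> in \<open>Q\<close>.\<close>
  obtain G where G: "G \<subseteq> carrier Q" "finite G" "{q \<in> carrier Q. CI.\<pi> q \<in> I} = genideal Q G"
    using QN.finetely_gen[OF \<pi>.ideal_vimage[OF assms(9)]] by blast
  define L where "L m = ideal_smult A (I [^]\<^bsub>ideals_set A\<^esub> m) N" for m :: nat
  interpret IS: monoid "ideals_set A"
    using comm_monoid.axioms(1)[OF N.ideals_set_is_comm_monoid] .
  have Im: "ideal (I [^]\<^bsub>ideals_set A\<^esub> m) A" for m :: nat
    using IS.nat_pow_closed[of I m] assms(9) by (simp add: ideals_set_simps)
  have L_Suc: "L (Suc m) = ideal_smult A (ideal_prod A (I [^]\<^bsub>ideals_set A\<^esub> m) I) N" for m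
    by (simp add: L_def ideals_set_simps)
  have L: "submodule (L m) A N" for m unfolding L_def by (rule ideal_smult_submodule[OF N Im])
  interpret EF: ext_filtration Q fs A M r W F d e n N L G
  proof (intro ext_filtration.intro ext_filtration_axioms.intro)
    show "complete_intersection Q fs A M r W F d e n" by (rule CI.complete_intersection_axioms)
    show "noetherian_ring Q" "module A N" by fact+
    show "\<exists>S. finite S \<and> module_span Q (restrict_scalars CI.\<pi> N) S = carrier N"
      using fg[OF assms(7)] unfolding \<pi> fin_gen_module_def by auto
    show "submodule (L m) Q (restrict_scalars CI.\<pi> N)" for m
      unfolding \<pi> submodule_restrict_scalars[OF surj] by (rule L)
    show "L 0 = carrier N"
      using ideal_smult_carrier[OF N] by (simp add: L_def ideals_set_simps)
    show "finite G" "G \<subseteq> carrier Q" by fact+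
    have "CI.\<pi> u \<in> I" if "u \<in> G" for u
      using Q.genideal_self[OF G(1)] that G(3) by blast
    then show "CI.\<pi> u \<odot>\<^bsub>N\<^esub> x \<in> L (Suc m)" if "u \<in> G" "x \<in> L m" for u x m
      unfolding L_Suc using that by (intro ideal_smult_prod[OF N Im assms(9)]) (simp_all add: L_def)
    show "L (Suc m) \<subseteq> module_span Q (restrict_scalars CI.\<pi> N) {CI.\<pi> u \<odot>\<^bsub>N\<^esub> x | u x. u \<in> G \<and> x \<in> L m}" for m
    proof -
      let ?K = "{CI.\<pi> u \<odot>\<^bsub>N\<^esub> x | u x. u \<in> G \<and> x \<in> L m}"
      have LN: "L m \<subseteq> carrier N" using N.submoduleE(1)[OF L] .
      have KN: "?K \<subseteq> carrier N" using LN G(1) CI.pi_mem(1) N.smult_closed by blast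
      have sub: "submodule (module_span A N ?K) A N" by (rule submodule_module_span[OF N KN])
      have NQ: "module Q (restrict_scalars CI.\<pi> N)" by (rule CI.rs_module[OF N])
      have subQ: "submodule (module_span A N ?K) Q (restrict_scalars CI.\<pi> N)"
        unfolding \<pi> submodule_restrict_scalars[OF surj] using sub unfolding \<pi> .
      have "a \<odot>\<^bsub>N\<^esub> x \<in> module_span A N ?K" if a: "a \<in> I" and x: "x \<in> L m" for a x
      proof -
        obtain q where q: "q \<in> carrier Q" "CI.\<pi> q = a" using CI.pi_surj[OF ideal.Icarr[OF assms(9) a]] by blast
        \<comment> \<open>The multipliers that carry \<open>x\<close> into the span form an ideal of
          \<open>Q\<close>. Containing \<open>G\<close>, it contains the full preimage of
          \<open>I\<close>, in particular \<open>q\<close>.\<close>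
        have "ideal {q \<in> carrier Q. q \<odot>\<^bsub>restrict_scalars CI.\<pi> N\<^esub> x \<in> module_span A N ?K} Q"
          by (rule colon_ideal[OF NQ subQ]) (use x LN in auto)
        moreover have "G \<subseteq> {q \<in> carrier Q. q \<odot>\<^bsub>restrict_scalars CI.\<pi> N\<^esub> x \<in> module_span A N ?K}"
          using G(1) x subsetD[OF module_span_superset[of ?K A N]] by auto
        ultimately have "genideal Q G \<subseteq> {q \<in> carrier Q. q \<odot>\<^bsub>restrict_scalars CI.\<pi> N\<^esub> x \<in> module_span A N ?K}"
          by (rule Q.genideal_minimal)
        then show ?thesis using q a unfolding G(3)[symmetric] by auto
      qed
      then have "L (Suc m) \<subseteq> module_span A N ?K"
        unfolding L_Suc by (intro ideal_smult_prod_subset[OF N Im assms(9) sub]) (simp add: L_def)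
      then show ?thesis unfolding \<pi> module_span_restrict_scalars[OF surj] .
    qed
  qed
  have "(\<Union>n\<in>{1::nat..}. \<Union>i::nat. Ass A (Ext A i M (quotient_module N (L n)))) \<subseteq> (\<lambda>p. CI.\<pi> ` p) ` EF.prime_set"
    by (auto dest!: EF.prime_of_Ext[OF _ L])
  then have "finite (\<Union>n\<in>{1::nat..}. \<Union>i::nat. Ass A (Ext A i M (quotient_module N (L n))))"
    by (rule finite_subset) (rule finite_imageI[OF EF.finite_prime_set])
  then show ?thesis unfolding L_def .
qed

end
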